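(* Let $N=3$, let $z_0=0$, and let $\Omega=\mathbb{C}_+$. Consider $A=(-\mathrm{i}\partial_x)^N$ in $L^2(\mathbb{R},\mathbb{C})$ with domain $\mathfrak{D}(A)=H^N(\mathbb{R},\mathbb{C})$. Let $s,s'>N-3/2$ and let $B:\,L^2_{-s'}(\mathbb{R},\mathbb{C})\to L^2_{s}(\mathbb{R},\mathbb{C})$ be $A$-compact. Then: - either the resolvent of $A+B$ satisfies the limiting absorption principle at $z_0=0$ with respect to $L^2_s,\,L^2_{-s'},\,\Omega$, so that the resolvent $R_B(z)=(A+B-zI)^{-1}$ converges in the uniform operator topology of $\mathscr{B}\big(L^2_s(\mathbb{R},\mathbb{C}),L^2_{-s'}(\mathbb{R},\mathbb{C})\big)$ as $z\to z_0$, $z\in\Omega$; - or there is a virtual state of $A+B$ at $z_0=0$: a nonzero $\Psi\in L^2_{-s'}(\mathbb{R},\mathbb{C})$ such that $(\hat A+B-z_0)\Psi=0$ and $\Psi\in\mathrm{Ran}\big((A+B+K-z_0I)^{-1}_{\Omega,L^2_s,L^2_{-s'}}\big)$, where $K:\,L^2_{-s'}(\mathbb{R},\mathbb{C})\to L^2_s(\mathbb{R},\mathbb{C})$ is some bounded operator of finite rank for which the limit operator $(A+B+K-z_0I)^{-1}_{\Omega,L^2_s,L^2_{-s'}}$ exists.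
   Context: $\mathbb{C}_+=\{z\in\mathbb{C}:\operatorname{Im}z>0\}$; $\mathbb{D}_\delta=\{z\in\mathbb{C}:|z|<\delta\}$; $\langle x\rangle=(1+x^2)^{1/2}$. For $s\in\mathbb{R}$, $L^2_s(\mathbb{R},\mathbb{C})=\{u\in L^2_{\mathrm{loc}}(\mathbb{R},\mathbb{C}):\langle x\rangle^s u\in L^2(\mathbb{R},\mathbb{C})\}$ with norm $\|u\|_{L^2_s}=\|\langle x\rangle^su\|_{L^2}$. There are continuous embeddings $L^2_s\hookrightarrow L^2\hookrightarrow L^2_{-s'}$ for $s,s'\ge0$, and $\mathscr{B}(\mathbf{E},\mathbf{F})$ denotes bounded operators from $\mathbf{E}$ to $\mathbf{F}$. $\hat A$ denotes the closed extension of $A$ to $\mathbf{F}=L^2_{-s'}(\mathbb{R},\mathbb{C})$ (the closure in $\mathbf{F}$ of $A$ considered as an operator $\mathbf{F}\to\mathbf{F}$ with domain $\mathfrak{D}(A)$). "$B$ is $A$-compact" means that $B$ is defined (linear) on $\mathfrak{D}(\hat A)\subset L^2_{-s'}$, takes values in $L^2_s$, and maps the set $\{f\in\mathfrak{D}(\hat A):\|f\|_{\mathbf{F}}+\|\hat Af\|_{\mathbf{F}}\le1\}$ to a precompact subset of $L^2_s(\mathbb{R},\mathbb{C})$. The operator $B$ is also regarded as an operator in $L^2$ via the embeddings, and $A+B$ has domain $\mathfrak{D}(A)$ in $L^2$. Limiting absorption principle at $z_0$ with respect to $(L^2_s,L^2_{-s'},\Omega)$ for an operator $T$ in $L^2$: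 there is $\delta>0$ such that $\Omega\cap\sigma(T)\cap\{z:|z-z_0|<\delta\}=\emptyset$, and the resolvents $(T-zI)^{-1}$, regarded as operators $L^2_s\to L^2_{-s'}$, have a limit in the weak operator topology of $\mathscr{B}(L^2_s,L^2_{-s'})$ as $z\to z_0$, $z\in\Omega$; this limit is denoted $(T-z_0I)^{-1}_{\Omega,L^2_s,L^2_{-s'}}$. *)

theory Defs
  imports "HOL-Analysis.Analysis"
begin

section \<open>Measurable functions on the real line modulo null sets\<close>

text \<open>Every Lebesgue measurable function agrees almost everywhere with a Borel measurable one,
  so Borel representatives suffice.\<close>

definition ae_eq :: "(real \<Rightarrow> complex) \<Rightarrow> (real \<Rightarrow> complex) \<Rightarrow> bool" where
  "ae_eq f g \<longleftrightarrow> f \<in> borel_measurable borel \<and> g \<in> borel_measurable borel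
     \<and> (AE x in lborel. f x = g x)"

quotient_type aefun = "real \<Rightarrow> complex" / partial: ae_eq
proof (rule part_equivpI)
  show "\<exists>x. ae_eq x x"
    by (rule exI[of _ "\<lambda>_. 0"]) (simp add: ae_eq_def)
  show "symp ae_eq"
    by (auto simp: symp_def ae_eq_def elim: eventually_mono)
  show "transp ae_eq"
    unfolding transp_def ae_eq_def by (auto elim: eventually_elim2)
qed

instantiation aefun :: ab_group_add
begin

lift_definition zero_aefun :: aefun is "\<lambda>_. 0"
  by (simp add: ae_eq_def)

lift_definition plus_aefun :: "aefun \<Rightarrow> aefun \<Rightarrow> aefun" is "\<lambda>f g x. f x + g x"
  by (auto simp: ae_eq_def elim: eventually_elim2)

lift_definition minus_aefun :: "aefun \<Rightarrow> aefun \<Rightarrow> aefun" is "\<lambda>f g x. f x - g x"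
  by (auto simp: ae_eq_def elim: eventually_elim2)

lift_definition uminus_aefun :: "aefun \<Rightarrow> aefun" is "\<lambda>f x. - f x"
  by (auto simp: ae_eq_def elim: eventually_mono)

instance
  by (standard; transfer; auto simp: ae_eq_def algebra_simps)

end

lift_definition cscale :: "complex \<Rightarrow> aefun \<Rightarrow> aefun"  (infixr "*\<^sub>c" 75)
  is "\<lambda>c f x. c * f x"
  by (auto simp: ae_eq_def elim: eventually_mono)

global_interpretation cvec: vector_space cscale
  by (unfold_locales; transfer; auto simp: ae_eq_def algebra_simps)


section \<open>Weighted spaces\<close>

definition jbracket :: "real \<Rightarrow> real" where
  "jbracket x = sqrt (1 + x\<^sup>2)"

lemma jbracket_pos [simp]: "jbracket x > 0"
  by (simp add: jbracket_def add_pos_nonneg)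

lemma jbracket_measurable [measurable]: "jbracket \<in> borel_measurable borel"
  unfolding jbracket_def by measurable

lift_definition L2w_mem :: "real \<Rightarrow> aefun \<Rightarrow> bool"
  is "\<lambda>s f. integrable lborel (\<lambda>x. (jbracket x powr s * cmod (f x))\<^sup>2)"
proof -
  fix s f g assume "ae_eq f g"
  then have [measurable]: "f \<in> borel_measurable borel" "g \<in> borel_measurable borel"
    and "AE x in lborel. f x = g x"
    by (auto simp: ae_eq_def)
  then show "integrable lborel (\<lambda>x. (jbracket x powr s * cmod (f x))\<^sup>2) =
             integrable lborel (\<lambda>x. (jbracket x powr s * cmod (g x))\<^sup>2)"
    by (intro integrable_cong_AE) (measurable, auto elim: eventually_mono)
qed

text \<open>Membership in \<open>L\<^sup>2\<^sub>l\<^sub>o\<^sub>c\<close> is implied, since the weight is locally bounded below.\<close>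

definition L2w :: "real \<Rightarrow> aefun set" where
  "L2w s = {u. L2w_mem s u}"

abbreviation L2 :: "aefun set" where
  "L2 \<equiv> L2w 0"

lift_definition L2w_norm :: "real \<Rightarrow> aefun \<Rightarrow> real"
  is "\<lambda>s f. sqrt (LINT x|lborel. (jbracket x powr s * cmod (f x))\<^sup>2)"
proof -
  fix s f g assume "ae_eq f g"
  then have [measurable]: "f \<in> borel_measurable borel" "g \<in> borel_measurable borel"
    and "AE x in lborel. f x = g x"
    by (auto simp: ae_eq_def)
  then show "sqrt (LINT x|lborel. (jbracket x powr s * cmod (f x))\<^sup>2) =
             sqrt (LINT x|lborel. (jbracket x powr s * cmod (g x))\<^sup>2)"
    by (intro arg_cong[of _ _ sqrt] integral_cong_AE) (measurable, auto elim: eventually_mono)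
qed

abbreviation L2w_dist :: "real \<Rightarrow> aefun \<Rightarrow> aefun \<Rightarrow> real" where
  "L2w_dist s u v \<equiv> L2w_norm s (u - v)"

definition L2w_topology :: "real \<Rightarrow> aefun topology" where
  "L2w_topology s = Metric_space.mtopology (L2w s) (L2w_dist s)"

definition precompact_in_L2w :: "real \<Rightarrow> aefun set \<Rightarrow> bool" where
  "precompact_in_L2w s S \<longleftrightarrow>
     S \<subseteq> L2w s \<and> compactin (L2w_topology s) (L2w_topology s closure_of S)"

subsection \<open>The weighted norm induces a metric\<close>

lemma L2w_norm_nonneg: "0 \<le> L2w_norm s u"
  by transfer simp

lemma L2w_norm_minus_commute: "L2w_norm s (u - v) = L2w_norm s (v - u)"
  by transfer (simp add: norm_minus_commute)

lemma L2w_norm_eq_0_iff: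
  assumes "u \<in> L2w s"
  shows "L2w_norm s u = 0 \<longleftrightarrow> u = 0"
  using assms unfolding L2w_def mem_Collect_eq
proof transfer
  fix s f assume "ae_eq f f" and int: "integrable lborel (\<lambda>x. (jbracket x powr s * cmod (f x))\<^sup>2)"
  then have f: "f \<in> borel_measurable borel" by (simp add: ae_eq_def)
  have "(LINT x|lborel. (jbracket x powr s * cmod (f x))\<^sup>2) = 0 \<longleftrightarrow>
        (AE x in lborel. (jbracket x powr s * cmod (f x))\<^sup>2 = 0)"
    by (rule integral_nonneg_eq_0_iff_AE[OF int]) simp
  also have "\<dots> \<longleftrightarrow> (AE x in lborel. f x = 0)"
    by (rule arg_cong[of _ _ "almost_everywhere lborel"]) (auto simp: less_imp_neq[symmetric])
  finally show "sqrt (LINT x|lborel. (jbracket x powr s * cmod (f x))\<^sup>2) = 0 \<longleftrightarrow> ae_eq f (\<lambda>_. 0)"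
    using f by (simp add: ae_eq_def)
qed

lemma weighted_sq_add_le:
  fixes a w :: real and f g :: complex
  assumes "a > 0"
  shows "(w * cmod (f + g))\<^sup>2 \<le> (1 + a) * (w * cmod f)\<^sup>2 + (1 + 1 / a) * (w * cmod g)\<^sup>2"
proof -
  define p q where "p = cmod f" and "q = cmod g"
  have "0 \<le> (a * p - q)\<^sup>2 / a" using assms by simp
  also have "\<dots> = a * p\<^sup>2 - 2 * p * q + q\<^sup>2 / a"
    using assms by (simp add: field_simps power2_eq_square)
  finally have *: "2 * p * q \<le> a * p\<^sup>2 + q\<^sup>2 / a" by simp
  have "(cmod (f + g))\<^sup>2 \<le> (p + q)\<^sup>2"
    unfolding p_def q_def by (intro power_mono norm_triangle_ineq) simp
  also have "\<dots> \<le> (1 + a) * p\<^sup>2 + (1 + 1 / a) * q\<^sup>2"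
    using * by (simp add: power2_sum algebra_simps)
  finally have "w\<^sup>2 * (cmod (f + g))\<^sup>2 \<le> w\<^sup>2 * ((1 + a) * p\<^sup>2 + (1 + 1 / a) * q\<^sup>2)"
    by (rule mult_left_mono) simp
  then show ?thesis
    by (simp add: p_def q_def power_mult_distrib algebra_simps)
qed

lemma L2w_add_aux:
  assumes "u \<in> L2w s" "v \<in> L2w s"
  shows "u + v \<in> L2w s \<and> (\<forall>a>0. (L2w_norm s (u + v))\<^sup>2 \<le>
           (1 + a) * (L2w_norm s u)\<^sup>2 + (1 + 1 / a) * (L2w_norm s v)\<^sup>2)"
  using assms unfolding L2w_def mem_Collect_eq
proof transfer
  fix s f g
  let ?w = "\<lambda>h x. (jbracket x powr s * cmod (h x))\<^sup>2"
  assume "ae_eq f f" "ae_eq g g" and f: "integrable lborel (?w f)" and g: "integrable lborel (?w g)"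
  then have [measurable]: "f \<in> borel_measurable borel" "g \<in> borel_measurable borel"
    by (auto simp: ae_eq_def)
  have le: "?w (\<lambda>x. f x + g x) x \<le> (1 + a) * ?w f x + (1 + 1 / a) * ?w g x" if "a > 0" for a x
    by (rule weighted_sq_add_le[OF that])
  have int: "integrable lborel (\<lambda>x. (1 + a) * ?w f x + (1 + 1 / a) * ?w g x)" for a
    by (intro Bochner_Integration.integrable_add integrable_mult_right f g)
  have fg: "integrable lborel (?w (\<lambda>x. f x + g x))"
  proof (rule Bochner_Integration.integrable_bound[OF int[of 1]])
    show "AE x in lborel. norm (?w (\<lambda>x. f x + g x) x) \<le>
            norm ((1 + 1) * ?w f x + (1 + 1 / 1) * ?w g x)"
    proof (rule AE_I2)
      fix x
      have "0 \<le> ?w (\<lambda>x. f x + g x) x" by simp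
      with le[of 1 x] show "norm (?w (\<lambda>x. f x + g x) x) \<le>
            norm ((1 + 1) * ?w f x + (1 + 1 / 1) * ?w g x)"
        unfolding real_norm_def by linarith
    qed
  qed measurable
  have "(LINT x|lborel. ?w (\<lambda>x. f x + g x) x) \<le>
          (1 + a) * (LINT x|lborel. ?w f x) + (1 + 1 / a) * (LINT x|lborel. ?w g x)"
    if "a > 0" for a
  proof -
    have "(LINT x|lborel. ?w (\<lambda>x. f x + g x) x) \<le>
            (LINT x|lborel. (1 + a) * ?w f x + (1 + 1 / a) * ?w g x)"
      by (intro integral_mono fg int le that)
    also have "\<dots> = (1 + a) * (LINT x|lborel. ?w f x) + (1 + 1 / a) * (LINT x|lborel. ?w g x)"
      by (subst Bochner_Integration.integral_add) (auto intro: integrable_mult_right f g)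
    finally show ?thesis .
  qed
  with fg show "integrable lborel (?w (\<lambda>x. f x + g x)) \<and> (\<forall>a>0.
      (sqrt (LINT x|lborel. ?w (\<lambda>x. f x + g x) x))\<^sup>2 \<le>
      (1 + a) * (sqrt (LINT x|lborel. ?w f x))\<^sup>2 + (1 + 1 / a) * (sqrt (LINT x|lborel. ?w g x))\<^sup>2)"
    by simp
qed

lemma L2w_norm_triangle:
  assumes "u \<in> L2w s" "v \<in> L2w s"
  shows "L2w_norm s (u + v) \<le> L2w_norm s u + L2w_norm s v"
proof (cases "L2w_norm s u = 0 \<or> L2w_norm s v = 0")
  case True
  then show ?thesis
    using assms by (auto simp: L2w_norm_eq_0_iff L2w_norm_nonneg)
next
  case False
  define p q where "p = L2w_norm s u" and "q = L2w_norm s v"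
  have pq: "p > 0" "q > 0"
    using False L2w_norm_nonneg[of s u] L2w_norm_nonneg[of s v] by (auto simp: p_def q_def)
  have "(L2w_norm s (u + v))\<^sup>2 \<le> (1 + q / p) * p\<^sup>2 + (1 + 1 / (q / p)) * q\<^sup>2"
    using L2w_add_aux[OF assms] pq unfolding p_def q_def by (metis divide_pos_pos)
  also have "\<dots> = (p + q)\<^sup>2"
    using pq by (simp add: field_simps power2_eq_square)
  finally show ?thesis
    using pq unfolding p_def q_def by (auto intro: power2_le_imp_le)
qed

lemma L2w_uminus: "u \<in> L2w s \<Longrightarrow> - u \<in> L2w s"
  unfolding L2w_def mem_Collect_eq by transfer simp

lemma L2w_diff: "u \<in> L2w s \<Longrightarrow> v \<in> L2w s \<Longrightarrow> u - v \<in> L2w s"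
  using L2w_add_aux[of u s "- v"] L2w_uminus[of v s] by simp

lemma Metric_space_L2w: "Metric_space (L2w s) (L2w_dist s)"
proof
  fix u v w
  show "0 \<le> L2w_dist s u v" by (rule L2w_norm_nonneg)
  show "L2w_dist s u v = L2w_dist s v u" by (rule L2w_norm_minus_commute)
  assume u: "u \<in> L2w s" and v: "v \<in> L2w s"
  show "L2w_dist s u v = 0 \<longleftrightarrow> u = v"
    by (simp add: L2w_norm_eq_0_iff[OF L2w_diff[OF u v]])
  assume w: "w \<in> L2w s"
  show "L2w_dist s u w \<le> L2w_dist s u v + L2w_dist s v w"
    using L2w_norm_triangle[OF L2w_diff[OF u v] L2w_diff[OF v w]] by simp
qed


section \<open>Linear operators\<close>

text \<open>An operator is given by a domain together with a function whose values outside the domain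
  are irrelevant.\<close>

definition linear_on :: "aefun set \<Rightarrow> (aefun \<Rightarrow> aefun) \<Rightarrow> bool" where
  "linear_on D T \<longleftrightarrow> cvec.subspace D \<and> (\<forall>u\<in>D. \<forall>v\<in>D. T (u + v) = T u + T v)
     \<and> (\<forall>c. \<forall>u\<in>D. T (c *\<^sub>c u) = c *\<^sub>c T u)"

definition bounded_op :: "real \<Rightarrow> real \<Rightarrow> (aefun \<Rightarrow> aefun) \<Rightarrow> bool" where
  "bounded_op a b T \<longleftrightarrow> linear_on (L2w a) T \<and> T ` L2w a \<subseteq> L2w b
     \<and> (\<exists>C. \<forall>u\<in>L2w a. L2w_norm b (T u) \<le> C * L2w_norm a u)"

definition finite_rank :: "real \<Rightarrow> (aefun \<Rightarrow> aefun) \<Rightarrow> bool" where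
  "finite_rank a T \<longleftrightarrow> (\<exists>S. finite S \<and> T ` L2w a \<subseteq> cvec.span S)"

definition dual_L2w :: "real \<Rightarrow> (aefun \<Rightarrow> complex) set" where
  "dual_L2w b = {l. (\<forall>u\<in>L2w b. \<forall>v\<in>L2w b. l (u + v) = l u + l v)
     \<and> (\<forall>c. \<forall>u\<in>L2w b. l (c *\<^sub>c u) = c * l u)
     \<and> (\<exists>C. \<forall>u\<in>L2w b. cmod (l u) \<le> C * L2w_norm b u)}"

definition wot_limit ::
  "real \<Rightarrow> real \<Rightarrow> (complex \<Rightarrow> aefun \<Rightarrow> aefun) \<Rightarrow> (aefun \<Rightarrow> aefun) \<Rightarrow> complex filter \<Rightarrow> bool" where
  "wot_limit a b T R F \<longleftrightarrow> bounded_op a b R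
     \<and> (\<forall>u\<in>L2w a. \<forall>l\<in>dual_L2w b. ((\<lambda>z. l (T z u)) \<longlongrightarrow> l (R u)) F)"

definition uniform_op_limit ::
  "real \<Rightarrow> real \<Rightarrow> (complex \<Rightarrow> aefun \<Rightarrow> aefun) \<Rightarrow> (aefun \<Rightarrow> aefun) \<Rightarrow> complex filter \<Rightarrow> bool" where
  "uniform_op_limit a b T R F \<longleftrightarrow> bounded_op a b R
     \<and> (\<forall>e>0. \<forall>\<^sub>F z in F. \<forall>u\<in>L2w a. L2w_norm b (T z u - R u) \<le> e * L2w_norm a u)"

text \<open>Spectrum and resolvent of an operator \<open>T\<close> in \<open>L2\<close> with domain \<open>D\<close>.\<close>

definition resolvent_op :: "aefun set \<Rightarrow> (aefun \<Rightarrow> aefun) \<Rightarrow> complex \<Rightarrow> aefun \<Rightarrow> aefun" where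
  "resolvent_op D T z = the_inv_into D (\<lambda>u. T u - z *\<^sub>c u)"

definition resolvent_set :: "aefun set \<Rightarrow> (aefun \<Rightarrow> aefun) \<Rightarrow> complex set" where
  "resolvent_set D T =
     {z. bij_betw (\<lambda>u. T u - z *\<^sub>c u) D L2 \<and> bounded_op 0 0 (resolvent_op D T z)}"

definition op_spectrum :: "aefun set \<Rightarrow> (aefun \<Rightarrow> aefun) \<Rightarrow> complex set" where
  "op_spectrum D T = - resolvent_set D T"

text \<open>The closure, in \<open>L2w b\<close>, of an operator with domain \<open>D\<close>.  The value of \<open>closure_op\<close> is
  meaningful for closable operators.\<close>

definition closure_graph ::
  "real \<Rightarrow> aefun set \<Rightarrow> (aefun \<Rightarrow> aefun) \<Rightarrow> (aefun \<times> aefun) set" where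
  "closure_graph b D T = {(f, g). f \<in> L2w b \<and> g \<in> L2w b \<and>
     (\<exists>u :: nat \<Rightarrow> aefun. (\<forall>n. u n \<in> D) \<and> (\<lambda>n. L2w_dist b (u n) f) \<longlonglongrightarrow> 0
        \<and> (\<lambda>n. L2w_dist b (T (u n)) g) \<longlonglongrightarrow> 0)}"

definition closure_dom :: "real \<Rightarrow> aefun set \<Rightarrow> (aefun \<Rightarrow> aefun) \<Rightarrow> aefun set" where
  "closure_dom b D T = Domain (closure_graph b D T)"

definition closure_op :: "real \<Rightarrow> aefun set \<Rightarrow> (aefun \<Rightarrow> aefun) \<Rightarrow> aefun \<Rightarrow> aefun" where
  "closure_op b D T f = (THE g. (f, g) \<in> closure_graph b D T)"

text \<open>\<open>B\<close> is \<open>A\<close>-compact from \<open>L2w b\<close> to \<open>L2w a\<close>, where \<open>A\<close> has domain \<open>D\<close>.\<close>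

definition relatively_compact_op ::
  "real \<Rightarrow> real \<Rightarrow> aefun set \<Rightarrow> (aefun \<Rightarrow> aefun) \<Rightarrow> (aefun \<Rightarrow> aefun) \<Rightarrow> bool" where
  "relatively_compact_op b a D A B \<longleftrightarrow>
     linear_on (closure_dom b D A) B \<and> B ` closure_dom b D A \<subseteq> L2w a \<and>
     precompact_in_L2w a
       (B ` {f \<in> closure_dom b D A. L2w_norm b f + L2w_norm b (closure_op b D A f) \<le> 1})"


section \<open>The differential operator\<close>

definition test_function :: "(real \<Rightarrow> complex) \<Rightarrow> bool" where
  "test_function \<phi> \<longleftrightarrow> compact (closure {x. \<phi> x \<noteq> 0})
     \<and> (\<forall>n x. ((\<lambda>g y. vector_derivative g (at y)) ^^ n) \<phi> differentiable (at x))"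

lemma test_function_deriv_measurable:
  assumes "test_function \<phi>"
  shows "((\<lambda>g y. vector_derivative g (at y)) ^^ n) \<phi> \<in> borel_measurable borel"
  using assms unfolding test_function_def
  by (intro borel_measurable_continuous_onI continuous_at_imp_continuous_on ballI
      differentiable_imp_continuous_within) auto

lift_definition weak_deriv :: "nat \<Rightarrow> aefun \<Rightarrow> aefun \<Rightarrow> bool"
  is "\<lambda>n u v. \<forall>\<phi>. test_function \<phi> \<longrightarrow>
    (LINT x|lborel. u x * ((\<lambda>g y. vector_derivative g (at y)) ^^ n) \<phi> x) =
    (-1) ^ n * (LINT x|lborel. v x * \<phi> x)"
proof (intro all_cong1 imp_cong refl)
  fix n u u' v v' \<phi>
  assume "ae_eq u u'" "ae_eq v v'" and \<phi>: "test_function \<phi>"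
  then have [measurable]: "u \<in> borel_measurable borel" "u' \<in> borel_measurable borel"
      "v \<in> borel_measurable borel" "v' \<in> borel_measurable borel"
    and ae: "AE x in lborel. u x = u' x" "AE x in lborel. v x = v' x"
    by (auto simp: ae_eq_def)
  let ?D = "((\<lambda>g y. vector_derivative g (at y)) ^^ n) \<phi>"
  have [measurable]: "?D \<in> borel_measurable borel" "\<phi> \<in> borel_measurable borel"
    using test_function_deriv_measurable[OF \<phi>, of n] test_function_deriv_measurable[OF \<phi>, of 0]
    by simp_all
  have "(LINT x|lborel. u x * ?D x) = (LINT x|lborel. u' x * ?D x)"
    by (rule integral_cong_AE) (measurable, use ae in \<open>auto elim: eventually_mono\<close>)
  moreover have "(LINT x|lborel. v x * \<phi> x) = (LINT x|lborel. v' x * \<phi> x)"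
    by (rule integral_cong_AE) (measurable, use ae in \<open>auto elim: eventually_mono\<close>)
  ultimately show "((LINT x|lborel. u x * ?D x) = (-1) ^ n * (LINT x|lborel. v x * \<phi> x)) =
      ((LINT x|lborel. u' x * ?D x) = (-1) ^ n * (LINT x|lborel. v' x * \<phi> x))"
    by simp
qed

definition Sobolev :: "nat \<Rightarrow> aefun set" where
  "Sobolev N = {u \<in> L2. \<forall>k\<le>N. \<exists>v\<in>L2. weak_deriv k u v}"

definition diff_op :: "nat \<Rightarrow> aefun \<Rightarrow> aefun" where
  "diff_op N u = (- \<i>) ^ N *\<^sub>c (THE v. v \<in> L2 \<and> weak_deriv N u v)"


section \<open>Limiting absorption principle and virtual states\<close>

text \<open>\<open>lap_limit a b \<Omega> z0 D T R\<close>: the limiting absorption principle for \<open>T\<close> (an operator in \<open>L2\<close>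
  with domain \<open>D\<close>) holds at \<open>z0\<close> with respect to \<open>L2w a\<close>, \<open>L2w b\<close>, \<open>\<Omega>\<close>, and \<open>R\<close> is the limit of
  the resolvents.  It is used with \<open>a \<ge> 0 \<ge> b\<close>, when \<open>L2w a \<subseteq> L2 \<subseteq> L2w b\<close>.\<close>

definition lap_limit ::
  "real \<Rightarrow> real \<Rightarrow> complex set \<Rightarrow> complex \<Rightarrow> aefun set \<Rightarrow> (aefun \<Rightarrow> aefun) \<Rightarrow> (aefun \<Rightarrow> aefun) \<Rightarrow> bool"
  where
  "lap_limit a b \<Omega> z0 D T R \<longleftrightarrow>
     (\<exists>\<delta>>0. \<Omega> \<inter> op_spectrum D T \<inter> {z. cmod (z - z0) < \<delta>} = {})
     \<and> wot_limit a b (resolvent_op D T) R (at z0 within \<Omega>)"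

definition LAP ::
  "real \<Rightarrow> real \<Rightarrow> complex set \<Rightarrow> complex \<Rightarrow> aefun set \<Rightarrow> (aefun \<Rightarrow> aefun) \<Rightarrow> bool" where
  "LAP a b \<Omega> z0 D T \<longleftrightarrow> (\<exists>R. lap_limit a b \<Omega> z0 D T R)"

definition virtual_state ::
  "real \<Rightarrow> real \<Rightarrow> complex set \<Rightarrow> complex \<Rightarrow> aefun set \<Rightarrow> (aefun \<Rightarrow> aefun) \<Rightarrow> (aefun \<Rightarrow> aefun)
     \<Rightarrow> aefun \<Rightarrow> bool" where
  "virtual_state a b \<Omega> z0 D A B \<Psi> \<longleftrightarrow>
     \<Psi> \<in> L2w b \<and> \<Psi> \<noteq> 0
     \<and> \<Psi> \<in> closure_dom b D A \<and> closure_op b D A \<Psi> + B \<Psi> - z0 *\<^sub>c \<Psi> = 0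
     \<and> (\<exists>K R. bounded_op b a K \<and> finite_rank b K
          \<and> lap_limit a b \<Omega> z0 D (\<lambda>u. A u + B u + K u) R \<and> \<Psi> \<in> R ` L2w a)"

end

theory Submission
  imports Defs
begin

text \<open>
  The proof has an abstract and a concrete half.

  \<^emph>\<open>Abstract half.\<close>  Suppose that some finite rank operator \<open>K0\<close> regularizes \<open>A\<close> at \<open>z0\<close>: the
  resolvents \<open>Rz\<close> of \<open>A + K0\<close> converge, uniformly as operators from
  \<open>L\<^sup>2\<^sub>s\<close> to \<open>L\<^sup>2\<^sub>-\<^sub>s\<^sub>'\<close>, to an operator \<open>R\<close>.  The
  resolvent equation turns this into convergence in the graph norm of the closure of \<open>A\<close>, on which
  \<open>B\<close> is compact.  Hence \<open>Tz = (B - K0) Rz\<close> and \<open>T = (B - K0) R\<close> are compact on \<open>L\<^sup>2\<^sub>s\<close>, \<open>Tz\<close>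
  converges to \<open>T\<close> in norm, and
    \<open>(A + B - z) Rz = 1 + Tz\<close>,  \<open>(A + B - z0) R = 1 + T\<close>,
  where \<open>A\<close> stands for its closure in the second identity.
  By the Riesz theory of compact operators \<open>1 + T\<close> is injective if and only if it is surjective.

  If it is injective, it is invertible, so are the nearby \<open>1 + Tz\<close>, and the resolvent
  \<open>Rz (1 + Tz)\<inverse>\<close> of \<open>A + B\<close> converges in norm to \<open>R (1 + T)\<inverse>\<close>
  (\<open>injective_imp_limit\<close>).  If it is not, a null vector \<open>g\<close> gives a solution \<open>R g\<close> of
  the homogeneous equation; a finite rank \<open>K\<close> restoring injectivity exists
  (\<open>exists_regularizer\<close>), and the limit resolvent of \<open>A + B + K\<close>, being \<open>R\<close> after an invertible
  operator, has \<open>R g\<close> in its range (\<open>virtual_state_from_kernel\<close>).  The two cases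
  exclude each other because even the weak limiting absorption principle for \<open>A + B\<close> forces
  \<open>1 + T\<close> to be surjective (\<open>lap_imp_surjective\<close>), while every virtual state, whichever \<open>K\<close> it comes
  from, has the form \<open>R h\<close> with \<open>h\<close> a null vector of \<open>1 + T\<close> (\<open>lap_excludes_virtual_state\<close>).

  \<^emph>\<open>Concrete half.\<close>  For \<open>Im z > 0\<close> let \<open>k\<close> run over the three cube roots of \<open>z\<close>.  The resolvent of
  \<open>(-i d/dx)\<^sup>3\<close> is convolution with a function \<open>G\<close> obtained from the partial fractions of
  \<open>1 / (\<xi>\<^sup>3 - z)\<close>, and \<open>G t = a + b t + g t\<close> with \<open>a\<close> of order \<open>\<bar>k\<bar>\<^sup>-\<^sup>2\<close>, \<open>b\<close> of order \<open>\<bar>k\<bar>\<^sup>-\<^sup>1\<close>, and \<open>g\<close>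
  regular at \<open>z = 0\<close>.  A rank one operator removes the divergence: let \<open>K0\<close> be the orthogonal
  projection onto the span of the indicator function of the unit interval centred at \<open>0\<close>.  The rank one
  resolvent formula gives for the resolvent of \<open>A + K0\<close> the kernel
    \<open>H x y = G (x - y) - (a + b x + p x) (a - b y + q y) / (a + d)\<close>,
  where \<open>p\<close>, \<open>q\<close>, \<open>d\<close> come from averages of \<open>g\<close>.  The quadratic terms in \<open>a\<close> cancel, which leaves
  \<open>\<bar>H x y\<bar> \<le> 60 \<langle>x\<rangle> \<langle>y\<rangle>\<close> uniformly for small \<open>z\<close> (\<open>H_bound\<close>) and pointwise convergence to a
  kernel \<open>H0\<close> as \<open>z\<close> tends to \<open>0\<close> (\<open>Hker_tendsto\<close>).  For \<open>s, s' > 3/2\<close> the function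
  \<open>\<langle>x\<rangle>\<^sup>2\<^sup>-\<^sup>2\<^sup>s\<^sup>' \<langle>y\<rangle>\<^sup>2\<^sup>-\<^sup>2\<^sup>s\<close> is integrable over the plane, so dominated convergence applies
  to the Hilbert--Schmidt norms and yields uniform convergence of the resolvents of \<open>A + K0\<close>
  (\<open>mean_perturbation_limit\<close>), the hypothesis of the abstract half.
\<close>

section \<open>Compact perturbations of the identity\<close>

text \<open>The weighted spaces and the graph domain of an operator are subspaces of one space of functions,
  each with its own norm; a norm on a carrier set allows operators between them to be composed
  without coercions.  All limits below are produced by compact operators, so the axioms speak of
  the norm only.\<close>

locale normed_carrier = vector_space scale
  for scale :: "complex \<Rightarrow> 'v::ab_group_add \<Rightarrow> 'v" +
  fixes V :: "'v set" and N :: "'v \<Rightarrow> real"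
  assumes carrier: "subspace V"
    and N_nonneg: "0 \<le> N x"
    and N_eq_0: "x \<in> V \<Longrightarrow> N x = 0 \<Longrightarrow> x = 0"
    and N_scale: "x \<in> V \<Longrightarrow> N (scale c x) = cmod c * N x"
    and N_triangle: "x \<in> V \<Longrightarrow> y \<in> V \<Longrightarrow> N (x + y) \<le> N x + N y"
begin

lemma N_0 [simp]: "N 0 = 0"
  using N_scale[of 0 0] subspace_0[OF carrier] by simp

lemma V_0 [simp, intro]: "0 \<in> V" by (rule subspace_0[OF carrier])
lemma V_add [simp, intro]: "x \<in> V \<Longrightarrow> y \<in> V \<Longrightarrow> x + y \<in> V" by (rule subspace_add[OF carrier])
lemma V_diff [simp, intro]: "x \<in> V \<Longrightarrow> y \<in> V \<Longrightarrow> x - y \<in> V" by (rule subspace_diff[OF carrier])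
lemma V_scale [simp, intro]: "x \<in> V \<Longrightarrow> scale c x \<in> V" by (rule subspace_scale[OF carrier])
lemma V_neg [simp, intro]: "x \<in> V \<Longrightarrow> - x \<in> V" by (rule subspace_neg[OF carrier])

lemma N_minus: "x \<in> V \<Longrightarrow> N (- x) = N x"
  using N_scale[of x "-1"] by (simp add: scale_minus_left)

lemma N_commute: "x \<in> V \<Longrightarrow> y \<in> V \<Longrightarrow> N (x - y) = N (y - x)"
  using N_minus[of "x - y"] by simp

lemma N_diff: "x \<in> V \<Longrightarrow> y \<in> V \<Longrightarrow> N (x - y) \<le> N x + N y"
  using N_triangle[of x "- y"] by (simp add: N_minus)

lemma N_dist3: "x \<in> V \<Longrightarrow> y \<in> V \<Longrightarrow> w \<in> V \<Longrightarrow> N (x - w) \<le> N (x - y) + N (y - w)"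
  using N_triangle[of "x - y" "y - w"] by simp

lemma N_le_diff: "x \<in> V \<Longrightarrow> y \<in> V \<Longrightarrow> N x \<le> N y + N (x - y)"
  using N_triangle[of y "x - y"] by simp

abbreviation conv :: "(nat \<Rightarrow> 'v) \<Rightarrow> 'v \<Rightarrow> bool" where
  "conv x l \<equiv> (\<lambda>n. N (x n - l)) \<longlonglongrightarrow> 0"

lemma conv_unique:
  assumes "\<And>n. x n \<in> V" "l \<in> V" "m \<in> V" "conv x l" "conv x m"
  shows "l = m"
proof -
  have "(\<lambda>n. N (x n - l) + N (x n - m)) \<longlonglongrightarrow> 0 + 0" by (intro tendsto_add assms)
  moreover have "N (l - m) \<le> N (x n - l) + N (x n - m)" for n
    using N_dist3[of l "x n" m] N_commute[of l "x n"] assms by simp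
  ultimately have "N (l - m) \<le> 0" by (intro LIMSEQ_le_const[of _ 0]) auto
  then show ?thesis using N_eq_0[of "l - m"] N_nonneg[of "l - m"] assms by auto
qed

lemma conv_add:
  assumes "\<And>n. x n \<in> V" "\<And>n. y n \<in> V" "l \<in> V" "m \<in> V" "conv x l" "conv y m"
  shows "conv (\<lambda>n. x n + y n) (l + m)"
proof -
  have "(\<lambda>n. N (x n - l) + N (y n - m)) \<longlonglongrightarrow> 0 + 0" by (intro tendsto_add assms)
  moreover have "N ((x n + y n) - (l + m)) \<le> N (x n - l) + N (y n - m)" for n
    using N_triangle[of "x n - l" "y n - m"] assms by (simp add: add_diff_add)
  ultimately show ?thesis
    using Lim_null_comparison[of "\<lambda>n. N (x n + y n - (l + m))" "\<lambda>n. N (x n - l) + N (y n - m)" sequentially]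
    by (simp add: N_nonneg)
qed

lemma conv_scale':
  assumes "\<And>n. x n \<in> V" "l \<in> V" "conv x l" and c: "a \<longlonglongrightarrow> c"
  shows "conv (\<lambda>n. scale (a n) (x n)) (scale c l)"
proof -
  have le: "N (scale (a n) (x n) - scale c l) \<le> cmod (a n) * N (x n - l) + cmod (a n - c) * N l" for n
  proof -
    have "scale (a n) (x n) - scale c l = scale (a n) (x n - l) + scale (a n - c) l"
      by (simp add: scale_right_diff_distrib scale_left_diff_distrib)
    then show ?thesis
      using N_triangle[of "scale (a n) (x n - l)" "scale (a n - c) l"] assms
      by (simp add: N_scale)
  qed
  have "(\<lambda>n. a n - c) \<longlonglongrightarrow> 0" using c by (rule LIM_zero)
  then have "(\<lambda>n. cmod (a n) * N (x n - l) + cmod (a n - c) * N l) \<longlonglongrightarrow> cmod c * 0 + 0 * N l"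
    using c assms(3) by (intro tendsto_add tendsto_mult tendsto_norm tendsto_norm_zero tendsto_const)
  then show ?thesis
    using le Lim_null_comparison[of "\<lambda>n. N (scale (a n) (x n) - scale c l)"
      "\<lambda>n. cmod (a n) * N (x n - l) + cmod (a n - c) * N l" sequentially]
    by (simp add: N_nonneg)
qed

lemma conv_scale:
  assumes "\<And>n. x n \<in> V" "l \<in> V" "conv x l"
  shows "conv (\<lambda>n. scale c (x n)) (scale c l)"
  using conv_scale'[OF assms tendsto_const] .

lemma conv_uminus:
  assumes "\<And>n. x n \<in> V" "l \<in> V" "conv x l"
  shows "conv (\<lambda>n. - x n) (- l)"
  using conv_scale[OF assms, of "-1"] by (simp add: scale_minus_left)

lemma conv_diff:
  assumes "\<And>n. x n \<in> V" "\<And>n. y n \<in> V" "l \<in> V" "m \<in> V" "conv x l" "conv y m"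
  shows "conv (\<lambda>n. x n - y n) (l - m)"
  using conv_add[of x "\<lambda>n. - y n" l "- m"] conv_uminus[of y m] assms by simp

lemma conv_N:
  assumes "\<And>n. x n \<in> V" "l \<in> V" "conv x l"
  shows "(\<lambda>n. N (x n)) \<longlonglongrightarrow> N l"
proof -
  have "\<bar>N (x n) - N l\<bar> \<le> N (x n - l)" for n
    using N_le_diff[of "x n" l] N_le_diff[of l "x n"] N_commute[of l "x n"] assms by auto
  then have "(\<lambda>n. N (x n) - N l) \<longlonglongrightarrow> 0"
    by (intro Lim_null_comparison[OF _ assms(3)]) simp
  then show ?thesis using LIM_zero_iff by blast
qed

lemma conv_subseq: "conv x l \<Longrightarrow> strict_mono r \<Longrightarrow> conv (\<lambda>n. x (r n)) l"
  using LIMSEQ_subseq_LIMSEQ[of "\<lambda>n. N (x n - l)" 0 r] by (simp add: o_def)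

definition closed_subspace :: "'v set \<Rightarrow> bool" where
  "closed_subspace M \<longleftrightarrow> subspace M \<and> M \<subseteq> V
     \<and> (\<forall>x l. (\<forall>n. x n \<in> M) \<longrightarrow> l \<in> V \<longrightarrow> conv x l \<longrightarrow> l \<in> M)"

text \<open>A point of \<open>M'\<close> at nearly minimal distance from \<open>M\<close>, recentred and normalized, plays the part of
  a unit normal vector.\<close>

lemma Riesz_almost_orthogonal:
  assumes M: "closed_subspace M" and M': "subspace M'" "M' \<subseteq> V" and MM': "M \<subset> M'"
  obtains x where "x \<in> M'" "N x = 1" "\<And>m. m \<in> M \<Longrightarrow> 1 / 2 \<le> N (x - m)"
proof -
  from MM' obtain p where p: "p \<in> M'" "p \<notin> M" by auto
  have pV: "p \<in> V" and MV: "M \<subseteq> V" and sM: "subspace M"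
    using p M' M by (auto simp: closed_subspace_def)
  define d where "d = Inf ((\<lambda>m. N (p - m)) ` M)"
  have M0: "0 \<in> M" using sM by (rule subspace_0)
  have bdd: "bdd_below ((\<lambda>m. N (p - m)) ` M)"
    by (rule bdd_belowI[of _ 0]) (auto simp: N_nonneg)
  have d_le: "d \<le> N (p - m)" if "m \<in> M" for m
    unfolding d_def using bdd that by (intro cInf_lower) auto
  have ex: "\<exists>m\<in>M. N (p - m) < e" if "d < e" for e
    using cInf_lessD[of "(\<lambda>m. N (p - m)) ` M" e] M0 that unfolding d_def by auto
  have "0 \<le> d" unfolding d_def using M0 by (intro cInf_greatest) (auto simp: N_nonneg)
  moreover have "d \<noteq> 0"
  proof
    assume d0: "d = 0"
    have "\<exists>m\<in>M. N (p - m) < 1 / real (Suc n)" for n using ex[of "1 / real (Suc n)"] d0 by auto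
    then obtain m where m: "\<And>n. m n \<in> M" "\<And>n. N (p - m n) < 1 / real (Suc n)" by metis
    have "conv m p"
    proof (rule Lim_null_comparison[OF _ LIMSEQ_Suc[OF lim_1_over_n]])
      show "\<forall>\<^sub>F n in sequentially. norm (N (m n - p)) \<le> 1 / real (Suc n)"
        using m MV pV N_commute[of p "m _"] less_imp_le N_nonneg by (intro always_eventually) (auto simp: subset_iff N_nonneg intro!: less_imp_le)
    qed
    with M m pV p(2) show False unfolding closed_subspace_def by blast
  qed
  ultimately have d: "0 < d" by simp
  then obtain m where m: "m \<in> M" "N (p - m) < 2 * d" using ex[of "2 * d"] by auto
  define q where "q = N (p - m)"
  have q: "0 < q" "q < 2 * d" using d_le[OF m(1)] d m(2) by (auto simp: q_def)
  define x where "x = scale (complex_of_real (1 / q)) (p - m)"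
  have pmV: "p - m \<in> V" using pV m MV by auto
  show ?thesis
  proof
    show "x \<in> M'" unfolding x_def
      using M' p m MM' by (intro subspace_scale subspace_diff) auto
    show "N x = 1" unfolding x_def N_scale[OF pmV] q_def[symmetric] norm_of_real using q by simp
    fix k assume k: "k \<in> M"
    have "x - k = scale (complex_of_real (1 / q)) (p - (m + scale (complex_of_real q) k))"
      using q by (simp add: x_def scale_right_diff_distrib scale_right_distrib algebra_simps)
    moreover have in_M: "m + scale (complex_of_real q) k \<in> M"
      using sM m k by (intro subspace_add subspace_scale)
    ultimately have "N (x - k) = (1 / q) * N (p - (m + scale (complex_of_real q) k))"
      using N_scale[of "p - (m + scale (complex_of_real q) k)" "complex_of_real (1 / q)"] q MV pV
      by (auto simp: norm_divide)
    moreover have "d \<le> N (p - (m + scale (complex_of_real q) k))" by (rule d_le[OF in_M])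
    ultimately have "(1 / q) * d \<le> N (x - k)" using q by (simp add: divide_right_mono)
    moreover have "1 / 2 \<le> (1 / q) * d" using q by (simp add: field_simps)
    ultimately show "1 / 2 \<le> N (x - k)" by linarith
  qed
qed

lemma N_normalize: "x \<in> V \<Longrightarrow> x \<noteq> 0 \<Longrightarrow> N (scale (complex_of_real (1 / N x)) x) = 1"
  using N_eq_0[of x] N_nonneg[of x] unfolding N_scale[of x] norm_of_real by auto

lemma N_pos: "x \<in> V \<Longrightarrow> x \<noteq> 0 \<Longrightarrow> 0 < N x"
  using N_eq_0[of x] N_nonneg[of x] by fastforce

lemma closed_subspaceD:
  "closed_subspace M \<Longrightarrow> (\<And>n. x n \<in> M) \<Longrightarrow> l \<in> V \<Longrightarrow> conv x l \<Longrightarrow> l \<in> M"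
  unfolding closed_subspace_def by blast

lemma closed_subspace_carrier: "closed_subspace V"
  using carrier by (auto simp: closed_subspace_def)

lemma conv_bounded:
  assumes "\<And>n. x n \<in> V" "l \<in> V" "conv x l"
  obtains C where "\<And>n. N (x n) \<le> C"
proof -
  have "Bseq (\<lambda>n. N (x n))"
    using conv_N[OF assms] by (intro convergent_imp_Bseq convergentI)
  then obtain C where "\<And>n. norm (N (x n)) \<le> C" unfolding Bseq_def by auto
  then show ?thesis using that[of C] by (simp add: N_nonneg)
qed

end

locale bounded_operator = dom: normed_carrier scale V N + cod: normed_carrier scale W M
  for scale :: "complex \<Rightarrow> 'v::ab_group_add \<Rightarrow> 'v" and V N W M +
  fixes T :: "'v \<Rightarrow> 'v"
  assumes T_in: "x \<in> V \<Longrightarrow> T x \<in> W"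
    and T_add: "x \<in> V \<Longrightarrow> y \<in> V \<Longrightarrow> T (x + y) = T x + T y"
    and T_scale: "x \<in> V \<Longrightarrow> T (scale c x) = scale c (T x)"
    and T_bounded: "\<exists>C. \<forall>x\<in>V. M (T x) \<le> C * N x"
begin

lemma T_0 [simp]: "T 0 = 0"
  using T_scale[of 0 0] by simp

lemma T_minus: "x \<in> V \<Longrightarrow> T (- x) = - T x"
  using T_scale[of x "-1"] by (simp add: dom.scale_minus_left)

lemma T_diff: "x \<in> V \<Longrightarrow> y \<in> V \<Longrightarrow> T (x - y) = T x - T y"
  using T_add[of x "- y"] by (simp add: T_minus)

lemma T_bound_pos: obtains C where "C > 0" "\<And>x. x \<in> V \<Longrightarrow> M (T x) \<le> C * N x"
proof -
  obtain C where C: "\<And>x. x \<in> V \<Longrightarrow> M (T x) \<le> C * N x" using T_bounded by auto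
  have "M (T x) \<le> max C 1 * N x" if "x \<in> V" for x
    using C[OF that] dom.N_nonneg[of x] by (meson max.cobounded1 mult_right_mono order_trans)
  then show ?thesis using that[of "max C 1"] by auto
qed

lemma conv_T:
  assumes "\<And>n. x n \<in> V" "l \<in> V" "dom.conv x l"
  shows "cod.conv (\<lambda>n. T (x n)) (T l)"
proof -
  obtain C where C: "\<And>x. x \<in> V \<Longrightarrow> M (T x) \<le> C * N x" using T_bounded by auto
  have "(\<lambda>n. C * N (x n - l)) \<longlonglongrightarrow> 0" using tendsto_mult_right_zero[OF assms(3)] by simp
  then show ?thesis
    using C[of "x _ - l"] assms
      Lim_null_comparison[of "\<lambda>n. M (T (x n) - T l)" "\<lambda>n. C * N (x n - l)" sequentially]
    by (simp add: cod.N_nonneg T_diff[symmetric])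
qed

end

text \<open>Compactness is stated for sequences, the form in which it is used throughout.\<close>

locale compact_operator = dom: normed_carrier scale V N + cod: normed_carrier scale W M
  for scale :: "complex \<Rightarrow> 'v::ab_group_add \<Rightarrow> 'v" and V N W M +
  fixes T :: "'v \<Rightarrow> 'v"
  assumes T_in: "x \<in> V \<Longrightarrow> T x \<in> W"
    and T_add: "x \<in> V \<Longrightarrow> y \<in> V \<Longrightarrow> T (x + y) = T x + T y"
    and T_scale: "x \<in> V \<Longrightarrow> T (scale c x) = scale c (T x)"
    and T_compact: "\<And>X C. (\<And>n::nat. X n \<in> V) \<Longrightarrow> (\<And>n. N (X n) \<le> C) \<Longrightarrow>
      \<exists>r y. strict_mono (r :: nat \<Rightarrow> nat) \<and> y \<in> W \<and> (\<lambda>n. M (T (X (r n)) - y)) \<longlonglongrightarrow> 0"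

text \<open>Otherwise there are unit vectors \<open>y n\<close> with images of norm above \<open>n\<close>, and no subsequence of these
  images converges.\<close>

sublocale compact_operator \<subseteq> bounded_operator
proof
  show "\<exists>C. \<forall>x\<in>V. M (T x) \<le> C * N x"
  proof (rule ccontr)
    assume "\<not> ?thesis"
    then have "\<forall>n. \<exists>x\<in>V. real n * N x < M (T x)" by (metis not_le)
    then obtain x where x: "\<And>n. x n \<in> V" "\<And>n. real n * N (x n) < M (T (x n))" by metis
    have T0: "T 0 = 0" using T_scale[of 0 0] by simp
    have nz: "x n \<noteq> 0" for n using x(2)[of n] by (auto simp: T0)
    define y where "y n = scale (complex_of_real (1 / N (x n))) (x n)" for n
    have y: "y n \<in> V" "N (y n) = 1" for n
      unfolding y_def using dom.N_normalize[OF x(1) nz] x(1) by auto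
    have big: "real n < M (T (y n))" for n
    proof -
      have "M (T (y n)) = (1 / N (x n)) * M (T (x n))"
        using dom.N_nonneg[of "x n"] unfolding y_def T_scale[OF x(1)] cod.N_scale[OF T_in[OF x(1)]] norm_of_real by simp
      then show ?thesis using x(2)[of n] dom.N_pos[OF x(1) nz, of n] by (simp add: pos_less_divide_eq)
    qed
    obtain r w where r: "strict_mono r" "w \<in> W" "cod.conv (\<lambda>n. T (y (r n))) w"
      using T_compact[of y 1] y by auto
    obtain C where C: "\<And>n. M (T (y (r n))) \<le> C"
      using cod.conv_bounded[OF _ r(2) r(3)] T_in y by blast
    obtain n where "C < real n" using reals_Archimedean2 by blast
    moreover have "n \<le> r n" using r(1) by (simp add: seq_suble)
    ultimately show False using C[of n] big[of "r n"] by linarith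
  qed
qed (use T_in T_add T_scale in auto)

locale compact_endomorphism = compact_operator scale V N V N T
  for scale :: "complex \<Rightarrow> 'v::ab_group_add \<Rightarrow> 'v" and V N T
begin

definition S :: "'v \<Rightarrow> 'v" where "S x = x + T x"

lemma S_V [simp, intro]: "x \<in> V \<Longrightarrow> S x \<in> V" unfolding S_def using T_in by auto
lemma S_add: "x \<in> V \<Longrightarrow> y \<in> V \<Longrightarrow> S (x + y) = S x + S y"
  by (simp add: S_def T_add algebra_simps)
lemma S_scale: "x \<in> V \<Longrightarrow> S (scale c x) = scale c (S x)"
  by (simp add: S_def T_scale dom.scale_right_distrib)
lemma S_diff: "x \<in> V \<Longrightarrow> y \<in> V \<Longrightarrow> S (x - y) = S x - S y"
  by (simp add: S_def T_diff algebra_simps)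
lemma S_0 [simp]: "S 0 = 0" by (simp add: S_def)

lemma conv_S:
  assumes "\<And>n. x n \<in> V" "l \<in> V" "dom.conv x l"
  shows "dom.conv (\<lambda>n. S (x n)) (S l)"
  unfolding S_def using assms T_in by (intro dom.conv_add conv_T) auto

lemma inj_S_iff: "inj_on S V \<longleftrightarrow> (\<forall>x\<in>V. S x = 0 \<longrightarrow> x = 0)"
proof
  assume "inj_on S V" then show "\<forall>x\<in>V. S x = 0 \<longrightarrow> x = 0" 
    by (metis S_0 dom.V_0 inj_onD)
next
  assume *: "\<forall>x\<in>V. S x = 0 \<longrightarrow> x = 0"
  show "inj_on S V"
  proof (rule inj_onI)
    fix x y assume "x \<in> V" "y \<in> V" "S x = S y"
    then have "S (x - y) = 0" by (simp add: S_diff)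
    with * \<open>x \<in> V\<close> \<open>y \<in> V\<close> have "x - y = 0" by blast
    then show "x = y" by simp
  qed
qed

text \<open>As \<open>x = S x - T x\<close>, compactness of \<open>T\<close> turns convergence of \<open>S (x n)\<close> into convergence of a
  subsequence of \<open>x n\<close>.\<close>

lemma preimage_conv:
  assumes x: "\<And>n. x n \<in> V" "\<And>n. N (x n) \<le> C" and l: "l \<in> V" "dom.conv (\<lambda>n. S (x n)) l"
  obtains r w where "strict_mono r" "w \<in> V" "dom.conv (\<lambda>n. x (r n)) w" "S w = l"
proof -
  obtain r y where r: "strict_mono r" "y \<in> V" "dom.conv (\<lambda>n. T (x (r n))) y"
    using T_compact[of x C] x by auto
  have "dom.conv (\<lambda>n. S (x (r n)) - T (x (r n))) (l - y)"
    using r l x T_in by (intro dom.conv_diff dom.conv_subseq[OF l(2)]) auto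
  then have w: "dom.conv (\<lambda>n. x (r n)) (l - y)" by (simp add: S_def)
  have "S (l - y) = l"
    using x r l
    by (intro dom.conv_unique[OF _ _ _ conv_S[OF _ _ w] dom.conv_subseq[OF l(2) r(1)]]) auto
  then show ?thesis using that[OF r(1) _ w] r l by auto
qed

text \<open>Otherwise unit vectors with \<open>S (y n)\<close> tending to \<open>0\<close> would accumulate at a unit vector in the
  kernel of \<open>S\<close>.\<close>

lemma S_bounded_below:
  assumes inj: "inj_on S V"
  obtains c where "c > 0" "\<And>x. x \<in> V \<Longrightarrow> c * N x \<le> N (S x)"
proof (rule ccontr)
  assume neg: "\<not> thesis"
  have "\<exists>x\<in>V. N (S x) < 1 / real (Suc n) * N x" for n
    using neg that[of "1 / real (Suc n)"] by (force simp: not_le)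
  then obtain x where x: "\<And>n. x n \<in> V" "\<And>n. N (S (x n)) < 1 / real (Suc n) * N (x n)" by metis
  have nz: "x n \<noteq> 0" for n using x(2)[of n] by (auto)
  define y where "y n = scale (complex_of_real (1 / N (x n))) (x n)" for n
  have y: "y n \<in> V" "N (y n) = 1" for n
    unfolding y_def using dom.N_normalize[OF x(1) nz] x(1) by auto
  have small: "N (S (y n)) \<le> 1 / real (Suc n)" for n
  proof -
    have "N (S (y n)) = (1 / N (x n)) * N (S (x n))"
      using dom.N_nonneg[of "x n"] unfolding y_def S_scale[OF x(1)] dom.N_scale[OF S_V[OF x(1)]] norm_of_real by simp
    also have "\<dots> \<le> 1 / real (Suc n)"
      using mult_left_mono[OF less_imp_le[OF x(2)[of n]], of "1 / N (x n)"] dom.N_pos[OF x(1) nz, of n]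
      by simp
    finally show ?thesis .
  qed
  have "dom.conv (\<lambda>n. S (y n)) 0"
    by (rule Lim_null_comparison[OF _ LIMSEQ_Suc[OF lim_1_over_n]])
       (use small in \<open>auto simp: dom.N_nonneg\<close>)
  then obtain r w where r: "strict_mono r" "w \<in> V" "dom.conv (\<lambda>n. y (r n)) w" "S w = 0"
    using preimage_conv[of y 1 0] y by auto
  have "(\<lambda>n. N (y (r n))) \<longlonglongrightarrow> N w" using dom.conv_N[OF _ r(2,3)] y by auto
  then have "N w = 1" using y by (simp add: LIMSEQ_const_iff)
  moreover have "w = 0" using inj r unfolding inj_S_iff by auto
  ultimately show False by simp
qed

text \<open>By the lower bound, preimages of a convergent sequence are bounded, so \<open>preimage_conv\<close> applies.\<close>

lemma closed_image:
  assumes inj: "inj_on S V" and M: "dom.closed_subspace M"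
  shows "dom.closed_subspace (S ` M)"
proof -
  have MV: "M \<subseteq> V" and sM: "dom.subspace M" using M by (auto simp: dom.closed_subspace_def)
  obtain c where c: "c > 0" "\<And>x. x \<in> V \<Longrightarrow> c * N x \<le> N (S x)"
    using S_bounded_below[OF inj] by blast
  have "dom.subspace (S ` M)"
    unfolding dom.subspace_def
  proof (intro conjI ballI allI)
    show "0 \<in> S ` M" using dom.subspace_0[OF sM] by (metis S_0 imageI)
    fix x assume "x \<in> S ` M"
    then obtain a where a: "a \<in> M" "x = S a" by auto
    show "scale k x \<in> S ` M" for k
      using a MV S_scale[of a k] dom.subspace_scale[OF sM a(1), of k] by (metis imageI subsetD)
    fix y assume "y \<in> S ` M"
    then obtain b where b: "b \<in> M" "y = S b" by auto
    show "x + y \<in> S ` M"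
      using a b MV S_add[of a b] dom.subspace_add[OF sM a(1) b(1)] by (metis imageI subsetD)
  qed
  moreover have "l \<in> S ` M" if seq: "\<And>n. x n \<in> S ` M" "l \<in> V" "dom.conv x l" for x l
  proof -
    have "\<forall>n. \<exists>m. m \<in> M \<and> x n = S m" using seq(1) by blast
    then obtain m where m: "\<And>n. m n \<in> M" "\<And>n. x n = S (m n)" by metis
    have mV: "m n \<in> V" for n using m MV by auto
    obtain C where C: "\<And>n. N (x n) \<le> C"
      using dom.conv_bounded[OF _ seq(2,3)] m mV by auto
    have m_le: "N (m n) \<le> C / c" for n
      using c(2)[OF mV, of n] C[of n] c(1) m by (simp add: field_simps)
    have "dom.conv (\<lambda>n. S (m n)) l" using seq(3) by (simp add: m(2))
    from preimage_conv[OF mV m_le seq(2) this]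
    obtain r w where r: "strict_mono r" "w \<in> V" "dom.conv (\<lambda>n. m (r n)) w" "S w = l" .
    have "w \<in> M" by (rule dom.closed_subspaceD[OF M m(1) r(2,3)])
    with r show ?thesis by auto
  qed
  moreover have "S ` M \<subseteq> V" using MV by auto
  ultimately show ?thesis unfolding dom.closed_subspace_def by blast
qed

lemma no_separated_sequence:
  assumes x: "\<And>n::nat. x n \<in> V" "\<And>n. N (x n) \<le> 1"
    and sep: "\<And>m n. m < n \<Longrightarrow> 1 / 2 \<le> N (T (x n) - T (x m))"
  shows False
proof -
  obtain r y where r: "strict_mono r" "y \<in> V" "dom.conv (\<lambda>n. T (x (r n))) y"
    using T_compact[of x 1] x by auto
  have "\<forall>\<^sub>F n in sequentially. N (T (x (r n)) - y) < 1 / 4"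
    using order_tendstoD(2)[OF r(3), of "1 / 4"] by simp
  then obtain n where n: "\<And>k. k \<ge> n \<Longrightarrow> N (T (x (r k)) - y) < 1 / 4"
    unfolding eventually_sequentially by auto
  have "r n < r (Suc n)" using r(1) by (simp add: strict_mono_Suc_iff)
  from sep[OF this] have "1 / 2 \<le> N (T (x (r (Suc n))) - T (x (r n)))" .
  also have "\<dots> \<le> N (T (x (r (Suc n))) - y) + N (T (x (r n)) - y)"
    using dom.N_dist3[of "T (x (r (Suc n)))" y "T (x (r n))"] dom.N_commute[of y "T (x (r n))"] T_in x r
    by simp
  also have "\<dots> < 1 / 2" using n[of n] n[of "Suc n"] by simp
  finally show False by simp
qed

text \<open>Choose unit vectors \<open>x n\<close> of \<open>M n\<close> almost orthogonal to \<open>M (Suc n)\<close>.  For \<open>m < n\<close> the difference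
  \<open>T (x n) - T (x m)\<close> is \<open>x m\<close> up to an element of \<open>M (Suc m)\<close>, so the images under \<open>T\<close> stay
  separated, which compactness forbids.\<close>

lemma no_decreasing_chain:
  assumes closed: "\<And>n. dom.closed_subspace (M n)" and dec: "\<And>n. M (Suc n) \<subset> M n"
    and S: "\<And>n. S ` M n \<subseteq> M (Suc n)"
  shows False
proof -
  have "\<exists>x. x \<in> M n \<and> N x = 1 \<and> (\<forall>m\<in>M (Suc n). 1 / 2 \<le> N (x - m))" for n
  proof -
    have "dom.subspace (M n)" "M n \<subseteq> V" using closed[of n] by (auto simp: dom.closed_subspace_def)
    then show ?thesis
      using dom.Riesz_almost_orthogonal[OF closed[of "Suc n"] _ _ dec[of n]] by metis
  qed
  then obtain x where x: "\<And>n. x n \<in> M n" "\<And>n. N (x n) = 1"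
    "\<And>n m. m \<in> M (Suc n) \<Longrightarrow> 1 / 2 \<le> N (x n - m)" by metis
  have sub: "dom.subspace (M n)" and MV: "M n \<subseteq> V" for n
    using closed[of n] by (auto simp: dom.closed_subspace_def)
  have anti: "M n \<subseteq> M m" if "m \<le> n" for m n
    using lift_Suc_antimono_le[of M, OF _ that] dec by auto
  have xV: "x n \<in> V" for n using x(1)[of n] MV by blast
  show False
  proof (rule no_separated_sequence[of x])
    fix m n :: nat assume "m < n"
    have "S (x n) \<in> M (Suc n)" "S (x m) \<in> M (Suc m)" using S x by auto
    then have "S (x n) \<in> M (Suc m)" "S (x m) \<in> M (Suc m)" "x n \<in> M (Suc m)"
      using anti[of "Suc m" "Suc n"] anti[of "Suc m" n] x(1)[of n] \<open>m < n\<close> by auto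
    then have "S (x m) - S (x n) + x n \<in> M (Suc m)"
      using sub by (intro dom.subspace_add dom.subspace_diff)
    from x(3)[OF this] have "1 / 2 \<le> N (T (x n) - T (x m))"
      by (simp add: S_def algebra_simps)
    then show "1 / 2 \<le> N (T (x n) - T (x m))" .
  qed (use x xV in auto)
qed

text \<open>The same argument with \<open>x n\<close> in \<open>M (Suc n)\<close> almost orthogonal to \<open>M n\<close>.\<close>

lemma no_increasing_chain:
  assumes closed: "\<And>n. dom.closed_subspace (M n)" and inc: "\<And>n. M n \<subset> M (Suc n)"
    and S: "\<And>n. S ` M (Suc n) \<subseteq> M n"
  shows False
proof -
  have "\<exists>x. x \<in> M (Suc n) \<and> N x = 1 \<and> (\<forall>m\<in>M n. 1 / 2 \<le> N (x - m))" for n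
  proof -
    have "dom.subspace (M (Suc n))" "M (Suc n) \<subseteq> V" using closed[of "Suc n"] by (auto simp: dom.closed_subspace_def)
    then show ?thesis
      using dom.Riesz_almost_orthogonal[OF closed[of n] _ _ inc[of n]] by metis
  qed
  then obtain x where x: "\<And>n. x n \<in> M (Suc n)" "\<And>n. N (x n) = 1"
    "\<And>n m. m \<in> M n \<Longrightarrow> 1 / 2 \<le> N (x n - m)" by metis
  have sub: "dom.subspace (M n)" and MV: "M n \<subseteq> V" for n
    using closed[of n] by (auto simp: dom.closed_subspace_def)
  have mono: "M m \<subseteq> M n" if "m \<le> n" for m n
    using lift_Suc_mono_le[of M, OF _ that] inc by auto
  have xV: "x n \<in> V" for n using x(1)[of n] MV by blast
  show False
  proof (rule no_separated_sequence[of x])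
    fix m n :: nat assume "m < n"
    have "S (x n) \<in> M n" "S (x m) \<in> M m" using S x by auto
    then have "S (x n) \<in> M n" "S (x m) \<in> M n" "x m \<in> M n"
      using mono[of m n] mono[of "Suc m" n] x(1)[of m] \<open>m < n\<close> by auto
    then have "S (x n) - S (x m) + x m \<in> M n"
      using sub by (intro dom.subspace_add dom.subspace_diff)
    from x(3)[OF this] have "1 / 2 \<le> N (T (x m) - T (x n))"
      by (simp add: S_def algebra_simps)
    then show "1 / 2 \<le> N (T (x n) - T (x m))"
      using dom.N_commute T_in xV by simp
  qed (use x xV in auto)
qed

text \<open>If \<open>S\<close> is injective but not surjective, the images of its powers decrease strictly.\<close>

lemma inj_imp_surj:
  assumes inj: "inj_on S V"
  shows "S ` V = V"
proof (rule ccontr)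
  assume ne: "S ` V \<noteq> V"
  have "S ` V \<subseteq> V" by auto
  then obtain v where v: "v \<in> V" "v \<notin> S ` V" using ne by blast
  define M where "M n = (S ^^ n) ` V" for n
  have M_Suc: "M (Suc n) = S ` M n" for n by (auto simp: M_def image_image)
  have closed: "dom.closed_subspace (M n)" for n
  proof (induction n)
    case 0 then show ?case by (simp add: M_def dom.closed_subspace_carrier)
  next
    case (Suc n) then show ?case unfolding M_Suc by (rule closed_image[OF inj])
  qed
  have MV: "M n \<subseteq> V" for n using closed[of n] by (auto simp: dom.closed_subspace_def)
  have strict: "M (Suc n) \<subset> M n" for n
  proof (induction n)
    case 0 then show ?case using v M_Suc[of 0] by (auto simp: M_def)
  next
    case (Suc n)
    then show ?case unfolding M_Suc[of "Suc n"] M_Suc[of n]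
      using inj_on_image_eq_iff[OF inj MV[of "Suc n"] MV[of n]] M_Suc[of n] by auto
  qed
  show False
    by (rule no_decreasing_chain[of M]) (use closed strict M_Suc in auto)
qed

text \<open>If \<open>S\<close> is surjective but not injective, the kernels of its powers increase strictly.\<close>

lemma surj_imp_inj:
  assumes surj: "S ` V = V"
  shows "inj_on S V"
proof (rule ccontr)
  assume "\<not> inj_on S V"
  then obtain v where v: "v \<in> V" "v \<noteq> 0" "S v = 0" unfolding inj_S_iff by auto
  define M where "M n = {x \<in> V. (S ^^ n) x = 0}" for n
  have iter_V: "(S ^^ n) x \<in> V" if "x \<in> V" for n x
    using that by (induction n) auto
  have iter_lin: "(S ^^ n) (x + y) = (S ^^ n) x + (S ^^ n) y" "(S ^^ n) (scale c x) = scale c ((S ^^ n) x)"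
    if "x \<in> V" "y \<in> V" for n x y c
    using that by (induction n) (auto simp: S_add S_scale iter_V)
  have iter_0: "(S ^^ n) 0 = 0" for n by (induction n) auto
  have iter_conv: "dom.conv (\<lambda>k. (S ^^ n) (x k)) ((S ^^ n) l)"
    if "\<And>k. x k \<in> V" "l \<in> V" "dom.conv x l" for n x l
    by (induction n) (auto intro!: conv_S iter_V simp: that)
  have closed: "dom.closed_subspace (M n)" for n
    unfolding dom.closed_subspace_def dom.subspace_def
  proof (intro conjI ballI allI impI)
    fix x l assume x: "\<forall>k. x k \<in> M n" and l: "l \<in> V" "dom.conv x l"
    have "dom.conv (\<lambda>k. (S ^^ n) (x k)) 0" using x by (simp add: M_def)
    then have "(S ^^ n) l = 0"
      using x l iter_V by (intro dom.conv_unique[OF _ _ _ iter_conv[of x l n]]) (auto simp: M_def)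
    then show "l \<in> M n" using l by (simp add: M_def)
  qed (auto simp: M_def iter_lin iter_0)
  have S_M: "S x \<in> M n \<longleftrightarrow> x \<in> M (Suc n)" if "x \<in> V" for x n
    using that by (simp add: M_def funpow_swap1)
  have sub: "M n \<subseteq> M (Suc n)" for n
    by (auto simp: M_def)
  have "\<exists>x. x \<in> M (Suc n) \<and> x \<notin> M n" for n
  proof (induction n)
    case 0 then show ?case using v by (intro exI[of _ v]) (auto simp: M_def)
  next
    case (Suc n)
    then obtain x where x: "x \<in> M (Suc n)" "x \<notin> M n" by auto
    then have "x \<in> V" by (simp add: M_def)
    then obtain y where y: "y \<in> V" "x = S y" using surj by auto
    then have "y \<in> M (Suc (Suc n))" "y \<notin> M (Suc n)"
      using x S_M[OF y(1), of "Suc n"] S_M[OF y(1), of n] by simp_all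
    then show ?case by auto
  qed
  with sub have "M n \<subset> M (Suc n)" for n by blast
  then show False
    by (rule no_increasing_chain[of M, OF closed]) (auto simp: M_def funpow_swap1)
qed

end

context normed_carrier
begin

text \<open>Induction on the dimension.  The coefficients of the new vector \<open>a\<close> along a bounded sequence are
  bounded: otherwise, after division by them, elements of \<open>span F\<close> would converge to \<open>a\<close>, and
  by induction \<open>a\<close> would lie in \<open>span F\<close>.\<close>

lemma finite_dim_compact:
  assumes "finite F" "F \<subseteq> V" "\<And>n::nat. x n \<in> span F" "\<And>n. N (x n) \<le> C"
  shows "\<exists>r y. strict_mono (r :: nat \<Rightarrow> nat) \<and> y \<in> span F \<and> conv (\<lambda>n. x (r n)) y"
  using assms
proof (induction F arbitrary: x C rule: finite_induct)
  case empty
  then show ?case by (intro exI[of _ id] exI[of _ 0]) (simp add: strict_mono_def)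
next
  case (insert a F)
  have FV: "F \<subseteq> V" and aV: "a \<in> V" using insert.prems by auto
  have span_V: "span F \<subseteq> V" using FV carrier by (rule span_minimal)
  show ?case
  proof (cases "a \<in> span F")
    case True
    then have "span (insert a F) = span F" by (rule span_redundant)
    then show ?thesis using insert.IH[OF FV _ insert.prems(3)] insert.prems(2) by simp
  next
    case False
    have "\<exists>c. x n - scale c a \<in> span F" for n
      using insert.prems(2)[of n] by (simp add: span_insert)
    then obtain c where c: "\<And>n. x n - scale (c n) a \<in> span F" by metis
    have xV: "x n \<in> V" for n
      using V_add[of "x n - scale (c n) a" "scale (c n) a"] span_V c[of n] aV by auto
    have "\<exists>K. \<forall>n. cmod (c n) \<le> K"
    proof (rule ccontr)
      assume "\<nexists>K. \<forall>n. cmod (c n) \<le> K"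
      then have "\<forall>k. \<exists>n. real (Suc k) < cmod (c n)" by (metis not_le)
      then obtain m where m: "\<And>k. real (Suc k) < cmod (c (m k))" by metis
      have cm: "c (m k) \<noteq> 0" for k using m[of k] by auto
      define w where "w k = scale (- 1 / c (m k)) (x (m k) - scale (c (m k)) a)" for k
      have w: "w k \<in> span F" for k unfolding w_def by (intro span_scale c)
      have wV: "w k \<in> V" for k using w span_V by auto
      have w_a: "w k - a = scale (- 1 / c (m k)) (x (m k))" for k
        using cm[of k] by (simp add: w_def scale_right_diff_distrib scale_minus_left)
      have C0: "0 \<le> C" using N_nonneg[of "x 0"] insert.prems(3)[of 0] by linarith
      have "N (w k - a) \<le> C * (1 / real (Suc k))" for k
      proof -
        have "N (w k - a) = (1 / cmod (c (m k))) * N (x (m k))"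
          unfolding w_a N_scale[OF xV] by (simp add: norm_divide)
        also have "\<dots> \<le> (1 / real (Suc k)) * C"
          using m[of k] insert.prems(3)[of "m k"] N_nonneg cm[of k]
          by (intro mult_mono divide_left_mono mult_pos_pos) auto
        finally show ?thesis by (simp add: mult.commute)
      qed
      then have wa: "conv w a"
        using tendsto_mult_right_zero[OF LIMSEQ_Suc[OF lim_1_over_n], of C]
          Lim_null_comparison[of "\<lambda>k. N (w k - a)" "\<lambda>k. C * (1 / real (Suc k))" sequentially]
        by (simp add: N_nonneg)
      have "\<exists>C'. \<forall>n. N (w n) \<le> C'" by (rule conv_bounded[of w, OF wV aV wa]) blast
      then obtain C' where C': "\<And>n. N (w n) \<le> C'" by blast
      obtain r y where r: "strict_mono r" "y \<in> span F" "conv (\<lambda>n. w (r n)) y"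
        using insert.IH[of w, OF FV w C'] by auto
      have "y = a"
        using conv_unique[OF _ _ aV r(3) conv_subseq[OF wa r(1)]] wV r(2) span_V by auto
      with r False show False by simp
    qed
    then obtain K where K: "\<And>n. cmod (c n) \<le> K" by auto
    have "bounded (range c)" using K by (auto simp: bounded_iff)
    then obtain c0 r1 where r1: "strict_mono r1" "(\<lambda>n. c (r1 n)) \<longlonglongrightarrow> c0"
      using bounded_imp_convergent_subsequence[of c] by (auto simp: o_def)
    have v_bd: "N (x (r1 n) - scale (c (r1 n)) a) \<le> C + K * N a" for n
    proof -
      have "N (x (r1 n) - scale (c (r1 n)) a) \<le> N (x (r1 n)) + cmod (c (r1 n)) * N a"
        using N_diff[OF xV V_scale[OF aV]] N_scale[OF aV] by metis
      also have "\<dots> \<le> C + K * N a"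
        using insert.prems(3) K N_nonneg[of a] by (intro add_mono mult_right_mono)
      finally show ?thesis .
    qed
    obtain r2 y where r2: "strict_mono r2" "y \<in> span F"
      "conv (\<lambda>n. x (r1 (r2 n)) - scale (c (r1 (r2 n))) a) y"
      using insert.IH[of "\<lambda>n. x (r1 n) - scale (c (r1 n)) a", OF FV c v_bd] by auto
    have "(\<lambda>n. c (r1 (r2 n)) - c0) \<longlonglongrightarrow> 0"
      using LIMSEQ_subseq_LIMSEQ[OF r1(2) r2(1)] by (simp add: o_def LIM_zero)
    then have "(\<lambda>n. cmod (c (r1 (r2 n)) - c0) * N a) \<longlonglongrightarrow> 0"
      by (intro tendsto_mult_left_zero tendsto_norm_zero)
    moreover have "N (scale (c (r1 (r2 n))) a - scale c0 a) = cmod (c (r1 (r2 n)) - c0) * N a" for n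
      using N_scale[OF aV] by (simp add: scale_left_diff_distrib[symmetric])
    ultimately have "conv (\<lambda>n. scale (c (r1 (r2 n))) a) (scale c0 a)" by simp
    then have "conv (\<lambda>n. (x (r1 (r2 n)) - scale (c (r1 (r2 n))) a) + scale (c (r1 (r2 n))) a) (y + scale c0 a)"
      using r2 span_V aV c xV by (intro conv_add) auto
    then have "conv (\<lambda>n. x ((r1 \<circ> r2) n)) (y + scale c0 a)" by simp
    moreover have "y + scale c0 a \<in> span (insert a F)"
      using r2(2) span_mono[of F "insert a F"] by (intro span_add span_scale) (auto intro: span_base)
    ultimately show ?thesis using strict_mono_o[OF r1(1) r2(1)] by blast
  qed
qed

text \<open>The spanning set need not lie in \<open>V\<close>; a basis of \<open>V \<inter> span F\<close> takes its place.\<close>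

lemma finite_span_compact:
  assumes F: "finite F" and x: "\<And>n::nat. x n \<in> span F" "\<And>n. x n \<in> V" "\<And>n. N (x n) \<le> C"
  shows "\<exists>r y. strict_mono (r :: nat \<Rightarrow> nat) \<and> y \<in> V \<and> conv (\<lambda>n. x (r n)) y"
proof -
  have sub: "subspace (V \<inter> span F)" by (intro subspace_inter carrier subspace_span)
  obtain Z where Z: "Z \<subseteq> V \<inter> span F" "independent Z" "V \<inter> span F \<subseteq> span Z"
    using maximal_independent_subset[of "V \<inter> span F"] by auto
  have "finite Z" using independent_span_bound[OF F Z(2)] Z(1) by auto
  moreover have "Z \<subseteq> V" using Z(1) by auto
  moreover have "x n \<in> span Z" for n using x Z by auto
  ultimately obtain r y where "strict_mono r" "y \<in> span Z" "conv (\<lambda>n. x (r n)) y"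
    using finite_dim_compact[of Z x C] x(3) by blast
  moreover have "span Z \<subseteq> V" using span_minimal[OF \<open>Z \<subseteq> V\<close> carrier] .
  ultimately show ?thesis by blast
qed

end

lemma compact_operator_comp:
  assumes "bounded_operator smul V N W M R" "compact_operator smul W M Z P T"
  shows "compact_operator smul V N Z P (\<lambda>x. T (R x))"
proof -
  interpret R: bounded_operator smul V N W M R by fact
  interpret T: compact_operator smul W M Z P T by fact
  show ?thesis
  proof
    fix X :: "nat \<Rightarrow> _" and C
    assume X: "\<And>n. X n \<in> V" "\<And>n. N (X n) \<le> C"
    obtain K where K: "K > 0" "\<And>x. x \<in> V \<Longrightarrow> M (R x) \<le> K * N x" using R.T_bound_pos by blast
    have "M (R (X n)) \<le> K * C" for n
      using K(2)[OF X(1), of n] mult_left_mono[OF X(2)[of n], of K] K(1) by linarith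
    then show "\<exists>r y. strict_mono r \<and> y \<in> Z \<and> (\<lambda>n. P (T (R (X (r n))) - y)) \<longlonglongrightarrow> 0"
      by (intro T.T_compact[of "\<lambda>n. R (X n)"]) (use R.T_in X in auto)
  qed (auto simp: R.T_in T.T_in R.T_add T.T_add R.T_scale T.T_scale)
qed

lemma compact_operator_diff:
  assumes "compact_operator smul V N W M T" "compact_operator smul V N W M U"
  shows "compact_operator smul V N W M (\<lambda>x. T x - U x)"
proof -
  interpret T: compact_operator smul V N W M T by fact
  interpret U: compact_operator smul V N W M U by fact
  show ?thesis
  proof
    fix X :: "nat \<Rightarrow> _" and C
    assume X: "\<And>n. X n \<in> V" "\<And>n. N (X n) \<le> C"
    obtain r y where r: "strict_mono r" "y \<in> W" "T.cod.conv (\<lambda>n. T (X (r n))) y"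
      using T.T_compact[of X, OF X] by auto
    obtain q w where q: "strict_mono q" "w \<in> W" "T.cod.conv (\<lambda>n. U (X (r (q n)))) w"
      using U.T_compact[of "\<lambda>n. X (r n)" C] X by auto
    have "T.cod.conv (\<lambda>n. T (X (r (q n))) - U (X (r (q n)))) (y - w)"
      using X r q T.T_in U.T_in by (intro T.cod.conv_diff T.cod.conv_subseq[OF r(3)]) auto
    then show "\<exists>r y. strict_mono r \<and> y \<in> W \<and> (\<lambda>n. M (T (X (r n)) - U (X (r n)) - y)) \<longlonglongrightarrow> 0"
      using strict_mono_o[OF r(1) q(1)] r(2) q(2) by (intro exI[of _ "r \<circ> q"] exI[of _ "y - w"] conjI) auto
  qed (auto simp: T.T_in U.T_in T.T_add U.T_add T.T_scale U.T_scale T.dom.scale_right_diff_distrib algebra_simps)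
qed

lemma compact_operator_uminus:
  assumes "compact_operator smul V N W M T"
  shows "compact_operator smul V N W M (\<lambda>x. - T x)"
proof -
  interpret T: compact_operator smul V N W M T by fact
  show ?thesis
  proof
    fix X :: "nat \<Rightarrow> _" and C
    assume X: "\<And>n. X n \<in> V" "\<And>n. N (X n) \<le> C"
    obtain r y where r: "strict_mono r" "y \<in> W" "T.cod.conv (\<lambda>n. T (X (r n))) y"
      using T.T_compact[of X, OF X] by auto
    have "T.cod.conv (\<lambda>n. - T (X (r n))) (- y)"
      by (rule T.cod.conv_uminus[OF _ r(2,3)]) (simp add: X T.T_in)
    then show "\<exists>r y. strict_mono r \<and> y \<in> W \<and> (\<lambda>n. M (- T (X (r n)) - y)) \<longlonglongrightarrow> 0"
      using r by blast
  qed (auto simp: T.T_in T.T_add T.T_scale T.dom.scale_minus_right)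
qed

lemma compact_operator_add:
  assumes "compact_operator smul V N W M T" "compact_operator smul V N W M U"
  shows "compact_operator smul V N W M (\<lambda>x. T x + U x)"
  using compact_operator_diff[OF assms(1) compact_operator_uminus[OF assms(2)]] by simp

lemma (in bounded_operator) finite_rank_imp_compact:
  assumes "finite F" "T ` V \<subseteq> dom.span F"
  shows "compact_operator scale V N W M T"
proof
  fix X :: "nat \<Rightarrow> _" and C
  assume X: "\<And>n. X n \<in> V" "\<And>n. N (X n) \<le> C"
  obtain K where K: "K > 0" "\<And>x. x \<in> V \<Longrightarrow> M (T x) \<le> K * N x" using T_bound_pos by blast
  have "M (T (X n)) \<le> K * C" for n
    using K(2)[OF X(1), of n] mult_left_mono[OF X(2)[of n], of K] K(1) by linarith
  then show "\<exists>r y. strict_mono r \<and> y \<in> W \<and> (\<lambda>n. M (T (X (r n)) - y)) \<longlonglongrightarrow> 0"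
    by (intro cod.finite_span_compact[OF assms(1), of "\<lambda>n. T (X n)"]) (use assms T_in X in auto)
qed (auto simp: T_in T_add T_scale)

lemma bounded_operator_comp:
  assumes "bounded_operator smul V N W M R" "bounded_operator smul W M Z P T"
  shows "bounded_operator smul V N Z P (\<lambda>x. T (R x))"
proof -
  interpret R: bounded_operator smul V N W M R by fact
  interpret T: bounded_operator smul W M Z P T by fact
  show ?thesis
  proof
    obtain K where K: "K > 0" "\<And>x. x \<in> V \<Longrightarrow> M (R x) \<le> K * N x" using R.T_bound_pos by blast
    obtain L where L: "L > 0" "\<And>x. x \<in> W \<Longrightarrow> P (T x) \<le> L * M x" using T.T_bound_pos by blast
    have "P (T (R x)) \<le> (L * K) * N x" if "x \<in> V" for x
      using order_trans[OF L(2)[OF R.T_in[OF that]] mult_left_mono[OF K(2)[OF that] less_imp_le[OF L(1)]]]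
      by (simp add: mult.assoc)
    then show "\<exists>C. \<forall>x\<in>V. P (T (R x)) \<le> C * N x" by blast
  qed (auto simp: R.T_in T.T_in R.T_add T.T_add R.T_scale T.T_scale)
qed

lemma bounded_operator_add:
  assumes "bounded_operator smul V N W M T" "bounded_operator smul V N W M U"
  shows "bounded_operator smul V N W M (\<lambda>x. T x + U x)"
proof -
  interpret T: bounded_operator smul V N W M T by fact
  interpret U: bounded_operator smul V N W M U by fact
  show ?thesis
  proof
    obtain K where K: "K > 0" "\<And>x. x \<in> V \<Longrightarrow> M (T x) \<le> K * N x" using T.T_bound_pos by blast
    obtain L where L: "L > 0" "\<And>x. x \<in> V \<Longrightarrow> M (U x) \<le> L * N x" using U.T_bound_pos by blast
    have "M (T x + U x) \<le> (K + L) * N x" if "x \<in> V" for x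
      using K(2)[OF that] L(2)[OF that] T.cod.N_triangle[OF T.T_in[OF that] U.T_in[OF that]]
      by (simp add: algebra_simps)
    then show "\<exists>C. \<forall>x\<in>V. M (T x + U x) \<le> C * N x" by blast
  qed (auto simp: T.T_in U.T_in T.T_add U.T_add T.T_scale U.T_scale T.dom.scale_right_distrib algebra_simps)
qed

section \<open>Weighted spaces and their duality\<close>

lemma ae_eq_refl: "ae_eq f f \<longleftrightarrow> f \<in> borel_measurable borel"
  by (simp add: ae_eq_def)

lemma rep_aefun_measurable [measurable]: "rep_aefun u \<in> borel_measurable borel"
  using Quotient3_rep_reflp[OF Quotient3_aefun, of u] by (simp add: ae_eq_refl)

lemma abs_rep_aefun [simp]: "abs_aefun (rep_aefun u) = u"
  by (rule Quotient3_abs_rep[OF Quotient3_aefun])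

lemma rep_abs_aefun:
  assumes "f \<in> borel_measurable borel"
  shows "AE x in lborel. rep_aefun (abs_aefun f) x = f x"
  using Quotient3_rep_abs[OF Quotient3_aefun, of f] assms by (simp add: ae_eq_def)

lemma abs_aefun_eqI:
  assumes "f \<in> borel_measurable borel" "g \<in> borel_measurable borel" "AE x in lborel. f x = g x"
  shows "abs_aefun f = abs_aefun g"
  using Quotient3_rel_abs[OF Quotient3_aefun, of f g] assms by (simp add: ae_eq_def)

lemma aefun_eqI:
  assumes "AE x in lborel. rep_aefun u x = rep_aefun v x"
  shows "u = v"
  using abs_aefun_eqI[OF _ _ assms] by simp

lemma rep_add: "AE x in lborel. rep_aefun (u + v) x = rep_aefun u x + rep_aefun v x"
proof -
  have "u + v = abs_aefun (\<lambda>x. rep_aefun u x + rep_aefun v x)"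
    using plus_aefun.abs_eq[of "rep_aefun u" "rep_aefun v"] by (simp add: ae_eq_refl)
  then show ?thesis using rep_abs_aefun[of "\<lambda>x. rep_aefun u x + rep_aefun v x"] by simp
qed

lemma rep_cscale: "AE x in lborel. rep_aefun (c *\<^sub>c u) x = c * rep_aefun u x"
proof -
  have "c *\<^sub>c u = abs_aefun (\<lambda>x. c * rep_aefun u x)"
    using cscale.abs_eq[of "rep_aefun u" c] by (simp add: ae_eq_refl)
  then show ?thesis using rep_abs_aefun[of "\<lambda>x. c * rep_aefun u x"] by simp
qed

lemma rep_0: "AE x in lborel. rep_aefun 0 x = 0"
  using rep_abs_aefun[of "\<lambda>_. 0"] by (simp add: zero_aefun.abs_eq)

lemma L2w_iff:
  "u \<in> L2w s \<longleftrightarrow> integrable lborel (\<lambda>x. (jbracket x powr s * cmod (rep_aefun u x))\<^sup>2)"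
  by (simp add: L2w_def L2w_mem.rep_eq)

lemma L2w_norm_sq:
  "(L2w_norm s u)\<^sup>2 = (LINT x|lborel. (jbracket x powr s * cmod (rep_aefun u x))\<^sup>2)"
  by (simp add: L2w_norm.rep_eq)

lemma abs_L2w_iff:
  "f \<in> borel_measurable borel \<Longrightarrow>
   abs_aefun f \<in> L2w s \<longleftrightarrow> integrable lborel (\<lambda>x. (jbracket x powr s * cmod (f x))\<^sup>2)"
  by (simp add: L2w_def L2w_mem.abs_eq ae_eq_refl)

lemma abs_L2w_norm_sq:
  "f \<in> borel_measurable borel \<Longrightarrow>
   (L2w_norm s (abs_aefun f))\<^sup>2 = (LINT x|lborel. (jbracket x powr s * cmod (f x))\<^sup>2)"
  by (simp add: L2w_norm.abs_eq ae_eq_refl)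

lemma jbracket_ge_1: "1 \<le> jbracket x"
  by (simp add: jbracket_def)

lemma jbracket_powr_mono: "s \<le> t \<Longrightarrow> jbracket x powr s \<le> jbracket x powr t"
  by (rule powr_mono[OF _ jbracket_ge_1])

lemma L2w_cscale: "u \<in> L2w s \<Longrightarrow> c *\<^sub>c u \<in> L2w s"
  and L2w_norm_cscale: "L2w_norm s (c *\<^sub>c u) = cmod c * L2w_norm s u"
proof -
  have eq: "AE x in lborel. (jbracket x powr s * cmod (rep_aefun (c *\<^sub>c u) x))\<^sup>2 =
      (cmod c)\<^sup>2 * (jbracket x powr s * cmod (rep_aefun u x))\<^sup>2"
    using rep_cscale[of c u] by eventually_elim (simp add: norm_mult power_mult_distrib)
  show "c *\<^sub>c u \<in> L2w s" if "u \<in> L2w s"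
  proof -
    have "integrable lborel (\<lambda>x. (cmod c)\<^sup>2 * (jbracket x powr s * cmod (rep_aefun u x))\<^sup>2)"
      using that by (simp add: L2w_iff)
    then show ?thesis unfolding L2w_iff
      by (rule integrable_cong_AE_imp) (use eq in \<open>auto elim: eventually_mono\<close>)
  qed
  have "(L2w_norm s (c *\<^sub>c u))\<^sup>2 = (cmod c * L2w_norm s u)\<^sup>2"
    unfolding power_mult_distrib[of "cmod c"] L2w_norm_sq
    by (subst integral_cong_AE[OF _ _ eq]) simp_all
  then show "L2w_norm s (c *\<^sub>c u) = cmod c * L2w_norm s u"
    by (simp add: L2w_norm_nonneg power2_eq_iff_nonneg)
qed

lemma L2w_mono:
  assumes "s \<le> t" "u \<in> L2w t"
  shows "u \<in> L2w s" "L2w_norm s u \<le> L2w_norm t u"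
proof -
  have le: "(jbracket x powr s * cmod (rep_aefun u x))\<^sup>2 \<le> (jbracket x powr t * cmod (rep_aefun u x))\<^sup>2" for x
    using jbracket_powr_mono[OF assms(1)] by (intro power_mono mult_right_mono) auto
  have t: "integrable lborel (\<lambda>x. (jbracket x powr t * cmod (rep_aefun u x))\<^sup>2)"
    using assms by (simp add: L2w_iff)
  show u: "u \<in> L2w s" unfolding L2w_iff
    by (rule Bochner_Integration.integrable_bound[OF t]) (use le in auto)
  have "(L2w_norm s u)\<^sup>2 \<le> (L2w_norm t u)\<^sup>2"
    unfolding L2w_norm_sq
    by (rule integral_mono[OF u[unfolded L2w_iff] t le])
  then show "L2w_norm s u \<le> L2w_norm t u"
    by (rule power2_le_imp_le) (rule L2w_norm_nonneg)
qed

lemma L2w_0 [simp, intro]: "0 \<in> L2w s"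
  by (simp add: zero_aefun.abs_eq abs_L2w_iff)

lemma L2w_subspace: "cvec.subspace (L2w s)"
  unfolding cvec.subspace_def using L2w_add_aux L2w_cscale by auto

text \<open>Cauchy--Schwarz, from the positivity of the integral of \<open>(t \<bar>p\<bar> - \<bar>q\<bar>)\<^sup>2\<close> for every \<open>t\<close>.\<close>

lemma L2_pairing:
  fixes p q :: "real \<Rightarrow> real"
  assumes [measurable]: "p \<in> borel_measurable lborel" "q \<in> borel_measurable lborel"
    and p: "integrable lborel (\<lambda>x. (p x)\<^sup>2)" and q: "integrable lborel (\<lambda>x. (q x)\<^sup>2)"
  shows "integrable lborel (\<lambda>x. p x * q x)"
    and "(LINT x|lborel. \<bar>p x * q x\<bar>) \<le> sqrt (LINT x|lborel. (p x)\<^sup>2) * sqrt (LINT x|lborel. (q x)\<^sup>2)"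
proof -
  have am: "\<bar>p x * q x\<bar> \<le> (p x)\<^sup>2 + (q x)\<^sup>2" for x
  proof -
    have "0 \<le> (p x - q x)\<^sup>2" "0 \<le> (p x + q x)\<^sup>2" "0 \<le> (p x)\<^sup>2" "0 \<le> (q x)\<^sup>2" by auto
    then show ?thesis unfolding power2_diff power2_sum by linarith
  qed
  show int: "integrable lborel (\<lambda>x. p x * q x)"
    by (rule Bochner_Integration.integrable_bound[OF Bochner_Integration.integrable_add[OF p q]]) (use am in auto)
  define P Q I where "P = (LINT x|lborel. (p x)\<^sup>2)" and "Q = (LINT x|lborel. (q x)\<^sup>2)"
    and "I = (LINT x|lborel. \<bar>p x * q x\<bar>)"
  have I0: "0 \<le> I" "0 \<le> P" "0 \<le> Q" by (auto simp: I_def P_def Q_def)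
  have quad: "2 * t * I \<le> t\<^sup>2 * P + Q" for t
  proof -
    have "2 * t * \<bar>p x * q x\<bar> \<le> t\<^sup>2 * (p x)\<^sup>2 + (q x)\<^sup>2" for x
    proof -
      have "0 \<le> (t * \<bar>p x\<bar> - \<bar>q x\<bar>)\<^sup>2" by simp
      then show ?thesis by (simp add: power2_diff abs_mult power_mult_distrib algebra_simps)
    qed
    then have "(LINT x|lborel. 2 * t * \<bar>p x * q x\<bar>) \<le> (LINT x|lborel. t\<^sup>2 * (p x)\<^sup>2 + (q x)\<^sup>2)"
      by (intro integral_mono Bochner_Integration.integrable_add integrable_mult_right integrable_abs int p q)
    then show ?thesis using p q by (simp add: I_def P_def Q_def)
  qed
  have "I\<^sup>2 \<le> P * Q"
  proof (cases "P = 0")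
    case True
    have "I = 0"
    proof (rule ccontr)
      assume "I \<noteq> 0"
      with quad[of "(Q + 1) / (2 * I)"] True I0 show False by (auto simp: field_simps)
    qed
    with True show ?thesis by simp
  next
    case False
    with I0 have "0 < P" by simp
    with quad[of "I / P"] show ?thesis by (simp add: field_simps power2_eq_square)
  qed
  then have "I \<le> sqrt (P * Q)" by (rule real_le_rsqrt)
  then show "I \<le> sqrt P * sqrt Q" by (simp add: real_sqrt_mult)
qed

text \<open>The weights \<open>s\<close> and \<open>- s\<close> cancel in the product.\<close>

lemma L2w_pairing:
  assumes "u \<in> L2w s" "v \<in> L2w (- s)"
  shows "integrable lborel (\<lambda>x. rep_aefun u x * rep_aefun v x)"
    and "cmod (LINT x|lborel. rep_aefun u x * rep_aefun v x) \<le> L2w_norm s u * L2w_norm (- s) v"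
proof -
  let ?p = "\<lambda>x. jbracket x powr s * cmod (rep_aefun u x)"
  let ?q = "\<lambda>x. jbracket x powr (- s) * cmod (rep_aefun v x)"
  have pq: "?p x * ?q x = cmod (rep_aefun u x * rep_aefun v x)" for x
    using less_imp_neq[OF jbracket_pos[of x]] by (simp add: norm_mult powr_minus field_simps)
  have P: "integrable lborel (\<lambda>x. (?p x)\<^sup>2)" and Q: "integrable lborel (\<lambda>x. (?q x)\<^sup>2)"
    using assms unfolding L2w_iff by simp_all
  have *: "integrable lborel (\<lambda>x. ?p x * ?q x)"
    "(LINT x|lborel. \<bar>?p x * ?q x\<bar>) \<le> sqrt (LINT x|lborel. (?p x)\<^sup>2) * sqrt (LINT x|lborel. (?q x)\<^sup>2)"
    by (rule L2_pairing[OF _ _ P Q]; measurable)+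
  show int: "integrable lborel (\<lambda>x. rep_aefun u x * rep_aefun v x)"
    by (rule Bochner_Integration.integrable_bound[OF *(1)]) (use pq in auto)
  have "cmod (LINT x|lborel. rep_aefun u x * rep_aefun v x) \<le> (LINT x|lborel. \<bar>?p x * ?q x\<bar>)"
    unfolding pq using integral_norm_bound[of lborel "\<lambda>x. rep_aefun u x * rep_aefun v x"] by simp
  with *(2) show "cmod (LINT x|lborel. rep_aefun u x * rep_aefun v x) \<le> L2w_norm s u * L2w_norm (- s) v"
    unfolding L2w_norm.rep_eq by linarith
qed

lemma pairing_in_dual:
  assumes v: "v \<in> L2w (- s)"
  shows "(\<lambda>u. LINT x|lborel. rep_aefun u x * rep_aefun v x) \<in> dual_L2w s"
  unfolding dual_L2w_def mem_Collect_eq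
proof (intro conjI ballI allI)
  fix u w assume u: "u \<in> L2w s" and w: "w \<in> L2w s"
  have "(LINT x|lborel. rep_aefun (u + w) x * rep_aefun v x) =
      (LINT x|lborel. rep_aefun u x * rep_aefun v x + rep_aefun w x * rep_aefun v x)"
    using rep_add[of u w] by (intro integral_cong_AE) (auto simp: algebra_simps)
  then show "(LINT x|lborel. rep_aefun (u + w) x * rep_aefun v x) =
      (LINT x|lborel. rep_aefun u x * rep_aefun v x) + (LINT x|lborel. rep_aefun w x * rep_aefun v x)"
    using L2w_pairing(1)[OF u v] L2w_pairing(1)[OF w v] by simp
next
  fix c u assume u: "u \<in> L2w s"
  have "(LINT x|lborel. rep_aefun (c *\<^sub>c u) x * rep_aefun v x) =
      (LINT x|lborel. c * (rep_aefun u x * rep_aefun v x))"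
    using rep_cscale[of c u] by (intro integral_cong_AE) (auto simp: algebra_simps)
  then show "(LINT x|lborel. rep_aefun (c *\<^sub>c u) x * rep_aefun v x) =
      c * (LINT x|lborel. rep_aefun u x * rep_aefun v x)" by simp
next
  show "\<exists>C. \<forall>u\<in>L2w s. cmod (LINT x|lborel. rep_aefun u x * rep_aefun v x) \<le> C * L2w_norm s u"
    using L2w_pairing(2)[OF _ v] by (intro exI[of _ "L2w_norm (- s) v"]) (auto simp: mult.commute)
qed

text \<open>Pairing with the conjugate of \<open>u\<close>, weighted by \<open>\<langle>x\<rangle>\<^sup>2\<^sup>s\<close>, returns the squared norm of \<open>u\<close>.\<close>

lemma dual_L2w_separates:
  assumes u: "u \<in> L2w s" "u \<noteq> 0"
  obtains l where "l \<in> dual_L2w s" "l u \<noteq> 0"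
proof -
  define f where "f x = complex_of_real ((jbracket x powr s)\<^sup>2) * cnj (rep_aefun u x)" for x
  have f[measurable]: "f \<in> borel_measurable borel" 
    unfolding f_def using borel_measurable_continuous_onI[OF continuous_on_cnj[OF continuous_on_id]] by measurable
  have "(jbracket x powr (- s) * cmod (f x))\<^sup>2 = (jbracket x powr s * cmod (rep_aefun u x))\<^sup>2" for x
    unfolding f_def using less_imp_neq[OF jbracket_pos[of x]]
    by (simp add: norm_mult powr_minus power2_eq_square field_simps norm_power del: of_real_power)
  then have v: "abs_aefun f \<in> L2w (- s)" using u by (simp add: abs_L2w_iff[OF f] L2w_iff[of u])
  let ?l = "\<lambda>w. LINT x|lborel. rep_aefun w x * rep_aefun (abs_aefun f) x"
  have "?l u = (LINT x|lborel. complex_of_real ((jbracket x powr s * cmod (rep_aefun u x))\<^sup>2))"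
  proof (rule integral_cong_AE)
    show "AE x in lborel. rep_aefun u x * rep_aefun (abs_aefun f) x =
        complex_of_real ((jbracket x powr s * cmod (rep_aefun u x))\<^sup>2)"
      using rep_abs_aefun[OF f]
    proof eventually_elim
      case (elim x)
      have "rep_aefun u x * cnj (rep_aefun u x) = complex_of_real ((cmod (rep_aefun u x))\<^sup>2)"
        unfolding complex_norm_square ..
      with elim show ?case by (simp add: f_def power_mult_distrib mult.left_commute)
    qed
  qed measurable
  also have "\<dots> = complex_of_real ((L2w_norm s u)\<^sup>2)"
    unfolding L2w_norm_sq by (rule integral_complex_of_real)
  finally have "?l u \<noteq> 0" using u L2w_norm_eq_0_iff[OF u(1)] by simp
  with pairing_in_dual[OF v] show ?thesis by (rule that)
qed

section \<open>Resolvents and closures\<close>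

lemma normed_carrier_L2w: "normed_carrier cscale (L2w s) (L2w_norm s)"
proof
  fix x assume "x \<in> L2w s" "L2w_norm s x = 0"
  then show "x = 0" by (simp add: L2w_norm_eq_0_iff)
qed (auto intro: L2w_norm_triangle simp: L2w_subspace L2w_norm_nonneg L2w_norm_cscale)

global_interpretation L2w: normed_carrier cscale "L2w s" "L2w_norm s" for s
  by (rule normed_carrier_L2w)

lemma bounded_op_iff:
  "bounded_op a b T \<longleftrightarrow>
     bounded_operator cscale (L2w a) (L2w_norm a) (L2w b) (L2w_norm b) T"
  by (auto simp: bounded_op_def linear_on_def bounded_operator_def bounded_operator_axioms_def
      normed_carrier_L2w L2w_subspace)

lemma dual_L2wD:
  assumes "l \<in> dual_L2w b"
  shows "u \<in> L2w b \<Longrightarrow> v \<in> L2w b \<Longrightarrow> l (u + v) = l u + l v"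
    and "u \<in> L2w b \<Longrightarrow> l (c *\<^sub>c u) = c * l u"
    and "\<exists>C. \<forall>u\<in>L2w b. cmod (l u) \<le> C * L2w_norm b u"
  using assms by (auto simp: dual_L2w_def)

lemma dual_L2w_diff:
  assumes "l \<in> dual_L2w b" "u \<in> L2w b" "v \<in> L2w b"
  shows "l (u - v) = l u - l v"
  using dual_L2wD(1)[OF assms(1), of "u - v" v] assms by (auto simp: L2w_diff)

lemma dual_L2w_bound_pos:
  assumes "l \<in> dual_L2w b"
  obtains C where "C > 0" "\<And>u. u \<in> L2w b \<Longrightarrow> cmod (l u) \<le> C * L2w_norm b u"
proof -
  obtain C where C: "\<And>u. u \<in> L2w b \<Longrightarrow> cmod (l u) \<le> C * L2w_norm b u"
    using dual_L2wD(3)[OF assms] by auto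
  have "cmod (l u) \<le> max C 1 * L2w_norm b u" if "u \<in> L2w b" for u
    using C[OF that] L2w_norm_nonneg[of b u] by (meson max.cobounded1 mult_right_mono order_trans)
  then show ?thesis using that[of "max C 1"] by auto
qed

lemma resolvent_setD:
  assumes "z \<in> resolvent_set D T"
  shows "f \<in> L2 \<Longrightarrow> resolvent_op D T z f \<in> D"
    and "f \<in> L2 \<Longrightarrow> T (resolvent_op D T z f) - z *\<^sub>c resolvent_op D T z f = f"
    and "u \<in> D \<Longrightarrow> resolvent_op D T z (T u - z *\<^sub>c u) = u"
    and "bounded_op 0 0 (resolvent_op D T z)"
proof -
  have bij: "bij_betw (\<lambda>u. T u - z *\<^sub>c u) D L2" and "bounded_op 0 0 (resolvent_op D T z)"
    using assms by (auto simp: resolvent_set_def)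
  then show "bounded_op 0 0 (resolvent_op D T z)" by simp
  from bij have inj: "inj_on (\<lambda>u. T u - z *\<^sub>c u) D" and im: "(\<lambda>u. T u - z *\<^sub>c u) ` D = L2"
    by (auto simp: bij_betw_def)
  show "f \<in> L2 \<Longrightarrow> resolvent_op D T z f \<in> D"
    unfolding resolvent_op_def using the_inv_into_into[OF inj, of f D] im by auto
  show "f \<in> L2 \<Longrightarrow> T (resolvent_op D T z f) - z *\<^sub>c resolvent_op D T z f = f"
    unfolding resolvent_op_def using f_the_inv_into_f[OF inj, of f] im by auto
  show "u \<in> D \<Longrightarrow> resolvent_op D T z (T u - z *\<^sub>c u) = u"
    unfolding resolvent_op_def using the_inv_into_f_f[OF inj, of u] by auto
qed

lemma resolvent_setI:
  assumes lin: "linear_on D T" and DL: "D \<subseteq> L2" and TL: "T ` D \<subseteq> L2"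
    and inj: "\<And>u. u \<in> D \<Longrightarrow> T u - z *\<^sub>c u = 0 \<Longrightarrow> u = 0"
    and sol: "\<And>f. f \<in> L2 \<Longrightarrow> \<exists>u\<in>D. T u - z *\<^sub>c u = f \<and> L2w_norm 0 u \<le> C * L2w_norm 0 f"
  shows "z \<in> resolvent_set D T"
proof -
  let ?S = "\<lambda>u. T u - z *\<^sub>c u"
  have sub: "cvec.subspace D" using lin by (simp add: linear_on_def)
  have S_add: "?S (u + v) = ?S u + ?S v" if "u \<in> D" "v \<in> D" for u v
    using lin that by (simp add: linear_on_def cvec.scale_right_distrib)
  have S_scale: "?S (c *\<^sub>c u) = c *\<^sub>c ?S u" if "u \<in> D" for u c
    using lin that by (simp add: linear_on_def cvec.scale_right_diff_distrib cvec.scale_left_commute)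
  have S_diff: "?S (u - v) = ?S u - ?S v" if "u \<in> D" "v \<in> D" for u v
    using S_add[of "u - v" v] that cvec.subspace_diff[OF sub] by (simp add: algebra_simps)
  have injS: "inj_on ?S D"
  proof (rule inj_onI)
    fix u v assume uv: "u \<in> D" "v \<in> D" "?S u = ?S v"
    then have "?S (u - v) = 0" using S_diff[OF uv(1,2)] by simp
    then have "u - v = 0" using inj[of "u - v"] cvec.subspace_diff[OF sub uv(1,2)] by auto
    then show "u = v" by simp
  qed
  have im: "?S ` D = L2"
  proof
    show "?S ` D \<subseteq> L2" using DL TL by (auto intro!: L2w_diff L2w_cscale)
    show "L2 \<subseteq> ?S ` D" using sol by blast
  qed
  have bij: "bij_betw ?S D L2" using injS im by (simp add: bij_betw_def)
  have R: "resolvent_op D T z (?S u) = u" if "u \<in> D" for u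
    unfolding resolvent_op_def using the_inv_into_f_f[OF injS that] .
  have "bounded_op 0 0 (resolvent_op D T z)"
    unfolding bounded_op_def linear_on_def
  proof (intro conjI ballI allI)
    show "cvec.subspace L2" by (rule L2w_subspace)
    fix f assume "f \<in> L2"
    then obtain u where u: "u \<in> D" "f = ?S u" using im by blast
    show "resolvent_op D T z (c *\<^sub>c f) = c *\<^sub>c resolvent_op D T z f" for c
      using R[of "c *\<^sub>c u"] R[OF u(1)] S_scale[OF u(1)] cvec.subspace_scale[OF sub u(1)] u(2) by metis
    fix g assume "g \<in> L2"
    then obtain v where v: "v \<in> D" "g = ?S v" using im by blast
    show "resolvent_op D T z (f + g) = resolvent_op D T z f + resolvent_op D T z g"
      using R[of "u + v"] R[OF u(1)] R[OF v(1)] S_add[OF u(1) v(1)] cvec.subspace_add[OF sub u(1) v(1)] u(2) v(2) by metis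
  next
    show "resolvent_op D T z ` L2 \<subseteq> L2" using im R DL by (auto simp flip: im)
    show "\<exists>C. \<forall>u\<in>L2. L2w_norm 0 (resolvent_op D T z u) \<le> C * L2w_norm 0 u"
      using sol R by (intro exI[of _ C]) metis
  qed
  with bij show ?thesis by (simp add: resolvent_set_def)
qed

text \<open>This expresses the spectral condition of the limiting absorption principle through the filter in
  which the limits are taken.\<close>

lemma spectral_gap_iff:
  assumes "z0 \<notin> \<Omega>"
  shows "(\<exists>\<delta>>0. \<Omega> \<inter> op_spectrum D T \<inter> {z. cmod (z - z0) < \<delta>} = {}) \<longleftrightarrow>
    (\<forall>\<^sub>F z in at z0 within \<Omega>. z \<in> resolvent_set D T)"
proof -
  have "(\<Omega> \<inter> op_spectrum D T \<inter> {z. cmod (z - z0) < \<delta>} = {}) \<longleftrightarrow>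
      (\<forall>z\<in>\<Omega>. z \<noteq> z0 \<and> dist z z0 < \<delta> \<longrightarrow> z \<in> resolvent_set D T)" for \<delta>
    unfolding op_spectrum_def dist_norm using assms by auto
  then show ?thesis unfolding eventually_at by simp
qed

lemma eventually_at_within_sequence:
  fixes z0 :: complex
  assumes "eventually P (at z0 within \<Omega>)" "at z0 within \<Omega> \<noteq> bot"
  obtains \<zeta> :: "nat \<Rightarrow> complex" where "filterlim \<zeta> (at z0 within \<Omega>) sequentially" "\<And>n. P (\<zeta> n)"
proof -
  have "z0 islimpt \<Omega>" using assms(2) by (simp add: trivial_limit_within)
  then obtain \<xi> where \<xi>: "\<And>n. \<xi> n \<in> \<Omega> - {z0}" "\<xi> \<longlonglongrightarrow> z0"
    unfolding islimpt_sequential by auto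
  then have lim: "filterlim \<xi> (at z0 within \<Omega>) sequentially"
    unfolding filterlim_at by (auto intro!: always_eventually)
  then have "\<forall>\<^sub>F n in sequentially. P (\<xi> n)"
    using assms(1) by (simp add: filterlim_iff)
  then obtain n0 where n0: "\<And>n. n \<ge> n0 \<Longrightarrow> P (\<xi> n)" unfolding eventually_sequentially by auto
  show ?thesis
  proof (rule that)
    show "filterlim (\<lambda>n. \<xi> (n + n0)) (at z0 within \<Omega>) sequentially"
      using filterlim_compose[OF lim filterlim_add_const_nat_at_top] .
  qed (use n0 in auto)
qed

lemma precompact_imp_subsequence:
  assumes "precompact_in_L2w a S" "\<And>n::nat. g n \<in> S"
  obtains r y where "strict_mono (r :: nat \<Rightarrow> nat)" "y \<in> L2w a" "(\<lambda>n. L2w_norm a (g (r n) - y)) \<longlonglongrightarrow> 0"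
proof -
  interpret Metric_space "L2w a" "L2w_dist a" by (rule Metric_space_L2w)
  have S: "S \<subseteq> L2w a" and "compactin mtopology (mtopology closure_of S)"
    using assms by (auto simp: precompact_in_L2w_def L2w_topology_def)
  moreover have "S \<subseteq> mtopology closure_of S"
    using S by (intro closure_of_subset) simp
  ultimately obtain l r where "l \<in> mtopology closure_of S" "strict_mono (r :: nat \<Rightarrow> nat)"
    "limitin mtopology (g \<circ> r) l sequentially"
    using assms(2) unfolding compactin_sequentially by (metis image_subsetI subsetD)
  then show ?thesis using that[of r l] by (auto simp: limitin_metric_dist_null o_def)
qed

text \<open>Single-valuedness of the closed graph makes \<open>closure_op\<close> a function; its domain with the graph
  norm is the space on which relatively compact operators are compact.\<close>

locale closable_operator =
  fixes b :: real and D :: "aefun set" and A :: "aefun \<Rightarrow> aefun"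
  assumes A_linear: "linear_on D A" and D_sub: "D \<subseteq> L2w b" and A_sub: "A ` D \<subseteq> L2w b"
    and closable: "(f, g) \<in> closure_graph b D A \<Longrightarrow> (f, h) \<in> closure_graph b D A \<Longrightarrow> g = h"
begin

abbreviation "Dc \<equiv> closure_dom b D A"
abbreviation "Ac \<equiv> closure_op b D A"
definition graph_norm :: "aefun \<Rightarrow> real" where
  "graph_norm f = L2w_norm b f + L2w_norm b (Ac f)"

lemma closure_opI:
  assumes "(f, g) \<in> closure_graph b D A"
  shows "f \<in> Dc" "Ac f = g"
  using assms closable unfolding closure_dom_def closure_op_def by auto

lemma closure_graphI:
  assumes "\<And>n. u n \<in> D" "f \<in> L2w b" "g \<in> L2w b" "L2w.conv b u f" "L2w.conv b (\<lambda>n. A (u n)) g"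
  shows "(f, g) \<in> closure_graph b D A"
  using assms unfolding closure_graph_def by blast

lemma closure_op_graph: "f \<in> Dc \<Longrightarrow> (f, Ac f) \<in> closure_graph b D A"
  using closure_opI unfolding closure_dom_def by blast

lemma closure_domD:
  assumes "f \<in> Dc"
  shows "f \<in> L2w b" "Ac f \<in> L2w b"
    and "\<exists>u. (\<forall>n. u n \<in> D) \<and> L2w.conv b u f \<and> L2w.conv b (\<lambda>n. A (u n)) (Ac f)"
  using closure_op_graph[OF assms] unfolding closure_graph_def by auto

lemma A_in: "u \<in> D \<Longrightarrow> A u \<in> L2w b" and D_in: "u \<in> D \<Longrightarrow> u \<in> L2w b"
  using A_sub D_sub by auto

lemma D_subspace: "cvec.subspace D" and A_add: "u \<in> D \<Longrightarrow> v \<in> D \<Longrightarrow> A (u + v) = A u + A v"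
  and A_scale: "u \<in> D \<Longrightarrow> A (c *\<^sub>c u) = c *\<^sub>c A u"
  using A_linear by (auto simp: linear_on_def)

lemma closure_op_on_D: "u \<in> D \<Longrightarrow> u \<in> Dc" "u \<in> D \<Longrightarrow> Ac u = A u"
  using closure_opI[OF closure_graphI[of "\<lambda>_. u" u "A u"]] A_in D_in by auto

lemma closure_op_add:
  assumes "f \<in> Dc" "g \<in> Dc" shows "f + g \<in> Dc" "Ac (f + g) = Ac f + Ac g"
proof -
  obtain u where u: "\<And>n. u n \<in> D" "L2w.conv b u f" "L2w.conv b (\<lambda>n. A (u n)) (Ac f)"
    using closure_domD(3)[OF assms(1)] by auto
  obtain v where v: "\<And>n. v n \<in> D" "L2w.conv b v g" "L2w.conv b (\<lambda>n. A (v n)) (Ac g)"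
    using closure_domD(3)[OF assms(2)] by auto
  have "(f + g, Ac f + Ac g) \<in> closure_graph b D A"
  proof (rule closure_graphI)
    show "u n + v n \<in> D" for n using cvec.subspace_add[OF D_subspace u(1) v(1)] .
    show "L2w.conv b (\<lambda>n. u n + v n) (f + g)"
      using u v D_in closure_domD assms by (intro L2w.conv_add) auto
    show "L2w.conv b (\<lambda>n. A (u n + v n)) (Ac f + Ac g)"
      unfolding A_add[OF u(1) v(1)]
      using u v A_in closure_domD assms by (intro L2w.conv_add) auto
  qed (use closure_domD assms in auto)
  then show "f + g \<in> Dc" "Ac (f + g) = Ac f + Ac g" by (auto dest: closure_opI)
qed

lemma closure_op_scale:
  assumes "f \<in> Dc" shows "c *\<^sub>c f \<in> Dc" "Ac (c *\<^sub>c f) = c *\<^sub>c Ac f"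
proof -
  obtain u where u: "\<And>n. u n \<in> D" "L2w.conv b u f" "L2w.conv b (\<lambda>n. A (u n)) (Ac f)"
    using closure_domD(3)[OF assms(1)] by auto
  have "(c *\<^sub>c f, c *\<^sub>c Ac f) \<in> closure_graph b D A"
  proof (rule closure_graphI)
    show "c *\<^sub>c u n \<in> D" for n using cvec.subspace_scale[OF D_subspace u(1)] .
    show "L2w.conv b (\<lambda>n. c *\<^sub>c u n) (c *\<^sub>c f)"
      using u D_in closure_domD assms by (intro L2w.conv_scale) auto
    show "L2w.conv b (\<lambda>n. A (c *\<^sub>c u n)) (c *\<^sub>c Ac f)"
      unfolding A_scale[OF u(1)]
      using u A_in closure_domD assms by (intro L2w.conv_scale) auto
  qed (use closure_domD assms in auto)
  then show "c *\<^sub>c f \<in> Dc" "Ac (c *\<^sub>c f) = c *\<^sub>c Ac f" by (auto dest: closure_opI)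
qed

sublocale graph: normed_carrier cscale Dc graph_norm
proof
  show "cvec.subspace Dc" unfolding cvec.subspace_def
    using closure_op_on_D(1)[OF cvec.subspace_0[OF D_subspace]] closure_op_add(1) closure_op_scale(1) by auto
  fix x show "0 \<le> graph_norm x" by (simp add: graph_norm_def L2w_norm_nonneg)
  assume x: "x \<in> Dc"
  show "graph_norm x = 0 \<Longrightarrow> x = 0"
    using x closure_domD(1)[OF x] L2w_norm_nonneg[of b x] L2w_norm_nonneg[of b "Ac x"] L2w_norm_eq_0_iff[of x b]
    by (auto simp: graph_norm_def)
  show "graph_norm (c *\<^sub>c x) = cmod c * graph_norm x" for c
    using x by (simp add: graph_norm_def closure_op_scale L2w_norm_cscale algebra_simps)
  fix y assume y: "y \<in> Dc"
  show "graph_norm (x + y) \<le> graph_norm x + graph_norm y"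
    using L2w_norm_triangle[OF closure_domD(1)[OF x] closure_domD(1)[OF y]]
      L2w_norm_triangle[OF closure_domD(2)[OF x] closure_domD(2)[OF y]] x y
    by (simp add: graph_norm_def closure_op_add)
qed

lemma closure_op_diff:
  assumes "f \<in> Dc" "g \<in> Dc" shows "Ac (f - g) = Ac f - Ac g"
  using closure_op_add(2)[of "f - g" g] graph.V_diff[OF assms] assms by simp

lemma relatively_compact_imp_compact:
  assumes "relatively_compact_op b a D A B"
  shows "compact_operator cscale Dc graph_norm (L2w a) (L2w_norm a) B"
proof -
  have lin: "linear_on Dc B" and sub: "B ` Dc \<subseteq> L2w a"
    and pre: "precompact_in_L2w a (B ` {f \<in> Dc. graph_norm f \<le> 1})"
    using assms by (auto simp: relatively_compact_op_def graph_norm_def)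
  have B_scale: "B (c *\<^sub>c f) = c *\<^sub>c B f" if "f \<in> Dc" for c f
    using lin that by (simp add: linear_on_def)
  show ?thesis
  proof
    fix X :: "nat \<Rightarrow> aefun" and C
    assume X: "\<And>n. X n \<in> Dc" "\<And>n. graph_norm (X n) \<le> C"
    \<comment> \<open>Precompactness of the image of the unit ball is transported to the ball of radius \<open>C\<close>.\<close>
    define K where "K = max C 1"
    have K: "K > 0" "C \<le> K" by (auto simp: K_def)
    define Y where "Y n = complex_of_real (1 / K) *\<^sub>c X n" for n
    have XY: "X n = complex_of_real K *\<^sub>c Y n" for n using K by (simp add: Y_def)
    have Y: "Y n \<in> Dc" for n using X by (simp add: Y_def closure_op_scale)
    have "graph_norm (Y n) \<le> 1" for n
      unfolding Y_def graph.N_scale[OF X(1)] norm_of_real using X(2)[of n] K by simp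
    with Y have "B (Y n) \<in> B ` {f \<in> Dc. graph_norm f \<le> 1}" for n by auto
    from precompact_imp_subsequence[of a _ "\<lambda>n. B (Y n)", OF pre this]
    obtain r y where r: "strict_mono r" "y \<in> L2w a" "L2w.conv a (\<lambda>n. B (Y (r n))) y" .
    have "L2w.conv a (\<lambda>n. complex_of_real K *\<^sub>c B (Y (r n))) (complex_of_real K *\<^sub>c y)"
      using sub Y r by (intro L2w.conv_scale) auto
    then have "L2w.conv a (\<lambda>n. B (X (r n))) (complex_of_real K *\<^sub>c y)"
      unfolding XY B_scale[OF Y] .
    then show "\<exists>r y. strict_mono r \<and> y \<in> L2w a \<and> L2w.conv a (\<lambda>n. B (X (r n))) y"
      using r(1) L2w_cscale[OF r(2)] by blast
  qed (use lin sub in \<open>auto simp: linear_on_def\<close>)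
qed

end

section \<open>Operators with a finite rank regularization\<close>

text \<open>The resolvents of \<open>A\<close> itself may diverge at \<open>z0\<close>; adding the finite rank operator \<open>K0\<close> makes them
  converge to \<open>R\<close>.\<close>

locale finite_rank_regularization = closable_operator "- s'" D A for s' D A +
  fixes s :: real and \<Omega> :: "complex set" and z0 :: complex
    and K0 R :: "aefun \<Rightarrow> aefun"
  assumes s_nonneg: "0 \<le> s" "0 \<le> s'"
    and D_L2: "D \<subseteq> L2" and A_L2: "A ` D \<subseteq> L2"
    and K0_bounded: "bounded_op (- s') s K0" and K0_finite_rank: "finite_rank (- s') K0"
    and z0_notin: "z0 \<notin> \<Omega>" and nontrivial: "at z0 within \<Omega> \<noteq> bot"
    and eventually_resolvent:
      "\<forall>\<^sub>F z in at z0 within \<Omega>. z \<in> resolvent_set D (\<lambda>u. A u + K0 u)"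
    and resolvent_limit:
      "uniform_op_limit s (- s') (resolvent_op D (\<lambda>u. A u + K0 u)) R (at z0 within \<Omega>)"
begin

abbreviation "Rz z \<equiv> resolvent_op D (\<lambda>u. A u + K0 u) z"
abbreviation "good z \<equiv> z \<in> resolvent_set D (\<lambda>u. A u + K0 u)"

lemma E_L2: "u \<in> L2w s \<Longrightarrow> u \<in> L2" "u \<in> L2w s \<Longrightarrow> L2w_norm 0 u \<le> L2w_norm s u"
  and L2_X: "u \<in> L2 \<Longrightarrow> u \<in> L2w (- s')" "u \<in> L2 \<Longrightarrow> L2w_norm (- s') u \<le> L2w_norm 0 u"
  and E_X: "u \<in> L2w s \<Longrightarrow> u \<in> L2w (- s')" "u \<in> L2w s \<Longrightarrow> L2w_norm (- s') u \<le> L2w_norm s u"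
  using L2w_mono[of 0 s u] L2w_mono[of "- s'" 0 u] L2w_mono[of "- s'" s u] s_nonneg by auto

sublocale K0: bounded_operator cscale "L2w (- s')" "L2w_norm (- s')" "L2w s" "L2w_norm s" K0
  using K0_bounded by (simp add: bounded_op_iff)

sublocale R: bounded_operator cscale "L2w s" "L2w_norm s" "L2w (- s')" "L2w_norm (- s')" R
  using resolvent_limit by (simp add: bounded_op_iff uniform_op_limit_def)

lemma graph_inclusion:
  "bounded_operator cscale Dc graph_norm (L2w (- s')) (L2w_norm (- s')) (\<lambda>u. u)"
proof
  show "\<exists>C. \<forall>x\<in>Dc. L2w_norm (- s') x \<le> C * graph_norm x"
    by (intro exI[of _ 1]) (auto simp: graph_norm_def L2w_norm_nonneg)
qed (auto intro: closure_domD)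

lemma finite_rank_graph_compact:
  assumes "bounded_op (- s') s K" "finite_rank (- s') K"
  shows "compact_operator cscale Dc graph_norm (L2w s) (L2w_norm s) K"
proof -
  interpret K: bounded_operator cscale Dc graph_norm "L2w s" "L2w_norm s" K
    using bounded_operator_comp[OF graph_inclusion, of "L2w s" "L2w_norm s" K] assms(1)
    by (simp add: bounded_op_iff)
  obtain F where F: "finite F" "K ` L2w (- s') \<subseteq> cvec.span F"
    using assms(2) by (auto simp: finite_rank_def)
  show ?thesis
    by (rule K.finite_rank_imp_compact[OF F(1)]) (use F(2) closure_domD(1) in auto)
qed

lemma good_resolvent:
  assumes "good z" "f \<in> L2"
  shows "Rz z f \<in> D" "A (Rz z f) = f - K0 (Rz z f) + z *\<^sub>c Rz z f"
proof -
  show "Rz z f \<in> D" using resolvent_setD(1)[OF assms] .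
  show "A (Rz z f) = f - K0 (Rz z f) + z *\<^sub>c Rz z f"
    using resolvent_setD(2)[OF assms] by (simp add: algebra_simps)
qed

lemma Rz_eqI: "good z \<Longrightarrow> u \<in> D \<Longrightarrow> A u + K0 u - z *\<^sub>c u = f \<Longrightarrow> Rz z f = u"
  using resolvent_setD(3)[of z D "\<lambda>u. A u + K0 u" u] by simp

text \<open>The resolvent equation expresses \<open>A (Rz z f)\<close> through \<open>f\<close>, \<open>K0 (Rz z f)\<close> and \<open>Rz z f\<close>, and so
  bounds the graph norm.\<close>

lemma Rz_L2_graph:
  assumes z: "good z"
  shows "bounded_operator cscale L2 (L2w_norm 0) Dc graph_norm (Rz z)"
proof -
  interpret Q: bounded_operator cscale L2 "L2w_norm 0" L2 "L2w_norm 0" "Rz z"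
    using resolvent_setD(4)[OF z] by (simp add: bounded_op_iff)
  show ?thesis
  proof
    fix x assume x: "x \<in> L2"
    show "Rz z x \<in> Dc" using closure_op_on_D(1) good_resolvent(1)[OF z x] .
  next
    obtain C where C: "C > 0" "\<And>x. x \<in> L2 \<Longrightarrow> L2w_norm 0 (Rz z x) \<le> C * L2w_norm 0 x"
      using Q.T_bound_pos by blast
    obtain K where K: "K > 0" "\<And>x. x \<in> L2w (- s') \<Longrightarrow> L2w_norm s (K0 x) \<le> K * L2w_norm (- s') x"
      using K0.T_bound_pos by blast
    have "graph_norm (Rz z x) \<le> (C + 1 + K * C + cmod z * C) * L2w_norm 0 x" if x: "x \<in> L2" for x
    proof -
      let ?u = "Rz z x"
      have u: "?u \<in> D" "?u \<in> L2" "?u \<in> L2w (- s')"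
        using good_resolvent(1)[OF z x] D_L2 D_in by auto
      have nu: "L2w_norm (- s') ?u \<le> C * L2w_norm 0 x"
        using L2_X(2)[OF u(2)] C(2)[OF x] by linarith
      have "L2w_norm (- s') (K0 ?u) \<le> K * L2w_norm (- s') ?u"
        using E_X(2)[OF K0.T_in[OF u(3)]] K(2)[OF u(3)] by linarith
      also have "\<dots> \<le> K * (C * L2w_norm 0 x)" using nu K(1) by simp
      finally have nK: "L2w_norm (- s') (K0 ?u) \<le> K * (C * L2w_norm 0 x)" .
      have "L2w_norm (- s') (A ?u) \<le> L2w_norm (- s') (x - K0 ?u) + L2w_norm (- s') (z *\<^sub>c ?u)"
        unfolding good_resolvent(2)[OF z x]
        using u x by (intro L2w_norm_triangle L2w_diff L2w_cscale E_X K0.T_in L2_X) auto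
      also have "\<dots> \<le> (L2w_norm (- s') x + L2w_norm (- s') (K0 ?u)) + cmod z * L2w_norm (- s') ?u"
        unfolding L2w_norm_cscale
        using u x by (intro add_mono L2w.N_diff E_X K0.T_in L2_X) auto
      also have "\<dots> \<le> (L2w_norm 0 x + K * (C * L2w_norm 0 x)) + cmod z * (C * L2w_norm 0 x)"
        using nu nK L2_X(2)[OF x] by (intro add_mono mult_left_mono) auto
      finally show ?thesis
        unfolding graph_norm_def closure_op_on_D(2)[OF u(1)] using nu by (simp add: algebra_simps)
    qed
    then show "\<exists>C. \<forall>x\<in>L2. graph_norm (Rz z x) \<le> C * L2w_norm 0 x" by blast
  qed (simp_all add: Q.T_add Q.T_scale)
qed

lemma E_L2_inclusion: "bounded_operator cscale (L2w s) (L2w_norm s) L2 (L2w_norm 0) (\<lambda>u. u)"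
proof
  show "\<exists>C. \<forall>x\<in>L2w s. L2w_norm 0 x \<le> C * L2w_norm s x"
    using E_L2 by (intro exI[of _ 1]) auto
qed (auto intro: E_L2)

lemma Rz_E_graph: "good z \<Longrightarrow> bounded_operator cscale (L2w s) (L2w_norm s) Dc graph_norm (Rz z)"
  using bounded_operator_comp[OF E_L2_inclusion Rz_L2_graph] .

lemma good_sequence:
  assumes "\<forall>\<^sub>F z in at z0 within \<Omega>. P z"
  obtains \<zeta> :: "nat \<Rightarrow> complex" where "filterlim \<zeta> (at z0 within \<Omega>) sequentially" "\<zeta> \<longlonglongrightarrow> z0"
    "\<And>n. P (\<zeta> n)" "\<And>n. good (\<zeta> n)"
proof -
  obtain \<zeta> :: "nat \<Rightarrow> complex" where z: "filterlim \<zeta> (at z0 within \<Omega>) sequentially"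
    "\<And>n. P (\<zeta> n) \<and> good (\<zeta> n)"
    using eventually_at_within_sequence[OF eventually_conj[OF assms eventually_resolvent] nontrivial] by blast
  moreover have "\<zeta> \<longlonglongrightarrow> z0" using z(1) by (simp add: filterlim_at)
  ultimately show ?thesis using that[of \<zeta>] by blast
qed

lemma Rz_limit:
  assumes "e > 0"
  shows "\<forall>\<^sub>F z in at z0 within \<Omega>. \<forall>u\<in>L2w s. L2w_norm (- s') (Rz z u - R u) \<le> e * L2w_norm s u"
  using resolvent_limit assms by (simp add: uniform_op_limit_def)

lemma Rz_pointwise:
  assumes \<zeta>: "filterlim \<zeta> (at z0 within \<Omega>) sequentially" and f: "f \<in> L2w s"
  shows "L2w.conv (- s') (\<lambda>n. Rz (\<zeta> n) f) (R f)"
proof (rule tendstoI)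
  fix e :: real assume e: "e > 0"
  define d where "d = e / (L2w_norm s f + 1)"
  have d: "d > 0" using e L2w_norm_nonneg[of s f] by (auto simp: d_def intro!: divide_pos_pos)
  have lt: "d * L2w_norm s f < e"
    using e L2w_norm_nonneg[of s f] by (simp add: d_def pos_divide_less_eq field_simps)
  have "\<forall>\<^sub>F n in sequentially. \<forall>u\<in>L2w s. L2w_norm (- s') (Rz (\<zeta> n) u - R u) \<le> d * L2w_norm s u"
    by (rule eventually_compose_filterlim[OF Rz_limit[OF d] \<zeta>])
  then show "\<forall>\<^sub>F n in sequentially. dist (L2w_norm (- s') (Rz (\<zeta> n) f - R f)) 0 < e"
    by eventually_elim (use f lt L2w_norm_nonneg in \<open>fastforce\<close>)
qed

text \<open>The resolvents converge pointwise and, by the resolvent equation, so do their images under \<open>A\<close>;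
  the limits belong to the graph of the closure.\<close>

lemma R_graph:
  assumes f: "f \<in> L2w s"
  shows "R f \<in> Dc" "Ac (R f) = f - K0 (R f) + z0 *\<^sub>c R f"
proof -
  obtain \<zeta> :: "nat \<Rightarrow> complex" where \<zeta>: "filterlim \<zeta> (at z0 within \<Omega>) sequentially" "\<zeta> \<longlonglongrightarrow> z0"
    "\<And>n. good (\<zeta> n)" using good_sequence[of "\<lambda>_. True"] by auto
  let ?u = "\<lambda>n. Rz (\<zeta> n) f"
  have fL: "f \<in> L2" and fX: "f \<in> L2w (- s')" and RX: "R f \<in> L2w (- s')"
    using f E_L2 E_X R.T_in by auto
  have uD: "?u n \<in> D" and uX: "?u n \<in> L2w (- s')" for n
    using good_resolvent(1)[OF \<zeta>(3) fL] D_in by auto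
  have KX: "K0 v \<in> L2w (- s')" if "v \<in> L2w (- s')" for v using E_X(1)[OF K0.T_in[OF that]] .
  have conv: "L2w.conv (- s') ?u (R f)" by (rule Rz_pointwise[OF \<zeta>(1) f])
  have "L2w.conv s (\<lambda>n. K0 (?u n)) (K0 (R f))" by (rule K0.conv_T[OF uX RX conv])
  then have convK: "L2w.conv (- s') (\<lambda>n. K0 (?u n)) (K0 (R f))"
    by (rule Lim_null_comparison[rotated])
       (auto intro!: always_eventually E_X(2) L2w_diff K0.T_in uX RX simp: L2w_norm_nonneg)
  have convz: "L2w.conv (- s') (\<lambda>n. \<zeta> n *\<^sub>c ?u n) (z0 *\<^sub>c R f)"
    by (rule L2w.conv_scale'[OF uX RX conv \<zeta>(2)])
  have "L2w.conv (- s') (\<lambda>n. f - K0 (?u n) + \<zeta> n *\<^sub>c ?u n) (f - K0 (R f) + z0 *\<^sub>c R f)"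
    by (intro L2w.conv_add L2w.conv_diff convz convK)
       (simp_all add: L2w_diff L2w_cscale KX uX RX fX)
  then have "L2w.conv (- s') (\<lambda>n. A (?u n)) (f - K0 (R f) + z0 *\<^sub>c R f)"
    unfolding good_resolvent(2)[OF \<zeta>(3) fL] .
  then have "(R f, f - K0 (R f) + z0 *\<^sub>c R f) \<in> closure_graph (- s') D A"
    by (intro closure_graphI[OF uD RX _ conv]) (simp_all add: L2w_diff L2w_cscale KX RX fX)
  then show "R f \<in> Dc" "Ac (R f) = f - K0 (R f) + z0 *\<^sub>c R f" by (auto dest: closure_opI)
qed

lemma R_eq_0:
  assumes "f \<in> L2w s" "R f = 0" shows "f = 0"
  using R_graph(2)[OF assms(1)] assms(2) closure_op_on_D(2)[OF cvec.subspace_0[OF D_subspace]]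
    A_scale[OF cvec.subspace_0[OF D_subspace], of 0] by simp

lemma R_E_graph: "bounded_operator cscale (L2w s) (L2w_norm s) Dc graph_norm R"
proof
  obtain C where C: "C > 0" "\<And>x. x \<in> L2w s \<Longrightarrow> L2w_norm (- s') (R x) \<le> C * L2w_norm s x"
    using R.T_bound_pos by blast
  obtain K where K: "K > 0" "\<And>x. x \<in> L2w (- s') \<Longrightarrow> L2w_norm s (K0 x) \<le> K * L2w_norm (- s') x"
    using K0.T_bound_pos by blast
  have "graph_norm (R x) \<le> (C + 1 + K * C + cmod z0 * C) * L2w_norm s x" if x: "x \<in> L2w s" for x
  proof -
    let ?u = "R x"
    have u: "?u \<in> L2w (- s')" using R.T_in[OF x] .
    have nu: "L2w_norm (- s') ?u \<le> C * L2w_norm s x" using C(2)[OF x] .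
    have "L2w_norm (- s') (K0 ?u) \<le> K * L2w_norm (- s') ?u"
      using E_X(2)[OF K0.T_in[OF u]] K(2)[OF u] by linarith
    also have "\<dots> \<le> K * (C * L2w_norm s x)" using nu K(1) by simp
    finally have nK: "L2w_norm (- s') (K0 ?u) \<le> K * (C * L2w_norm s x)" .
    have "L2w_norm (- s') (Ac ?u) \<le> L2w_norm (- s') (x - K0 ?u) + L2w_norm (- s') (z0 *\<^sub>c ?u)"
      unfolding R_graph(2)[OF x]
      using u E_X(1)[OF x] E_X(1)[OF K0.T_in[OF u]] by (intro L2w_norm_triangle L2w_diff L2w_cscale) auto
    also have "\<dots> \<le> (L2w_norm (- s') x + L2w_norm (- s') (K0 ?u)) + cmod z0 * L2w_norm (- s') ?u"
      unfolding L2w_norm_cscale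
      using u E_X(1)[OF x] E_X(1)[OF K0.T_in[OF u]] by (intro add_mono L2w.N_diff) auto
    also have "\<dots> \<le> (L2w_norm s x + K * (C * L2w_norm s x)) + cmod z0 * (C * L2w_norm s x)"
      using nu nK E_X(2)[OF x] by (intro add_mono mult_left_mono) auto
    finally show ?thesis
      unfolding graph_norm_def using nu by (simp add: algebra_simps)
  qed
  then show "\<exists>C. \<forall>x\<in>L2w s. graph_norm (R x) \<le> C * L2w_norm s x" by blast
qed (auto simp: R_graph R.T_add R.T_scale)

text \<open>The resolvent equations for \<open>Rz z\<close> and \<open>R\<close> express the difference of the images under the
  closure of \<open>A\<close> through \<open>Rz z f - R f\<close>, which lifts the norm convergence to the graph norm.\<close>

lemma Rz_graph_limit:
  assumes e: "e > 0"
  shows "\<forall>\<^sub>F z in at z0 within \<Omega>. good z \<and> (\<forall>f\<in>L2w s. graph_norm (Rz z f - R f) \<le> e * L2w_norm s f)"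
proof -
  obtain C where C: "C > 0" "\<And>x. x \<in> L2w s \<Longrightarrow> L2w_norm (- s') (R x) \<le> C * L2w_norm s x"
    using R.T_bound_pos by blast
  obtain K where K: "K > 0" "\<And>x. x \<in> L2w (- s') \<Longrightarrow> L2w_norm s (K0 x) \<le> K * L2w_norm (- s') x"
    using K0.T_bound_pos by blast
  define H where "H = 2 + K + cmod z0"
  have H: "H > 0" unfolding H_def using K(1) norm_ge_zero[of z0] by linarith
  define d where "d = e / (2 * H)"
  have d: "d > 0" using H e by (simp add: d_def)
  have "\<forall>\<^sub>F z in at z0 within \<Omega>. dist z z0 < min 1 (e / (2 * C))"
    using C(1) e by (intro tendstoD[OF tendsto_ident_at]) simp
  with eventually_resolvent Rz_limit[OF d] show ?thesis
  proof eventually_elim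
    case (elim z)
    have zz: "cmod (z - z0) \<le> 1" "cmod (z - z0) \<le> e / (2 * C)" using elim(3) by (auto simp: dist_norm)
    have z1: "cmod z \<le> cmod z0 + 1" using norm_triangle_sub[of z z0] zz(1) by linarith
    have "graph_norm (Rz z f - R f) \<le> e * L2w_norm s f" if f: "f \<in> L2w s" for f
    proof -
      have fL: "f \<in> L2" using f E_L2 by auto
      let ?d = "Rz z f - R f"
      have RzD: "Rz z f \<in> D" and A_eq: "A (Rz z f) = f - K0 (Rz z f) + z *\<^sub>c Rz z f"
        using good_resolvent[OF elim(1) fL] by auto
      have X: "Rz z f \<in> L2w (- s')" "R f \<in> L2w (- s')" "?d \<in> L2w (- s')"
        using D_in[OF RzD] R.T_in[OF f] by auto
      have "Ac ?d = - K0 ?d + z *\<^sub>c ?d + (z - z0) *\<^sub>c R f"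
        unfolding closure_op_diff[OF closure_op_on_D(1)[OF RzD] R_graph(1)[OF f]]
          closure_op_on_D(2)[OF RzD] A_eq R_graph(2)[OF f] K0.T_diff[OF X(1,2)]
        by (simp add: cvec.scale_right_diff_distrib cvec.scale_left_diff_distrib)
      then have "L2w_norm (- s') (Ac ?d) \<le> L2w_norm (- s') (K0 ?d) + cmod z * L2w_norm (- s') ?d
          + cmod (z - z0) * L2w_norm (- s') (R f)"
        using L2w.N_triangle[of "- K0 ?d + z *\<^sub>c ?d" "- s'" "(z - z0) *\<^sub>c R f"]
          L2w.N_triangle[of "- K0 ?d" "- s'" "z *\<^sub>c ?d"] X E_X(1)[OF K0.T_in[OF X(3)]]
        by (simp add: L2w_norm_cscale L2w.N_minus)
      moreover have "L2w_norm (- s') (K0 ?d) \<le> K * L2w_norm (- s') ?d"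
        using E_X(2)[OF K0.T_in[OF X(3)]] K(2)[OF X(3)] by linarith
      moreover have "cmod z * L2w_norm (- s') ?d \<le> (cmod z0 + 1) * L2w_norm (- s') ?d"
        using z1 L2w_norm_nonneg by (intro mult_right_mono) auto
      moreover have "cmod (z - z0) * L2w_norm (- s') (R f) \<le> e / (2 * C) * (C * L2w_norm s f)"
        using zz(2) C f L2w_norm_nonneg e by (intro mult_mono) auto
      ultimately have "graph_norm ?d \<le> H * L2w_norm (- s') ?d + e / (2 * C) * (C * L2w_norm s f)"
        unfolding graph_norm_def H_def by (simp add: algebra_simps)
      also have "\<dots> \<le> H * (d * L2w_norm s f) + e / (2 * C) * (C * L2w_norm s f)"
        using elim(2) f H by simp
      also have "\<dots> = e * L2w_norm s f"
        using H C(1) by (simp add: d_def field_simps)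
      finally show ?thesis .
    qed
    with elim(1) show ?case by blast
  qed
qed

end

section \<open>Relatively compact perturbations\<close>

locale compact_perturbation = finite_rank_regularization s' D A s \<Omega> z0 K0 R
  for s' D A s \<Omega> z0 K0 R +
  fixes B :: "aefun \<Rightarrow> aefun"
  assumes B_compact: "compact_operator cscale Dc graph_norm (L2w s) (L2w_norm s) B"
begin

sublocale B1: compact_operator cscale Dc graph_norm "L2w s" "L2w_norm s" "\<lambda>u. B u - K0 u"
  by (rule compact_operator_diff[OF B_compact finite_rank_graph_compact[OF K0_bounded K0_finite_rank]])

sublocale B: compact_operator cscale Dc graph_norm "L2w s" "L2w_norm s" B
  by (rule B_compact)

text \<open>Since \<open>A + B = (A + K0) + (B - K0)\<close>, the operator \<open>1 + T\<close> is \<open>A + B - z0\<close> after the regularized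
  limit resolvent; its invertibility on \<open>L2w s\<close> decides the dichotomy.\<close>

definition T :: "aefun \<Rightarrow> aefun" where "T f = B (R f) - K0 (R f)"
definition Tz :: "complex \<Rightarrow> aefun \<Rightarrow> aefun" where "Tz z f = B (Rz z f) - K0 (Rz z f)"

sublocale T: compact_endomorphism cscale "L2w s" "L2w_norm s" T
  unfolding T_def compact_endomorphism_def
  by (rule compact_operator_comp[OF R_E_graph B1.compact_operator_axioms])

lemma Tz_compact: "good z \<Longrightarrow> compact_endomorphism cscale (L2w s) (L2w_norm s) (Tz z)"
  unfolding Tz_def compact_endomorphism_def
  by (rule compact_operator_comp[OF Rz_E_graph B1.compact_operator_axioms])

lemma R_in_Dc: "f \<in> L2w s \<Longrightarrow> R f \<in> Dc" using R_graph(1) .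

lemma Rz_in_D: "good z \<Longrightarrow> f \<in> L2w s \<Longrightarrow> Rz z f \<in> D" "good z \<Longrightarrow> f \<in> L2w s \<Longrightarrow> Rz z f \<in> Dc"
  using good_resolvent(1)[of z f] E_L2(1) closure_op_on_D(1) by auto

lemma perturbed_R:
  assumes "f \<in> L2w s"
  shows "Ac (R f) + B (R f) - z0 *\<^sub>c R f = T.S f"
  using R_graph(2)[OF assms] by (simp add: T.S_def T_def algebra_simps)

lemma perturbed_Rz:
  assumes "good z" "f \<in> L2w s"
  shows "A (Rz z f) + B (Rz z f) - z *\<^sub>c Rz z f = f + Tz z f"
  using good_resolvent(2)[OF assms(1) E_L2(1)[OF assms(2)]] by (simp add: Tz_def algebra_simps)

lemma Rz_of_perturbed:
  assumes "good z" "u \<in> D"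
  shows "Rz z ((A u + B u - z *\<^sub>c u) - (B u - K0 u)) = u"
  by (rule Rz_eqI[OF assms]) (simp add: algebra_simps)

lemma Tz_limit:
  assumes e: "e > 0"
  shows "\<forall>\<^sub>F z in at z0 within \<Omega>. good z \<and> (\<forall>f\<in>L2w s. L2w_norm s (Tz z f - T f) \<le> e * L2w_norm s f)"
proof -
  obtain C where C: "C > 0" "\<And>x. x \<in> Dc \<Longrightarrow> L2w_norm s (B x - K0 x) \<le> C * graph_norm x"
    using B1.T_bound_pos by blast
  show ?thesis using Rz_graph_limit[of "e / C"]
  proof (rule eventually_mono)
    show "0 < e / C" using e C by simp
    fix z assume z: "good z \<and> (\<forall>f\<in>L2w s. graph_norm (Rz z f - R f) \<le> e / C * L2w_norm s f)"
    have "L2w_norm s (Tz z f - T f) \<le> e * L2w_norm s f" if f: "f \<in> L2w s" for f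
    proof -
      let ?d = "Rz z f - R f"
      have d: "Rz z f \<in> Dc" "R f \<in> Dc" using z f R_in_Dc Rz_in_D by auto
      have "Tz z f - T f = B ?d - K0 ?d"
        using B1.T_diff[OF d] by (simp add: T_def Tz_def)
      then have "L2w_norm s (Tz z f - T f) \<le> C * graph_norm ?d"
        using C(2)[of ?d] d by auto
      also have "\<dots> \<le> C * (e / C * L2w_norm s f)" using z f C(1) by (intro mult_left_mono) auto
      also have "\<dots> = e * L2w_norm s f" using C(1) by simp
      finally show ?thesis .
    qed
    with z show "good z \<and> (\<forall>f\<in>L2w s. L2w_norm s (Tz z f - T f) \<le> e * L2w_norm s f)" by blast
  qed
qed

text \<open>A lower bound for \<open>1 + T\<close> passes, halved, to \<open>1 + Tz\<close>, because \<open>Tz\<close> converges to \<open>T\<close> in norm.\<close>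

lemma eventually_bounded_below:
  assumes inj: "inj_on T.S (L2w s)"
  obtains c where "c > 0" "\<And>f. f \<in> L2w s \<Longrightarrow> c * L2w_norm s f \<le> L2w_norm s (T.S f)"
    "\<forall>\<^sub>F z in at z0 within \<Omega>. good z \<and> (\<forall>f\<in>L2w s. c * L2w_norm s f \<le> L2w_norm s (f + Tz z f))"
proof -
  obtain c where c: "c > 0" "\<And>f. f \<in> L2w s \<Longrightarrow> c * L2w_norm s f \<le> L2w_norm s (T.S f)"
    using T.S_bounded_below[OF inj] by blast
  show ?thesis
  proof (rule that[of "c / 2"])
    show "0 < c / 2" using c by simp
    show "c / 2 * L2w_norm s f \<le> L2w_norm s (T.S f)" if "f \<in> L2w s" for f
      using c(2)[OF that] mult_nonneg_nonneg[OF less_imp_le[OF c(1)] L2w_norm_nonneg[of s f]] by linarith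
    show "\<forall>\<^sub>F z in at z0 within \<Omega>. good z \<and> (\<forall>f\<in>L2w s. c / 2 * L2w_norm s f \<le> L2w_norm s (f + Tz z f))"
      using Tz_limit[of "c / 2"]
    proof (rule eventually_mono)
      show "0 < c / 2" using c by simp
      fix z assume z: "good z \<and> (\<forall>f\<in>L2w s. L2w_norm s (Tz z f - T f) \<le> c / 2 * L2w_norm s f)"
      interpret Q: compact_endomorphism cscale "L2w s" "L2w_norm s" "Tz z" using Tz_compact z by blast
      have "c / 2 * L2w_norm s f \<le> L2w_norm s (f + Tz z f)" if f: "f \<in> L2w s" for f
      proof -
        have "L2w_norm s (T.S f) \<le> L2w_norm s (f + Tz z f) + L2w_norm s (T.S f - (f + Tz z f))"
          using f Q.T_in[OF f] T.S_V[OF f] by (intro L2w.N_le_diff) auto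
        moreover have "L2w_norm s (T.S f - (f + Tz z f)) = L2w_norm s (Tz z f - T f)"
          by (subst L2w_norm_minus_commute) (simp add: T.S_def)
        ultimately show ?thesis using c(2)[OF f] z f by (auto simp: field_simps)
      qed
      with z show "good z \<and> (\<forall>f\<in>L2w s. c / 2 * L2w_norm s f \<le> L2w_norm s (f + Tz z f))" by blast
    qed
  qed
qed

lemma A_plus_linear: "linear_on D (\<lambda>u. A u + B u)"
  using A_add A_scale B.T_add B.T_scale closure_op_on_D(1)
  by (auto simp: linear_on_def D_subspace cvec.scale_right_distrib algebra_simps)

lemma A_plus_in: "(\<lambda>u. A u + B u) ` D \<subseteq> L2"
  using A_L2 B.T_in closure_op_on_D(1) E_L2(1) by (auto intro!: L2w.V_add)

text \<open>The lower bound is on \<open>L2w s\<close>, but equations with right-hand side \<open>f\<close> in \<open>L2\<close> have to be solved.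
  The trial solution \<open>w = Rz z f\<close> leaves the error \<open>B w - K0 w\<close>, which lies in \<open>L2w s\<close>; it is
  corrected by \<open>Rz z h\<close> with \<open>h + Tz z h\<close> equal to minus the error.\<close>

lemma resolvent_perturbed:
  assumes z: "good z" and c: "c > 0" "\<And>f. f \<in> L2w s \<Longrightarrow> c * L2w_norm s f \<le> L2w_norm s (f + Tz z f)"
  shows "z \<in> resolvent_set D (\<lambda>u. A u + B u)"
proof -
  interpret Q: compact_endomorphism cscale "L2w s" "L2w_norm s" "Tz z" using Tz_compact[OF z] .
  interpret RL: bounded_operator cscale L2 "L2w_norm 0" Dc graph_norm "Rz z" using Rz_L2_graph[OF z] .
  interpret RB: bounded_operator cscale L2 "L2w_norm 0" L2 "L2w_norm 0" "Rz z"
    using resolvent_setD(4)[OF z] by (simp add: bounded_op_iff)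
  have Q_inj: "f = 0" if "f \<in> L2w s" "f + Tz z f = 0" for f
  proof -
    have "c * L2w_norm s f \<le> 0" using c(2)[OF that(1)] that(2) by simp
    then have "L2w_norm s f = 0" using c(1) L2w_norm_nonneg[of s f] by (simp add: mult_le_0_iff)
    then show ?thesis using L2w_norm_eq_0_iff that(1) by blast
  qed
  then have inj: "inj_on Q.S (L2w s)" unfolding Q.inj_S_iff by (auto simp: Q.S_def)
  have surj: "Q.S ` L2w s = L2w s" by (rule Q.inj_imp_surj[OF inj])
  obtain C1 where C1: "C1 > 0" "\<And>f. f \<in> L2 \<Longrightarrow> graph_norm (Rz z f) \<le> C1 * L2w_norm 0 f"
    using RL.T_bound_pos by blast
  obtain C2 where C2: "C2 > 0" "\<And>f. f \<in> L2 \<Longrightarrow> L2w_norm 0 (Rz z f) \<le> C2 * L2w_norm 0 f"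
    using RB.T_bound_pos by blast
  obtain C3 where C3: "C3 > 0" "\<And>f. f \<in> Dc \<Longrightarrow> L2w_norm s (B f - K0 f) \<le> C3 * graph_norm f"
    using B1.T_bound_pos by blast
  show ?thesis
  proof (rule resolvent_setI[OF A_plus_linear D_L2 A_plus_in, where C = "C2 + C2 * (C3 * C1 / c)"])
    fix u assume u: "u \<in> D" "A u + B u - z *\<^sub>c u = 0"
    define h where "h = - (B u - K0 u)"
    have h: "h \<in> L2w s" unfolding h_def by (rule L2w.V_neg[OF B1.T_in[OF closure_op_on_D(1)[OF u(1)]]])
    have Rh: "Rz z h = u" using Rz_of_perturbed[OF z u(1)] unfolding u(2) h_def diff_0 .
    have "h + Tz z h = 0" using perturbed_Rz[OF z h] unfolding Rh u(2) by simp
    then have "h = 0" using Q_inj h by blast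
    then show "u = 0" using Rh by simp
  next
    fix f assume f: "f \<in> L2"
    define w where "w = Rz z f"
    have w: "w \<in> D" "w \<in> Dc" using good_resolvent(1)[OF z f] closure_op_on_D(1) by (auto simp: w_def)
    have "- (B w - K0 w) \<in> L2w s" by (rule L2w.V_neg[OF B1.T_in[OF w(2)]])
    then obtain h where h: "h \<in> L2w s" "h + Tz z h = - (B w - K0 w)"
      using surj by (metis Q.S_def imageE)
    have v: "Rz z h \<in> D" "Rz z h \<in> Dc" using Rz_in_D z h by auto
    have hL: "h \<in> L2" using E_L2 h by auto
    have "A (w + Rz z h) + B (w + Rz z h) - z *\<^sub>c (w + Rz z h) =
        (A w + B w - z *\<^sub>c w) + (A (Rz z h) + B (Rz z h) - z *\<^sub>c Rz z h)"
      using A_add[OF w(1) v(1)] B.T_add[OF w(2) v(2)] by (simp add: cvec.scale_right_distrib)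
    also have "\<dots> = (A w + B w - z *\<^sub>c w) - (B w - K0 w)"
      unfolding perturbed_Rz[OF z h(1)] h(2) by simp
    also have "\<dots> = f" using good_resolvent(2)[OF z f] by (simp add: w_def)
    finally have eq: "A (w + Rz z h) + B (w + Rz z h) - z *\<^sub>c (w + Rz z h) = f" .
    have "c * L2w_norm s h \<le> L2w_norm s (B w - K0 w)"
      using c(2)[OF h(1)] unfolding h(2) L2w.N_minus[OF B1.T_in[OF w(2)]] .
    also have "\<dots> \<le> C3 * (C1 * L2w_norm 0 f)"
      unfolding w_def
      by (rule order_trans[OF C3(2)[OF w(2)[unfolded w_def]] mult_left_mono[OF C1(2)[OF f] less_imp_le[OF C3(1)]]])
    finally have "L2w_norm s h \<le> C3 * C1 / c * L2w_norm 0 f" using c(1) by (simp add: field_simps)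
    then have h0: "L2w_norm 0 h \<le> C3 * C1 / c * L2w_norm 0 f" using E_L2(2)[OF h(1)] by linarith
    have "L2w_norm 0 (w + Rz z h) \<le> L2w_norm 0 w + L2w_norm 0 (Rz z h)"
      using w(1) v(1) D_L2 by (intro L2w_norm_triangle) auto
    also have "\<dots> \<le> C2 * L2w_norm 0 f + C2 * (C3 * C1 / c * L2w_norm 0 f)"
      unfolding w_def using C2(2)[OF f] order_trans[OF C2(2)[OF hL] mult_left_mono[OF h0 less_imp_le[OF C2(1)]]]
      by (rule add_mono)
    finally have "L2w_norm 0 (w + Rz z h) \<le> (C2 + C2 * (C3 * C1 / c)) * L2w_norm 0 f"
      by (simp add: algebra_simps)
    with eq cvec.subspace_add[OF D_subspace w(1) v(1)]
    show "\<exists>u\<in>D. A u + B u - z *\<^sub>c u = f \<and> L2w_norm 0 u \<le> (C2 + C2 * (C3 * C1 / c)) * L2w_norm 0 f"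
      by blast
  qed
qed

lemma uniform_imp_wot:
  assumes "uniform_op_limit s (- s') Q Q0 F"
    "\<forall>\<^sub>F z in F. \<forall>u\<in>L2w s. Q z u \<in> L2w (- s')"
  shows "wot_limit s (- s') Q Q0 F"
  unfolding wot_limit_def
proof (intro conjI ballI)
  show bd: "bounded_op s (- s') Q0" using assms(1) by (simp add: uniform_op_limit_def)
  fix u l assume u: "u \<in> L2w s" and l: "l \<in> dual_L2w (- s')"
  obtain C where C: "C > 0" "\<And>u. u \<in> L2w (- s') \<Longrightarrow> cmod (l u) \<le> C * L2w_norm (- s') u"
    using dual_L2w_bound_pos[OF l] by blast
  have Q0u: "Q0 u \<in> L2w (- s')" using bd u by (auto simp: bounded_op_def)
  show "((\<lambda>z. l (Q z u)) \<longlongrightarrow> l (Q0 u)) F"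
  proof (rule tendstoI)
    fix e :: real assume e: "e > 0"
    define H where "H = C * (L2w_norm s u + 1)"
    have H: "H > 0" unfolding H_def using C(1) L2w_norm_nonneg[of s u] by (intro mult_pos_pos) auto
    have "\<forall>\<^sub>F z in F. \<forall>u\<in>L2w s. L2w_norm (- s') (Q z u - Q0 u) \<le> (e / H) * L2w_norm s u"
      using assms(1) divide_pos_pos[OF e H] unfolding uniform_op_limit_def by blast
    with assms(2) show "\<forall>\<^sub>F z in F. dist (l (Q z u)) (l (Q0 u)) < e"
    proof eventually_elim
      case (elim z)
      have "dist (l (Q z u)) (l (Q0 u)) \<le> C * L2w_norm (- s') (Q z u - Q0 u)"
        unfolding dist_norm using C(2)[of "Q z u - Q0 u"] dual_L2w_diff[OF l, of "Q z u" "Q0 u"] elim(1) u Q0u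
        by auto
      also have "\<dots> \<le> C * ((e / H) * L2w_norm s u)" using elim(2) u C(1) by (intro mult_left_mono) auto
      also have "\<dots> = (e / H) * (C * L2w_norm s u)" by simp
      also have "\<dots> < (e / H) * H"
        using e H C(1) by (intro mult_strict_left_mono) (auto simp: H_def)
      also have "\<dots> = e" using H by simp
      finally show ?case .
    qed
  qed
qed

text \<open>The resolvent of \<open>A + B\<close> is \<open>Rz z\<close> after the inverse of \<open>1 + Tz z\<close>.  The inverses are bounded
  uniformly in \<open>z\<close>, so both factors converge in norm.\<close>

lemma injective_imp_limit:
  assumes inj: "inj_on T.S (L2w s)"
  defines "R' \<equiv> \<lambda>f. R (inv_into (L2w s) T.S f)"
  shows "uniform_op_limit s (- s') (resolvent_op D (\<lambda>u. A u + B u)) R' (at z0 within \<Omega>)"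
    and "lap_limit s (- s') \<Omega> z0 D (\<lambda>u. A u + B u) R'"
proof -
  let ?E = "L2w s"
  have surj: "T.S ` ?E = ?E" by (rule T.inj_imp_surj[OF inj])
  define J where "J = inv_into ?E T.S"
  have J: "J f \<in> ?E" "T.S (J f) = f" if "f \<in> ?E" for f
    using that inv_into_into[of f T.S ?E] f_inv_into_f[of f T.S ?E] surj by (auto simp: J_def)
  have JS: "J (T.S f) = f" if "f \<in> ?E" for f
    using inv_into_f_f[OF inj that] by (simp add: J_def)
  have R'_def': "R' f = R (J f)" for f by (simp add: R'_def J_def)
  obtain c where c: "c > 0" "\<And>f. f \<in> ?E \<Longrightarrow> c * L2w_norm s f \<le> L2w_norm s (T.S f)"
    and ev: "\<forall>\<^sub>F z in at z0 within \<Omega>. good z \<and> (\<forall>f\<in>?E. c * L2w_norm s f \<le> L2w_norm s (f + Tz z f))"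
    using eventually_bounded_below[OF inj] by blast
  have J_le: "L2w_norm s (J f) \<le> L2w_norm s f / c" if "f \<in> ?E" for f
    using c(2)[OF J(1)[OF that]] J(2)[OF that] c(1) by (simp add: field_simps)
  have "bounded_operator cscale ?E (L2w_norm s) ?E (L2w_norm s) J"
  proof
    fix f assume f: "f \<in> ?E"
    show "J f \<in> ?E" using J f by auto
    show "J (k *\<^sub>c f) = k *\<^sub>c J f" for k
      using JS[of "k *\<^sub>c J f"] T.S_scale[OF J(1)[OF f]] J[OF f] by auto
    fix g assume g: "g \<in> ?E"
    show "J (f + g) = J f + J g"
      using JS[of "J f + J g"] T.S_add[OF J(1)[OF f] J(1)[OF g]] J[OF f] J[OF g] by auto
  next
    show "\<exists>C. \<forall>x\<in>?E. L2w_norm s (J x) \<le> C * L2w_norm s x"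
      using J_le by (intro exI[of _ "1 / c"]) auto
  qed
  then have R'_bd: "bounded_op s (- s') R'"
    unfolding bounded_op_iff R'_def' by (rule bounded_operator_comp[OF _ R.bounded_operator_axioms])
  have ev_res: "\<forall>\<^sub>F z in at z0 within \<Omega>. z \<in> resolvent_set D (\<lambda>u. A u + B u)"
    using ev by (rule eventually_mono) (auto intro: resolvent_perturbed[OF _ c(1)])
  obtain CR where CR: "CR > 0" "\<And>x. x \<in> ?E \<Longrightarrow> L2w_norm (- s') (R x) \<le> CR * L2w_norm s x"
    using R.T_bound_pos by blast
  show lim: "uniform_op_limit s (- s') (resolvent_op D (\<lambda>u. A u + B u)) R' (at z0 within \<Omega>)"
    unfolding uniform_op_limit_def
  proof (intro conjI R'_bd allI impI)
    fix e :: real assume e: "e > 0"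
    define d where "d = min (e * c / 2) (e * c * c / (2 * CR))"
    have d: "d > 0" "d \<le> e * c / 2" "d \<le> e * c * c / (2 * CR)" using e c(1) CR(1) by (auto simp: d_def)
    from ev ev_res Tz_limit[OF d(1)] Rz_limit[OF d(1)]
    show "\<forall>\<^sub>F z in at z0 within \<Omega>. \<forall>u\<in>?E. L2w_norm (- s') (resolvent_op D (\<lambda>u. A u + B u) z u - R' u) \<le> e * L2w_norm s u"
    proof eventually_elim
      case (elim z)
      show ?case
      proof
        fix f assume f: "f \<in> ?E"
        interpret Q: compact_endomorphism cscale ?E "L2w_norm s" "Tz z" using Tz_compact elim(1) by blast
        define u where "u = resolvent_op D (\<lambda>u. A u + B u) z f"
        have u: "u \<in> D" "A u + B u - z *\<^sub>c u = f"
          using resolvent_setD(1,2)[OF elim(2) E_L2(1)[OF f]] by (auto simp: u_def)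
        define h where "h = f - (B u - K0 u)"
        have h: "h \<in> ?E" unfolding h_def using f B1.T_in[OF closure_op_on_D(1)[OF u(1)]] by auto
        have Rh: "Rz z h = u" using Rz_of_perturbed[OF conjunct1[OF elim(1)] u(1)] unfolding u(2) h_def .
        have Sh: "h + Tz z h = f" using perturbed_Rz[of z h] elim(1) h unfolding Rh u(2) by simp
        have hX: "Rz z h \<in> L2w (- s')" "R h \<in> L2w (- s')" "R (J f) \<in> L2w (- s')"
          using D_in u Rh R.T_in h J(1)[OF f] by auto
        have dE: "h - J f \<in> ?E" using h J(1)[OF f] by auto
        have "(h - J f) + Tz z (h - J f) = f - (J f + Tz z (J f))"
          using Q.T_diff[OF h J(1)[OF f]] Sh by (simp add: algebra_simps)
        also have "\<dots> = - (Tz z (J f) - T (J f))" using J(2)[OF f] by (simp add: T.S_def algebra_simps)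
        finally have "c * L2w_norm s (h - J f) \<le> L2w_norm s (Tz z (J f) - T (J f))"
          using elim(1) dE L2w.N_minus[of "Tz z (J f) - T (J f)" s] Q.T_in T.T_in J(1)[OF f] by (metis L2w.V_diff)
        also have "\<dots> \<le> d * (L2w_norm s f / c)"
          using elim(3) J(1)[OF f] mult_left_mono[OF J_le[OF f] less_imp_le[OF d(1)]] by fastforce
        finally have hJ: "L2w_norm s (h - J f) \<le> d * (L2w_norm s f / c) / c" using c(1) by (simp add: field_simps)
        have h_le: "L2w_norm s h \<le> L2w_norm s f / c"
          using elim(1) h Sh c(1) by (auto simp: field_simps)
        have "L2w_norm (- s') (u - R' f) \<le> L2w_norm (- s') (Rz z h - R h) + L2w_norm (- s') (R h - R (J f))"
          unfolding R'_def' Rh[symmetric] by (rule L2w.N_dist3[OF hX])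
        also have "R h - R (J f) = R (h - J f)" using R.T_diff[OF h J(1)[OF f]] by simp
        also have "L2w_norm (- s') (Rz z h - R h) + L2w_norm (- s') (R (h - J f))
            \<le> d * (L2w_norm s f / c) + CR * (d * (L2w_norm s f / c) / c)"
        proof (rule add_mono)
          show "L2w_norm (- s') (Rz z h - R h) \<le> d * (L2w_norm s f / c)"
            using elim(4) h mult_left_mono[OF h_le less_imp_le[OF d(1)]] by fastforce
          show "L2w_norm (- s') (R (h - J f)) \<le> CR * (d * (L2w_norm s f / c) / c)"
            using order_trans[OF CR(2)[OF dE] mult_left_mono[OF hJ less_imp_le[OF CR(1)]]] .
        qed
        also have "\<dots> = d / c * L2w_norm s f + (CR * d / (c * c)) * L2w_norm s f" by simp
        also have "\<dots> \<le> e / 2 * L2w_norm s f + e / 2 * L2w_norm s f"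
          using d c(1) CR(1) L2w_norm_nonneg[of s f]
          by (intro add_mono mult_right_mono) (auto simp: field_simps)
        finally show "L2w_norm (- s') (resolvent_op D (\<lambda>u. A u + B u) z f - R' f) \<le> e * L2w_norm s f"
          by (simp add: u_def)
      qed
    qed
  qed
  have "\<forall>\<^sub>F z in at z0 within \<Omega>. \<forall>u\<in>?E. resolvent_op D (\<lambda>u. A u + B u) z u \<in> L2w (- s')"
    using ev_res by (rule eventually_mono) (use resolvent_setD(1) E_L2(1) D_in in blast)
  then show "lap_limit s (- s') \<Omega> z0 D (\<lambda>u. A u + B u) R'"
    unfolding lap_limit_def spectral_gap_iff[OF z0_notin]
    using ev_res uniform_imp_wot[OF lim] by blast
qed

text \<open>For \<open>f\<close> in \<open>L2w s\<close> let \<open>h n\<close> solve \<open>h + Tz h = f\<close> along a sequence tending to \<open>z0\<close>.  If a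
  subsequence of \<open>h n\<close> is bounded, compactness yields a preimage of \<open>f\<close> under \<open>1 + T\<close>.
  Otherwise the normalized \<open>h n\<close> accumulate at some \<open>w \<noteq> 0\<close>, and \<open>R w\<close> is the limit of the
  solutions \<open>Rz (h n)\<close> divided by the norms of \<open>h n\<close>.  These solutions converge weakly, so \<open>R w\<close>
  is weakly zero, against injectivity of \<open>R\<close>.\<close>

lemma lap_imp_surjective:
  assumes lap: "lap_limit s (- s') \<Omega> z0 D (\<lambda>u. A u + B u) R'"
  shows "T.S ` L2w s = L2w s"
proof
  let ?E = "L2w s"
  show "T.S ` ?E \<subseteq> ?E" by auto
  show "?E \<subseteq> T.S ` ?E"
  proof
    fix f assume f: "f \<in> ?E"
    let ?Q = "\<lambda>z. resolvent_op D (\<lambda>u. A u + B u) z f"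
    have ev: "\<forall>\<^sub>F z in at z0 within \<Omega>. z \<in> resolvent_set D (\<lambda>u. A u + B u)"
      and wot: "bounded_op s (- s') R'"
        "\<And>l. l \<in> dual_L2w (- s') \<Longrightarrow> ((\<lambda>z. l (?Q z)) \<longlongrightarrow> l (R' f)) (at z0 within \<Omega>)"
      using lap f unfolding lap_limit_def spectral_gap_iff[OF z0_notin] wot_limit_def by blast+
    obtain \<zeta> :: "nat \<Rightarrow> complex" where \<zeta>: "filterlim \<zeta> (at z0 within \<Omega>) sequentially" "\<zeta> \<longlonglongrightarrow> z0"
      "\<And>n. \<zeta> n \<in> resolvent_set D (\<lambda>u. A u + B u)" "\<And>n. good (\<zeta> n)"
      by (rule good_sequence[OF ev]) (rule that)
    define u where "u n = ?Q (\<zeta> n)" for n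
    have u: "u n \<in> D" "A (u n) + B (u n) - \<zeta> n *\<^sub>c u n = f" for n
      using resolvent_setD(1,2)[OF \<zeta>(3) E_L2(1)[OF f]] by (auto simp: u_def)
    define h where "h n = f - (B (u n) - K0 (u n))" for n
    have h: "h n \<in> ?E" for n
      unfolding h_def using f B1.T_in[OF closure_op_on_D(1)[OF u(1)]] by auto
    have Rh: "Rz (\<zeta> n) (h n) = u n" for n
      using Rz_of_perturbed[OF \<zeta>(4)[of n] u(1)[of n]] unfolding u(2) h_def .
    have Sh: "h n + Tz (\<zeta> n) (h n) = f" for n
      using perturbed_Rz[OF \<zeta>(4)[of n] h[of n]] unfolding Rh u(2) by simp
    have Tz_in: "Tz (\<zeta> n) g \<in> ?E" if "g \<in> ?E" for n g
    proof -
      interpret Q: compact_endomorphism cscale ?E "L2w_norm s" "Tz (\<zeta> n)" using Tz_compact[OF \<zeta>(4)] .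
      show ?thesis using Q.T_in[OF that] .
    qed
    \<comment> \<open>On bounded sequences the difference between \<open>Tz\<close> and \<open>T\<close> is negligible.\<close>
    have T_diff_null: "(\<lambda>n. L2w_norm s (Tz (\<zeta> (q n)) (g n) - T (g n))) \<longlonglongrightarrow> 0"
      if q: "strict_mono (q :: nat \<Rightarrow> nat)" and g: "\<And>n. g n \<in> ?E" "\<And>n. L2w_norm s (g n) \<le> C" for q g C
    proof (rule tendstoI)
      fix e :: real assume e: "e > 0"
      have C0: "0 \<le> C" using order_trans[OF L2w_norm_nonneg g(2)[of 0]] .
      define d where "d = e / (C + 1)"
      have d: "d > 0" "d * C < e" using e C0 by (auto simp: d_def field_simps)
      have "filterlim (\<lambda>n. \<zeta> (q n)) (at z0 within \<Omega>) sequentially"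
        using filterlim_compose[OF \<zeta>(1) filterlim_subseq[OF q]] .
      from eventually_compose_filterlim[OF Tz_limit[OF d(1)] this]
      show "\<forall>\<^sub>F n in sequentially. dist (L2w_norm s (Tz (\<zeta> (q n)) (g n) - T (g n))) 0 < e"
      proof eventually_elim
        case (elim n)
        have "L2w_norm s (Tz (\<zeta> (q n)) (g n) - T (g n)) \<le> d * L2w_norm s (g n)" using elim g by auto
        also have "\<dots> \<le> d * C" using g(2) d(1) by simp
        also have "\<dots> < e" by (rule d)
        finally show ?case by (simp add: L2w_norm_nonneg)
      qed
    qed
    show "f \<in> T.S ` ?E"
    proof (cases "filterlim (\<lambda>n. L2w_norm s (h n)) at_top sequentially")
      case False
      then obtain C where "\<not> (\<forall>\<^sub>F n in sequentially. C \<le> L2w_norm s (h n))"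
        unfolding filterlim_at_top by auto
      then have "infinite {n. L2w_norm s (h n) < C}"
        unfolding not_eventually not_le frequently_cofinite[symmetric] cofinite_eq_sequentially .
      then obtain q where q: "strict_mono (q :: nat \<Rightarrow> nat)" "\<And>n. L2w_norm s (h (q n)) < C"
        using infinite_enumerate by blast
      have "(\<lambda>n. L2w_norm s (Tz (\<zeta> (q n)) (h (q n)) - T (h (q n)))) \<longlonglongrightarrow> 0"
        using T_diff_null[OF q(1), of "\<lambda>n. h (q n)" C] h q(2) less_imp_le by auto
      moreover have "L2w_norm s (T.S (h (q n)) - f) = L2w_norm s (Tz (\<zeta> (q n)) (h (q n)) - T (h (q n)))" for n
        by (subst L2w_norm_minus_commute, subst Sh[of "q n", symmetric]) (simp add: T.S_def)
      ultimately have "L2w.conv s (\<lambda>n. T.S (h (q n))) f" by simp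
      from T.preimage_conv[of "\<lambda>n. h (q n)" C f, OF h less_imp_le[OF q(2)] f this]
      obtain w where "w \<in> ?E" "T.S w = f" by blast
      then show ?thesis by blast
    next
      case True
      \<comment> \<open>If the \<open>h n\<close> blow up, their normalizations produce a null vector \<open>w\<close> of \<open>1 + T\<close> such that
        \<open>R w\<close> is annihilated by every functional.\<close>
      define k where "k n = complex_of_real (1 / L2w_norm s (h n)) *\<^sub>c h n" for n
      have inv0: "(\<lambda>n. 1 / L2w_norm s (h n)) \<longlonglongrightarrow> 0"
        using tendsto_inverse_0_at_top[OF True] by (simp add: inverse_eq_divide)
      have k: "k n \<in> ?E" for n unfolding k_def using h by auto
      have nk: "L2w_norm s (k n) = (if h n = 0 then 0 else 1)" for n
        unfolding k_def L2w_norm_cscale norm_of_real using L2w_norm_eq_0_iff[OF h[of n]] L2w_norm_nonneg[of s "h n"]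
        by auto
      then have k_le: "L2w_norm s (k n) \<le> 1" for n by simp
      have "\<forall>\<^sub>F n in sequentially. 1 \<le> L2w_norm s (h n)" using True by (simp add: filterlim_at_top)
      then have nk_ev: "\<forall>\<^sub>F n in sequentially. L2w_norm s (k n) = 1"
        unfolding nk by eventually_elim (auto simp: L2w_norm_eq_0_iff)
      have diff0: "(\<lambda>n. L2w_norm s (Tz (\<zeta> n) (k n) - T (k n))) \<longlonglongrightarrow> 0"
        using T_diff_null[of "\<lambda>n. n" k 1] k k_le by (simp add: strict_mono_def)
      have Sk: "k n + Tz (\<zeta> n) (k n) = complex_of_real (1 / L2w_norm s (h n)) *\<^sub>c f" for n
      proof -
        interpret Q: compact_endomorphism cscale ?E "L2w_norm s" "Tz (\<zeta> n)" using Tz_compact[OF \<zeta>(4)] .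
        show ?thesis unfolding k_def Q.T_scale[OF h] cvec.scale_right_distrib[symmetric] Sh ..
      qed
      have "L2w.conv s (\<lambda>n. T.S (k n)) 0"
      proof (rule Lim_null_comparison)
        show "\<forall>\<^sub>F n in sequentially. norm (L2w_norm s (T.S (k n) - 0)) \<le>
            1 / L2w_norm s (h n) * L2w_norm s f + L2w_norm s (Tz (\<zeta> n) (k n) - T (k n))"
        proof (intro always_eventually allI)
          fix n
          have "T.S (k n) = complex_of_real (1 / L2w_norm s (h n)) *\<^sub>c f - (Tz (\<zeta> n) (k n) - T (k n))"
            unfolding Sk[symmetric] T.S_def by simp
          then have "L2w_norm s (T.S (k n)) \<le> L2w_norm s (complex_of_real (1 / L2w_norm s (h n)) *\<^sub>c f)
              + L2w_norm s (Tz (\<zeta> n) (k n) - T (k n))"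
            using L2w.N_diff[of "complex_of_real (1 / L2w_norm s (h n)) *\<^sub>c f" s "Tz (\<zeta> n) (k n) - T (k n)"]
              f Tz_in[OF k] T.T_in[OF k] by auto
          then show "norm (L2w_norm s (T.S (k n) - 0)) \<le>
              1 / L2w_norm s (h n) * L2w_norm s f + L2w_norm s (Tz (\<zeta> n) (k n) - T (k n))"
            unfolding L2w_norm_cscale norm_of_real by (simp add: L2w_norm_nonneg)
        qed
        show "(\<lambda>n. 1 / L2w_norm s (h n) * L2w_norm s f + L2w_norm s (Tz (\<zeta> n) (k n) - T (k n))) \<longlonglongrightarrow> 0"
          using tendsto_add[OF tendsto_mult_left_zero[OF inv0] diff0] by simp
      qed
      from T.preimage_conv[of k 1 0, OF k k_le L2w_0 this]
      obtain r w where r: "strict_mono (r :: nat \<Rightarrow> nat)" and w: "w \<in> ?E" "L2w.conv s (\<lambda>n. k (r n)) w" "T.S w = 0"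
        by blast
      have "(\<lambda>n. L2w_norm s (k (r n))) \<longlonglongrightarrow> L2w_norm s w" by (rule L2w.conv_N[OF k w(1,2)])
      moreover have "\<forall>\<^sub>F n in sequentially. L2w_norm s (k (r n)) = 1"
        using eventually_subseq[OF r nk_ev] .
      ultimately have "L2w_norm s w = 1" by (rule LIMSEQ_unique[OF _ tendsto_eventually])
      then have "w \<noteq> 0" by auto
      then have "R w \<noteq> 0" using R_eq_0 w(1) by blast
      then obtain l where l: "l \<in> dual_L2w (- s')" "l (R w) \<noteq> 0"
        using dual_L2w_separates[OF R.T_in[OF w(1)]] by blast
      obtain C where C: "C > 0" "\<And>u. u \<in> L2w (- s') \<Longrightarrow> cmod (l u) \<le> C * L2w_norm (- s') u"
        using dual_L2w_bound_pos[OF l(1)] by blast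
      obtain CR where CR: "CR > 0" "\<And>x. x \<in> ?E \<Longrightarrow> L2w_norm (- s') (R x) \<le> CR * L2w_norm s x"
        using R.T_bound_pos by blast
      have RkX: "Rz (\<zeta> n) (k m) \<in> L2w (- s')" "R (k m) \<in> L2w (- s')" for n m
        using Rz_in_D(1)[OF \<zeta>(4) k] D_in R.T_in[OF k] by auto
      have lim_r: "filterlim (\<lambda>n. \<zeta> (r n)) (at z0 within \<Omega>) sequentially"
        using filterlim_compose[OF \<zeta>(1) filterlim_subseq[OF r]] .
      have "(\<lambda>n. L2w_norm (- s') (Rz (\<zeta> (r n)) (k (r n)) - R (k (r n)))) \<longlonglongrightarrow> 0"
      proof (rule tendstoI)
        fix e :: real assume "e > 0"
        then have "e / 2 > 0" by simp
        from eventually_compose_filterlim[OF Rz_limit[OF this] lim_r]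
        show "\<forall>\<^sub>F n in sequentially. dist (L2w_norm (- s') (Rz (\<zeta> (r n)) (k (r n)) - R (k (r n)))) 0 < e"
        proof eventually_elim
          case (elim n)
          have "L2w_norm (- s') (Rz (\<zeta> (r n)) (k (r n)) - R (k (r n))) \<le> e / 2 * L2w_norm s (k (r n))"
            using elim k by blast
          also have "\<dots> \<le> e / 2 * 1" using k_le \<open>e > 0\<close> by (intro mult_left_mono) auto
          also have "\<dots> < e" using \<open>e > 0\<close> by simp
          finally show ?case by (simp add: L2w_norm_nonneg)
        qed
      qed
      then have "L2w.conv (- s') (\<lambda>n. (Rz (\<zeta> (r n)) (k (r n)) - R (k (r n))) + R (k (r n))) (0 + R w)"
        using RkX R.T_in[OF w(1)]
        by (intro L2w.conv_add R.conv_T[of "\<lambda>n. k (r n)", OF k w(1,2)]) auto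
      then have convR: "L2w.conv (- s') (\<lambda>n. Rz (\<zeta> (r n)) (k (r n))) (R w)" by simp
      have Rk: "Rz (\<zeta> n) (k n) = complex_of_real (1 / L2w_norm s (h n)) *\<^sub>c u n" for n
      proof -
        interpret Q: bounded_operator cscale ?E "L2w_norm s" Dc graph_norm "Rz (\<zeta> n)" using Rz_E_graph[OF \<zeta>(4)] .
        show ?thesis unfolding k_def Q.T_scale[OF h] Rh ..
      qed
      have uX: "u n \<in> L2w (- s')" for n using D_in[OF u(1)] .
      have "(\<lambda>n. l (Rz (\<zeta> (r n)) (k (r n)))) \<longlonglongrightarrow> l (R w)"
      proof (rule LIM_zero_cancel, rule Lim_null_comparison)
        show "(\<lambda>n. C * L2w_norm (- s') (Rz (\<zeta> (r n)) (k (r n)) - R w)) \<longlonglongrightarrow> 0"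
          by (rule tendsto_mult_right_zero[OF convR])
        show "\<forall>\<^sub>F n in sequentially. norm (l (Rz (\<zeta> (r n)) (k (r n))) - l (R w)) \<le>
            C * L2w_norm (- s') (Rz (\<zeta> (r n)) (k (r n)) - R w)"
          unfolding dual_L2w_diff[OF l(1) RkX(1) R.T_in[OF w(1)], symmetric]
          by (intro always_eventually allI C(2) L2w_diff RkX(1) R.T_in[OF w(1)])
      qed
      moreover have "(\<lambda>n. l (Rz (\<zeta> (r n)) (k (r n)))) \<longlonglongrightarrow> 0"
      proof -
        have "(\<lambda>n. l (u (r n))) \<longlonglongrightarrow> l (R' f)"
          unfolding u_def by (rule filterlim_compose[OF wot(2)[OF l(1)] lim_r])
        moreover have "(\<lambda>n. 1 / L2w_norm s (h (r n))) \<longlonglongrightarrow> 0"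
          using LIMSEQ_subseq_LIMSEQ[OF inv0 r] by (simp add: o_def)
        then have "(\<lambda>n. complex_of_real (1 / L2w_norm s (h (r n)))) \<longlonglongrightarrow> 0"
          using tendsto_of_real[where 'a = complex] by fastforce
        ultimately have "(\<lambda>n. complex_of_real (1 / L2w_norm s (h (r n))) * l (u (r n))) \<longlonglongrightarrow> 0 * l (R' f)"
          by (intro tendsto_mult)
        then show ?thesis unfolding Rk dual_L2wD(2)[OF l(1) uX] by simp
      qed
      ultimately have "l (R w) = 0" using LIMSEQ_unique by blast
      with l(2) show ?thesis by simp
    qed
  qed
qed

lemma add_finite_rank:
  assumes "bounded_op (- s') s K" "finite_rank (- s') K"
  shows "compact_perturbation s' D A s \<Omega> z0 K0 R (\<lambda>u. B u + K u)"
  by (intro compact_perturbation.intro finite_rank_regularization_axioms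
      compact_perturbation_axioms.intro compact_operator_add[OF B_compact finite_rank_graph_compact[OF assms]])

end

lemma rank_one_bounded_op:
  assumes "l \<in> dual_L2w a" "h \<in> L2w b"
  shows "bounded_op a b (\<lambda>u. l u *\<^sub>c h)"
  unfolding bounded_op_iff
proof
  obtain C where C: "C > 0" "\<And>u. u \<in> L2w a \<Longrightarrow> cmod (l u) \<le> C * L2w_norm a u"
    using dual_L2w_bound_pos[OF assms(1)] by blast
  have "L2w_norm b (l u *\<^sub>c h) \<le> (C * L2w_norm b h) * L2w_norm a u" if "u \<in> L2w a" for u
    using mult_right_mono[OF C(2)[OF that] L2w_norm_nonneg[of b h]] by (simp add: L2w_norm_cscale mult_ac)
  then show "\<exists>C. \<forall>u\<in>L2w a. L2w_norm b (l u *\<^sub>c h) \<le> C * L2w_norm a u" by blast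
qed (simp_all add: assms dual_L2wD[OF assms(1)] L2w_cscale cvec.scale_left_distrib)

lemma rank_one_finite_rank: "finite_rank a (\<lambda>u. l u *\<^sub>c h)"
  unfolding finite_rank_def
  by (intro exI[of _ "{h}"]) (auto intro: cvec.span_scale cvec.span_base)

lemma finite_rank_add:
  assumes "finite_rank a K" "finite_rank a L"
  shows "finite_rank a (\<lambda>u. K u + L u)"
proof -
  obtain F G where F: "finite F" "K ` L2w a \<subseteq> cvec.span F" and G: "finite G" "L ` L2w a \<subseteq> cvec.span G"
    using assms by (auto simp: finite_rank_def)
  have "(\<lambda>u. K u + L u) ` L2w a \<subseteq> cvec.span (F \<union> G)"
    using F(2) G(2) cvec.span_mono[of F "F \<union> G"] cvec.span_mono[of G "F \<union> G"]
    by (auto intro!: cvec.span_add)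
  then show ?thesis unfolding finite_rank_def using F(1) G(1) by (intro exI[of _ "F \<union> G"]) simp
qed

lemma bounded_op_add: "bounded_op a b K \<Longrightarrow> bounded_op a b L \<Longrightarrow> bounded_op a b (\<lambda>u. K u + L u)"
  unfolding bounded_op_iff by (rule bounded_operator_add)

context compact_perturbation
begin

text \<open>If \<open>1 + T + K R\<close> has a null vector \<open>g\<close>, it also misses some \<open>h\<close>.  Adding to \<open>K\<close> the rank one
  operator \<open>l(.) h\<close>, with \<open>l\<close> a functional that does not vanish at \<open>R g\<close>, removes \<open>g\<close> from the
  kernel and adds nothing to it.  Were there no end to this, the kernels would form a strictly
  decreasing chain of closed subspaces, which compactness of \<open>T + K 0 R\<close> excludes.\<close>

lemma exists_regularizer:
  "\<exists>K. bounded_op (- s') s K \<and> finite_rank (- s') K \<and> inj_on (\<lambda>f. T.S f + K (R f)) (L2w s)"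
proof (rule ccontr)
  let ?E = "L2w s"
  define ker where "ker K = {f \<in> ?E. T.S f + K (R f) = 0}" for K
  let ?P = "\<lambda>n::nat. \<lambda>K. bounded_op (- s') s K \<and> finite_rank (- s') K"
  assume none: "\<not> ?thesis"
  have endo: "compact_endomorphism cscale ?E (L2w_norm s) (\<lambda>f. T f + K (R f))"
    if "bounded_op (- s') s K" "finite_rank (- s') K" for K
    unfolding compact_endomorphism_def
    by (rule compact_operator_add[OF T.compact_operator_axioms
          compact_operator_comp[OF R_E_graph finite_rank_graph_compact[OF that]]])
  have step: "\<exists>K'. ?P (Suc n) K' \<and> ker K' \<subset> ker K" if K: "?P n K" for n :: nat and K
  proof -
    interpret Q: compact_endomorphism cscale ?E "L2w_norm s" "\<lambda>f. T f + K (R f)" using endo K by blast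
    interpret KK: bounded_operator cscale "L2w (- s')" "L2w_norm (- s')" ?E "L2w_norm s" K
      using K by (simp add: bounded_op_iff)
    have QS: "Q.S = (\<lambda>f. T.S f + K (R f))"
      by (rule ext) (simp only: Q.S_def T.S_def add.assoc)
    have ninj: "\<not> inj_on Q.S ?E" using none K unfolding QS by blast
    then obtain g where g: "g \<in> ?E" "Q.S g = 0" "g \<noteq> 0" unfolding Q.inj_S_iff by blast
    have "Q.S ` ?E \<noteq> ?E" using Q.surj_imp_inj ninj by blast
    then obtain h where h: "h \<in> ?E" "h \<notin> Q.S ` ?E" using Q.S_V by blast
    have "R g \<noteq> 0" using R_eq_0 g by blast
    then obtain l where l: "l \<in> dual_L2w (- s')" "l (R g) \<noteq> 0"
      using dual_L2w_separates[OF R.T_in[OF g(1)]] by blast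
    define K' where "K' u = K u + l u *\<^sub>c h" for u
    have "?P (Suc n) K'"
      unfolding K'_def using K rank_one_bounded_op[OF l(1) h(1)] rank_one_finite_rank
      by (auto intro: bounded_op_add finite_rank_add)
    moreover have "ker K' \<subset> ker K"
    proof
      show "ker K' \<subseteq> ker K"
      proof
        fix w assume w: "w \<in> ker K'"
        then have wE: "w \<in> ?E" and eq: "Q.S w + l (R w) *\<^sub>c h = 0"
          by (auto simp: ker_def K'_def QS add.assoc)
        have "l (R w) = 0"
        proof (rule ccontr)
          assume nz: "l (R w) \<noteq> 0"
          have "h = (1 / l (R w)) *\<^sub>c (l (R w) *\<^sub>c h)" using nz by simp
          also have "l (R w) *\<^sub>c h = - Q.S w" using eq by (simp add: eq_neg_iff_add_eq_0 add.commute)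
          also have "(1 / l (R w)) *\<^sub>c - Q.S w = Q.S ((- 1 / l (R w)) *\<^sub>c w)"
            using Q.S_scale[OF wE, of "- 1 / l (R w)"] by (simp add: cvec.scale_minus_left)
          finally have "h \<in> Q.S ` ?E" using L2w_cscale[OF wE] by blast
          with h(2) show False by simp
        qed
        with eq wE show "w \<in> ker K" by (simp add: ker_def QS)
      qed
      show "ker K' \<noteq> ker K"
      proof
        assume "ker K' = ker K"
        moreover have "g \<in> ker K" using g by (simp add: ker_def QS)
        ultimately have "g \<in> ker K'" by simp
        then have "Q.S g + l (R g) *\<^sub>c h = 0" by (auto simp: ker_def K'_def QS add.assoc)
        with g(2) have "l (R g) *\<^sub>c h = 0" by simp
        then have "h = 0" using l(2) by (simp add: cvec.scale_eq_0_iff)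
        then show False using h(2) Q.S_0 L2w_0 by (metis imageI)
      qed
    qed
    ultimately show ?thesis by blast
  qed
  have "?P 0 (\<lambda>u. 0)"
    using rank_one_bounded_op[OF pairing_in_dual[OF L2w_0] L2w_0, of "- s'" s] rank_one_finite_rank[of "- s'" _ 0]
    by simp
  then obtain K where K: "\<And>n. ?P n (K n)" "\<And>n. ker (K (Suc n)) \<subset> ker (K n)"
    using dependent_nat_choice[of ?P "\<lambda>n K K'. ker K' \<subset> ker K"] step by metis
  interpret Q: compact_endomorphism cscale ?E "L2w_norm s" "\<lambda>f. T f + K 0 (R f)" using endo K(1) by blast
  have QS: "Q.S = (\<lambda>f. T.S f + K 0 (R f))"
    by (rule ext) (simp only: Q.S_def T.S_def add.assoc)
  have anti: "ker (K n) \<subseteq> ker (K 0)" for n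
    by (induction n) (use K(2) in auto)
  show False
  proof (rule Q.no_decreasing_chain[of "\<lambda>n. ker (K n)", OF _ K(2)])
    fix n
    interpret Qn: compact_endomorphism cscale ?E "L2w_norm s" "\<lambda>f. T f + K n (R f)" using endo K(1) by blast
    have QnS: "Qn.S f = T.S f + K n (R f)" for f
      by (simp only: Qn.S_def T.S_def add.assoc)
    have ker_n: "ker (K n) = {f \<in> ?E. Qn.S f = 0}" by (simp add: ker_def QnS)
    show "L2w.closed_subspace s (ker (K n))"
      unfolding L2w.closed_subspace_def cvec.subspace_def
    proof (intro conjI ballI allI impI)
      fix x l assume x: "\<forall>n'. x n' \<in> ker (K n)" and l: "l \<in> ?E" "L2w.conv s x l"
      have "L2w.conv s (\<lambda>n'. Qn.S (x n')) (Qn.S l)" using x l by (intro Qn.conv_S) (auto simp: ker_n)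
      moreover have "L2w.conv s (\<lambda>n'. Qn.S (x n')) 0" using x by (simp add: ker_n)
      ultimately have "Qn.S l = 0"
        using x l by (intro L2w.conv_unique[of "\<lambda>n'. Qn.S (x n')" s]) (auto simp: ker_n)
      with l show "l \<in> ker (K n)" by (simp add: ker_n)
    qed (auto simp: ker_n Qn.S_add Qn.S_scale L2w_cscale)
    have "0 \<in> ker (K (Suc n))"
    proof -
      interpret KK: bounded_operator cscale "L2w (- s')" "L2w_norm (- s')" ?E "L2w_norm s" "K (Suc n)"
        using K(1) by (simp add: bounded_op_iff)
      show ?thesis by (simp add: ker_def)
    qed
    moreover have "Q.S f = 0" if "f \<in> ker (K n)" for f
      using anti[of n] that unfolding QS by (auto simp: ker_def)
    ultimately show "Q.S ` ker (K n) \<subseteq> ker (K (Suc n))" by auto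
  qed
qed

text \<open>The limit resolvent of \<open>A + B + K\<close> is \<open>R\<close> after a bijection of \<open>L2w s\<close>, so it has the range of
  \<open>R\<close>.\<close>

lemma virtual_state_from_kernel:
  assumes g: "g \<in> L2w s" "g \<noteq> 0" "T.S g = 0"
  shows "virtual_state s (- s') \<Omega> z0 D A B (R g)"
proof -
  obtain K where K: "bounded_op (- s') s K" "finite_rank (- s') K"
    and inj: "inj_on (\<lambda>f. T.S f + K (R f)) (L2w s)" using exists_regularizer by blast
  interpret PK: compact_perturbation s' D A s \<Omega> z0 K0 R "\<lambda>u. B u + K u"
    by (rule add_finite_rank[OF K])
  have S_eq: "PK.T.S = (\<lambda>f. T.S f + K (R f))"
    by (rule ext) (simp only: PK.T.S_def PK.T_def T.S_def T_def algebra_simps)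
  have inj': "inj_on PK.T.S (L2w s)" using inj unfolding S_eq .
  have "lap_limit s (- s') \<Omega> z0 D (\<lambda>u. A u + B u + K u) (\<lambda>f. R (inv_into (L2w s) PK.T.S f))"
    using PK.injective_imp_limit(2)[OF inj'] by (simp add: add.assoc)
  moreover have "R g \<in> (\<lambda>f. R (inv_into (L2w s) PK.T.S f)) ` L2w s"
    using inv_into_f_f[OF inj' g(1)] PK.T.S_V[OF g(1)] by (intro image_eqI[of _ _ "PK.T.S g"]) auto
  moreover have "closure_op (- s') D A (R g) + B (R g) - z0 *\<^sub>c R g = 0"
    using perturbed_R[OF g(1)] g(3) by simp
  ultimately show ?thesis
    unfolding virtual_state_def using K R.T_in[OF g(1)] R_eq_0[OF g(1)] g(2) R_graph(1)[OF g(1)] by blast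
qed

text \<open>The principle for \<open>A + B\<close> makes \<open>1 + T\<close> injective.  A virtual state lies in the range of the
  limit resolvent of \<open>A + B + K\<close>, which is contained in that of \<open>R\<close>; if it is \<open>R h\<close>, then
  \<open>h\<close> is a null vector of \<open>1 + T\<close>.\<close>

lemma lap_excludes_virtual_state:
  assumes lap: "LAP s (- s') \<Omega> z0 D (\<lambda>u. A u + B u)"
    and vs: "virtual_state s (- s') \<Omega> z0 D A B \<Psi>"
  shows False
proof -
  have inj: "inj_on T.S (L2w s)"
    using lap lap_imp_surjective T.surj_imp_inj unfolding LAP_def by blast
  obtain K RK f where K: "bounded_op (- s') s K" "finite_rank (- s') K"
    and RK: "lap_limit s (- s') \<Omega> z0 D (\<lambda>u. A u + B u + K u) RK"
    and f: "f \<in> L2w s" "\<Psi> = RK f" and \<Psi>: "\<Psi> \<noteq> 0" "Ac \<Psi> + B \<Psi> - z0 *\<^sub>c \<Psi> = 0"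
    using vs unfolding virtual_state_def by blast
  interpret PK: compact_perturbation s' D A s \<Omega> z0 K0 R "\<lambda>u. B u + K u"
    by (rule add_finite_rank[OF K])
  have RK': "lap_limit s (- s') \<Omega> z0 D (\<lambda>u. A u + (B u + K u)) RK"
    using RK by (simp add: add.assoc)
  have surj: "PK.T.S ` L2w s = L2w s" by (rule PK.lap_imp_surjective[OF RK'])
  define h where "h = inv_into (L2w s) PK.T.S f"
  have h: "h \<in> L2w s" unfolding h_def using inv_into_into[of f PK.T.S "L2w s"] f(1) surj by simp
  \<comment> \<open>Weak limits are unique, so \<open>\<Psi>\<close> lies in the range of the regularized limit operator.\<close>
  have "RK f = R h"
  proof (rule ccontr)
    assume "RK f \<noteq> R h"
    then have ne: "RK f - R h \<noteq> 0" by simp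
    have wot: "wot_limit s (- s') (resolvent_op D (\<lambda>u. A u + (B u + K u))) RK (at z0 within \<Omega>)"
      "wot_limit s (- s') (resolvent_op D (\<lambda>u. A u + (B u + K u))) (\<lambda>f. R (inv_into (L2w s) PK.T.S f)) (at z0 within \<Omega>)"
      using RK' PK.injective_imp_limit(2)[OF PK.T.surj_imp_inj[OF surj]] by (auto simp: lap_limit_def)
    have in_X: "RK f \<in> L2w (- s')" "R h \<in> L2w (- s')"
      using wot(1) f(1) R.T_in[OF h] by (auto simp: wot_limit_def bounded_op_def)
    obtain l where l: "l \<in> dual_L2w (- s')" "l (RK f - R h) \<noteq> 0"
      using dual_L2w_separates[OF L2w_diff[OF in_X] ne] by blast
    have "l (RK f) = l (R h)"
      using wot f(1) l(1) tendsto_unique[OF nontrivial] unfolding wot_limit_def h_def by blast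
    then show False using l(2) dual_L2w_diff[OF l(1) in_X] by simp
  qed
  then have "\<Psi> = R h" using f(2) by simp
  then have "T.S h = 0" using perturbed_R[OF h] \<Psi>(2) by simp
  then have "h = 0" using inj h unfolding T.inj_S_iff by blast
  then show False using \<Psi>(1) \<open>\<Psi> = R h\<close> by simp
qed

theorem virtual_state_dichotomy:
  "((\<exists>R'. lap_limit s (- s') \<Omega> z0 D (\<lambda>u. A u + B u) R'
       \<and> uniform_op_limit s (- s') (resolvent_op D (\<lambda>u. A u + B u)) R' (at z0 within \<Omega>))
     \<and> \<not> (\<exists>\<Psi>. virtual_state s (- s') \<Omega> z0 D A B \<Psi>))
   \<or> ((\<exists>\<Psi>. virtual_state s (- s') \<Omega> z0 D A B \<Psi>) \<and> \<not> LAP s (- s') \<Omega> z0 D (\<lambda>u. A u + B u))"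
proof (cases "inj_on T.S (L2w s)")
  case True
  have "LAP s (- s') \<Omega> z0 D (\<lambda>u. A u + B u)"
    using injective_imp_limit(2)[OF True] unfolding LAP_def by blast
  then show ?thesis
    using injective_imp_limit[OF True] lap_excludes_virtual_state by blast
next
  case False
  then obtain g where "g \<in> L2w s" "g \<noteq> 0" "T.S g = 0" unfolding T.inj_S_iff by blast
  from virtual_state_from_kernel[OF this] show ?thesis using lap_excludes_virtual_state by blast
qed

end

section \<open>Smooth functions and test functions\<close>

abbreviation vderiv :: "(real \<Rightarrow> complex) \<Rightarrow> real \<Rightarrow> complex" where
  "vderiv \<equiv> \<lambda>g y. vector_derivative g (at y)"

definition smooth :: "(real \<Rightarrow> complex) \<Rightarrow> bool" where
  "smooth f \<longleftrightarrow> (\<forall>n x. (vderiv ^^ n) f differentiable (at x))"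

text \<open>Smoothness is proved below by exhibiting a family of functions closed under differentiation.\<close>

lemma smooth_coinduct:
  assumes step: "\<And>g. g \<in> F \<Longrightarrow> \<exists>g'\<in>F. \<forall>x. (g has_vector_derivative g' x) (at x)" and f: "f \<in> F"
  shows "smooth f"
proof -
  have "(vderiv ^^ n) f \<in> F" for n
  proof (induction n)
    case (Suc n)
    then obtain g' where g': "g' \<in> F" "\<And>x. ((vderiv ^^ n) f has_vector_derivative g' x) (at x)"
      using step by blast
    then have "(vderiv ^^ Suc n) f = g'" by (auto simp: vector_derivative_at)
    with g' show ?case by simp
  qed (use f in simp)
  then show ?thesis
    unfolding smooth_def using step by (metis differentiableI_vector)
qed

lemma smooth_has_vderiv: "smooth f \<Longrightarrow> (f has_vector_derivative vderiv f x) (at x)"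
  unfolding smooth_def using vector_derivative_works[of f "at x"] by (metis funpow_0)

lemma smooth_vderiv: "smooth f \<Longrightarrow> smooth (vderiv f)"
  unfolding smooth_def by (metis comp_apply funpow_Suc_right)

lemma smooth_continuous: "smooth f \<Longrightarrow> continuous_on A f"
  using smooth_has_vderiv has_vector_derivative_continuous
  by (intro continuous_at_imp_continuous_on) blast

lemma smooth_measurable: "smooth f \<Longrightarrow> f \<in> borel_measurable borel"
  by (intro borel_measurable_continuous_onI smooth_continuous)

lemma smooth_exp: "smooth (\<lambda>x. k * exp (c * of_real x))"
proof (rule smooth_coinduct[where F = "{\<lambda>x. k * exp (c * of_real x) | k. True}"], safe)
  fix k
  have "((\<lambda>x. k * exp (c * of_real x)) has_vector_derivative (k * c) * exp (c * of_real x)) (at x)" for x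
    by (rule has_vector_derivative_real_field[where f = "\<lambda>x. k * exp (c * x)"])
       (auto intro!: derivative_eq_intros)
  then show "\<exists>g'\<in>{\<lambda>x. k * exp (c * of_real x) | k. True}. \<forall>x. ((\<lambda>x. k * exp (c * of_real x)) has_vector_derivative g' x) (at x)"
    by (intro bexI[of _ "\<lambda>x. (k * c) * exp (c * of_real x)"]) auto
qed auto

lemma smooth_const: "smooth (\<lambda>x. k)"
  using smooth_exp[of k 0] by simp

text \<open>A family containing all products of smooth functions and closed under the Leibniz rule.\<close>

inductive_set product_sums :: "(real \<Rightarrow> complex) set" where
  prod: "smooth f \<Longrightarrow> smooth g \<Longrightarrow> (\<lambda>x. f x * g x) \<in> product_sums"
| sum: "u \<in> product_sums \<Longrightarrow> v \<in> product_sums \<Longrightarrow> (\<lambda>x. u x + v x) \<in> product_sums"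

lemma product_sums_smooth: "u \<in> product_sums \<Longrightarrow> smooth u"
proof (erule smooth_coinduct[rotated])
  fix u assume "u \<in> product_sums"
  then show "\<exists>u'\<in>product_sums. \<forall>x. (u has_vector_derivative u' x) (at x)"
  proof induction
    case (prod f g)
    have "((\<lambda>x. f x * g x) has_vector_derivative f x * vderiv g x + vderiv f x * g x) (at x)" for x
      using has_vector_derivative_mult[OF smooth_has_vderiv[OF prod(1)] smooth_has_vderiv[OF prod(2)]] .
    then show ?case
      using prod smooth_vderiv
      by (intro bexI[of _ "\<lambda>x. f x * vderiv g x + vderiv f x * g x"] product_sums.intros) auto
  next
    case (sum u v)
    then obtain u' v' where "u' \<in> product_sums" "\<And>x. (u has_vector_derivative u' x) (at x)"
      "v' \<in> product_sums" "\<And>x. (v has_vector_derivative v' x) (at x)" by blast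
    then show ?case
      by (intro bexI[of _ "\<lambda>x. u' x + v' x"]) (auto intro: has_vector_derivative_add product_sums.sum)
  qed
qed

lemma smooth_mult: "smooth f \<Longrightarrow> smooth g \<Longrightarrow> smooth (\<lambda>x. f x * g x)"
  by (rule product_sums_smooth[OF product_sums.prod])

lemma smooth_add: "smooth f \<Longrightarrow> smooth g \<Longrightarrow> smooth (\<lambda>x. f x + g x)"
  using product_sums_smooth[OF product_sums.sum[OF product_sums.prod[OF _ smooth_const[of 1]] product_sums.prod[OF _ smooth_const[of 1]]], of f g]
  by simp

lemma smooth_affine:
  assumes "smooth f" shows "smooth (\<lambda>x. f (a * x + b))"
proof (rule smooth_coinduct[where F = "{\<lambda>x. k * f (a * x + b) | k f. smooth f}"], safe)
  fix k :: complex and f assume f: "smooth f"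
  have "((\<lambda>x. f (a * x + b)) has_vector_derivative a *\<^sub>R vderiv f (a * x + b)) (at x)" for x
  proof -
    have "((\<lambda>x. a * x + b) has_vector_derivative a) (at x)"
      by (auto intro!: derivative_eq_intros simp: has_vector_derivative_def)
    from vector_diff_chain_at[OF this smooth_has_vderiv[OF f]] show ?thesis by (simp add: o_def)
  qed
  then have "((\<lambda>x. k * f (a * x + b)) has_vector_derivative (k * of_real a) * vderiv f (a * x + b)) (at x)" for x
    using has_vector_derivative_mult_right[of _ _ "at x" k] by (fastforce simp: scaleR_conv_of_real mult.assoc)
  then show "\<exists>g'\<in>{\<lambda>x. k * f (a * x + b) | k f. smooth f}. \<forall>x. ((\<lambda>x. k * f (a * x + b)) has_vector_derivative g' x) (at x)"
    using smooth_vderiv[OF f]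
    by (intro bexI[of _ "\<lambda>x. (k * of_real a) * vderiv f (a * x + b)"] CollectI allI
        exI[of _ "k * of_real a"] exI[of _ "vderiv f"]) auto
next
  have "(\<lambda>x. f (a * x + b)) = (\<lambda>x. 1 * f (a * x + b))" by simp
  then show "\<exists>k g. (\<lambda>x. f (a * x + b)) = (\<lambda>x. k * g (a * x + b)) \<and> smooth g" using assms by blast
qed

section \<open>The flat function\<close>

text \<open>The functions \<open>p (1/x) exp (-1/x)\<close>, extended by zero: differentiation acts on the polynomial by
  \<open>p \<mapsto> (p - p') X\<^sup>2\<close>, so the family is closed under it.\<close>

definition flat :: "real poly \<Rightarrow> real \<Rightarrow> real" where
  "flat p x = (if x > 0 then poly p (1 / x) * exp (- (1 / x)) else 0)"

lemma flat_tendsto_0: "(flat p \<longlongrightarrow> 0) (at 0)"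
proof -
  have "((\<lambda>y. poly p y * exp (- y)) \<longlongrightarrow> 0) at_top"
  proof (induction p)
    case 0 then show ?case by simp
  next
    case (pCons a p)
    have mono: "((\<lambda>y::real. y ^ k * exp (- y)) \<longlongrightarrow> 0) at_top" for k
      using tendsto_power_div_exp_0[of k] by (simp add: exp_minus divide_inverse)
    have pol: "((\<lambda>y::real. y * (poly q y * exp (- y))) \<longlongrightarrow> 0) at_top" for q
    proof -
      have "y * (poly q y * exp (- y)) = (\<Sum>i\<le>degree q. coeff q i * (y ^ Suc i * exp (- y)))" for y :: real
        by (simp add: poly_altdef sum_distrib_left sum_distrib_right mult_ac)
      moreover have "((\<lambda>y::real. \<Sum>i\<le>degree q. coeff q i * (y ^ Suc i * exp (- y))) \<longlongrightarrow> (\<Sum>i\<le>degree q. coeff q i * 0)) at_top"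
        by (intro tendsto_sum tendsto_mult tendsto_const mono)
      ultimately show ?thesis by simp
    qed
    have "((\<lambda>y. a * (y ^ 0 * exp (- y)) + y * (poly p y * exp (- y))) \<longlongrightarrow> a * 0 + 0) at_top"
      by (intro tendsto_add tendsto_mult tendsto_const mono pol)
    then show ?case by (simp add: algebra_simps)
  qed
  then have right: "((\<lambda>x. poly p (1 / x) * exp (- (1 / x))) \<longlongrightarrow> 0) (at_right 0)"
    by (rule filterlim_compose) (use filterlim_inverse_at_top_right in \<open>simp add: inverse_eq_divide\<close>)
  have "(flat p \<longlongrightarrow> 0) (at_right 0)"
    using right by (rule Lim_transform_eventually) (auto simp: flat_def eventually_at_filter)
  moreover have "(flat p \<longlongrightarrow> 0) (at_left 0)"
    by (rule Lim_transform_eventually[OF tendsto_const]) (auto simp: flat_def eventually_at_filter)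
  ultimately show ?thesis by (simp add: filterlim_split_at)
qed

lemma flat_deriv: "(flat p has_real_derivative flat ((p - pderiv p) * [:0, 0, 1:]) x) (at x)"
proof (cases "x = 0")
  case True
  have "((\<lambda>h. (flat p (0 + h) - flat p 0) / h) \<longlongrightarrow> 0) (at 0)"
  proof (rule Lim_transform_eventually[OF flat_tendsto_0[of "p * [:0, 1:]"]])
    show "\<forall>\<^sub>F h in at 0. flat (p * [:0, 1:]) h = (flat p (0 + h) - flat p 0) / h"
      by (auto simp: flat_def eventually_at_filter)
  qed
  then show ?thesis using True by (simp add: DERIV_def flat_def)
next
  case False
  then consider "x < 0" | "x > 0" by linarith
  then show ?thesis
  proof cases
    case 1
    have "((\<lambda>_. 0) has_real_derivative 0) (at x)" by simp
    then have "(flat p has_real_derivative 0) (at x)"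
      by (rule has_field_derivative_transform_within_open[of _ _ _ "{..<0}"]) (use 1 in \<open>auto simp: flat_def\<close>)
    with 1 show ?thesis by (simp add: flat_def)
  next
    case 2
    have "((\<lambda>x. poly p (1 / x) * exp (- (1 / x))) has_real_derivative
        poly p (1 / x) * (exp (- (1 / x)) * (1 / x\<^sup>2)) + (poly (pderiv p) (1 / x) * (- 1 / x\<^sup>2)) * exp (- (1 / x))) (at x)"
      using 2 by (auto intro!: derivative_eq_intros DERIV_chain'[where g = "poly p"] poly_DERIV simp: power2_eq_square)
    then have "(flat p has_real_derivative
        poly p (1 / x) * (exp (- (1 / x)) * (1 / x\<^sup>2)) + (poly (pderiv p) (1 / x) * (- 1 / x\<^sup>2)) * exp (- (1 / x))) (at x)"
      by (rule has_field_derivative_transform_within_open[of _ _ _ "{0<..}"]) (use 2 in \<open>auto simp: flat_def\<close>)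
    moreover have "flat ((p - pderiv p) * [:0, 0, 1:]) x =
        poly p (1 / x) * (exp (- (1 / x)) * (1 / x\<^sup>2)) + (poly (pderiv p) (1 / x) * (- 1 / x\<^sup>2)) * exp (- (1 / x))"
      using 2 by (simp add: flat_def power2_eq_square algebra_simps)
    ultimately show ?thesis by simp
  qed
qed

lemma smooth_flat: "smooth (\<lambda>x. of_real (flat p x))"
proof (rule smooth_coinduct[where F = "{\<lambda>x. of_real (flat p x) | p. True}"], safe)
  fix p
  have "((\<lambda>x. complex_of_real (flat p x)) has_vector_derivative of_real (flat ((p - pderiv p) * [:0, 0, 1:]) x)) (at x)" for x
    by (rule has_vector_derivative_of_real[OF flat_deriv])
  then show "\<exists>g'\<in>{\<lambda>x. of_real (flat p x) | p. True}. \<forall>x. ((\<lambda>x. complex_of_real (flat p x)) has_vector_derivative g' x) (at x)"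
    by (intro bexI[of _ "\<lambda>x. of_real (flat ((p - pderiv p) * [:0, 0, 1:]) x)"]) auto
qed auto

section \<open>Test functions\<close>

lemma test_function_iff:
  "test_function \<phi> \<longleftrightarrow> smooth \<phi> \<and> (\<exists>r. \<forall>x. r < \<bar>x\<bar> \<longrightarrow> \<phi> x = 0)"
proof -
  have "compact (closure {x. \<phi> x \<noteq> 0}) \<longleftrightarrow> (\<exists>r. \<forall>x. r < \<bar>x\<bar> \<longrightarrow> \<phi> x = 0)"
  proof -
    have "compact (closure {x. \<phi> x \<noteq> 0}) \<longleftrightarrow> bounded {x. \<phi> x \<noteq> 0}"
      by (meson bounded_closure bounded_subset closed_closure closure_subset compact_eq_bounded_closed)
    also have "\<dots> \<longleftrightarrow> (\<exists>r. \<forall>x. r < \<bar>x\<bar> \<longrightarrow> \<phi> x = 0)"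
      unfolding bounded_iff by (auto simp: not_less[symmetric])
    finally show ?thesis .
  qed
  then show ?thesis unfolding test_function_def smooth_def by blast
qed

lemma vderiv_eq_0_outside:
  assumes "\<And>x. r < \<bar>x\<bar> \<Longrightarrow> \<phi> x = 0" "r < \<bar>x\<bar>" shows "vderiv \<phi> x = 0"
proof -
  have "((\<lambda>_. 0) has_vector_derivative 0) (at x)" by simp
  moreover have "open {x. r < \<bar>x\<bar>}" by (intro open_Collect_less continuous_intros)
  ultimately have "(\<phi> has_vector_derivative 0) (at x)"
    by (rule has_vector_derivative_transform_within_open[of _ _ _ "{x. r < \<bar>x\<bar>}"]) (use assms in auto)
  then show ?thesis by (rule vector_derivative_at)
qed

lemma test_function_vderiv: "test_function \<phi> \<Longrightarrow> test_function (vderiv \<phi>)"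
  unfolding test_function_iff using smooth_vderiv vderiv_eq_0_outside by metis

lemma test_function_vderiv_n: "test_function \<phi> \<Longrightarrow> test_function ((vderiv ^^ n) \<phi>)"
  by (induction n) (auto dest: test_function_vderiv)

lemma test_function_mult: "test_function \<phi> \<Longrightarrow> smooth f \<Longrightarrow> test_function (\<lambda>x. f x * \<phi> x)"
  unfolding test_function_iff using smooth_mult[of f \<phi>] by auto

lemma test_function_bounded:
  assumes "test_function \<phi>" obtains M where "M > 0" "\<And>x. cmod (\<phi> x) \<le> M"
proof -
  obtain r where r: "\<And>x. r < \<bar>x\<bar> \<Longrightarrow> \<phi> x = 0" and s: "smooth \<phi>" using assms by (auto simp: test_function_iff)
  have "compact (\<phi> ` {-r..r})" by (intro compact_continuous_image smooth_continuous s compact_Icc)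
  then obtain M where M: "M > 0" "\<And>x. x \<in> {-r..r} \<Longrightarrow> cmod (\<phi> x) \<le> M"
    using compact_imp_bounded bounded_pos by (metis imageI)
  have "cmod (\<phi> x) \<le> M" for x using M r[of x] by (cases "r < \<bar>x\<bar>") (auto simp: not_less abs_le_iff)
  then show ?thesis using that M by blast
qed

text \<open>A test function supported in the interval from \<open>a\<close> to \<open>b\<close> that tends to its indicator as \<open>n\<close>
  grows.\<close>

definition bump :: "real \<Rightarrow> real \<Rightarrow> nat \<Rightarrow> real \<Rightarrow> real" where
  "bump a b n x = flat 1 (real n * (x - a)) * flat 1 (real n * (b - x))"

lemma flat_1_bounds: "0 \<le> flat 1 x" "flat 1 x \<le> 1"
  by (auto simp: flat_def)

lemma bump_bounds: "0 \<le> bump a b n x" "bump a b n x \<le> 1" "x \<notin> {a<..<b} \<Longrightarrow> bump a b n x = 0"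
proof -
  show "0 \<le> bump a b n x" unfolding bump_def by (intro mult_nonneg_nonneg flat_1_bounds)
  show "bump a b n x \<le> 1" unfolding bump_def by (intro mult_le_one flat_1_bounds)
  show "x \<notin> {a<..<b} \<Longrightarrow> bump a b n x = 0" unfolding bump_def flat_def
    by (auto simp: zero_less_mult_iff)
qed

lemma test_function_bump: "test_function (\<lambda>x. of_real (bump a b n x))"
proof -
  have "smooth (\<lambda>x. of_real (flat 1 (real n * x + - real n * a)) * of_real (flat 1 (- real n * x + real n * b)))"
    by (intro smooth_mult smooth_affine[of "\<lambda>x. of_real (flat 1 x)"] smooth_flat)
  moreover have "bump a b n x = 0" if "max \<bar>a\<bar> \<bar>b\<bar> < \<bar>x\<bar>" for x
    using that by (intro bump_bounds(3)) auto
  ultimately show ?thesis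
    unfolding test_function_iff
    by (intro conjI exI[of _ "max \<bar>a\<bar> \<bar>b\<bar>"]) (auto simp: bump_def algebra_simps)
qed

lemma bump_tendsto: "(\<lambda>n. bump a b n x) \<longlonglongrightarrow> indicat_real {a<..<b} x"
proof (cases "x \<in> {a<..<b}")
  case True
  have *: "(\<lambda>n. flat 1 (real n * t)) \<longlonglongrightarrow> 1" if "t > 0" for t
  proof -
    have "(\<lambda>n. exp (- (1 / t * (1 / real n)))) \<longlonglongrightarrow> exp (- (1 / t * 0))"
      by (intro tendsto_intros lim_1_over_n)
    moreover have "\<forall>\<^sub>F n in sequentially. exp (- (1 / t * (1 / real n))) = flat 1 (real n * t)"
      using eventually_gt_at_top[of 0] by eventually_elim (use that in \<open>simp add: flat_def mult.commute\<close>)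
    ultimately show ?thesis by (auto intro: Lim_transform_eventually)
  qed
  have "(\<lambda>n. bump a b n x) \<longlonglongrightarrow> 1 * 1"
    unfolding bump_def by (intro tendsto_mult *) (use True in auto)
  then show ?thesis using True by simp
next
  case False
  then show ?thesis by (simp add: bump_bounds(3))
qed

section \<open>The fundamental lemma of the calculus of variations\<close>

definition loc_integrable :: "(real \<Rightarrow> complex) \<Rightarrow> bool" where
  "loc_integrable f \<longleftrightarrow> f \<in> borel_measurable borel \<and> (\<forall>r. integrable lborel (\<lambda>x. indicat_real {-r..r} x *\<^sub>R f x))"

lemma loc_integrable_mult:
  assumes f: "loc_integrable f" and g: "g \<in> borel_measurable borel" "\<And>x. cmod (g x) \<le> M" "\<And>x. r < \<bar>x\<bar> \<Longrightarrow> g x = 0"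
  shows "integrable lborel (\<lambda>x. f x * g x)"
proof (rule Bochner_Integration.integrable_bound)
  show "integrable lborel (\<lambda>x. M *\<^sub>R (indicat_real {-r..r} x *\<^sub>R f x))"
    using f unfolding loc_integrable_def by (intro integrable_scaleR_right) auto
  show "(\<lambda>x. f x * g x) \<in> borel_measurable lborel"
    using f g(1) unfolding loc_integrable_def by (auto intro: borel_measurable_times)
  have "0 \<le> M" using order_trans[OF norm_ge_zero g(2)[of 0]] .
  then show "AE x in lborel. norm (f x * g x) \<le> norm (M *\<^sub>R (indicat_real {-r..r} x *\<^sub>R f x))"
    using g(2,3)
    by (intro AE_I2) (auto simp: norm_mult indicator_def abs_le_iff mult.commute[of M] intro!: mult_left_mono)
qed

lemma loc_integrable_mult_test:
  assumes "loc_integrable f" "test_function \<phi>"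
  shows "integrable lborel (\<lambda>x. f x * \<phi> x)"
proof -
  obtain M where "\<And>x. cmod (\<phi> x) \<le> M" using test_function_bounded[OF assms(2)] by blast
  moreover obtain r where "\<And>x. r < \<bar>x\<bar> \<Longrightarrow> \<phi> x = 0" "smooth \<phi>" using assms(2) by (auto simp: test_function_iff)
  ultimately show ?thesis using loc_integrable_mult[OF assms(1)] smooth_measurable by blast
qed

lemma loc_integrable_diff:
  "loc_integrable f \<Longrightarrow> loc_integrable g \<Longrightarrow> loc_integrable (\<lambda>x. f x - g x)"
  unfolding loc_integrable_def by (auto simp: scaleR_diff_right)

lemma loc_integrable_const: "loc_integrable (\<lambda>x. c)"
proof -
  have "integrable lborel (\<lambda>x. indicat_real {-r..r} x *\<^sub>R c)" for r :: real
    by (intro integrable_scaleR_left) (simp add: integrable_indicator_iff emeasure_lborel_Icc_eq)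
  then show ?thesis unfolding loc_integrable_def by simp
qed

text \<open>Bump functions approximate indicators, so the integral over every bounded interval vanishes; on
  a bounded window the sets of vanishing integral form a Dynkin system, hence contain all Borel
  sets.\<close>

lemma fundamental_lemma:
  assumes f: "loc_integrable f" and 0: "\<And>\<phi>. test_function \<phi> \<Longrightarrow> (LINT x|lborel. f x * \<phi> x) = 0"
  shows "AE x in lborel. f x = 0"
proof -
  have [measurable]: "f \<in> borel_measurable borel" using f by (simp add: loc_integrable_def)
  have bump_meas [measurable]: "bump a b n \<in> borel_measurable borel" for a b n
    using measurable_compose[OF smooth_measurable, of "\<lambda>x. of_real (bump a b n x)" Re borel]
      test_function_bump[of a b n] by (simp add: test_function_iff)
  have interval: "(LINT x|lborel. indicat_real {a<..<b} x *\<^sub>R f x) = 0" for a b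
  proof -
    define r where "r = max \<bar>a\<bar> \<bar>b\<bar>"
    have "(\<lambda>n. LINT x|lborel. bump a b n x *\<^sub>R f x) \<longlonglongrightarrow> (LINT x|lborel. indicat_real {a<..<b} x *\<^sub>R f x)"
    proof (rule integral_dominated_convergence)
      show "integrable lborel (\<lambda>x. norm (indicat_real {-r..r} x *\<^sub>R f x))"
        using f by (intro integrable_norm) (simp add: loc_integrable_def)
      show "AE x in lborel. (\<lambda>n. bump a b n x *\<^sub>R f x) \<longlonglongrightarrow> indicat_real {a<..<b} x *\<^sub>R f x"
        by (intro AE_I2 tendsto_scaleR bump_tendsto tendsto_const)
      show "AE x in lborel. norm (bump a b n x *\<^sub>R f x) \<le> norm (indicat_real {-r..r} x *\<^sub>R f x)" for n
      proof (rule AE_I2)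
        fix x
        show "norm (bump a b n x *\<^sub>R f x) \<le> norm (indicat_real {-r..r} x *\<^sub>R f x)"
        proof (cases "x \<in> {a<..<b}")
          case True
          then have "x \<in> {-r..r}" by (auto simp: r_def)
          then show ?thesis using bump_bounds(1,2)[of a b n x] by (simp add: mult_left_le_one_le)
        qed (simp add: bump_bounds(3))
      qed
    qed measurable
    moreover have "(LINT x|lborel. bump a b n x *\<^sub>R f x) = 0" for n
      using 0[OF test_function_bump[of a b n]] by (simp add: scaleR_conv_of_real mult.commute)
    ultimately show ?thesis by (simp add: LIMSEQ_const_iff)
  qed
  have "AE x in lborel. indicat_real {-real n<..<real n} x *\<^sub>R f x = 0" for n :: nat
  proof (rule sigma_finite_measure.density_zero[OF lborel.sigma_finite_measure_axioms])
    let ?r = "real n"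
    let ?g = "\<lambda>x. indicat_real {-?r<..<?r} x *\<^sub>R f x"
    show int: "integrable lborel ?g"
    proof (rule Bochner_Integration.integrable_bound)
      show "integrable lborel (\<lambda>x. indicat_real {-?r..?r} x *\<^sub>R f x)" using f by (simp add: loc_integrable_def)
    qed (auto simp: indicator_def)
    fix A :: "real set" assume "A \<in> sets lborel"
    then have "A \<in> sigma_sets UNIV (range (\<lambda>a. {a<..}))"
      using borel_Ioi[where 'a = real] by (metis sets_lborel sets_measure_of subset_UNIV Pow_UNIV)
    then show "set_lebesgue_integral lborel A ?g = 0"
    proof (rule sigma_sets_induct_disjoint[rotated 2])
      show "Int_stable (range (\<lambda>a::real. {a<..}))" by (auto simp: Int_stable_def lessThan_Int_lessThan)
      show "range (\<lambda>a::real. {a<..}) \<subseteq> Pow UNIV" by simp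
      fix B assume "B \<in> range (\<lambda>a::real. {a<..})"
      then obtain a where a: "B = {a<..}" by auto
      have *: "indicat_real B x *\<^sub>R ?g x = indicat_real {max a (-?r)<..<?r} x *\<^sub>R f x" for x
        by (auto simp: a indicator_def)
      show "set_lebesgue_integral lborel B ?g = 0" unfolding set_lebesgue_integral_def * by (rule interval)
    next
      show "set_lebesgue_integral lborel {} ?g = 0" by (simp add: set_lebesgue_integral_def)
    next
      fix B assume B: "B \<in> sigma_sets UNIV (range (\<lambda>a::real. {a<..}))" "set_lebesgue_integral lborel B ?g = 0"
      then have [measurable]: "B \<in> sets borel"
        using borel_Ioi[where 'a = real] by (metis sets_measure_of subset_UNIV Pow_UNIV)
      have "set_lebesgue_integral lborel (UNIV - B) ?g =
          (LINT x|lborel. ?g x - indicat_real B x *\<^sub>R ?g x)"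
        unfolding set_lebesgue_integral_def by (rule Bochner_Integration.integral_cong) (auto simp: indicator_def)
      also have "\<dots> = (LINT x|lborel. ?g x) - (LINT x|lborel. indicat_real B x *\<^sub>R ?g x)"
        by (rule Bochner_Integration.integral_diff[OF int integrable_mult_indicator[OF _ int]]) simp
      also have "\<dots> = 0 - 0"
        using B(2) interval unfolding set_lebesgue_integral_def by simp
      finally show "set_lebesgue_integral lborel (UNIV - B) ?g = 0" by simp
    next
      fix B :: "nat \<Rightarrow> real set"
      assume dis: "disjoint_family B" and B: "range B \<subseteq> sigma_sets UNIV (range (\<lambda>a::real. {a<..}))"
        and B0: "\<And>i. set_lebesgue_integral lborel (B i) ?g = 0"
      have sets: "B i \<in> sets lborel" for i
        using borel_Ioi[where 'a = real] B by (metis range_subsetD sets_lborel sets_measure_of subset_UNIV Pow_UNIV)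
      have "set_lebesgue_integral lborel (\<Union>i. B i) ?g = (\<Sum>i. set_lebesgue_integral lborel (B i) ?g)"
      proof (rule lebesgue_integral_countable_add)
        show "set_integrable lborel (\<Union>i. B i) ?g"
          unfolding set_integrable_def
          by (rule integrable_mult_indicator[OF _ int]) (use sets in auto)
      qed (use sets dis in \<open>auto simp: disjoint_family_on_def\<close>)
      then show "set_lebesgue_integral lborel (\<Union>i. B i) ?g = 0" using B0 by simp
    qed
  qed
  then have "AE x in lborel. \<forall>n::nat. indicat_real {-real n<..<real n} x *\<^sub>R f x = 0"
    unfolding AE_all_countable ..
  then show ?thesis
  proof eventually_elim
    case (elim x)
    obtain n :: nat where "\<bar>x\<bar> < real n" using reals_Archimedean2 by blast
    then show ?case using elim[rule_format, of n] by (auto simp: indicator_def abs_less_iff)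
  qed
qed

text \<open>Subtracting a multiple of one fixed test function \<open>\<psi>\<close> of nonzero integral makes the integral of any
  test function vanish, and a test function of vanishing integral is a derivative.  The constant
  is fixed by testing with \<open>\<psi>\<close>.\<close>

lemma du_Bois_Reymond:
  assumes g: "loc_integrable g" and 0: "\<And>\<omega>. test_function \<omega> \<Longrightarrow> (LINT x|lborel. g x * vderiv \<omega> x) = 0"
  shows "\<exists>c. AE x in lborel. g x = c"
proof -
  have "\<exists>\<psi>. test_function \<psi> \<and> (LINT x|lborel. \<psi> x) \<noteq> 0"
  proof (rule ccontr)
    assume "\<not> ?thesis"
    then have "AE x in lborel :: real measure. (1::complex) = 0"
      using fundamental_lemma[OF loc_integrable_const[of 1]] by simp
    then have "UNIV \<in> null_sets (lborel :: real measure)"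
      by (auto simp: eventually_ae_filter top.extremum_unique)
    then show False using emeasure_lborel_UNIV[where 'a = real] by (simp add: null_sets_def)
  qed
  then obtain \<psi> where \<psi>: "test_function \<psi>" "(LINT x|lborel. \<psi> x) \<noteq> 0" by blast
  have int: "integrable lborel \<phi>" "integrable lborel (\<lambda>x. g x * \<phi> x)" if "test_function \<phi>" for \<phi>
    using loc_integrable_mult_test[OF loc_integrable_const[of 1] that] loc_integrable_mult_test[OF g that] by simp_all
  define c where "c = (LINT x|lborel. g x * \<psi> x) / (LINT x|lborel. \<psi> x)"
  have "AE x in lborel. g x - c = 0"
  proof (rule fundamental_lemma[OF loc_integrable_diff[OF g loc_integrable_const]])
    fix \<phi> assume \<phi>: "test_function \<phi>"
    define k where "k = (LINT x|lborel. \<phi> x) / (LINT x|lborel. \<psi> x)"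
    define \<eta> where "\<eta> x = \<phi> x - k * \<psi> x" for x
    obtain r1 where r1: "\<And>x. r1 < \<bar>x\<bar> \<Longrightarrow> \<phi> x = 0" and s1: "smooth \<phi>" using \<phi> by (auto simp: test_function_iff)
    obtain r2 where r2: "\<And>x. r2 < \<bar>x\<bar> \<Longrightarrow> \<psi> x = 0" and s2: "smooth \<psi>" using \<psi> by (auto simp: test_function_iff)
    define r where "r = max (max r1 r2) 0"
    have r: "\<eta> x = 0" if "r < \<bar>x\<bar>" for x using r1[of x] r2[of x] that by (auto simp: \<eta>_def r_def)
    have r_nonneg: "0 \<le> r" by (simp add: r_def)
    have \<eta>_smooth: "smooth \<eta>"
      unfolding \<eta>_def using smooth_add[OF s1 smooth_mult[OF smooth_const[of "-k"] s2]] by simp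
    have \<eta>_int: "(LINT x|lborel. \<eta> x) = 0"
      using \<psi>(2) int(1)[OF \<phi>] int(1)[OF \<psi>(1)] by (simp add: \<eta>_def k_def)
    \<comment> \<open>A test function with vanishing integral is the derivative of a test function.\<close>
    have "continuous_on UNIV \<eta>" by (rule smooth_continuous[OF \<eta>_smooth])
    then obtain F where F: "\<And>x. (F has_vector_derivative \<eta> x) (at x)"
      using einterval_antiderivative[of "-\<infinity>" "\<infinity>" \<eta>] by (auto simp: continuous_on_eq_continuous_at)
    define \<omega> where "\<omega> x = F x - F (- (r + 1))" for x
    have \<omega>_deriv: "(\<omega> has_vector_derivative \<eta> x) (at x)" for x
      unfolding \<omega>_def using has_vector_derivative_diff[OF F has_vector_derivative_const] by simp
    have FTC: "(LINT x|lborel. indicator {a..b} x *\<^sub>R \<eta> x) = F b - F a" if "a \<le> b" for a b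
      by (rule integral_FTC_Icc[OF that]) (auto intro: has_vector_derivative_at_within F smooth_continuous \<eta>_smooth)
    have left: "F b = F a" if "a \<le> b" "b < - r" for a b
    proof -
      have *: "indicator {a..b} x *\<^sub>R \<eta> x = 0" for x using r[of x] that r_nonneg by (auto simp: indicator_def)
      show ?thesis using FTC[OF that(1)] unfolding * by simp
    qed
    have right: "F b = F (- (r + 1))" if "r < b" for b
    proof -
      have *: "indicator {- (r + 1)..b} x *\<^sub>R \<eta> x = \<eta> x" for x
        using r[of x] that by (cases "r < \<bar>x\<bar>") (auto simp: indicator_def)
      show ?thesis using FTC[of "- (r + 1)" b] that \<eta>_int r_nonneg unfolding * by simp
    qed
    have \<omega>0: "\<omega> x = 0" if "r + 1 < \<bar>x\<bar>" for x
      using that left[of x "- (r + 1)"] right[of x] by (cases "x < 0") (auto simp: \<omega>_def)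
    have "smooth \<omega>"
    proof (rule smooth_coinduct[where F = "insert \<omega> {f. smooth f}"])
      fix h assume "h \<in> insert \<omega> {f. smooth f}"
      then show "\<exists>h'\<in>insert \<omega> {f. smooth f}. \<forall>x. (h has_vector_derivative h' x) (at x)"
      proof
        assume "h = \<omega>"
        then show ?thesis using \<omega>_deriv \<eta>_smooth by (intro bexI[of _ \<eta>]) auto
      next
        assume "h \<in> {f. smooth f}"
        then show ?thesis using smooth_has_vderiv smooth_vderiv by (intro bexI[of _ "vderiv h"]) auto
      qed
    qed simp
    then have "test_function \<omega>" unfolding test_function_iff using \<omega>0 by blast
    moreover have "vderiv \<omega> = \<eta>" using \<omega>_deriv by (auto simp: vector_derivative_at)
    ultimately have "(LINT x|lborel. g x * \<eta> x) = 0" using 0 by metis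
    moreover have "(LINT x|lborel. g x * \<eta> x) = (LINT x|lborel. g x * \<phi> x - k * (g x * \<psi> x))"
      by (rule Bochner_Integration.integral_cong) (auto simp: \<eta>_def algebra_simps)
    then have "(LINT x|lborel. g x * \<eta> x) = (LINT x|lborel. g x * \<phi> x) - k * (LINT x|lborel. g x * \<psi> x)"
      using int[OF \<phi>] int[OF \<psi>(1)] by simp
    moreover have "(LINT x|lborel. (g x - c) * \<phi> x) = (LINT x|lborel. g x * \<phi> x) - c * (LINT x|lborel. \<phi> x)"
      using int[OF \<phi>] by (simp add: left_diff_distrib)
    ultimately show "(LINT x|lborel. (g x - c) * \<phi> x) = 0"
      using \<psi>(2) by (simp add: k_def c_def field_simps)
  qed
  then show ?thesis by auto
qed

section \<open>Weak derivatives\<close>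

lemma compact_support_L2w:
  assumes g: "g \<in> borel_measurable borel" "\<And>x. cmod (g x) \<le> M" "\<And>x. r < \<bar>x\<bar> \<Longrightarrow> g x = 0"
  shows "abs_aefun g \<in> L2w t"
  unfolding abs_L2w_iff[OF g(1)]
proof (rule Bochner_Integration.integrable_bound)
  let ?C = "(jbracket r powr \<bar>t\<bar> * M)\<^sup>2"
  show "integrable lborel (\<lambda>x. ?C * indicat_real {-r..r} x)"
    by (intro integrable_mult_right) (simp add: integrable_indicator_iff emeasure_lborel_Icc_eq)
  show "(\<lambda>x. (jbracket x powr t * cmod (g x))\<^sup>2) \<in> borel_measurable lborel"
    using g(1) by measurable
  have M: "0 \<le> M" using order_trans[OF norm_ge_zero g(2)[of 0]] .
  have "(jbracket x powr t * cmod (g x))\<^sup>2 \<le> ?C" if "x \<in> {-r..r}" for x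
  proof (intro power_mono mult_mono g(2))
    have "x\<^sup>2 \<le> r\<^sup>2" using that by (intro abs_le_square_iff[THEN iffD1]) auto
    then have "jbracket x \<le> jbracket r" by (simp add: jbracket_def)
    then have "jbracket x powr \<bar>t\<bar> \<le> jbracket r powr \<bar>t\<bar>"
      by (intro powr_mono2) (auto intro: less_imp_le)
    moreover have "jbracket x powr t \<le> jbracket x powr \<bar>t\<bar>" by (rule jbracket_powr_mono) simp
    ultimately show "jbracket x powr t \<le> jbracket r powr \<bar>t\<bar>" by linarith
  qed auto
  then show "AE x in lborel. norm ((jbracket x powr t * cmod (g x))\<^sup>2) \<le> norm (?C * indicat_real {-r..r} x)"
    using g(3) by (intro AE_I2) (auto simp: indicator_def abs_le_iff)
qed

lemma test_function_L2w:
  assumes "test_function \<phi>" shows "abs_aefun \<phi> \<in> L2w t" "\<phi> \<in> borel_measurable borel"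
proof -
  show "\<phi> \<in> borel_measurable borel" using assms smooth_measurable by (auto simp: test_function_iff)
  then show "abs_aefun \<phi> \<in> L2w t"
    using compact_support_L2w test_function_bounded[OF assms] assms test_function_iff by metis
qed

definition test_pairing :: "(real \<Rightarrow> complex) \<Rightarrow> aefun \<Rightarrow> complex" where
  "test_pairing \<phi> u = (LINT x|lborel. rep_aefun u x * \<phi> x)"

lemma pairing_abs:
  assumes "g \<in> borel_measurable borel"
  shows "(LINT x|lborel. rep_aefun u x * rep_aefun (abs_aefun g) x) = (LINT x|lborel. rep_aefun u x * g x)"
proof (rule integral_cong_AE)
  show "AE x in lborel. rep_aefun u x * rep_aefun (abs_aefun g) x = rep_aefun u x * g x"
    using rep_abs_aefun[OF assms] by eventually_elim simp
qed (use assms in measurable)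

lemma test_pairing_dual:
  assumes "test_function \<phi>" shows "test_pairing \<phi> \<in> dual_L2w s"
proof -
  have "test_pairing \<phi> = (\<lambda>u. LINT x|lborel. rep_aefun u x * rep_aefun (abs_aefun \<phi>) x)"
    unfolding test_pairing_def pairing_abs[OF test_function_L2w(2)[OF assms]] ..
  then show ?thesis using pairing_in_dual[OF test_function_L2w(1)[OF assms]] by simp
qed

lemma L2w_loc_integrable:
  assumes u: "u \<in> L2w s" shows "loc_integrable (rep_aefun u)"
  unfolding loc_integrable_def
proof (intro conjI allI)
  fix r :: real
  have ind_meas: "(\<lambda>x. complex_of_real (indicat_real {-r..r} x)) \<in> borel_measurable borel" by simp
  have g: "abs_aefun (\<lambda>x. of_real (indicat_real {-r..r} x)) \<in> L2w (- s)"
    by (rule compact_support_L2w[where M = 1 and r = r]) (auto simp: indicator_def)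
  have "integrable lborel (\<lambda>x. rep_aefun u x * rep_aefun (abs_aefun (\<lambda>x. of_real (indicat_real {-r..r} x))) x)"
    by (rule L2w_pairing(1)[OF u g])
  then show "integrable lborel (\<lambda>x. indicat_real {-r..r} x *\<^sub>R rep_aefun u x)"
  proof (rule integrable_cong_AE_imp)
    show "AE x in lborel. rep_aefun u x * rep_aefun (abs_aefun (\<lambda>x. complex_of_real (indicat_real {-r..r} x))) x
        = indicat_real {-r..r} x *\<^sub>R rep_aefun u x"
      using rep_abs_aefun[OF ind_meas] by eventually_elim (simp add: scaleR_conv_of_real)
  qed measurable
qed simp

lemma test_pairing_eq_0:
  assumes u: "u \<in> L2w s" and 0: "\<And>\<phi>. test_function \<phi> \<Longrightarrow> test_pairing \<phi> u = 0"
  shows "u = 0"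
proof (rule aefun_eqI)
  have "AE x in lborel. rep_aefun u x = 0"
    using 0 by (intro fundamental_lemma[OF L2w_loc_integrable[OF u]]) (simp add: test_pairing_def)
  with rep_0 show "AE x in lborel. rep_aefun u x = rep_aefun 0 x" by eventually_elim simp
qed

lemma dual_L2w_tendsto:
  assumes l: "l \<in> dual_L2w b" and u: "\<And>n. u n \<in> L2w b" "f \<in> L2w b" "L2w.conv b u f"
  shows "(\<lambda>n. l (u n)) \<longlonglongrightarrow> l f"
proof -
  obtain C where C: "\<And>u. u \<in> L2w b \<Longrightarrow> cmod (l u) \<le> C * L2w_norm b u"
    using dual_L2w_bound_pos[OF l] by blast
  show ?thesis
  proof (rule LIM_zero_cancel, rule Lim_null_comparison)
  show "(\<lambda>n. C * L2w_norm b (u n - f)) \<longlonglongrightarrow> 0" by (rule tendsto_mult_right_zero[OF u(3)])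
  show "\<forall>\<^sub>F n in sequentially. norm (l (u n) - l f) \<le> C * L2w_norm b (u n - f)"
    unfolding dual_L2w_diff[OF l u(1,2), symmetric] by (intro always_eventually allI C L2w_diff u(1,2))
  qed
qed

lemma weak_deriv_iff:
  "weak_deriv n u v \<longleftrightarrow> (\<forall>\<phi>. test_function \<phi> \<longrightarrow> test_pairing ((vderiv ^^ n) \<phi>) u = (-1) ^ n * test_pairing \<phi> v)"
  by (simp add: weak_deriv.rep_eq test_pairing_def)

lemma weak_deriv_unique:
  assumes "weak_deriv n u v" "weak_deriv n u w" "v \<in> L2w s" "w \<in> L2w s"
  shows "v = w"
proof -
  have "test_pairing \<phi> v = test_pairing \<phi> w" if "test_function \<phi>" for \<phi>
    using assms(1,2) that unfolding weak_deriv_iff by (metis mult_cancel_left power_eq_0_iff neg_equal_0_iff_equal zero_neq_one)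
  then have "v - w = 0"
    using dual_L2w_diff[OF test_pairing_dual assms(3,4)] by (intro test_pairing_eq_0[OF L2w_diff[OF assms(3,4)]]) simp
  then show ?thesis by simp
qed

lemma weak_deriv_0: "weak_deriv 0 u u"
  by (simp add: weak_deriv_iff)

lemma weak_deriv_add:
  assumes "weak_deriv n u v" "weak_deriv n u' v'" "u \<in> L2w s" "u' \<in> L2w s" "v \<in> L2w s" "v' \<in> L2w s"
  shows "weak_deriv n (u + u') (v + v')"
  using assms dual_L2wD(1)[OF test_pairing_dual] test_function_vderiv_n
  unfolding weak_deriv_iff by (simp add: distrib_left)

lemma weak_deriv_scale:
  assumes "weak_deriv n u v" "u \<in> L2w s" "v \<in> L2w s"
  shows "weak_deriv n (c *\<^sub>c u) (c *\<^sub>c v)"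
  using assms dual_L2wD(2)[OF test_pairing_dual] test_function_vderiv_n
  unfolding weak_deriv_iff by (simp add: mult.left_commute)

lemma weak_deriv_comp:
  assumes "weak_deriv n u v" "weak_deriv m v w"
  shows "weak_deriv (n + m) u w"
  using assms test_function_vderiv_n unfolding weak_deriv_iff by (simp add: funpow_add power_add)

lemma weak_deriv_cancel:
  assumes "weak_deriv n u v" "weak_deriv (n + m) u w"
  shows "weak_deriv m v w"
  unfolding weak_deriv_iff
proof (intro allI impI)
  fix \<phi> assume \<phi>: "test_function \<phi>"
  have "(-1) ^ n * test_pairing ((vderiv ^^ m) \<phi>) v = test_pairing ((vderiv ^^ n) ((vderiv ^^ m) \<phi>)) u"
    using assms(1) test_function_vderiv_n[OF \<phi>] by (simp add: weak_deriv_iff)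
  also have "\<dots> = (-1) ^ (n + m) * test_pairing \<phi> w"
    using assms(2) \<phi> by (simp add: weak_deriv_iff funpow_add)
  finally show "test_pairing ((vderiv ^^ m) \<phi>) v = (-1) ^ m * test_pairing \<phi> w"
    by (simp add: power_add mult.assoc)
qed

lemma weak_deriv_limit:
  assumes "\<And>k. weak_deriv n (u k) (v k)" "\<And>k. u k \<in> L2w s" "\<And>k. v k \<in> L2w s"
    "f \<in> L2w s" "g \<in> L2w s" "L2w.conv s u f" "L2w.conv s v g"
  shows "weak_deriv n f g"
  unfolding weak_deriv_iff
proof (intro allI impI)
  fix \<phi> assume \<phi>: "test_function \<phi>"
  have "(\<lambda>k. test_pairing ((vderiv ^^ n) \<phi>) (u k)) \<longlonglongrightarrow> test_pairing ((vderiv ^^ n) \<phi>) f"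
    using assms by (intro dual_L2w_tendsto[OF test_pairing_dual[OF test_function_vderiv_n[OF \<phi>]]])
  moreover have "(\<lambda>k. (-1) ^ n * test_pairing \<phi> (v k)) \<longlonglongrightarrow> (-1) ^ n * test_pairing \<phi> g"
    using assms by (intro tendsto_mult tendsto_const dual_L2w_tendsto[OF test_pairing_dual[OF \<phi>]])
  moreover have "test_pairing ((vderiv ^^ n) \<phi>) (u k) = (-1) ^ n * test_pairing \<phi> (v k)" for k
    using assms(1) \<phi> by (simp add: weak_deriv_iff)
  ultimately show "test_pairing ((vderiv ^^ n) \<phi>) f = (-1) ^ n * test_pairing \<phi> g"
    by (simp only: LIMSEQ_unique)
qed

text \<open>On a half line the integrand is at least \<open>1\<close>.\<close>

lemma exponential_not_square_integrable:
  fixes a :: real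
  assumes "a \<noteq> 0" "integrable lborel (\<lambda>x. (exp (a * x))\<^sup>2)"
  shows False
proof -
  define S where "S = (if a > 0 then {0::real..} else {..0})"
  have le: "indicat_real S x \<le> (exp (a * x))\<^sup>2" for x
    using assms(1) by (auto simp: S_def indicator_def mult_nonpos_nonpos)
  have [measurable]: "S \<in> sets borel" by (simp add: S_def)
  have "integrable lborel (indicat_real S)"
    by (rule Bochner_Integration.integrable_bound[OF assms(2)]) (use le in \<open>auto simp: abs_of_nonneg\<close>)
  then have fin: "emeasure lborel S < \<infinity>" by (simp add: integrable_indicator_iff)
  define m where "m = measure lborel S"
  have big: "real n \<le> m" for n :: nat
  proof -
    define I where "I = (if a > 0 then {0..real n} else {- real n..0})"
    have "I \<subseteq> S" by (auto simp: I_def S_def)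
    then have "measure lborel I \<le> m" unfolding m_def using fin by (intro measure_mono_fmeasurable) (auto simp: fmeasurable_def I_def)
    then show ?thesis by (auto simp: I_def split: if_splits)
  qed
  obtain n :: nat where "m < real n" using reals_Archimedean2 by blast
  with big[of n] show False by simp
qed

text \<open>With the integrating factor \<open>exp (- c x)\<close>, the equation \<open>w' = c w\<close> says that \<open>w exp (- c x)\<close> has
  weak derivative zero, so \<open>w\<close> is a multiple of \<open>exp (c x)\<close>, which is not square integrable
  unless it vanishes.\<close>

lemma first_order_injective:
  assumes w: "w \<in> L2" and c: "Re c \<noteq> 0" and wd: "weak_deriv 1 w (c *\<^sub>c w)"
  shows "w = 0"
proof -
  define e where "e x = exp (- c * complex_of_real x)" for x
  have e_smooth: "smooth e" unfolding e_def using smooth_exp[of 1 "- c"] by simp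
  have [measurable]: "e \<in> borel_measurable borel" by (rule smooth_measurable[OF e_smooth])
  have e_deriv: "(e has_vector_derivative (- c) * e x) (at x)" for x
    unfolding e_def
    by (rule has_vector_derivative_real_field[where f = "\<lambda>x. exp (- c * x)"]) (auto intro!: derivative_eq_intros)
  have loc: "loc_integrable (\<lambda>x. rep_aefun w x * e x)"
    unfolding loc_integrable_def
  proof (intro conjI allI)
    fix r :: real
    have "compact (e ` {-r..r})" by (intro compact_continuous_image smooth_continuous e_smooth compact_Icc)
    then obtain M where M: "M > 0" "\<And>x. x \<in> {-r..r} \<Longrightarrow> cmod (e x) \<le> M"
      using compact_imp_bounded bounded_pos by (metis imageI)
    have "integrable lborel (\<lambda>x. rep_aefun w x * (indicat_real {-r..r} x *\<^sub>R e x))"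
      by (rule loc_integrable_mult[OF L2w_loc_integrable[OF w], of _ M r])
         (use M in \<open>auto simp: indicator_def\<close>)
    then show "integrable lborel (\<lambda>x. indicat_real {-r..r} x *\<^sub>R (rep_aefun w x * e x))" by simp
  qed measurable
  have "\<exists>k. AE x in lborel. rep_aefun w x * e x = k"
  proof (rule du_Bois_Reymond[OF loc])
    fix \<omega> assume \<omega>: "test_function \<omega>"
    then have s: "smooth \<omega>" by (simp add: test_function_iff)
    define \<phi> where "\<phi> x = e x * \<omega> x" for x
    have \<phi>: "test_function \<phi>" unfolding \<phi>_def by (rule test_function_mult[OF \<omega> e_smooth])
    have "(\<phi> has_vector_derivative e x * vderiv \<omega> x + (- c) * e x * \<omega> x) (at x)" for x
      unfolding \<phi>_def using has_vector_derivative_mult[OF e_deriv smooth_has_vderiv[OF s]] .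
    then have d: "vderiv \<phi> = (\<lambda>x. e x * vderiv \<omega> x + (- c) * e x * \<omega> x)"
      by (auto simp: vector_derivative_at)
    have int: "integrable lborel (\<lambda>x. rep_aefun w x * e x * vderiv \<omega> x)" "integrable lborel (\<lambda>x. rep_aefun w x * e x * \<omega> x)"
      using loc_integrable_mult_test[OF loc test_function_vderiv[OF \<omega>]] loc_integrable_mult_test[OF loc \<omega>] by auto
    have "test_pairing (vderiv \<phi>) w = - (c * test_pairing \<phi> w)"
      using wd \<phi> dual_L2wD(2)[OF test_pairing_dual[OF \<phi>] w] by (simp add: weak_deriv_iff)
    moreover have "test_pairing (vderiv \<phi>) w =
        (LINT x|lborel. rep_aefun w x * e x * vderiv \<omega> x - c * (rep_aefun w x * e x * \<omega> x))"
      unfolding test_pairing_def d by (rule Bochner_Integration.integral_cong) (auto simp: algebra_simps)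
    moreover have "\<dots> = (LINT x|lborel. rep_aefun w x * e x * vderiv \<omega> x) - c * (LINT x|lborel. rep_aefun w x * e x * \<omega> x)"
      using int by simp
    moreover have "test_pairing \<phi> w = (LINT x|lborel. rep_aefun w x * e x * \<omega> x)"
      by (simp add: test_pairing_def \<phi>_def mult.assoc)
    ultimately show "(LINT x|lborel. rep_aefun w x * e x * vderiv \<omega> x) = 0" by simp
  qed
  then obtain k where k: "AE x in lborel. rep_aefun w x * e x = k" by blast
  then have wk: "AE x in lborel. rep_aefun w x = k * exp (c * of_real x)"
    by eventually_elim (auto simp: e_def exp_minus field_simps)
  have "k = 0"
  proof (rule ccontr)
    assume k0: "k \<noteq> 0"
    have "integrable lborel (\<lambda>x. (jbracket x powr 0 * cmod (rep_aefun w x))\<^sup>2)" using w by (simp add: L2w_iff)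
    then have "integrable lborel (\<lambda>x. (cmod k)\<^sup>2 * (exp (Re c * x))\<^sup>2)"
    proof (rule integrable_cong_AE_imp)
      show "AE x in lborel. (jbracket x powr 0 * cmod (rep_aefun w x))\<^sup>2 = (cmod k)\<^sup>2 * (exp (Re c * x))\<^sup>2"
        using wk by eventually_elim (simp add: norm_mult power_mult_distrib less_imp_neq[OF jbracket_pos, symmetric])
    qed measurable
    then have "integrable lborel (\<lambda>x. (exp (Re c * x))\<^sup>2)" using k0 by simp
    then show False by (rule exponential_not_square_integrable[OF c])
  qed
  show "w = 0"
  proof (rule aefun_eqI)
    show "AE x in lborel. rep_aefun w x = rep_aefun 0 x"
      using wk rep_0 by eventually_elim (simp add: \<open>k = 0\<close>)
  qed
qed

section \<open>Integrability on the line and convolutions\<close>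

lemma integrable_half_line:
  fixes f :: "real \<Rightarrow> real"
  assumes [measurable]: "f \<in> borel_measurable borel" and f: "\<And>x. 0 \<le> f x" "(f has_integral I) {c..}"
  shows "integrable lborel (\<lambda>x. indicator {c..} x * f x)"
proof (rule integrableI_nonneg)
  have "((\<lambda>x. indicator {c..} x * f x) has_integral I) UNIV"
    using f(2) unfolding has_integral_restrict_UNIV[of "{c..}" f, symmetric]
    by (rule has_integral_eq[rotated]) (auto simp: indicator_def)
  then have "(\<integral>\<^sup>+x. ennreal (indicator {c..} x * f x) \<partial>lborel) = ennreal I"
    by (intro nn_integral_has_integral_lborel) (auto simp: f)
  then show "(\<integral>\<^sup>+x. ennreal (indicator {c..} x * f x) \<partial>lborel) < \<infinity>" by simp
qed (auto simp: f)

lemma integrable_even: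
  fixes f :: "real \<Rightarrow> real"
  assumes [measurable]: "f \<in> borel_measurable borel" and f: "integrable lborel (\<lambda>x. indicator {0..} x * f x)"
  shows "integrable lborel (\<lambda>x. f \<bar>x\<bar>)"
proof -
  have f': "integrable lborel (\<lambda>x. indicator {0..} (- x) * f (- x))"
    using lborel_integrable_real_affine[OF f, of "-1" 0] by simp
  show ?thesis
  proof (rule Bochner_Integration.integrable_bound[OF Bochner_Integration.integrable_add[OF integrable_abs[OF f] integrable_abs[OF f']]])
    show "AE x in lborel. norm (f \<bar>x\<bar>) \<le> norm (\<bar>indicator {0..} x * f x\<bar> + \<bar>indicator {0..} (- x) * f (- x)\<bar>)"
      by (intro AE_I2) (auto simp: indicator_def abs_if)
  qed measurable
qed

lemma integrable_exp_abs:
  fixes a :: real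
  assumes "0 < a" shows "integrable lborel (\<lambda>x. exp (- (a * \<bar>x\<bar>)))"
  using integrable_even[OF _ integrable_half_line[OF _ _ has_integral_exp_minus_to_infinity[OF assms, of 0]]] by simp

lemma integrable_jbracket_powr:
  assumes r: "r < -1" shows "integrable lborel (\<lambda>x. jbracket x powr r)"
proof -
  have p: "integrable lborel (\<lambda>x. indicator {1..} x * x powr r)"
    using integrable_half_line[OF _ _ has_integral_powr_to_inf[OF r, of 1]] by simp
  have q: "integrable lborel (\<lambda>x::real. indicat_real {0..1} x)"
    by (simp add: integrable_indicator_iff)
  have "integrable lborel (\<lambda>x. indicator {0..} x * jbracket x powr r)"
  proof (rule Bochner_Integration.integrable_bound[OF Bochner_Integration.integrable_add[OF p q]])
    have *: "jbracket x powr r \<le> x powr r" if "1 \<le> x" for x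
    proof (rule powr_mono2')
      show "x \<le> jbracket x" using that unfolding jbracket_def by (intro real_le_rsqrt) simp
    qed (use r that in auto)
    have **: "jbracket x powr r \<le> 1" for x
      using jbracket_powr_mono[of r 0 x] r less_imp_neq[OF jbracket_pos[of x]] by simp
    show "AE x in lborel. norm (indicator {0..} x * jbracket x powr r) \<le> norm (indicator {1..} x * x powr r + indicat_real {0..1} x)"
    proof (rule AE_I2)
      fix x :: real
      show "norm (indicator {0..} x * jbracket x powr r) \<le> norm (indicator {1..} x * x powr r + indicat_real {0..1} x)"
        using *[of x] **[of x] by (auto simp: indicator_def)
    qed
  qed measurable
  moreover have "jbracket \<bar>x\<bar> = jbracket x" for x by (simp add: jbracket_def)
  ultimately show ?thesis using integrable_even[of "\<lambda>x. jbracket x powr r"] by simp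
qed

lemma integrable_product_kernel:
  fixes p q :: "real \<Rightarrow> real"
  assumes p: "integrable lborel p" and q: "integrable lborel q"
  shows "integrable (lborel \<Otimes>\<^sub>M lborel) (\<lambda>(x, y). p x * q y)"
proof -
  have [measurable]: "p \<in> borel_measurable borel" "q \<in> borel_measurable borel"
    using p q by (simp_all add: integrable_iff_bounded)
  show ?thesis
  proof (rule lborel_pair.Fubini_integrable)
    show "integrable lborel (\<lambda>x. LINT y|lborel. norm (case (x, y) of (x, y) \<Rightarrow> p x * q y))"
      using p by (simp add: abs_mult)
    show "AE x in lborel. integrable lborel (\<lambda>y. case (x, y) of (x, y) \<Rightarrow> p x * q y)"
      using q by simp
  qed measurable
qed

text \<open>By translation invariance the inner integral of \<open>\<bar>p (x - y)\<bar>\<close> does not depend on the outer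
  variable.\<close>

lemma integrable_convolution_kernel:
  fixes p q :: "real \<Rightarrow> real"
  assumes p: "integrable lborel p" and q: "integrable lborel q"
  shows "integrable (lborel \<Otimes>\<^sub>M lborel) (\<lambda>(x, y). p (x - y) * q x)"
    and "integrable (lborel \<Otimes>\<^sub>M lborel) (\<lambda>(x, y). p (x - y) * q y)"
proof -
  have [measurable]: "p \<in> borel_measurable borel" "q \<in> borel_measurable borel"
    using p q by (simp_all add: integrable_iff_bounded)
  have shift: "integrable lborel (\<lambda>y. p (x - y))" "(LINT y|lborel. \<bar>p (x - y)\<bar>) = (LINT y|lborel. \<bar>p y\<bar>)"
    "integrable lborel (\<lambda>y. p (y - x))" "(LINT y|lborel. \<bar>p (y - x)\<bar>) = (LINT y|lborel. \<bar>p y\<bar>)" for x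
    using lborel_integrable_real_affine[OF p, of "-1" x] lborel_integral_real_affine[of "-1" "\<lambda>y. \<bar>p y\<bar>" x]
      lborel_integrable_real_affine[OF p, of 1 "- x"] lborel_integral_real_affine[of 1 "\<lambda>y. \<bar>p y\<bar>" "- x"]
    by (simp_all add: algebra_simps)
  show 1: "integrable (lborel \<Otimes>\<^sub>M lborel) (\<lambda>(x, y). p (x - y) * q x)"
  proof (rule lborel_pair.Fubini_integrable)
    show "integrable lborel (\<lambda>x. LINT y|lborel. norm (case (x, y) of (x, y) \<Rightarrow> p (x - y) * q x))"
      using q shift by (simp add: abs_mult)
    show "AE x in lborel. integrable lborel (\<lambda>y. case (x, y) of (x, y) \<Rightarrow> p (x - y) * q x)"
      using shift by simp
  qed measurable
  have "integrable (lborel \<Otimes>\<^sub>M lborel) (\<lambda>(x, y). p (y - x) * q x)"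
  proof (rule lborel_pair.Fubini_integrable)
    show "integrable lborel (\<lambda>x. LINT y|lborel. norm (case (x, y) of (x, y) \<Rightarrow> p (y - x) * q x))"
      using q shift by (simp add: abs_mult)
    show "AE x in lborel. integrable lborel (\<lambda>y. case (x, y) of (x, y) \<Rightarrow> p (y - x) * q x)"
      using shift by simp
  qed measurable
  from lborel_pair.integrable_product_swap[OF this]
  show "integrable (lborel \<Otimes>\<^sub>M lborel) (\<lambda>(x, y). p (x - y) * q y)"
    by (simp add: case_prod_beta')
qed

lemma L2_norm_0: "(L2w_norm 0 u)\<^sup>2 = (LINT x|lborel. (cmod (rep_aefun u x))\<^sup>2)"
  using less_imp_neq[OF jbracket_pos] by (simp add: L2w_norm_sq powr_zero_eq_one)

lemma L2_iff: "u \<in> L2 \<longleftrightarrow> integrable lborel (\<lambda>x. (cmod (rep_aefun u x))\<^sup>2)"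
  using less_imp_neq[OF jbracket_pos] by (simp add: L2w_iff powr_zero_eq_one)

definition conv_op :: "(real \<Rightarrow> complex) \<Rightarrow> aefun \<Rightarrow> aefun" where
  "conv_op k u = abs_aefun (\<lambda>x. LINT y|lborel. k (x - y) * rep_aefun u y)"

lemma conv_measurable [measurable]:
  assumes [measurable]: "k \<in> borel_measurable borel" "f \<in> borel_measurable borel"
  shows "(\<lambda>x. LINT y|lborel. k (x - y) * f y :: complex) \<in> borel_measurable borel"
  by measurable

text \<open>Cauchy--Schwarz with one factor \<open>\<bar>k\<bar>\<^sup>1\<^sup>/\<^sup>2\<close> put on each side; integrating the bound over \<open>x\<close>
  gives Young's inequality.\<close>

lemma conv_AE_integrable:
  assumes k: "integrable lborel k" and u: "u \<in> L2"
  shows "AE x in lborel. integrable lborel (\<lambda>y. k (x - y) * rep_aefun u y)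
      \<and> (cmod (LINT y|lborel. k (x - y) * rep_aefun u y))\<^sup>2 \<le>
        (LINT x|lborel. cmod (k x)) * (LINT y|lborel. cmod (k (x - y)) * (cmod (rep_aefun u y))\<^sup>2)"
    (is "AE x in lborel. ?P x")
proof -
  let ?f = "rep_aefun u"
  have [measurable]: "k \<in> borel_measurable borel" using k by (simp add: integrable_iff_bounded)
  have u2: "integrable lborel (\<lambda>y. (cmod (?f y))\<^sup>2)" using u by (simp add: L2_iff)
  have "integrable (lborel \<Otimes>\<^sub>M lborel) (\<lambda>(x, y). cmod (k (x - y)) * (cmod (?f y))\<^sup>2)"
    by (rule integrable_convolution_kernel(2)[OF integrable_norm[OF k] u2])
  from lborel_pair.AE_integrable_fst'[OF this]
  have "AE x in lborel. integrable lborel (\<lambda>y. cmod (k (x - y)) * (cmod (?f y))\<^sup>2)" by simp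
  then show ?thesis
  proof eventually_elim
    case (elim x)
    let ?p = "\<lambda>y. sqrt (cmod (k (x - y)))" and ?q = "\<lambda>y. sqrt (cmod (k (x - y))) * cmod (?f y)"
    have pq: "?p y * ?q y = cmod (k (x - y) * ?f y)" for y by (simp add: norm_mult)
    have kx: "integrable lborel (\<lambda>y. cmod (k (x - y)))"
      using lborel_integrable_real_affine[OF integrable_norm[OF k], of "-1" x] by simp
    have kx': "(LINT y|lborel. cmod (k (x - y))) = (LINT y|lborel. cmod (k y))"
      using lborel_integral_real_affine[of "-1" "\<lambda>y. cmod (k y)" x] by simp
    have P: "integrable lborel (\<lambda>y. (?p y)\<^sup>2)" using kx by simp
    have Q: "integrable lborel (\<lambda>y. (?q y)\<^sup>2)" using elim by (simp add: power_mult_distrib)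
    have 1: "integrable lborel (\<lambda>y. ?p y * ?q y)"
      and 2: "(LINT y|lborel. \<bar>?p y * ?q y\<bar>) \<le> sqrt (LINT y|lborel. (?p y)\<^sup>2) * sqrt (LINT y|lborel. (?q y)\<^sup>2)"
      by (rule L2_pairing[OF _ _ P Q]; measurable)+
    have int: "integrable lborel (\<lambda>y. k (x - y) * ?f y)"
    proof (rule Bochner_Integration.integrable_bound[OF 1])
      show "AE y in lborel. norm (k (x - y) * ?f y) \<le> norm (?p y * ?q y)" unfolding pq by simp
    qed measurable
    have "cmod (LINT y|lborel. k (x - y) * ?f y) \<le> (LINT y|lborel. \<bar>?p y * ?q y\<bar>)"
      unfolding pq using integral_norm_bound[of lborel "\<lambda>y. k (x - y) * ?f y"] by simp
    also note 2
    finally have "(cmod (LINT y|lborel. k (x - y) * ?f y))\<^sup>2 \<le>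
        (sqrt (LINT y|lborel. (?p y)\<^sup>2) * sqrt (LINT y|lborel. (?q y)\<^sup>2))\<^sup>2"
      by (rule power_mono) simp
    also have "\<dots> = (LINT x|lborel. cmod (k x)) * (LINT y|lborel. cmod (k (x - y)) * (cmod (?f y))\<^sup>2)"
      using kx' by (simp add: power_mult_distrib)
    finally show ?case using int by simp
  qed
qed

lemma conv_op_bounded:
  assumes k: "integrable lborel k" shows "bounded_op 0 0 (conv_op k)"
proof -
  have [measurable]: "k \<in> borel_measurable borel" using k by (simp add: integrable_iff_bounded)
  define I where "I = (LINT x|lborel. cmod (k x))"
  have I0: "0 \<le> I" by (simp add: I_def)
  have norm_le: "conv_op k u \<in> L2 \<and> L2w_norm 0 (conv_op k u) \<le> I * L2w_norm 0 u" if u: "u \<in> L2" for u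
  proof -
    let ?f = "rep_aefun u"
    let ?h = "\<lambda>x. LINT y|lborel. k (x - y) * ?f y"
    let ?W = "\<lambda>x. LINT y|lborel. cmod (k (x - y)) * (cmod (?f y))\<^sup>2"
    have u2: "integrable lborel (\<lambda>y. (cmod (?f y))\<^sup>2)" using u by (simp add: L2_iff)
    have ker: "integrable (lborel \<Otimes>\<^sub>M lborel) (\<lambda>(x, y). cmod (k (x - y)) * (cmod (?f y))\<^sup>2)"
      by (rule integrable_convolution_kernel(2)[OF integrable_norm[OF k] u2])
    have W: "integrable lborel ?W" using lborel_pair.integrable_fst'[OF ker] by simp
    have "(LINT x|lborel. ?W x) = (LINT y|lborel. LINT x|lborel. cmod (k (x - y)) * (cmod (?f y))\<^sup>2)"
      using lborel_pair.Fubini_integral[OF ker] by simp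
    also have "\<dots> = (LINT y|lborel. I * (cmod (?f y))\<^sup>2)"
    proof -
      have "(LINT x|lborel. cmod (k (x - y))) = I" for y
        using lborel_integral_real_affine[of 1 "\<lambda>x. cmod (k x)" "- y"] by (simp add: I_def algebra_simps)
      then show ?thesis by simp
    qed
    also have "\<dots> = I * (L2w_norm 0 u)\<^sup>2" by (simp add: L2_norm_0)
    finally have W_int: "(LINT x|lborel. ?W x) = I * (L2w_norm 0 u)\<^sup>2" .
    have le: "AE x in lborel. (cmod (?h x))\<^sup>2 \<le> I * ?W x"
      using conv_AE_integrable[OF k u] by (auto simp: I_def elim: eventually_mono)
    have int: "integrable lborel (\<lambda>x. (cmod (?h x))\<^sup>2)"
      by (rule Bochner_Integration.integrable_bound[OF integrable_mult_right[OF W, of I]])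
         (measurable, use le in \<open>auto elim!: eventually_mono intro: order_trans[OF _ abs_ge_self]\<close>)
    have h: "conv_op k u \<in> L2"
      using int less_imp_neq[OF jbracket_pos] by (simp add: conv_op_def abs_L2w_iff powr_zero_eq_one)
    have "(L2w_norm 0 (conv_op k u))\<^sup>2 = (LINT x|lborel. (cmod (?h x))\<^sup>2)"
      using less_imp_neq[OF jbracket_pos] by (simp add: conv_op_def abs_L2w_norm_sq powr_zero_eq_one)
    also have "\<dots> \<le> (LINT x|lborel. I * ?W x)"
      by (rule integral_mono_AE[OF int integrable_mult_right[OF W] le])
    also have "\<dots> = (I * L2w_norm 0 u)\<^sup>2" using W_int by (simp add: power_mult_distrib power2_eq_square)
    finally have "L2w_norm 0 (conv_op k u) \<le> I * L2w_norm 0 u"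
      by (rule power2_le_imp_le) (simp add: I0 L2w_norm_nonneg)
    with h show ?thesis by simp
  qed
  show ?thesis
    unfolding bounded_op_iff
  proof
    fix u assume u: "u \<in> L2"
    show "conv_op k u \<in> L2" using norm_le[OF u] by simp
    show "conv_op k (c *\<^sub>c u) = c *\<^sub>c conv_op k u" for c
    proof -
      have "(LINT y|lborel. k (x - y) * rep_aefun (c *\<^sub>c u) y) = c * (LINT y|lborel. k (x - y) * rep_aefun u y)" for x
      proof -
        have "(LINT y|lborel. k (x - y) * rep_aefun (c *\<^sub>c u) y) = (LINT y|lborel. c * (k (x - y) * rep_aefun u y))"
          using rep_cscale[of c u] by (intro integral_cong_AE) (auto elim!: eventually_mono)
        then show ?thesis by simp
      qed
      then show ?thesis
        unfolding conv_op_def using cscale.abs_eq[of "\<lambda>x. LINT y|lborel. k (x - y) * rep_aefun u y" c]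
        by (simp add: ae_eq_refl)
    qed
    fix v assume v: "v \<in> L2"
    have "AE x in lborel. (LINT y|lborel. k (x - y) * rep_aefun (u + v) y) =
        (LINT y|lborel. k (x - y) * rep_aefun u y) + (LINT y|lborel. k (x - y) * rep_aefun v y)"
      using conv_AE_integrable[OF k u] conv_AE_integrable[OF k v]
    proof eventually_elim
      case (elim x)
      have "(LINT y|lborel. k (x - y) * rep_aefun (u + v) y) =
          (LINT y|lborel. k (x - y) * rep_aefun u y + k (x - y) * rep_aefun v y)"
        using rep_add[of u v] by (intro integral_cong_AE) (auto simp: algebra_simps elim!: eventually_mono)
      then show ?case using elim by simp
    qed
    then show "conv_op k (u + v) = conv_op k u + conv_op k v"
      unfolding conv_op_def
      by (subst plus_aefun.abs_eq) (auto simp: ae_eq_refl intro!: abs_aefun_eqI)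
  next
    show "\<exists>C. \<forall>u\<in>L2. L2w_norm 0 (conv_op k u) \<le> C * L2w_norm 0 u" using norm_le by blast
  qed
qed

text \<open>The transpose of a convolution, by Fubini's theorem.\<close>

lemma conv_op_pairing:
  assumes k: "integrable lborel k" and u: "u \<in> L2"
    and [measurable]: "g \<in> borel_measurable borel" and g: "integrable lborel (\<lambda>x. (cmod (g x))\<^sup>2)"
  shows "(LINT x|lborel. rep_aefun (conv_op k u) x * g x) =
         (LINT y|lborel. rep_aefun u y * (LINT x|lborel. k (x - y) * g x))"
    and "integrable lborel (\<lambda>y. rep_aefun u y * (LINT x|lborel. k (x - y) * g x))"
proof -
  let ?f = "rep_aefun u"
  have [measurable]: "k \<in> borel_measurable borel" using k by (simp add: integrable_iff_bounded)
  have u2: "integrable lborel (\<lambda>y. (cmod (?f y))\<^sup>2)" using u by (simp add: L2_iff)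
  note ker = integrable_convolution_kernel[OF integrable_norm[OF k]]
  have dom: "integrable (lborel \<Otimes>\<^sub>M lborel)
      (\<lambda>z. (\<lambda>(x, y). cmod (k (x - y)) * (cmod (g x))\<^sup>2) z + (\<lambda>(x, y). cmod (k (x - y)) * (cmod (?f y))\<^sup>2) z)"
    by (rule Bochner_Integration.integrable_add[OF ker(1)[OF g] ker(2)[OF u2]])
  have am: "a * b \<le> b\<^sup>2 + a\<^sup>2" if "0 \<le> a" "0 \<le> b" for a b :: real
    using sum_squares_bound[of a b] mult_nonneg_nonneg[OF that] unfolding mult.assoc by linarith
  have int: "integrable (lborel \<Otimes>\<^sub>M lborel) (\<lambda>(x, y). k (x - y) * ?f y * g x)"
  proof (rule Bochner_Integration.integrable_bound[OF dom])
    show "AE z in lborel \<Otimes>\<^sub>M lborel. norm (case z of (x, y) \<Rightarrow> k (x - y) * ?f y * g x) \<le>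
       norm ((\<lambda>(x, y). cmod (k (x - y)) * (cmod (g x))\<^sup>2) z + (\<lambda>(x, y). cmod (k (x - y)) * (cmod (?f y))\<^sup>2) z)"
    proof (intro AE_I2)
      fix z :: "real \<times> real"
      obtain x y where z: "z = (x, y)" by (cases z)
      have "cmod (k (x - y)) * (cmod (?f y) * cmod (g x)) \<le> cmod (k (x - y)) * ((cmod (g x))\<^sup>2 + (cmod (?f y))\<^sup>2)"
        by (intro mult_left_mono am) auto
      then show "norm (case z of (x, y) \<Rightarrow> k (x - y) * ?f y * g x) \<le>
       norm ((\<lambda>(x, y). cmod (k (x - y)) * (cmod (g x))\<^sup>2) z + (\<lambda>(x, y). cmod (k (x - y)) * (cmod (?f y))\<^sup>2) z)"
        unfolding z by (simp add: norm_mult algebra_simps)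
    qed
  qed measurable
  have "(LINT x|lborel. rep_aefun (conv_op k u) x * g x) = (LINT x|lborel. LINT y|lborel. k (x - y) * ?f y * g x)"
  proof (rule integral_cong_AE)
    show "AE x in lborel. rep_aefun (conv_op k u) x * g x = (LINT y|lborel. k (x - y) * ?f y * g x)"
      using rep_abs_aefun[of "\<lambda>x. LINT y|lborel. k (x - y) * ?f y"]
      unfolding conv_op_def by (auto elim!: eventually_mono)
  qed measurable
  also have "\<dots> = (LINT y|lborel. LINT x|lborel. k (x - y) * ?f y * g x)"
    using lborel_pair.Fubini_integral[OF int] by simp
  also have swap: "(\<lambda>y. LINT x|lborel. k (x - y) * ?f y * g x) = (\<lambda>y. ?f y * (LINT x|lborel. k (x - y) * g x))"
    by (rule ext) (simp flip: integral_mult_right_zero add: mult_ac)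
  finally show "(LINT x|lborel. rep_aefun (conv_op k u) x * g x) =
      (LINT y|lborel. ?f y * (LINT x|lborel. k (x - y) * g x))" .
  show "integrable lborel (\<lambda>y. ?f y * (LINT x|lborel. k (x - y) * g x))"
    using lborel_pair.integrable_snd[OF int] unfolding swap .
qed

section \<open>First-order resolvents\<close>

text \<open>The square integrable fundamental solution of \<open>- i d/dt - \<kappa>\<close>: decay forces it to vanish on the
  half line selected by the sign of \<open>Im \<kappa>\<close>.\<close>

definition expker :: "complex \<Rightarrow> real \<Rightarrow> complex" where
  "expker \<kappa> t = (if 0 < Im \<kappa> then (if 0 \<le> t then \<i> * exp (\<i> * \<kappa> * of_real t) else 0)
     else (if t < 0 then - \<i> * exp (\<i> * \<kappa> * of_real t) else 0))"

lemma exp_i_measurable [measurable]: "(\<lambda>t::real. exp (c * of_real t) :: complex) \<in> borel_measurable borel"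
  by (intro borel_measurable_continuous_onI continuous_intros)

lemma expker_measurable [measurable]: "expker \<kappa> \<in> borel_measurable borel"
  unfolding expker_def by measurable

lemma norm_exp_i: "cmod (exp (\<i> * \<kappa> * of_real t)) = exp (- (Im \<kappa> * t))"
  by simp

lemma expker_le: "Im \<kappa> \<noteq> 0 \<Longrightarrow> cmod (expker \<kappa> t) \<le> exp (- (\<bar>Im \<kappa>\<bar> * \<bar>t\<bar>))"
  unfolding expker_def by (auto simp: norm_mult norm_exp_i)

lemma expker_integrable:
  assumes "Im \<kappa> \<noteq> 0" shows "integrable lborel (expker \<kappa>)"
  by (rule Bochner_Integration.integrable_bound[OF integrable_exp_abs[of "\<bar>Im \<kappa>\<bar>"]])
     (use assms expker_le in auto)

lemma kernel_times_test_integrable: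
  assumes k: "integrable lborel k" and \<phi>: "test_function \<phi>"
  shows "integrable lborel (\<lambda>x. k (x - y) * \<phi> x)"
proof -
  obtain M where M: "\<And>x. cmod (\<phi> x) \<le> M" using test_function_bounded[OF \<phi>] by blast
  have [measurable]: "\<phi> \<in> borel_measurable borel" "k \<in> borel_measurable borel"
    using test_function_L2w(2)[OF \<phi>] k by (auto simp: integrable_iff_bounded)
  have "integrable lborel (\<lambda>x. M *\<^sub>R k (- y + 1 * x))"
    using lborel_integrable_real_affine[OF k, of 1 "- y"] by simp
  then show ?thesis
    by (rule Bochner_Integration.integrable_bound)
       (use M in \<open>auto simp: norm_mult mult.commute[of _ M] intro!: AE_I2 order_trans[OF mult_left_mono[OF M]] mult_right_mono\<close>)
qed

text \<open>Integration by parts on the half line supporting the kernel; the boundary term at \<open>y\<close> gives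
  \<open>- i \<phi> y\<close>.\<close>

lemma expker_test:
  assumes \<kappa>: "Im \<kappa> \<noteq> 0" and \<phi>: "test_function \<phi>"
  shows "(LINT x|lborel. expker \<kappa> (x - y) * vderiv \<phi> x) =
         - \<i> * \<phi> y - \<i> * \<kappa> * (LINT x|lborel. expker \<kappa> (x - y) * \<phi> x)"
proof -
  obtain r where r: "\<And>x. r < \<bar>x\<bar> \<Longrightarrow> \<phi> x = 0" and s: "smooth \<phi>" using \<phi> by (auto simp: test_function_iff)
  have r': "vderiv \<phi> x = 0" if "r < \<bar>x\<bar>" for x using vderiv_eq_0_outside[of r \<phi> x] r that by blast
  define R where "R = max r \<bar>y\<bar> + 1"
  define e where "e x = exp (\<i> * \<kappa> * of_real (x - y))" for x
  have e_deriv: "(e has_vector_derivative \<i> * \<kappa> * e x) (at x)" for x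
    unfolding e_def of_real_diff
    by (rule has_vector_derivative_real_field[where f = "\<lambda>x. exp (\<i> * \<kappa> * (x - of_real y))"])
       (auto intro!: derivative_eq_intros)
  have D: "((\<lambda>x. e x * \<phi> x) has_vector_derivative e x * (vderiv \<phi> x + \<i> * \<kappa> * \<phi> x)) (at x)" for x
    using has_vector_derivative_mult[OF e_deriv smooth_has_vderiv[OF s], of x] by (simp add: algebra_simps)
  have cont: "continuous_on A (\<lambda>x. e x * (vderiv \<phi> x + \<i> * \<kappa> * \<phi> x))" for A
    unfolding e_def by (intro continuous_intros smooth_continuous s smooth_vderiv)
  have FTC: "(LINT x|lborel. indicator {a..b} x *\<^sub>R (e x * (vderiv \<phi> x + \<i> * \<kappa> * \<phi> x))) = e b * \<phi> b - e a * \<phi> a"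
    if "a \<le> b" for a b
    by (rule integral_FTC_Icc[OF that has_vector_derivative_at_within[OF D] cont])
  have out: "\<phi> R = 0" "\<phi> (- R) = 0" "e y = 1" using r[of R] r[of "- R"] by (auto simp: R_def e_def)
  have "(LINT x|lborel. expker \<kappa> (x - y) * (vderiv \<phi> x + \<i> * \<kappa> * \<phi> x)) = - \<i> * \<phi> y"
  proof (cases "0 < Im \<kappa>")
    case True
    have "expker \<kappa> (x - y) * (vderiv \<phi> x + \<i> * \<kappa> * \<phi> x) =
        \<i> * (indicator {y..R} x *\<^sub>R (e x * (vderiv \<phi> x + \<i> * \<kappa> * \<phi> x)))" for x
      using r[of x] r'[of x] True by (auto simp: expker_def e_def indicator_def R_def)
    then have "(LINT x|lborel. expker \<kappa> (x - y) * (vderiv \<phi> x + \<i> * \<kappa> * \<phi> x)) =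
        \<i> * (LINT x|lborel. indicator {y..R} x *\<^sub>R (e x * (vderiv \<phi> x + \<i> * \<kappa> * \<phi> x)))"
      by (simp only: integral_mult_right_zero)
    also have "\<dots> = \<i> * (e R * \<phi> R - e y * \<phi> y)" by (subst FTC) (auto simp: R_def)
    finally show ?thesis using out by simp
  next
    case False
    have "AE x in lborel. expker \<kappa> (x - y) * (vderiv \<phi> x + \<i> * \<kappa> * \<phi> x) =
        - \<i> * (indicator {- R..y} x *\<^sub>R (e x * (vderiv \<phi> x + \<i> * \<kappa> * \<phi> x)))"
      using AE_lborel_singleton[of y]
    proof eventually_elim
      case (elim x)
      then show ?case using r[of x] r'[of x] False by (auto simp: expker_def e_def indicator_def R_def)
    qed
    then have "(LINT x|lborel. expker \<kappa> (x - y) * (vderiv \<phi> x + \<i> * \<kappa> * \<phi> x)) =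
        (LINT x|lborel. - \<i> * (indicator {- R..y} x *\<^sub>R (e x * (vderiv \<phi> x + \<i> * \<kappa> * \<phi> x))))"
      by (intro integral_cong_AE)
         (use smooth_measurable[OF s] smooth_measurable[OF smooth_vderiv[OF s]] in \<open>auto simp: e_def\<close>)
    also have "\<dots> = - \<i> * (e y * \<phi> y - e (- R) * \<phi> (- R))"
      unfolding integral_mult_right_zero by (subst FTC) (auto simp: R_def)
    finally show ?thesis using out by simp
  qed
  moreover have "(LINT x|lborel. expker \<kappa> (x - y) * (vderiv \<phi> x + \<i> * \<kappa> * \<phi> x)) =
      (LINT x|lborel. expker \<kappa> (x - y) * vderiv \<phi> x) + \<i> * \<kappa> * (LINT x|lborel. expker \<kappa> (x - y) * \<phi> x)"
  proof -
    have "(LINT x|lborel. expker \<kappa> (x - y) * (vderiv \<phi> x + \<i> * \<kappa> * \<phi> x)) =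
        (LINT x|lborel. expker \<kappa> (x - y) * vderiv \<phi> x + \<i> * \<kappa> * (expker \<kappa> (x - y) * \<phi> x))"
      by (rule Bochner_Integration.integral_cong) (auto simp: algebra_simps)
    then show ?thesis
      using kernel_times_test_integrable[OF expker_integrable[OF \<kappa>] test_function_vderiv[OF \<phi>], of y]
        kernel_times_test_integrable[OF expker_integrable[OF \<kappa>] \<phi>, of y] by simp
  qed
  ultimately show ?thesis by (simp add: algebra_simps)
qed

lemma test_function_square_integrable:
  assumes "test_function \<phi>" shows "integrable lborel (\<lambda>x. (cmod (\<phi> x))\<^sup>2)"
  using test_function_L2w(1)[OF assms, of 0] abs_L2w_iff[OF test_function_L2w(2)[OF assms], of 0]
    less_imp_neq[OF jbracket_pos] by (simp add: powr_zero_eq_one)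

lemma bounded_op_in: "bounded_op a b T \<Longrightarrow> u \<in> L2w a \<Longrightarrow> T u \<in> L2w b"
  by (auto simp: bounded_op_def)

lemma test_pairing_0: "test_function \<phi> \<Longrightarrow> test_pairing \<phi> 0 = 0"
  using dual_L2wD(2)[OF test_pairing_dual[of \<phi> 0] L2w_0, of 0] by simp

lemma expker_weak_deriv:
  assumes \<kappa>: "Im \<kappa> \<noteq> 0" and u: "u \<in> L2"
  shows "weak_deriv 1 (conv_op (expker \<kappa>) u) (\<i> *\<^sub>c u + (\<i> * \<kappa>) *\<^sub>c conv_op (expker \<kappa>) u)"
  unfolding weak_deriv_iff
proof (intro allI impI)
  fix \<phi> assume \<phi>: "test_function \<phi>"
  let ?J = "conv_op (expker \<kappa>) u"
  note k = expker_integrable[OF \<kappa>]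
  have J: "?J \<in> L2" using conv_op_bounded[OF k] u by (auto simp: bounded_op_def)
  note dual = test_pairing_dual[OF \<phi>, of 0]
  have tp: "test_pairing \<psi> ?J = (LINT y|lborel. rep_aefun u y * (LINT x|lborel. expker \<kappa> (x - y) * \<psi> x))"
    "integrable lborel (\<lambda>y. rep_aefun u y * (LINT x|lborel. expker \<kappa> (x - y) * \<psi> x))" if "test_function \<psi>" for \<psi>
    unfolding test_pairing_def
    using conv_op_pairing[OF k u test_function_L2w(2)[OF that] test_function_square_integrable[OF that]] by auto
  have "test_pairing (vderiv \<phi>) ?J =
      (LINT y|lborel. - \<i> * (rep_aefun u y * \<phi> y) - \<i> * \<kappa> * (rep_aefun u y * (LINT x|lborel. expker \<kappa> (x - y) * \<phi> x)))"
    unfolding tp(1)[OF test_function_vderiv[OF \<phi>]] expker_test[OF \<kappa> \<phi>]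
    by (rule Bochner_Integration.integral_cong) (auto simp: algebra_simps)
  also have "\<dots> = - \<i> * test_pairing \<phi> u - \<i> * \<kappa> * test_pairing \<phi> ?J"
    using tp[OF \<phi>] loc_integrable_mult_test[OF L2w_loc_integrable[OF u] \<phi>]
    by (subst Bochner_Integration.integral_diff) (simp_all add: test_pairing_def)
  also have "\<dots> = - test_pairing \<phi> (\<i> *\<^sub>c u + (\<i> * \<kappa>) *\<^sub>c ?J)"
    using dual_L2wD(1)[OF dual L2w_cscale[OF u] L2w_cscale[OF J], of \<i> "\<i> * \<kappa>"] dual_L2wD(2)[OF dual u, of \<i>]
      dual_L2wD(2)[OF dual J, of "\<i> * \<kappa>"] by simp
  finally show "test_pairing ((vderiv ^^ 1) \<phi>) ?J = (-1) ^ 1 * test_pairing \<phi> (\<i> *\<^sub>c u + (\<i> * \<kappa>) *\<^sub>c ?J)"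
    by simp
qed

section \<open>The operator of order three\<close>

lemma Sobolev_3D:
  assumes "u \<in> Sobolev 3"
  obtains v1 v2 v3 where "u \<in> L2" "v1 \<in> L2" "v2 \<in> L2" "v3 \<in> L2"
    "weak_deriv 1 u v1" "weak_deriv 2 u v2" "weak_deriv 3 u v3" "diff_op 3 u = \<i> *\<^sub>c v3"
proof -
  have u: "u \<in> L2" and ex: "\<And>k. k \<le> 3 \<Longrightarrow> \<exists>v\<in>L2. weak_deriv k u v" using assms by (auto simp: Sobolev_def)
  obtain v1 where "v1 \<in> L2" "weak_deriv 1 u v1" using ex[of 1] by auto
  moreover obtain v2 where "v2 \<in> L2" "weak_deriv 2 u v2" using ex[of 2] by auto
  moreover obtain v3 where v3: "v3 \<in> L2" "weak_deriv 3 u v3" using ex[of 3] by auto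
  moreover have "(THE v. v \<in> L2 \<and> weak_deriv 3 u v) = v3"
    using v3 weak_deriv_unique by (intro the_equality) blast+
  then have "diff_op 3 u = \<i> *\<^sub>c v3" by (simp add: diff_op_def power3_eq_cube)
  ultimately show ?thesis using that u by blast
qed

lemma diff_op_3_eq:
  assumes "u \<in> Sobolev 3" "v \<in> L2" "weak_deriv 3 u v" shows "diff_op 3 u = \<i> *\<^sub>c v"
  using Sobolev_3D[OF assms(1)] weak_deriv_unique[OF _ assms(3) _ assms(2)] by metis

lemma Sobolev_subspace: "cvec.subspace (Sobolev n)"
  unfolding cvec.subspace_def
proof (intro conjI ballI allI)
  have "weak_deriv k 0 0" for k
    by (simp add: weak_deriv_iff test_pairing_0 test_function_vderiv_n)
  then show "0 \<in> Sobolev n" unfolding Sobolev_def using L2w_0 by blast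
  fix u assume u: "u \<in> Sobolev n"
  show "c *\<^sub>c u \<in> Sobolev n" for c
    using u weak_deriv_scale L2w_cscale unfolding Sobolev_def by blast
  fix v assume v: "v \<in> Sobolev n"
  show "u + v \<in> Sobolev n"
    using u v weak_deriv_add L2w.V_add unfolding Sobolev_def by blast
qed

lemma diff_op_3_linear: "linear_on (Sobolev 3) (diff_op 3)" and diff_op_3_in: "diff_op 3 ` Sobolev 3 \<subseteq> L2"
proof -
  show "diff_op 3 ` Sobolev 3 \<subseteq> L2" using Sobolev_3D L2w_cscale by (metis image_subsetI)
  show "linear_on (Sobolev 3) (diff_op 3)"
    unfolding linear_on_def
  proof (intro conjI ballI allI Sobolev_subspace)
    fix u assume u: "u \<in> Sobolev 3"
    obtain u3 where u3: "u \<in> L2" "u3 \<in> L2" "weak_deriv 3 u u3" "diff_op 3 u = \<i> *\<^sub>c u3"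
      using Sobolev_3D[OF u] by metis
    show "diff_op 3 (c *\<^sub>c u) = c *\<^sub>c diff_op 3 u" for c
      using diff_op_3_eq[OF cvec.subspace_scale[OF Sobolev_subspace u] L2w_cscale[OF u3(2)] weak_deriv_scale[OF u3(3,1,2)], of c]
      unfolding u3(4) by (simp add: mult.commute)
    fix v assume v: "v \<in> Sobolev 3"
    obtain v3 where v3: "v \<in> L2" "v3 \<in> L2" "weak_deriv 3 v v3" "diff_op 3 v = \<i> *\<^sub>c v3"
      using Sobolev_3D[OF v] by metis
    show "diff_op 3 (u + v) = diff_op 3 u + diff_op 3 v"
      using diff_op_3_eq[OF cvec.subspace_add[OF Sobolev_subspace u v] L2w.V_add[OF u3(2) v3(2)]
          weak_deriv_add[OF u3(3) v3(3) u3(1) v3(1) u3(2) v3(2)]]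
      unfolding u3(4) v3(4) by (simp add: cvec.scale_right_distrib)
  qed
qed

text \<open>The weak derivative is tested against functions in every dual space, so it survives limits in
  \<open>L2w b\<close> and determines the image.\<close>

lemma diff_op_3_closable:
  assumes b: "b \<le> 0"
  shows "closable_operator b (Sobolev 3) (diff_op 3)"
proof
  show "linear_on (Sobolev 3) (diff_op 3)" by (rule diff_op_3_linear)
  show "Sobolev 3 \<subseteq> L2w b" using L2w_mono(1)[OF b] by (auto simp: Sobolev_def)
  show "diff_op 3 ` Sobolev 3 \<subseteq> L2w b" using L2w_mono(1)[OF b] diff_op_3_in by auto
  have deriv: "weak_deriv 3 f ((- \<i>) *\<^sub>c g) \<and> g \<in> L2w b" if fg: "(f, g) \<in> closure_graph b (Sobolev 3) (diff_op 3)" for f g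
  proof -
    obtain u where u: "\<And>n. u n \<in> Sobolev 3" "L2w.conv b u f" "L2w.conv b (\<lambda>n. diff_op 3 (u n)) g"
      and in_X: "f \<in> L2w b" "g \<in> L2w b"
      using fg unfolding closure_graph_def by blast
    have wd: "weak_deriv 3 (u n) ((- \<i>) *\<^sub>c diff_op 3 (u n))" for n
    proof -
      obtain v where "weak_deriv 3 (u n) v" "diff_op 3 (u n) = \<i> *\<^sub>c v" using Sobolev_3D[OF u(1)[of n]] by metis
      then show ?thesis by simp
    qed
    have uX: "u n \<in> L2w b" "diff_op 3 (u n) \<in> L2w b" for n
      using u(1)[of n] L2w_mono(1)[OF b, of "u n"] L2w_mono(1)[OF b, of "diff_op 3 (u n)"] diff_op_3_in
      by (auto simp: Sobolev_def image_subset_iff)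
    have "weak_deriv 3 f ((- \<i>) *\<^sub>c g)"
      by (rule weak_deriv_limit[OF wd uX(1) L2w_cscale[OF uX(2)] in_X(1) L2w_cscale[OF in_X(2)] u(2)
            L2w.conv_scale[OF uX(2) in_X(2) u(3)]])
    with in_X show ?thesis by simp
  qed
  fix f g h assume "(f, g) \<in> closure_graph b (Sobolev 3) (diff_op 3)" "(f, h) \<in> closure_graph b (Sobolev 3) (diff_op 3)"
  from deriv[OF this(1)] deriv[OF this(2)] have "(- \<i>) *\<^sub>c g = (- \<i>) *\<^sub>c h"
    by (intro weak_deriv_unique[of 3 f _ _ b]) (auto intro: L2w_cscale)
  then show "g = h" by (simp add: cvec.scale_cancel_left)
qed

text \<open>The cube roots of \<open>z\<close>, given by their elementary symmetric functions, so that the identities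
  between them are polynomial.  For \<open>z\<close> in the upper half plane two of them lie in the upper and
  one in the lower half plane.\<close>

locale cubic_roots =
  fixes z k1 k2 k3 :: complex
  assumes Im_roots: "0 < Im k1" "0 < Im k2" "Im k3 < 0"
    and e1: "k1 + k2 + k3 = 0" and e2: "k1 * k2 + k1 * k3 + k2 * k3 = 0" and e3: "k1 * k2 * k3 = z"
begin

lemma roots_nonzero: "k1 \<noteq> 0" "k2 \<noteq> 0" "k3 \<noteq> 0" "z \<noteq> 0"
  using Im_roots e3 by auto

lemma root_power: "k1 ^ 3 = z" "k2 ^ 3 = z" "k3 ^ 3 = z"
  using e1 e2 e3 by algebra+

lemma inverse_sum: "1 / k1 + 1 / k2 + 1 / k3 = 0"
  using e2 roots_nonzero by (simp add: field_simps)

lemma inverse_square_sum: "1 / k1\<^sup>2 + 1 / k2\<^sup>2 + 1 / k3\<^sup>2 = 0"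
proof -
  have "(k2 * k3)\<^sup>2 + (k1 * k3)\<^sup>2 + (k1 * k2)\<^sup>2 = 0" using e1 e2 by algebra
  then show ?thesis using roots_nonzero by (simp add: field_simps power2_eq_square)
qed

text \<open>By partial fractions \<open>1 / (\<xi>\<^sup>3 - z)\<close> is the sum of \<open>1 / (3 k\<^sup>2 (\<xi> - k))\<close> over the cube roots \<open>k\<close>.\<close>

definition G :: "real \<Rightarrow> complex" where
  "G t = 1 / (3 * k1\<^sup>2) * expker k1 t + 1 / (3 * k2\<^sup>2) * expker k2 t + 1 / (3 * k3\<^sup>2) * expker k3 t"

lemma G_integrable: "integrable lborel G"
  unfolding G_def using Im_roots expker_integrable by (intro Bochner_Integration.integrable_add integrable_mult_right) auto

abbreviation "J1 \<equiv> conv_op (expker k1)"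
abbreviation "J2 \<equiv> conv_op (expker k2)"
abbreviation "J3 \<equiv> conv_op (expker k3)"
definition R0 :: "aefun \<Rightarrow> aefun" where "R0 = conv_op G"

lemma J_in: "u \<in> L2 \<Longrightarrow> J1 u \<in> L2" "u \<in> L2 \<Longrightarrow> J2 u \<in> L2" "u \<in> L2 \<Longrightarrow> J3 u \<in> L2"
  using bounded_op_in[OF conv_op_bounded[OF expker_integrable]] Im_roots by auto

lemma R0_bounded: "bounded_op 0 0 R0"
  unfolding R0_def by (rule conv_op_bounded[OF G_integrable])

lemma R0_eq:
  assumes u: "u \<in> L2"
  shows "R0 u = (1 / (3 * k1\<^sup>2)) *\<^sub>c J1 u + (1 / (3 * k2\<^sup>2)) *\<^sub>c J2 u + (1 / (3 * k3\<^sup>2)) *\<^sub>c J3 u"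
proof -
  have n: "Im k1 \<noteq> 0" "Im k2 \<noteq> 0" "Im k3 \<noteq> 0" using Im_roots by auto
  define j where "j k x = (LINT y|lborel. expker k (x - y) * rep_aefun u y)" for k x
  have jm [measurable]: "j k \<in> borel_measurable borel" for k unfolding j_def by measurable
  have "AE x in lborel. (LINT y|lborel. G (x - y) * rep_aefun u y) =
     1 / (3 * k1\<^sup>2) * j k1 x + 1 / (3 * k2\<^sup>2) * j k2 x + 1 / (3 * k3\<^sup>2) * j k3 x"
    using conv_AE_integrable[OF expker_integrable[OF n(1)] u] conv_AE_integrable[OF expker_integrable[OF n(2)] u]
      conv_AE_integrable[OF expker_integrable[OF n(3)] u]
  proof eventually_elim
    case (elim x)
    have "(LINT y|lborel. G (x - y) * rep_aefun u y) = (LINT y|lborel. 1 / (3 * k1\<^sup>2) * (expker k1 (x - y) * rep_aefun u y)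
        + 1 / (3 * k2\<^sup>2) * (expker k2 (x - y) * rep_aefun u y) + 1 / (3 * k3\<^sup>2) * (expker k3 (x - y) * rep_aefun u y))"
      by (rule Bochner_Integration.integral_cong) (auto simp: G_def algebra_simps)
    then show ?case using elim unfolding j_def
      by (simp only: Bochner_Integration.integral_add Bochner_Integration.integrable_add integrable_mult_right integral_mult_right_zero)
  qed
  moreover have "(\<lambda>x. LINT y|lborel. G (x - y) * rep_aefun u y) \<in> borel_measurable borel"
    unfolding G_def by measurable
  ultimately have "R0 u = abs_aefun (\<lambda>x. 1 / (3 * k1\<^sup>2) * j k1 x + 1 / (3 * k2\<^sup>2) * j k2 x + 1 / (3 * k3\<^sup>2) * j k3 x)"
    unfolding R0_def conv_op_def by (intro abs_aefun_eqI) auto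
  then show ?thesis
    unfolding conv_op_def j_def[symmetric] by (simp add: cscale.abs_eq plus_aefun.abs_eq ae_eq_refl)
qed

lemma combination_weak_deriv:
  assumes u: "u \<in> L2"
  shows "weak_deriv 1 (a1 *\<^sub>c J1 u + a2 *\<^sub>c J2 u + a3 *\<^sub>c J3 u)
    ((\<i> * (a1 + a2 + a3)) *\<^sub>c u + ((\<i> * k1 * a1) *\<^sub>c J1 u + (\<i> * k2 * a2) *\<^sub>c J2 u + (\<i> * k3 * a3) *\<^sub>c J3 u))"
proof -
  have n: "Im k1 \<noteq> 0" "Im k2 \<noteq> 0" "Im k3 \<noteq> 0" using Im_roots by auto
  note w = expker_weak_deriv[OF n(1) u] expker_weak_deriv[OF n(2) u] expker_weak_deriv[OF n(3) u]
  note J = J_in[OF u]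
  have in_L2: "\<i> *\<^sub>c u + (\<i> * k) *\<^sub>c v \<in> L2" if "v \<in> L2" for v k using u that by (intro L2w.V_add L2w_cscale)
  have "weak_deriv 1 (a1 *\<^sub>c J1 u + a2 *\<^sub>c J2 u + a3 *\<^sub>c J3 u)
     (a1 *\<^sub>c (\<i> *\<^sub>c u + (\<i> * k1) *\<^sub>c J1 u) + a2 *\<^sub>c (\<i> *\<^sub>c u + (\<i> * k2) *\<^sub>c J2 u) + a3 *\<^sub>c (\<i> *\<^sub>c u + (\<i> * k3) *\<^sub>c J3 u))"
    using J in_L2 u
    by (intro weak_deriv_add[where s = 0] weak_deriv_scale[where s = 0] w L2w.V_add L2w_cscale) auto
  moreover have "a1 *\<^sub>c (\<i> *\<^sub>c u + (\<i> * k1) *\<^sub>c J1 u) + a2 *\<^sub>c (\<i> *\<^sub>c u + (\<i> * k2) *\<^sub>c J2 u) + a3 *\<^sub>c (\<i> *\<^sub>c u + (\<i> * k3) *\<^sub>c J3 u)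
    = (\<i> * (a1 + a2 + a3)) *\<^sub>c u + ((\<i> * k1 * a1) *\<^sub>c J1 u + (\<i> * k2 * a2) *\<^sub>c J2 u + (\<i> * k3 * a3) *\<^sub>c J3 u)"
    by (simp add: cvec.scale_right_distrib cvec.scale_left_distrib distrib_left mult_ac add_ac)
  ultimately show ?thesis by simp
qed

text \<open>Each derivative of \<open>a1 J1 u + a2 J2 u + a3 J3 u\<close> multiplies the coefficients by \<open>i k\<close> and adds
  \<open>i (a1 + a2 + a3) u\<close>.  The sums of \<open>1 / k\<^sup>2\<close> and \<open>1 / k\<close> over the roots vanish, so \<open>u\<close> enters only
  in the third derivative.\<close>

lemma R0_solves:
  assumes u: "u \<in> L2"
  shows "R0 u \<in> Sobolev 3" "diff_op 3 (R0 u) - z *\<^sub>c R0 u = u"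
proof -
  note nz = roots_nonzero
  define c1 c2 c3 where "c1 = 1 / (3 * k1\<^sup>2)" and "c2 = 1 / (3 * k2\<^sup>2)" and "c3 = 1 / (3 * k3\<^sup>2)"
  have R0: "R0 u = c1 *\<^sub>c J1 u + c2 *\<^sub>c J2 u + c3 *\<^sub>c J3 u" using R0_eq[OF u] by (simp add: c1_def c2_def c3_def)
  have s0: "c1 + c2 + c3 = 0"
  proof -
    have "c1 + c2 + c3 = (1 / k1\<^sup>2 + 1 / k2\<^sup>2 + 1 / k3\<^sup>2) / 3"
      by (simp add: c1_def c2_def c3_def add_divide_distrib mult.commute)
    then show ?thesis by (simp add: inverse_square_sum)
  qed
  have s1: "\<i> * k1 * c1 + \<i> * k2 * c2 + \<i> * k3 * c3 = 0"
  proof -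
    have "\<i> * k1 * c1 + \<i> * k2 * c2 + \<i> * k3 * c3 = \<i> / 3 * (1 / k1 + 1 / k2 + 1 / k3)"
      using nz by (simp add: c1_def c2_def c3_def power2_eq_square distrib_left)
    then show ?thesis by (simp add: inverse_sum)
  qed
  have c_sq: "\<i> * k1 * (\<i> * k1 * c1) = - 1 / 3" "\<i> * k2 * (\<i> * k2 * c2) = - 1 / 3" "\<i> * k3 * (\<i> * k3 * c3) = - 1 / 3"
    using nz by (auto simp: c1_def c2_def c3_def power2_eq_square)
  have "z * c1 = k1 / 3" "z * c2 = k2 / 3" "z * c3 = k3 / 3"
    using nz root_power by (simp_all add: c1_def c2_def c3_def power3_eq_cube power2_eq_square field_simps)
  then have c_cube: "\<i> * k1 * (- 1 / 3) = - (\<i> * z) * c1" "\<i> * k2 * (- 1 / 3) = - (\<i> * z) * c2"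
    "\<i> * k3 * (- 1 / 3) = - (\<i> * z) * c3"
    by (simp_all add: mult.assoc)
  note J = J_in[OF u]
  define v1 v2 v3 where "v1 = (\<i> * k1 * c1) *\<^sub>c J1 u + (\<i> * k2 * c2) *\<^sub>c J2 u + (\<i> * k3 * c3) *\<^sub>c J3 u"
    and "v2 = (- 1 / 3) *\<^sub>c J1 u + (- 1 / 3) *\<^sub>c J2 u + (- 1 / 3) *\<^sub>c J3 u"
    and "v3 = (- \<i>) *\<^sub>c u + (- (\<i> * z)) *\<^sub>c R0 u"
  have w1: "weak_deriv 1 (R0 u) v1"
    using combination_weak_deriv[OF u, of c1 c2 c3] unfolding s0 R0 v1_def by simp
  have w2: "weak_deriv 1 v1 v2"
    using combination_weak_deriv[OF u, of "\<i> * k1 * c1" "\<i> * k2 * c2" "\<i> * k3 * c3"]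
    unfolding s1 c_sq v1_def v2_def by simp
  have w3: "weak_deriv 1 v2 v3"
    using combination_weak_deriv[OF u, of "- 1 / 3" "- 1 / 3" "- 1 / 3"]
    unfolding c_cube v2_def v3_def R0
    by (simp add: cvec.scale_right_distrib)
  have w12: "weak_deriv 2 (R0 u) v2" using weak_deriv_comp[OF w1 w2, unfolded one_add_one] .
  have w13: "weak_deriv 3 (R0 u) v3" using weak_deriv_comp[OF w12 w3] by simp
  have R0_in: "R0 u \<in> L2" by (rule bounded_op_in[OF R0_bounded u])
  have v_in: "v1 \<in> L2" "v2 \<in> L2" "v3 \<in> L2"
    unfolding v1_def v2_def v3_def using J u R0_in by (intro L2w.V_add L2w_cscale; simp)+
  show S: "R0 u \<in> Sobolev 3"
    unfolding Sobolev_def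
  proof (intro CollectI conjI R0_in allI impI)
    fix k :: nat assume "k \<le> 3"
    then consider "k = 0" | "k = 1" | "k = 2" | "k = 3" by linarith
    then show "\<exists>v\<in>L2. weak_deriv k (R0 u) v"
      using weak_deriv_0 R0_in w1 w12 w13 v_in by cases blast+
  qed
  show "diff_op 3 (R0 u) - z *\<^sub>c R0 u = u"
    unfolding diff_op_3_eq[OF S v_in(3) w13] v3_def cvec.scale_right_distrib cvec.scale_scale
    by (simp flip: mult.assoc)
qed

text \<open>Since the symbol factors as \<open>(\<xi> - k1) (\<xi> - k2) (\<xi> - k3)\<close>, injectivity follows by peeling off
  one first-order factor at a time.\<close>

lemma diff_op_3_injective:
  assumes u: "u \<in> Sobolev 3" and eq: "diff_op 3 u - z *\<^sub>c u = 0"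
  shows "u = 0"
proof -
  obtain v1 v2 v3 where v: "u \<in> L2" "v1 \<in> L2" "v2 \<in> L2" "v3 \<in> L2"
    "weak_deriv 1 u v1" "weak_deriv 2 u v2" "weak_deriv 3 u v3" "diff_op 3 u = \<i> *\<^sub>c v3"
    using Sobolev_3D[OF u] by metis
  have "\<i> *\<^sub>c v3 = z *\<^sub>c u" using eq v(8) by simp
  then have "(- \<i>) *\<^sub>c (\<i> *\<^sub>c v3) = (- \<i>) *\<^sub>c (z *\<^sub>c u)" by simp
  then have v3: "v3 = (- \<i> * z) *\<^sub>c u" by simp
  have d12: "weak_deriv 1 v1 v2" using weak_deriv_cancel[OF v(5), of 1 v2, unfolded one_add_one] v(6) .
  have d23: "weak_deriv 1 v2 v3" using weak_deriv_cancel[OF v(6), of 1 v3] v(7) by simp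
  have Re: "Re (\<i> * k1) \<noteq> 0" "Re (\<i> * k2) \<noteq> 0" "Re (\<i> * k3) \<noteq> 0" using Im_roots by auto
  have e1': "k2 + k3 = - k1" using e1 by (simp add: eq_neg_iff_add_eq_0 add.commute add.left_commute)
  define w where "w = (- 1) *\<^sub>c v2 + ((\<i> * (k2 + k3)) *\<^sub>c v1 + (k2 * k3) *\<^sub>c u)"
  have w_in: "w \<in> L2" unfolding w_def using v by (intro L2w.V_add L2w_cscale) auto
  have "weak_deriv 1 w ((- 1) *\<^sub>c v3 + ((\<i> * (k2 + k3)) *\<^sub>c v2 + (k2 * k3) *\<^sub>c v1))"
    unfolding w_def using v d12 d23
    by (intro weak_deriv_add[where s = 0] weak_deriv_scale[where s = 0] L2w.V_add L2w_cscale) auto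
  moreover have "(- 1) *\<^sub>c v3 + ((\<i> * (k2 + k3)) *\<^sub>c v2 + (k2 * k3) *\<^sub>c v1) = (\<i> * k1) *\<^sub>c w"
  proof -
    have "\<i> * k1 * (\<i> * (k2 + k3)) = k2 * k3" using e2 by (simp add: algebra_simps)  (metis add.commute add.left_commute eq_neg_iff_add_eq_0)
    moreover have "\<i> * k1 * (k2 * k3) = \<i> * z" using e3 by (simp add: mult.assoc)
    ultimately show ?thesis
      unfolding w_def v3 cvec.scale_right_distrib cvec.scale_scale e1' by (simp add: mult.assoc)
  qed
  ultimately have "w = 0" using first_order_injective[OF w_in Re(1)] by simp
  then have v2: "v2 = (\<i> * (k2 + k3)) *\<^sub>c v1 + (k2 * k3) *\<^sub>c u"
    unfolding w_def by (simp add: cvec.scale_minus_left)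
  define y where "y = (- \<i>) *\<^sub>c v1 + (- k3) *\<^sub>c u"
  have y_in: "y \<in> L2" unfolding y_def using v by (intro L2w.V_add L2w_cscale) auto
  have "weak_deriv 1 y ((- \<i>) *\<^sub>c v2 + (- k3) *\<^sub>c v1)"
    unfolding y_def using v d12
    by (intro weak_deriv_add[where s = 0] weak_deriv_scale[where s = 0] L2w.V_add L2w_cscale) auto
  moreover have "(- \<i>) *\<^sub>c v2 + (- k3) *\<^sub>c v1 = (\<i> * k2) *\<^sub>c y"
  proof -
    have "(- \<i>) *\<^sub>c v2 + (- k3) *\<^sub>c v1 = (k2 + k3 + - k3) *\<^sub>c v1 + (- \<i> * (k2 * k3)) *\<^sub>c u"
      unfolding v2 cvec.scale_right_distrib cvec.scale_scale cvec.scale_left_distrib[of "k2 + k3"] by (simp add: algebra_simps)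
    also have "\<dots> = (\<i> * k2) *\<^sub>c y"
    proof -
      have "\<i> * k2 * (- \<i>) = k2" "\<i> * k2 * (- k3) = - \<i> * (k2 * k3)" "k2 + k3 + - k3 = k2" by (auto simp: algebra_simps)
      then show ?thesis unfolding y_def cvec.scale_right_distrib cvec.scale_scale by simp
    qed
    finally show ?thesis .
  qed
  ultimately have "y = 0" using first_order_injective[OF y_in Re(2)] by simp
  then have "\<i> *\<^sub>c y = 0" by simp
  then have "v1 = (\<i> * k3) *\<^sub>c u"
    unfolding y_def cvec.scale_right_distrib cvec.scale_scale by (simp add: cvec.scale_minus_left)
  then show "u = 0" using first_order_injective[OF v(1) Re(3)] v(5) by simp
qed

end

section \<open>The regularized resolvent kernel\<close>

lemma vector_mean_value_bound:
  fixes f :: "real \<Rightarrow> complex"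
  assumes f: "\<And>t. t \<in> closed_segment x y \<Longrightarrow> (f has_vector_derivative f' t) (at t)"
    and B: "\<And>t. t \<in> closed_segment x y \<Longrightarrow> cmod (f' t) \<le> B"
  shows "cmod (f x - f y) \<le> B * \<bar>x - y\<bar>"
proof -
  have "norm (f x - f y) \<le> B * norm (x - y)"
  proof (rule differentiable_bound[of "closed_segment x y" f "\<lambda>t h. h *\<^sub>R f' t"])
    show "(f has_derivative (\<lambda>h. h *\<^sub>R f' t)) (at t within closed_segment x y)" if "t \<in> closed_segment x y" for t
      using f[OF that] by (simp add: has_vector_derivative_def has_derivative_at_withinI)
    show "onorm (\<lambda>h. h *\<^sub>R f' t) \<le> B" if "t \<in> closed_segment x y" for t
    proof (rule onorm_le)
      fix h show "norm (h *\<^sub>R f' t) \<le> B * norm h"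
        using mult_right_mono[OF B[OF that], of "\<bar>h\<bar>"] by (simp add: mult.commute)
    qed
  qed auto
  then show ?thesis by simp
qed

lemma has_vector_derivative_glue:
  fixes f :: "real \<Rightarrow> complex"
  assumes "(f has_vector_derivative d) (at 0 within {..0})" "(f has_vector_derivative d) (at 0 within {0..})"
  shows "(f has_vector_derivative d) (at 0)"
proof -
  have "at (0::real) = sup (at 0 within {..0}) (at 0 within {0..})"
  proof -
    have "{..0} \<union> {0..} = (UNIV :: real set)" by auto
    then show ?thesis by (metis at_within_union)
  qed
  then show ?thesis
    using assms unfolding has_vector_derivative_def has_derivative_within by (simp add: filterlim_sup)
qed

text \<open>The second-order Taylor remainder of \<open>exp (i k t)\<close>, scaled so that it has a finite limit as \<open>k\<close>
  tends to \<open>0\<close>.\<close>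

definition taylor_exp :: "complex \<Rightarrow> real \<Rightarrow> complex" where
  "taylor_exp k t = (exp (\<i> * k * of_real t) - 1 - \<i> * k * of_real t) / k\<^sup>2"

lemma taylor_exp_deriv:
  assumes "k \<noteq> 0"
  shows "(taylor_exp k has_vector_derivative \<i> * (exp (\<i> * k * of_real t) - 1) / k) (at t)"
  unfolding taylor_exp_def
  by (rule has_vector_derivative_real_field[where f = "\<lambda>x. (exp (\<i> * k * x) - 1 - \<i> * k * x) / k\<^sup>2"])
     (use assms in \<open>auto intro!: derivative_eq_intros simp: field_simps power2_eq_square\<close>)

lemma exp_i_lipschitz:
  assumes "0 \<le> Im k * x" "0 \<le> Im k * y"
  shows "cmod (exp (\<i> * k * of_real x) - exp (\<i> * k * of_real y)) \<le> cmod k * \<bar>x - y\<bar>"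
proof (rule vector_mean_value_bound)
  fix t assume t: "t \<in> closed_segment x y"
  show "((\<lambda>t. exp (\<i> * k * of_real t)) has_vector_derivative \<i> * k * exp (\<i> * k * of_real t)) (at t)"
    by (rule has_vector_derivative_real_field[where f = "\<lambda>t. exp (\<i> * k * t)"]) (auto intro!: derivative_eq_intros)
  have "0 \<le> Im k * t"
  proof -
    obtain u where u: "0 \<le> u" "u \<le> 1" "t = (1 - u) * x + u * y" using t by (auto simp: closed_segment_def)
    have "Im k * t = (1 - u) * (Im k * x) + u * (Im k * y)" by (simp add: u(3) algebra_simps)
    then show ?thesis using u assms by simp
  qed
  then show "cmod (\<i> * k * exp (\<i> * k * of_real t)) \<le> cmod k"
    unfolding norm_mult norm_exp_i by (simp add: mult_left_le)
qed

lemma exp_i_minus_1: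
  assumes "0 \<le> Im k * x" "k \<noteq> 0"
  shows "cmod ((exp (\<i> * k * of_real x) - 1) / k) \<le> 2 / cmod k"
proof -
  have "cmod (exp (\<i> * k * of_real x) - 1) \<le> cmod (exp (\<i> * k * of_real x)) + cmod 1" by (rule norm_triangle_ineq4)
  also have "\<dots> \<le> 2" unfolding norm_exp_i using assms by simp
  finally show ?thesis by (simp add: norm_divide divide_right_mono)
qed

text \<open>The part of \<open>G\<close> that remains after its affine singular part \<open>a + b t\<close>, see \<open>G_eq\<close>; \<open>gker'\<close> is its
  derivative.\<close>

definition gker :: "complex \<Rightarrow> complex \<Rightarrow> complex \<Rightarrow> real \<Rightarrow> complex" where
  "gker k1 k2 k3 t = (if 0 \<le> t then \<i> / 3 * (taylor_exp k1 t + taylor_exp k2 t) else - (\<i> / 3) * taylor_exp k3 t)"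

definition gker' :: "complex \<Rightarrow> complex \<Rightarrow> complex \<Rightarrow> real \<Rightarrow> complex" where
  "gker' k1 k2 k3 t = (if 0 \<le> t then - (1 / 3) * ((exp (\<i> * k1 * of_real t) - 1) / k1 + (exp (\<i> * k2 * of_real t) - 1) / k2)
     else 1 / 3 * ((exp (\<i> * k3 * of_real t) - 1) / k3))"

text \<open>The pairing with the indicator function that carries the rank one regularization.\<close>

definition average :: "(real \<Rightarrow> complex) \<Rightarrow> complex" where
  "average f = (LINT t|lborel. indicator {- (1/2)..1/2} t *\<^sub>R f t)"

lemma average_integrable: "continuous_on UNIV f \<Longrightarrow> integrable lborel (\<lambda>t. indicator {- (1/2)..1/2::real} t *\<^sub>R (f t :: complex))"
  by (intro borel_integrable_compact) (auto intro: continuous_on_subset)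

lemma average_const: "average (\<lambda>_. c) = c"
proof -
  have "average (\<lambda>_. c) = (LINT t|lborel. indicator {- (1/2)..1/2::real} t) *\<^sub>R c"
    unfolding average_def by (rule integral_scaleR_left) (simp add: integrable_indicator_iff emeasure_lborel_Icc_eq)
  then show ?thesis by simp
qed

lemma average_add: "continuous_on UNIV f \<Longrightarrow> continuous_on UNIV g \<Longrightarrow> average (\<lambda>t. f t + g t) = average f + average g"
  unfolding average_def by (simp add: average_integrable scaleR_add_right)

lemma average_diff: "continuous_on UNIV f \<Longrightarrow> continuous_on UNIV g \<Longrightarrow> average (\<lambda>t. f t - g t) = average f - average g"
  unfolding average_def by (simp add: average_integrable scaleR_diff_right)

lemma average_cmult: "average (\<lambda>t. c * f t) = c * average f"
  unfolding average_def by (simp flip: integral_mult_right_zero)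

lemma average_le:
  assumes "continuous_on UNIV f" "\<And>t. \<bar>t\<bar> \<le> 1/2 \<Longrightarrow> cmod (f t) \<le> B"
  shows "cmod (average f) \<le> B"
proof -
  have "cmod (average f) \<le> (LINT t|lborel. B * indicator {- (1/2)..1/2::real} t)"
    unfolding average_def
  proof (rule order_trans[OF integral_norm_bound integral_mono])
    show "integrable lborel (\<lambda>t. norm (indicator {- (1/2)..1/2::real} t *\<^sub>R f t))"
      by (intro integrable_norm average_integrable assms(1))
    show "integrable lborel (\<lambda>t. B * indicator {- (1/2)..1/2::real} t)"
      by (intro integrable_mult_right) (simp add: integrable_indicator_iff emeasure_lborel_Icc_eq)
  qed (use assms(2) in \<open>auto simp: indicator_def abs_le_iff\<close>)
  then show ?thesis by simp
qed

lemma average_close: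
  assumes "continuous_on UNIV f" "\<And>t. \<bar>t\<bar> \<le> 1/2 \<Longrightarrow> cmod (f t - c) \<le> B"
  shows "cmod (average f - c) \<le> B"
  using average_le[of "\<lambda>t. f t - c" B] average_diff[of f "\<lambda>_. c"] assms
  by (simp add: average_const continuous_on_diff)

lemma average_odd: "average (\<lambda>t. of_real t) = 0"
proof -
  have "average (\<lambda>t. of_real t) = (LINT t|lborel. indicator {- (1/2)..1/2::real} (- t) *\<^sub>R of_real (- t))"
    unfolding average_def using lborel_integral_real_affine[of "-1" "\<lambda>t. indicator {- (1/2)..1/2::real} t *\<^sub>R (of_real t :: complex)" 0] by simp
  also have "\<dots> = - average (\<lambda>t. of_real t)"
    unfolding average_def by (subst integral_minus[symmetric], rule Bochner_Integration.integral_cong) (auto simp: indicator_def)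
  finally show ?thesis by simp
qed

lemma average_tendsto:
  assumes "\<And>n. continuous_on UNIV (f n)" "\<And>t. (\<lambda>n. f n t) \<longlonglongrightarrow> g t"
    and "\<And>n t. \<bar>t\<bar> \<le> 1/2 \<Longrightarrow> cmod (f n t) \<le> B"
  shows "(\<lambda>n. average (f n)) \<longlonglongrightarrow> average g"
  unfolding average_def
proof (rule integral_dominated_convergence[where w = "\<lambda>t. B * indicator {- (1/2)..1/2::real} t"])
  have [measurable]: "f n \<in> borel_measurable borel" for n by (rule borel_measurable_continuous_onI[OF assms(1)])
  have [measurable]: "g \<in> borel_measurable borel" by (rule borel_measurable_LIMSEQ_metric[OF _ assms(2)]) measurable
  show "(\<lambda>t. indicator {- (1/2)..1/2::real} t *\<^sub>R g t) \<in> borel_measurable lborel" by measurable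
  show "(\<lambda>t. indicator {- (1/2)..1/2::real} t *\<^sub>R f n t) \<in> borel_measurable lborel" for n by measurable
  show "integrable lborel (\<lambda>t. B * indicator {- (1/2)..1/2::real} t)"
    by (intro integrable_mult_right) (simp add: integrable_indicator_iff emeasure_lborel_Icc_eq)
  show "AE t in lborel. (\<lambda>n. indicator {- (1/2)..1/2::real} t *\<^sub>R f n t) \<longlonglongrightarrow> indicator {- (1/2)..1/2::real} t *\<^sub>R g t"
    by (intro AE_I2 tendsto_scaleR tendsto_const assms(2))
  show "AE t in lborel. norm (indicator {- (1/2)..1/2::real} t *\<^sub>R f n t) \<le> B * indicator {- (1/2)..1/2::real} t" for n
    using assms(3) by (intro AE_I2) (auto simp: indicator_def abs_le_iff)
qed

text \<open>With \<open>w\<close> the indicator function of the unit interval, convolving \<open>G\<close> with \<open>w\<close> on either side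
  gives \<open>a + b x + p x\<close> and \<open>a - b y + q y\<close>, and \<open>1\<close> plus the pairing of \<open>w\<close> with the former is
  \<open>a + d\<close>.  So \<open>Hker\<close> is the kernel of the resolvent of \<open>A\<close> plus the projection onto \<open>w\<close>, by the
  rank one formula.\<close>

definition pker where "pker k1 k2 k3 x = average (\<lambda>t. gker k1 k2 k3 (x - t))"
definition qker where "qker k1 k2 k3 y = average (\<lambda>r. gker k1 k2 k3 (r - y))"
definition dker where "dker k1 k2 k3 = 1 + average (pker k1 k2 k3)"
definition aker :: "complex \<Rightarrow> complex" where "aker k3 = - \<i> / (3 * k3\<^sup>2)"
definition bker :: "complex \<Rightarrow> complex" where "bker k3 = 1 / (3 * k3)"

definition Hker :: "complex \<Rightarrow> complex \<Rightarrow> complex \<Rightarrow> real \<Rightarrow> real \<Rightarrow> complex" where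
  "Hker k1 k2 k3 x y = aker k3 + bker k3 * of_real (x - y) + gker k1 k2 k3 (x - y)
     - (aker k3 + bker k3 * of_real x + pker k1 k2 k3 x) * (aker k3 - bker k3 * of_real y + qker k1 k2 k3 y)
       / (aker k3 + dker k1 k2 k3)"

context cubic_roots
begin

abbreviation "g \<equiv> gker k1 k2 k3"
abbreviation "g' \<equiv> gker' k1 k2 k3"
abbreviation "p \<equiv> pker k1 k2 k3"
abbreviation "q \<equiv> qker k1 k2 k3"
abbreviation "d \<equiv> dker k1 k2 k3"
abbreviation "a \<equiv> aker k3"
abbreviation "b \<equiv> bker k3"

lemma norm_roots: "cmod k1 = root 3 (cmod z)" "cmod k2 = root 3 (cmod z)" "cmod k3 = root 3 (cmod z)"
proof -
  have "cmod k = root 3 (cmod (k ^ 3))" for k by (simp add: norm_power real_root_power_cancel)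
  then show "cmod k1 = root 3 (cmod z)" "cmod k2 = root 3 (cmod z)" "cmod k3 = root 3 (cmod z)"
    by (metis root_power(1), metis root_power(2), metis root_power(3))
qed

lemma norm_eq: "cmod k2 = cmod k1" "cmod k3 = cmod k1" using norm_roots by auto

lemma G_eq: "G t = a + b * of_real t + g t"
proof -
  have s: "1 / k1\<^sup>2 + 1 / k2\<^sup>2 = - 1 / k3\<^sup>2" "1 / k1 + 1 / k2 = - 1 / k3"
    using inverse_square_sum inverse_sum by (simp_all add: eq_neg_iff_add_eq_0)
  have E: "taylor_exp k t = exp (\<i> * k * of_real t) / k\<^sup>2 - 1 / k\<^sup>2 - \<i> * of_real t * (1 / k)" if "k \<noteq> 0" for k
    using that by (simp add: taylor_exp_def diff_divide_distrib power2_eq_square)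
  show ?thesis
  proof (cases "0 \<le> t")
    case True
    have "g t = \<i> / 3 * (exp (\<i> * k1 * of_real t) / k1\<^sup>2 + exp (\<i> * k2 * of_real t) / k2\<^sup>2
        - (1 / k1\<^sup>2 + 1 / k2\<^sup>2) - \<i> * of_real t * (1 / k1 + 1 / k2))"
      unfolding gker_def E[OF roots_nonzero(1)] E[OF roots_nonzero(2)] using True by (simp add: algebra_simps)
    then show ?thesis unfolding s
      using True Im_roots by (simp add: G_def expker_def aker_def bker_def algebra_simps)
  next
    case False
    have "g t = - (\<i> / 3) * (exp (\<i> * k3 * of_real t) / k3\<^sup>2 - 1 / k3\<^sup>2 - \<i> * of_real t * (1 / k3))"
      unfolding gker_def E[OF roots_nonzero(3)] using False by simp
    then show ?thesis
      using False Im_roots by (simp add: G_def expker_def aker_def bker_def algebra_simps)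
  qed
qed

lemma g_deriv: "(g has_vector_derivative g' t) (at t)"
proof -
  have R: "((\<lambda>t. \<i> / 3 * (taylor_exp k1 t + taylor_exp k2 t)) has_vector_derivative
      - (1 / 3) * ((exp (\<i> * k1 * of_real t) - 1) / k1 + (exp (\<i> * k2 * of_real t) - 1) / k2)) (at t)" for t
    using has_vector_derivative_mult_right[OF has_vector_derivative_add[OF
        taylor_exp_deriv[OF roots_nonzero(1), of t] taylor_exp_deriv[OF roots_nonzero(2), of t]], of "\<i> / 3"]
    by (simp add: algebra_simps)
  have L: "((\<lambda>t. - (\<i> / 3) * taylor_exp k3 t) has_vector_derivative
      1 / 3 * ((exp (\<i> * k3 * of_real t) - 1) / k3)) (at t)" for t
    using has_vector_derivative_mult_right[OF taylor_exp_deriv[OF roots_nonzero(3), of t], of "- (\<i> / 3)"]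
    by (simp add: algebra_simps)
  consider "t > 0" | "t < 0" | "t = 0" by linarith
  then show ?thesis
  proof cases
    case 1
    have "(g has_vector_derivative - (1 / 3) * ((exp (\<i> * k1 * of_real t) - 1) / k1 + (exp (\<i> * k2 * of_real t) - 1) / k2)) (at t)"
      by (rule has_vector_derivative_transform_within_open[OF R, of "{0<..}"]) (use 1 in \<open>auto simp: gker_def\<close>)
    then show ?thesis using 1 by (simp add: gker'_def)
  next
    case 2
    have "(g has_vector_derivative 1 / 3 * ((exp (\<i> * k3 * of_real t) - 1) / k3)) (at t)"
      by (rule has_vector_derivative_transform_within_open[OF L, of "{..<0}"]) (use 2 in \<open>auto simp: gker_def\<close>)
    then show ?thesis using 2 by (simp add: gker'_def)
  next
    case 3
    have "(g has_vector_derivative 0) (at 0)"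
    proof (rule has_vector_derivative_glue)
      have "((\<lambda>t. - (\<i> / 3) * taylor_exp k3 t) has_vector_derivative 0) (at 0 within {..0})"
        using has_vector_derivative_at_within[OF L[of 0]] by simp
      then show "(g has_vector_derivative 0) (at 0 within {..0})"
        by (rule has_vector_derivative_transform[rotated 2]) (auto simp: gker_def taylor_exp_def)
      have "((\<lambda>t. \<i> / 3 * (taylor_exp k1 t + taylor_exp k2 t)) has_vector_derivative 0) (at 0 within {0..})"
        using has_vector_derivative_at_within[OF R[of 0]] by simp
      then show "(g has_vector_derivative 0) (at 0 within {0..})"
        by (rule has_vector_derivative_transform[rotated 2]) (auto simp: gker_def)
    qed
    then show ?thesis using 3 by (simp add: gker'_def)
  qed
qed

lemma g_continuous: "continuous_on UNIV g"
  using g_deriv has_vector_derivative_continuous by (intro continuous_at_imp_continuous_on) blast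

lemma g_0 [simp]: "g 0 = 0" and g'_0 [simp]: "g' 0 = 0"
  by (auto simp: gker_def taylor_exp_def gker'_def)

text \<open>The constant is independent of the roots: this is the regularity of \<open>g\<close> at \<open>z = 0\<close>.\<close>

lemma g'_lipschitz: "cmod (g' x - g' y) \<le> 2 / 3 * \<bar>x - y\<bar>"
proof -
  have e: "cmod ((exp (\<i> * k * of_real x) - 1) / k - (exp (\<i> * k * of_real y) - 1) / k) \<le> \<bar>x - y\<bar>"
    if "0 \<le> Im k * x" "0 \<le> Im k * y" "k \<noteq> 0" for k x y
  proof -
    have "cmod ((exp (\<i> * k * of_real x) - 1) / k - (exp (\<i> * k * of_real y) - 1) / k)
        = cmod (exp (\<i> * k * of_real x) - exp (\<i> * k * of_real y)) / cmod k"
      by (simp add: norm_divide flip: diff_divide_distrib)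
    also have "\<dots> \<le> cmod k * \<bar>x - y\<bar> / cmod k"
      by (intro divide_right_mono exp_i_lipschitz that) simp
    finally show ?thesis using that by simp
  qed
  have pos: "cmod (g' x - g' y) \<le> 2 / 3 * \<bar>x - y\<bar>" if "0 \<le> x" "0 \<le> y" for x y
  proof -
    let ?D = "\<lambda>k. (exp (\<i> * k * of_real x) - 1) / k - (exp (\<i> * k * of_real y) - 1) / k"
    have "g' x - g' y = - (1 / 3) * (?D k1 + ?D k2)" using that by (simp add: gker'_def algebra_simps)
    then have "cmod (g' x - g' y) = 1 / 3 * cmod (?D k1 + ?D k2)" by (simp only: norm_mult) simp
    also have "\<dots> \<le> 1 / 3 * (\<bar>x - y\<bar> + \<bar>x - y\<bar>)"
      using that Im_roots roots_nonzero
      by (intro mult_left_mono norm_triangle_le add_mono e) (auto intro: mult_nonneg_nonneg less_imp_le)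
    finally show ?thesis by simp
  qed
  have neg: "cmod (g' x - g' y) \<le> 1 / 3 * \<bar>x - y\<bar>" if "x \<le> 0" "y \<le> 0" for x y
  proof -
    have g'_neg: "g' t = 1 / 3 * ((exp (\<i> * k3 * of_real t) - 1) / k3)" if "t \<le> 0" for t
      using that by (auto simp: gker'_def)
    have "g' x - g' y = 1 / 3 * ((exp (\<i> * k3 * of_real x) - 1) / k3 - (exp (\<i> * k3 * of_real y) - 1) / k3)"
      unfolding g'_neg[OF that(1)] g'_neg[OF that(2)] by (simp add: algebra_simps)
    then have "cmod (g' x - g' y) = 1 / 3 * cmod ((exp (\<i> * k3 * of_real x) - 1) / k3 - (exp (\<i> * k3 * of_real y) - 1) / k3)"
      by (simp only: norm_mult) simp
    also have "\<dots> \<le> 1 / 3 * \<bar>x - y\<bar>"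
      using that Im_roots roots_nonzero by (intro mult_left_mono e) (auto intro: mult_nonpos_nonpos less_imp_le)
    finally show ?thesis .
  qed
  have mixed: "cmod (g' x - g' y) \<le> 2 / 3 * \<bar>x - y\<bar>" if "y \<le> 0" "0 \<le> x" for x y
  proof -
    have "cmod (g' x - g' y) \<le> cmod (g' x - g' 0) + cmod (g' 0 - g' y)" using norm_triangle_ineq[of "g' x - g' 0" "g' 0 - g' y"] by simp
    also have "\<dots> \<le> 2 / 3 * \<bar>x - 0\<bar> + 1 / 3 * \<bar>0 - y\<bar>" by (intro add_mono pos neg) (use that in auto)
    also have "\<dots> \<le> 2 / 3 * \<bar>x - y\<bar>" using that by simp
    finally show ?thesis .
  qed
  consider "0 \<le> x \<and> 0 \<le> y" | "x \<le> 0 \<and> y \<le> 0" | "y \<le> 0 \<and> 0 \<le> x" | "x \<le> 0 \<and> 0 \<le> y" by linarith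
  then show ?thesis
  proof cases
    case 2
    then have "cmod (g' x - g' y) \<le> 1 / 3 * \<bar>x - y\<bar>" by (intro neg) auto
    also have "\<dots> \<le> 2 / 3 * \<bar>x - y\<bar>" by (intro mult_right_mono) auto
    finally show ?thesis .
  next
    case 4 then show ?thesis using mixed[of x y] norm_minus_commute[of "g' x" "g' y"] by (simp add: abs_minus_commute)
  qed (use pos mixed in auto)
qed

lemma g'_le: "cmod (g' x) \<le> 2 / 3 * \<bar>x\<bar>" "cmod (g' x) \<le> 4 / 3 / cmod k1"
proof -
  show "cmod (g' x) \<le> 2 / 3 * \<bar>x\<bar>" using g'_lipschitz[of x 0] by simp
  show "cmod (g' x) \<le> 4 / 3 / cmod k1"
  proof (cases "0 \<le> x")
    case True
    let ?e = "\<lambda>k. (exp (\<i> * k * of_real x) - 1) / k"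
    have "cmod (g' x) = 1 / 3 * cmod (?e k1 + ?e k2)" using True unfolding gker'_def by (simp only: norm_mult if_True) simp
    also have "\<dots> \<le> 1 / 3 * (2 / cmod k1 + 2 / cmod k2)"
      using True Im_roots roots_nonzero
      by (intro mult_left_mono norm_triangle_le add_mono exp_i_minus_1) (auto intro: mult_nonneg_nonneg less_imp_le)
    finally show ?thesis by (simp add: norm_eq)
  next
    case False
    have "cmod (g' x) = 1 / 3 * cmod ((exp (\<i> * k3 * of_real x) - 1) / k3)" using False unfolding gker'_def by (simp only: norm_mult if_False) simp
    also have "\<dots> \<le> 1 / 3 * (2 / cmod k3)"
      using False Im_roots roots_nonzero
      by (intro mult_left_mono exp_i_minus_1) (auto intro: mult_nonpos_nonpos less_imp_le)
    also have "\<dots> \<le> 4 / 3 / cmod k1" by (simp add: norm_eq divide_right_mono)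
    finally show ?thesis .
  qed
qed

lemma g_lipschitz: "cmod (g x - g y) \<le> 4 / 3 / cmod k1 * \<bar>x - y\<bar>"
  by (rule vector_mean_value_bound[OF g_deriv g'_le(2)])

lemma g_diff:
  assumes "\<bar>x\<bar> \<le> B" "\<bar>y\<bar> \<le> B" shows "cmod (g x - g y) \<le> 2 / 3 * B * \<bar>x - y\<bar>"
proof (rule vector_mean_value_bound[OF g_deriv])
  fix t assume "t \<in> closed_segment x y"
  then have "\<bar>t\<bar> \<le> B" using assms by (auto simp: closed_segment_eq_real_ivl split: if_splits)
  then show "cmod (g' t) \<le> 2 / 3 * B" using g'_le(1)[of t] by linarith
qed

lemma g_second_difference: "cmod (g (x - y) - g x - g (- y)) \<le> 2 / 3 * \<bar>x\<bar> * \<bar>y\<bar>"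
proof -
  have D: "((\<lambda>x. g (x - y) - g x) has_vector_derivative g' (t - y) - g' t) (at t)" for t
  proof -
    have "((\<lambda>x. x - y) has_vector_derivative 1) (at t)" by (auto intro!: derivative_eq_intros simp: has_vector_derivative_def)
    from vector_diff_chain_at[OF this g_deriv] have "((\<lambda>x. g (x - y)) has_vector_derivative g' (t - y)) (at t)"
      by (simp add: o_def)
    then show ?thesis using g_deriv by (rule has_vector_derivative_diff)
  qed
  have "cmod ((g (x - y) - g x) - (g (0 - y) - g 0)) \<le> (2 / 3 * \<bar>y\<bar>) * \<bar>x - 0\<bar>"
  proof (rule vector_mean_value_bound[OF D])
    fix t show "cmod (g' (t - y) - g' t) \<le> 2 / 3 * \<bar>y\<bar>" using g'_lipschitz[of "t - y" t] by simp
  qed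
  then show ?thesis by (simp add: algebra_simps)
qed

lemma shift_continuous: "continuous_on UNIV (\<lambda>t. g (x - t))" "continuous_on UNIV (\<lambda>t. g (t - x))"
  by (intro continuous_on_compose2[OF g_continuous] continuous_intros; simp)+

lemma p_close: "cmod (p x - g x) \<le> 1 / 3 * (\<bar>x\<bar> + 1 / 2)" and q_close: "cmod (q x - g (- x)) \<le> 1 / 3 * (\<bar>x\<bar> + 1 / 2)"
proof -
  have B: "2 / 3 * (\<bar>x\<bar> + 1 / 2) * \<bar>t\<bar> \<le> 1 / 3 * (\<bar>x\<bar> + 1 / 2)" if "\<bar>t\<bar> \<le> 1 / 2" for t
  proof -
    have "2 / 3 * (\<bar>x\<bar> + 1 / 2) * \<bar>t\<bar> \<le> 2 / 3 * (\<bar>x\<bar> + 1 / 2) * (1 / 2)"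
      by (intro mult_left_mono that) auto
    also have "\<dots> = 1 / 3 * (\<bar>x\<bar> + 1 / 2)" by simp
    finally show ?thesis .
  qed
  show "cmod (p x - g x) \<le> 1 / 3 * (\<bar>x\<bar> + 1 / 2)" unfolding pker_def
    by (rule average_close[OF shift_continuous(1)]) (use order_trans[OF g_diff B] in \<open>force simp: abs_if split: if_splits\<close>)
  show "cmod (q x - g (- x)) \<le> 1 / 3 * (\<bar>x\<bar> + 1 / 2)" unfolding qker_def
    by (rule average_close[OF shift_continuous(2)]) (use order_trans[OF g_diff B] in \<open>force simp: abs_if split: if_splits\<close>)
qed

lemma g_le: "cmod (g x) \<le> 4 / 3 / cmod k1 * \<bar>x\<bar>" "cmod (g x) \<le> 2 / 3 * \<bar>x\<bar> * \<bar>x\<bar>"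
  using g_lipschitz[of x 0] g_diff[of x "\<bar>x\<bar>" 0] by simp_all

lemma p_le: "cmod (p x) \<le> 4 / 3 / cmod k1 * (\<bar>x\<bar> + 1 / 2)" and q_le: "cmod (q x) \<le> 4 / 3 / cmod k1 * (\<bar>x\<bar> + 1 / 2)"
proof -
  have *: "4 / 3 / cmod k1 * s \<le> 4 / 3 / cmod k1 * (\<bar>x\<bar> + 1 / 2)" if "s \<le> \<bar>x\<bar> + 1 / 2" for s
    using that by (intro mult_left_mono) auto
  show "cmod (p x) \<le> 4 / 3 / cmod k1 * (\<bar>x\<bar> + 1 / 2)" unfolding pker_def
    by (rule average_le[OF shift_continuous(1)], rule order_trans[OF g_le(1)], rule *) linarith
  show "cmod (q x) \<le> 4 / 3 / cmod k1 * (\<bar>x\<bar> + 1 / 2)" unfolding qker_def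
    by (rule average_le[OF shift_continuous(2)], rule order_trans[OF g_le(1)], rule *) linarith
qed

lemma p_continuous: "continuous_on UNIV p"
proof -
  have "cmod (p x - p y) \<le> 4 / 3 / cmod k1 * \<bar>x - y\<bar>" for x y
  proof -
    have "p x - p y = average (\<lambda>t. g (x - t) - g (y - t))"
      unfolding pker_def using average_diff[OF shift_continuous(1) shift_continuous(1)] by simp
    also have "cmod \<dots> \<le> 4 / 3 / cmod k1 * \<bar>x - y\<bar>"
    proof (rule average_le)
      show "continuous_on UNIV (\<lambda>t. g (x - t) - g (y - t))" by (intro continuous_on_diff shift_continuous)
      fix t show "cmod (g (x - t) - g (y - t)) \<le> 4 / 3 / cmod k1 * \<bar>x - y\<bar>" using g_lipschitz[of "x - t" "y - t"] by simp
    qed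
    finally show ?thesis .
  qed
  then have "(4 / 3 / cmod k1)-lipschitz_on UNIV p"
    by (intro lipschitz_onI) (auto simp: dist_norm)
  then show ?thesis by (rule lipschitz_on_continuous_on)
qed

lemma p_small: "\<bar>r\<bar> \<le> 1 / 2 \<Longrightarrow> cmod (p r) \<le> 2 / 3"
  unfolding pker_def
proof (rule average_le[OF shift_continuous(1)])
  fix t :: real assume "\<bar>r\<bar> \<le> 1 / 2" "\<bar>t\<bar> \<le> 1 / 2"
  then have "\<bar>r - t\<bar> \<le> 1" by linarith
  then have "\<bar>r - t\<bar> * \<bar>r - t\<bar> \<le> 1 * 1" by (intro mult_mono) auto
  then show "cmod (g (r - t)) \<le> 2 / 3" using g_le(2)[of "r - t"] by linarith
qed

lemma d_le: "cmod d \<le> 5 / 3"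
  using average_le[OF p_continuous p_small] norm_triangle_ineq[of 1 "average p"] by (simp add: dker_def)

text \<open>The size of \<open>a\<close> is \<open>1 / (3 \<bar>k1\<bar>\<^sup>2)\<close>, at least \<open>16 / 3\<close> here, and dominates \<open>\<bar>d\<bar> \<le> 5 / 3\<close>.\<close>

lemma denominator:
  assumes k: "cmod k1 \<le> 1 / 4"
  shows "a + d \<noteq> 0" "cmod (1 / (a + d)) \<le> 6 * (cmod k1)\<^sup>2"
proof -
  define k where "k = cmod k1"
  have k0: "0 < k" "k \<le> 1 / 4" using roots_nonzero assms by (auto simp: k_def)
  have na: "cmod a = 1 / (3 * k\<^sup>2)" by (simp add: aker_def norm_divide norm_mult norm_power norm_eq k_def)
  have k2: "k\<^sup>2 \<le> 1 / 16" using power_mono[of k "1/4" 2] k0 by (simp add: power2_eq_square)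
  have "1 / (6 * k\<^sup>2) \<le> cmod a - cmod d"
  proof -
    have "1 / (3 * k\<^sup>2) - 1 / (6 * k\<^sup>2) = 1 / (6 * k\<^sup>2)" using k0 by (simp add: field_simps)
    moreover have "16 / 6 \<le> 1 / (6 * k\<^sup>2)" using k2 k0 by (simp add: field_simps)
    ultimately show ?thesis using d_le unfolding na by linarith
  qed
  also have "\<dots> \<le> cmod (a + d)" using norm_triangle_ineq4[of "a + d" d] by simp
  finally have le: "1 / (6 * k\<^sup>2) \<le> cmod (a + d)" .
  moreover have pos: "0 < 1 / (6 * k\<^sup>2)" using k0 by simp
  ultimately show "a + d \<noteq> 0" by auto
  have "cmod (1 / (a + d)) = 1 / cmod (a + d)" by (simp add: norm_divide)
  also have "\<dots> \<le> 1 / (1 / (6 * k\<^sup>2))" using le pos by (intro divide_left_mono mult_pos_pos) auto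
  finally show "cmod (1 / (a + d)) \<le> 6 * (cmod k1)\<^sup>2" by (simp add: k_def)
qed

text \<open>Over the common denominator \<open>a + d\<close> the terms in \<open>a\<^sup>2\<close> and \<open>a b\<close> cancel, and those in \<open>a p\<close> and
  \<open>a q\<close> become the \<open>- p x - q y\<close> of the first group, up to multiples of \<open>d\<close>.\<close>

lemma H_split:
  assumes "a + d \<noteq> 0"
  shows "Hker k1 k2 k3 x y = (g (x - y) - p x - q y)
     + (a * d + b * d * of_real (x - y) + b * b * of_real (x * y) + d * (p x + q y)
        - b * of_real x * q y + b * of_real y * p x - p x * q y) * (1 / (a + d))"
  using assms by (simp add: Hker_def field_simps)

end

lemma abs_le_jbracket: "\<bar>x\<bar> \<le> jbracket x"
  unfolding jbracket_def by (rule real_le_rsqrt) simp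

text \<open>In \<open>H_split\<close> the first group is a second difference of \<open>g\<close> up to the averaging errors, hence of
  order \<open>\<langle>x\<rangle> \<langle>y\<rangle>\<close>.  In the second group \<open>a\<close> is of order \<open>\<bar>k1\<bar>\<^sup>-\<^sup>2\<close>, each of \<open>b\<close>, \<open>p x / \<langle>x\<rangle>\<close> and
  \<open>q y / \<langle>y\<rangle>\<close> is of order \<open>\<bar>k1\<bar>\<^sup>-\<^sup>1\<close>, and \<open>1 / (a + d)\<close> of order \<open>\<bar>k1\<bar>\<^sup>2\<close>, so every product is
  bounded.\<close>

lemma (in cubic_roots) H_bound:
  assumes k: "cmod k1 \<le> 1 / 4"
  shows "cmod (Hker k1 k2 k3 x y) \<le> 60 * jbracket x * jbracket y"
proof -
  define K X Y where "K = cmod k1" and "X = jbracket x" and "Y = jbracket y"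
  have X: "1 \<le> X" "\<bar>x\<bar> \<le> X" and Y: "1 \<le> Y" "\<bar>y\<bar> \<le> Y"
    by (auto simp: X_def Y_def jbracket_ge_1 abs_le_jbracket)
  have XY: "1 \<le> X * Y" "X \<le> X * Y" "Y \<le> X * Y"
    using X Y mult_mono[of 1 X 1 Y] mult_left_mono[of 1 Y X] mult_right_mono[of 1 X Y] by auto
  have K: "0 < K" "K \<le> 1 / 4" using roots_nonzero k by (auto simp: K_def)
  have na: "cmod a = 1 / (3 * K\<^sup>2)" and nb: "cmod b = 1 / (3 * K)"
    by (auto simp: aker_def bker_def norm_divide norm_mult norm_power norm_eq K_def)
  have np: "cmod (p x) \<le> 2 * X / K"
  proof -
    have "cmod (p x) \<le> 4 / 3 / K * (X + X / 2)" using X K(1)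
      by (intro order_trans[OF p_le[folded K_def]] mult_left_mono) auto
    then show ?thesis using K(1) by (simp add: field_simps)
  qed
  have nq: "cmod (q y) \<le> 2 * Y / K"
  proof -
    have "cmod (q y) \<le> 4 / 3 / K * (Y + Y / 2)" using Y K(1)
      by (intro order_trans[OF q_le[folded K_def]] mult_left_mono) auto
    then show ?thesis using K(1) by (simp add: field_simps)
  qed
  have first: "cmod (g (x - y) - p x - q y) \<le> 3 * (X * Y)"
  proof -
    have "g (x - y) - p x - q y = (g (x - y) - g x - g (- y)) - (p x - g x) - (q y - g (- y))" by simp
    also have "cmod \<dots> \<le> cmod (g (x - y) - g x - g (- y)) + cmod (p x - g x) + cmod (q y - g (- y))"
      using norm_triangle_ineq4[of "(g (x - y) - g x - g (- y)) - (p x - g x)" "q y - g (- y)"]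
        norm_triangle_ineq4[of "g (x - y) - g x - g (- y)" "p x - g x"] by linarith
    also have "\<dots> \<le> 2 / 3 * (X * Y) + X + Y"
    proof (intro add_mono)
      have "\<bar>x\<bar> * \<bar>y\<bar> \<le> X * Y" using X Y by (intro mult_mono) auto
      then show "cmod (g (x - y) - g x - g (- y)) \<le> 2 / 3 * (X * Y)" using g_second_difference[of x y] by linarith
      show "cmod (p x - g x) \<le> X" using p_close[of x] X by (simp add: field_simps)
      show "cmod (q y - g (- y)) \<le> Y" using q_close[of y] Y by (simp add: field_simps)
    qed
    finally show ?thesis using XY by linarith
  qed
  have X0: "0 \<le> X" and Y0: "0 \<le> Y" using X Y by auto
  have t1: "cmod (a * d) \<le> 1 / (3 * K\<^sup>2) * (5 / 3)" unfolding norm_mult na using d_le by (intro mult_left_mono) auto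
  have t2: "cmod (b * d * of_real (x - y)) \<le> 1 / (3 * K) * (5 / 3) * (X + Y)"
    unfolding norm_mult nb norm_of_real using d_le X Y K(1) by (intro mult_mono) auto
  have t3: "cmod (b * b * of_real (x * y)) \<le> 1 / (3 * K) * (1 / (3 * K)) * (X * Y)"
    unfolding norm_mult nb norm_of_real abs_mult using X Y K(1) by (intro mult_mono) auto
  have t4: "cmod (d * (p x + q y)) \<le> 5 / 3 * (2 * X / K + 2 * Y / K)"
    unfolding norm_mult using d_le np nq by (intro mult_mono norm_triangle_le add_mono) auto
  have t5: "cmod (b * of_real x * q y) \<le> 1 / (3 * K) * X * (2 * Y / K)"
    unfolding norm_mult nb norm_of_real using nq X K(1) by (intro mult_mono) auto
  have t6: "cmod (b * of_real y * p x) \<le> 1 / (3 * K) * Y * (2 * X / K)"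
    unfolding norm_mult nb norm_of_real using np Y K(1) by (intro mult_mono) auto
  have t7: "cmod (p x * q y) \<le> 2 * X / K * (2 * Y / K)"
    unfolding norm_mult using np nq X0 K(1) by (intro mult_mono) auto
  let ?S = "a * d + b * d * of_real (x - y) + b * b * of_real (x * y) + d * (p x + q y)
        - b * of_real x * q y + b * of_real y * p x - p x * q y"
  have "cmod ?S \<le> cmod (a * d) + cmod (b * d * of_real (x - y)) + cmod (b * b * of_real (x * y)) + cmod (d * (p x + q y))
        + cmod (b * of_real x * q y) + cmod (b * of_real y * p x) + cmod (p x * q y)"
    by (intro order_trans[OF norm_triangle_ineq4] order_trans[OF norm_triangle_ineq] add_mono order_refl)
  also have "\<dots> \<le> 1 / (3 * K\<^sup>2) * (5 / 3) + 1 / (3 * K) * (5 / 3) * (X + Y) + 1 / (3 * K) * (1 / (3 * K)) * (X * Y)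
       + 5 / 3 * (2 * X / K + 2 * Y / K) + 1 / (3 * K) * X * (2 * Y / K) + 1 / (3 * K) * Y * (2 * X / K) + 2 * X / K * (2 * Y / K)"
    by (intro add_mono t1 t2 t3 t4 t5 t6 t7)
  finally have S: "cmod ?S \<le> \<dots>" .
  have "cmod (?S * (1 / (a + d))) \<le> \<dots> * (6 * K\<^sup>2)"
    unfolding norm_mult[of ?S] using denominator(2)[OF k] S by (intro mult_mono) (auto simp: K_def intro: order_trans[OF norm_ge_zero])
  also have "\<dots> = 10 / 3 + 10 / 3 * K * (X + Y) + 2 / 3 * (X * Y) + 20 * K * (X + Y) + 4 * (X * Y) + 4 * (X * Y) + 24 * (X * Y)"
    using K(1) by (simp add: field_simps power2_eq_square)
  also have "\<dots> \<le> 10 / 3 * (X * Y) + 10 / 3 * (1 / 4) * (2 * (X * Y)) + 2 / 3 * (X * Y) + 20 * (1 / 4) * (2 * (X * Y))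
      + 4 * (X * Y) + 4 * (X * Y) + 24 * (X * Y)"
    using K XY X0 Y0 by (intro add_mono mult_mono) auto
  finally have "cmod (?S * (1 / (a + d))) \<le> 57 * (X * Y)" using XY by (simp add: algebra_simps)
  then have "cmod (Hker k1 k2 k3 x y) \<le> 3 * (X * Y) + 57 * (X * Y)"
    unfolding H_split[OF denominator(1)[OF k]] using first by (intro norm_triangle_le add_mono)
  then show ?thesis by (simp add: X_def Y_def)
qed

section \<open>Cube roots in the two half planes\<close>

text \<open>For \<open>arg z\<close> between \<open>0\<close> and \<open>\<pi>\<close> the principal cube root and its rotation by \<open>2 \<pi> / 3\<close> lie in the
  upper half plane, its rotation by \<open>4 \<pi> / 3\<close> in the lower one.\<close>

lemma cubic_roots_exist:
  assumes z: "0 < Im z" shows "\<exists>k1 k2 k3. cubic_roots z k1 k2 k3"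
proof -
  define w where "w = cis (2 * pi / 3)"
  have w3: "w ^ 3 = 1"
  proof -
    have "w ^ 3 = cis (real 3 * (2 * pi / 3))" by (simp add: w_def Complex.DeMoivre)
    also have "\<dots> = 1" by simp
    finally show ?thesis .
  qed
  have "sin (2 * pi / 3) > 0" by (rule sin_gt_zero) (use pi_gt_zero in auto)
  then have "w \<noteq> 1" by (auto simp: w_def complex_eq_iff)
  moreover have "(w - 1) * (w\<^sup>2 + w + 1) = 0" using w3 by algebra
  ultimately have ww: "w\<^sup>2 + w + 1 = 0" by simp
  define r t where "r = root 3 (cmod z)" and "t = Arg z / 3"
  have z0: "z \<noteq> 0" using z by auto
  have r: "0 < r" using z0 by (simp add: r_def)
  have t: "0 < t" "t < pi / 3" using z Arg_lt_pi[of z] unfolding t_def by linarith+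
  define k where "k = of_real r * cis t"
  have k3: "k ^ 3 = z"
  proof -
    have "k ^ 3 = of_real (r ^ 3) * cis (real 3 * t)" by (simp add: k_def power_mult_distrib Complex.DeMoivre)
    also have "\<dots> = of_real (cmod z) * cis (Arg z)" by (simp add: r_def t_def real_root_pow_pos2)
    also have "\<dots> = z" using rcis_cmod_Arg[of z] by (simp add: rcis_def)
    finally show ?thesis .
  qed
  have "cubic_roots z k (w * k) (w\<^sup>2 * k)"
  proof
    show "0 < Im k" using r t sin_gt_zero[of t] pi_gt_zero by (simp add: k_def)
    have wk: "w * k = of_real r * cis (2 * pi / 3 + t)" by (simp add: w_def k_def cis_mult mult.left_commute)
    show "0 < Im (w * k)" unfolding wk using r t sin_gt_zero[of "2 * pi / 3 + t"] pi_gt_zero by simp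
    have "w\<^sup>2 = cis (4 * pi / 3)" by (simp add: w_def Complex.DeMoivre)
    then have wwk: "w\<^sup>2 * k = of_real r * cis (4 * pi / 3 + t)" by (simp add: k_def cis_mult mult.left_commute)
    have "sin (4 * pi / 3 + t) < 0" by (rule sin_lt_zero) (use t pi_gt_zero in auto)
    then show "Im (w\<^sup>2 * k) < 0" unfolding wwk using r by (simp add: mult_pos_neg)
    show "k + w * k + w\<^sup>2 * k = 0" using ww by algebra
    show "k * (w * k) + k * (w\<^sup>2 * k) + w * k * (w\<^sup>2 * k) = 0" using ww w3 by algebra
    have "k * (w * k) * (w\<^sup>2 * k) = w ^ 3 * k ^ 3" by (simp add: power2_eq_square power3_eq_cube)
    then show "k * (w * k) * (w\<^sup>2 * k) = z" using k3 w3 by simp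
  qed
  then show ?thesis by blast
qed

section \<open>The limit kernel\<close>

text \<open>The limits of \<open>g\<close>, \<open>p\<close>, \<open>q\<close> and of the resolvent kernel as \<open>z\<close> tends to \<open>0\<close>: each
  \<open>taylor_exp\<close> tends to \<open>- t\<^sup>2 / 2\<close>.\<close>

definition g0 :: "real \<Rightarrow> complex" where
  "g0 t = (if 0 \<le> t then - (\<i> / 3) * of_real (t\<^sup>2) else \<i> / 6 * of_real (t\<^sup>2))"
definition p0 where "p0 x = average (\<lambda>t. g0 (x - t))"
definition q0 where "q0 y = average (\<lambda>r. g0 (r - y))"
definition H0 :: "real \<Rightarrow> real \<Rightarrow> complex" where
  "H0 x y = g0 (x - y) - p0 x - q0 y + (1 + average p0) + \<i> / 3 * of_real (x * y)"

lemma taylor_exp_tendsto: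
  fixes k :: "nat \<Rightarrow> complex"
  assumes k: "k \<longlonglongrightarrow> 0" "\<And>n. k n \<noteq> 0"
  shows "(\<lambda>n. taylor_exp (k n) t) \<longlonglongrightarrow> - of_real (t\<^sup>2) / 2"
proof (rule LIM_zero_cancel, rule Lim_null_comparison)
  let ?B = "\<lambda>n. exp (cmod (k n) * \<bar>t\<bar>) * (cmod (k n) * \<bar>t\<bar> ^ 3) / 2"
  show "\<forall>\<^sub>F n in sequentially. norm (taylor_exp (k n) t - - of_real (t\<^sup>2) / 2) \<le> ?B n"
  proof (intro always_eventually allI)
    fix n
    define w where "w = \<i> * k n * of_real t"
    have nw: "cmod w = cmod (k n) * \<bar>t\<bar>" by (simp add: w_def norm_mult)
    have "(\<Sum>i\<le>2. w ^ i / fact i) = 1 + w + w\<^sup>2 / 2" by (simp add: numeral_2_eq_2)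
    then have T: "cmod (exp w - (1 + w + w\<^sup>2 / 2)) \<le> exp (cmod w) * cmod w ^ 3 / 2"
      using Taylor_exp_field[of w 2] by (simp add: numeral_2_eq_2 numeral_3_eq_3)
    have "taylor_exp (k n) t - - of_real (t\<^sup>2) / 2 = (exp w - (1 + w + w\<^sup>2 / 2)) / (k n)\<^sup>2"
    proof -
      have "taylor_exp (k n) t = (exp w - 1 - w) / (k n)\<^sup>2" by (simp add: taylor_exp_def w_def)
      moreover have "of_real (t\<^sup>2) = - w\<^sup>2 / (k n)\<^sup>2" using k(2)[of n] by (simp add: w_def power_mult_distrib)
      ultimately show ?thesis by (simp add: diff_divide_distrib add_divide_distrib)
    qed
    then have "cmod (taylor_exp (k n) t - - of_real (t\<^sup>2) / 2) = cmod (exp w - (1 + w + w\<^sup>2 / 2)) / (cmod (k n))\<^sup>2"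
      by (simp add: norm_divide norm_power)
    also have "\<dots> \<le> (exp (cmod w) * cmod w ^ 3 / 2) / (cmod (k n))\<^sup>2" by (intro divide_right_mono T) simp
    also have "\<dots> = ?B n" unfolding nw using k(2)[of n] by (simp add: field_simps power2_eq_square power3_eq_cube)
    finally show "norm (taylor_exp (k n) t - - of_real (t\<^sup>2) / 2) \<le> ?B n" .
  qed
  have "(\<lambda>n. cmod (k n)) \<longlonglongrightarrow> 0" using k(1) by (rule tendsto_norm_zero)
  then have "?B \<longlonglongrightarrow> exp (0 * \<bar>t\<bar>) * (0 * \<bar>t\<bar> ^ 3) / 2"
    by (intro tendsto_intros) auto
  then show "?B \<longlonglongrightarrow> 0" by simp
qed

text \<open>In \<open>H_split\<close> the quotients of \<open>1\<close>, \<open>b\<close>, \<open>a\<close> and \<open>b\<^sup>2\<close> by \<open>a + d\<close> tend to \<open>0\<close>, \<open>0\<close>, \<open>1\<close> and \<open>i / 3\<close>; the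
  last limit rests on \<open>b\<^sup>2 = i a / 3\<close>.\<close>

lemma Hker_tendsto:
  fixes z k1 k2 k3 :: "nat \<Rightarrow> complex"
  assumes roots: "\<And>n. cubic_roots (z n) (k1 n) (k2 n) (k3 n)" and small: "\<And>n. cmod (k1 n) \<le> 1 / 4"
    and lim: "k1 \<longlonglongrightarrow> 0"
  shows "(\<lambda>n. Hker (k1 n) (k2 n) (k3 n) x y) \<longlonglongrightarrow> H0 x y"
proof -
  note nz = cubic_roots.roots_nonzero[OF roots]
  have n1: "(\<lambda>n. cmod (k1 n)) \<longlonglongrightarrow> 0" using lim by (rule tendsto_norm_zero)
  have lim2: "k2 \<longlonglongrightarrow> 0" and lim3: "k3 \<longlonglongrightarrow> 0"
    by (rule tendsto_norm_zero_cancel, simp add: cubic_roots.norm_eq[OF roots] n1)+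
  define g p q d a b where "g n = gker (k1 n) (k2 n) (k3 n)" and "p n = pker (k1 n) (k2 n) (k3 n)"
    and "q n = qker (k1 n) (k2 n) (k3 n)" and "d n = dker (k1 n) (k2 n) (k3 n)"
    and "a n = aker (k3 n)" and "b n = bker (k3 n)" for n
  note defs = g_def p_def q_def d_def a_def b_def
  have g: "(\<lambda>n. g n t) \<longlonglongrightarrow> g0 t" for t
  proof (cases "0 \<le> t")
    case True
    have "(\<lambda>n. \<i> / 3 * (taylor_exp (k1 n) t + taylor_exp (k2 n) t)) \<longlonglongrightarrow> \<i> / 3 * (- of_real (t\<^sup>2) / 2 + - of_real (t\<^sup>2) / 2)"
      by (intro tendsto_mult tendsto_const tendsto_add taylor_exp_tendsto lim lim2 nz)
    then show ?thesis using True by (simp add: g_def gker_def g0_def field_simps)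
  next
    case False
    have "(\<lambda>n. - (\<i> / 3) * taylor_exp (k3 n) t) \<longlonglongrightarrow> - (\<i> / 3) * (- of_real (t\<^sup>2) / 2)"
      by (intro tendsto_mult tendsto_const taylor_exp_tendsto lim3 nz)
    then show ?thesis using False by (simp add: g_def gker_def g0_def)
  qed
  have g_bd: "cmod (g n (t - s)) \<le> 2 / 3 * (\<bar>x\<bar> + 1 / 2)\<^sup>2" if "\<bar>t - s\<bar> \<le> \<bar>x\<bar> + 1 / 2" for n t s x
  proof -
    have "cmod (g n (t - s)) \<le> 2 / 3 * (\<bar>t - s\<bar> * \<bar>t - s\<bar>)"
      using cubic_roots.g_le(2)[OF roots, of n "t - s"] by (simp add: g_def mult.assoc)
    also have "\<dots> \<le> 2 / 3 * ((\<bar>x\<bar> + 1 / 2) * (\<bar>x\<bar> + 1 / 2))"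
      using that by (intro mult_left_mono mult_mono) auto
    finally show ?thesis by (simp add: power2_eq_square)
  qed
  have p: "(\<lambda>n. p n x) \<longlonglongrightarrow> p0 x" for x
    unfolding p_def pker_def p0_def g_def[symmetric]
    by (rule average_tendsto[where B = "2 / 3 * (\<bar>x\<bar> + 1 / 2)\<^sup>2"])
       (use g cubic_roots.shift_continuous[OF roots] g_bd in \<open>auto simp: g_def\<close>)
  have q: "(\<lambda>n. q n y) \<longlonglongrightarrow> q0 y" for y
    unfolding q_def qker_def q0_def g_def[symmetric]
    by (rule average_tendsto[where B = "2 / 3 * (\<bar>y\<bar> + 1 / 2)\<^sup>2"])
       (use g cubic_roots.shift_continuous[OF roots] g_bd in \<open>auto simp: g_def\<close>)
  have d: "d \<longlonglongrightarrow> 1 + average p0"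
    unfolding d_def dker_def p_def[symmetric]
    by (intro tendsto_add tendsto_const average_tendsto[where B = "2 / 3"])
       (use p cubic_roots.p_continuous[OF roots] cubic_roots.p_small[OF roots] in \<open>auto simp: p_def\<close>)
  define u where "u n = 1 / (a n + d n)" for n
  have den: "a n + d n \<noteq> 0" "cmod (u n) \<le> 6 * (cmod (k1 n))\<^sup>2" for n
    using cubic_roots.denominator[OF roots small, of n] by (auto simp: a_def d_def u_def)
  have sq0: "(\<lambda>n. 6 * (cmod (k1 n))\<^sup>2) \<longlonglongrightarrow> 0"
    using tendsto_mult[OF tendsto_const tendsto_power[OF n1, of 2], of 6] by simp
  have u: "u \<longlonglongrightarrow> 0" by (rule Lim_null_comparison[OF _ sq0]) (use den in auto)
  have "(\<lambda>n. 1 - d n * u n) \<longlonglongrightarrow> 1 - (1 + average p0) * 0" by (intro tendsto_intros d u)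
  moreover have "1 - d n * u n = a n * u n" for n using den(1)[of n] by (simp add: u_def field_simps)
  ultimately have au: "(\<lambda>n. a n * u n) \<longlonglongrightarrow> 1" by simp
  have b_a: "b n = \<i> * k3 n * a n" "b n * b n = \<i> / 3 * a n" for n
    using nz(3)[of n] by (simp_all add: a_def b_def aker_def bker_def power2_eq_square)
  have "(\<lambda>n. \<i> * k3 n * (a n * u n)) \<longlonglongrightarrow> \<i> * 0 * 1" by (intro tendsto_intros lim3 au)
  then have bu: "(\<lambda>n. b n * u n) \<longlonglongrightarrow> 0" by (simp add: b_a(1) mult.assoc)
  have "(\<lambda>n. \<i> / 3 * (a n * u n)) \<longlonglongrightarrow> \<i> / 3 * 1" by (intro tendsto_intros au)
  then have bbu: "(\<lambda>n. b n * b n * u n) \<longlonglongrightarrow> \<i> / 3" by (simp add: b_a(2) mult.assoc)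
  have "(\<lambda>n. (g n (x - y) - p n x - q n y) + (d n * (a n * u n) + d n * of_real (x - y) * (b n * u n)
      + of_real (x * y) * (b n * b n * u n) + d n * (p n x + q n y) * u n - of_real x * q n y * (b n * u n)
      + of_real y * p n x * (b n * u n) - p n x * q n y * u n)) \<longlonglongrightarrow>
    (g0 (x - y) - p0 x - q0 y) + ((1 + average p0) * 1 + (1 + average p0) * of_real (x - y) * 0
      + of_real (x * y) * (\<i> / 3) + (1 + average p0) * (p0 x + q0 y) * 0 - of_real x * q0 y * 0
      + of_real y * p0 x * 0 - p0 x * q0 y * 0)"
    by (intro tendsto_add tendsto_diff tendsto_mult tendsto_const g p q d u au bu bbu)
  moreover have "Hker (k1 n) (k2 n) (k3 n) x y = (g n (x - y) - p n x - q n y) + (d n * (a n * u n) + d n * of_real (x - y) * (b n * u n)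
      + of_real (x * y) * (b n * b n * u n) + d n * (p n x + q n y) * u n - of_real x * q n y * (b n * u n)
      + of_real y * p n x * (b n * u n) - p n x * q n y * u n)" for n
    using cubic_roots.H_split[OF roots den(1)[of n, unfolded a_def d_def], of x y]
    unfolding defs[symmetric] u_def[symmetric] by (simp add: algebra_simps)
  ultimately show ?thesis by (simp add: H0_def mult.commute add.assoc)
qed

section \<open>Hilbert--Schmidt operators between weighted spaces\<close>

definition kernel_op :: "(real \<Rightarrow> real \<Rightarrow> complex) \<Rightarrow> aefun \<Rightarrow> aefun" where
  "kernel_op h f = abs_aefun (\<lambda>x. LINT y|lborel. h x y * rep_aefun f y)"

text \<open>The integral of this density over the plane is the squared Hilbert--Schmidt norm of the kernel,
  taken from \<open>L2w s\<close> to \<open>L2w (- s')\<close>.\<close>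

definition hs_density :: "real \<Rightarrow> real \<Rightarrow> (real \<Rightarrow> real \<Rightarrow> complex) \<Rightarrow> real \<Rightarrow> real \<Rightarrow> real" where
  "hs_density s s' h x y = (jbracket x powr (- s') * cmod (h x y) * jbracket y powr (- s))\<^sup>2"

lemma jbracket_weight:
  "(jbracket x powr (- s) * jbracket x)\<^sup>2 = jbracket x powr (2 - 2 * s)"
proof -
  have "jbracket x powr (- s) * jbracket x = jbracket x powr (1 - s)"
    using less_imp_neq[OF jbracket_pos[of x]] by (simp add: powr_diff powr_minus field_simps abs_of_pos)
  then have "(jbracket x powr (- s) * jbracket x)\<^sup>2 = jbracket x powr (1 - s) * jbracket x powr (1 - s)"
    by (simp add: power2_eq_square)
  also have "\<dots> = jbracket x powr ((1 - s) + (1 - s))" by (rule powr_add[symmetric])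
  finally show ?thesis by (simp add: algebra_simps)
qed

text \<open>Growth at most \<open>\<langle>x\<rangle> \<langle>y\<rangle>\<close> is just what the weights absorb: \<open>\<langle>x\<rangle>\<^sup>2\<^sup>-\<^sup>2\<^sup>s\<^sup>'\<close> and \<open>\<langle>y\<rangle>\<^sup>2\<^sup>-\<^sup>2\<^sup>s\<close> are
  integrable exactly for exponents below \<open>-1\<close>, that is for \<open>s, s' > 3/2\<close>.\<close>

locale moderate_kernel =
  fixes s s' :: real and h :: "real \<Rightarrow> real \<Rightarrow> complex" and C :: real
  assumes weights: "3 / 2 < s" "3 / 2 < s'"
    and h_meas [measurable]: "(\<lambda>(x, y). h x y) \<in> borel_measurable (borel \<Otimes>\<^sub>M borel)"
    and h_le: "cmod (h x y) \<le> C * jbracket x * jbracket y"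
begin

lemma h_section [measurable]: "h x \<in> borel_measurable borel"
  by measurable

lemma density_le:
  "hs_density s s' h x y \<le> C\<^sup>2 * (jbracket x powr (2 - 2 * s') * jbracket y powr (2 - 2 * s))"
proof -
  have "jbracket x powr (- s') * cmod (h x y) * jbracket y powr (- s)
      \<le> jbracket x powr (- s') * (C * jbracket x * jbracket y) * jbracket y powr (- s)"
    by (intro mult_right_mono mult_left_mono h_le) auto
  also have "\<dots> = C * ((jbracket x powr (- s') * jbracket x) * (jbracket y powr (- s) * jbracket y))" by simp
  finally have "hs_density s s' h x y \<le> (C * ((jbracket x powr (- s') * jbracket x) * (jbracket y powr (- s) * jbracket y)))\<^sup>2"
    unfolding hs_density_def by (rule power_mono) simp
  then show ?thesis
    unfolding power_mult_distrib[of C] power_mult_distrib[of "jbracket x powr (- s') * jbracket x"] jbracket_weight .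
qed

lemma dominating_integrable:
  "integrable (lborel \<Otimes>\<^sub>M lborel) (\<lambda>(x, y). C\<^sup>2 * (jbracket x powr (2 - 2 * s') * jbracket y powr (2 - 2 * s)))"
proof -
  have "integrable (lborel \<Otimes>\<^sub>M lborel) (\<lambda>(x, y). C\<^sup>2 * jbracket x powr (2 - 2 * s') * jbracket y powr (2 - 2 * s))"
    by (rule integrable_product_kernel[of "\<lambda>x. C\<^sup>2 * jbracket x powr (2 - 2 * s')"])
       (use weights in \<open>auto intro!: integrable_jbracket_powr\<close>)
  then show ?thesis by (simp add: mult.assoc)
qed

lemma density_integrable: "integrable (lborel \<Otimes>\<^sub>M lborel) (\<lambda>(x, y). hs_density s s' h x y)"
proof (rule Bochner_Integration.integrable_bound[OF dominating_integrable])
  show "AE z in lborel \<Otimes>\<^sub>M lborel. norm (case z of (x, y) \<Rightarrow> hs_density s s' h x y) \<le>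
      norm (case z of (x, y) \<Rightarrow> C\<^sup>2 * (jbracket x powr (2 - 2 * s') * jbracket y powr (2 - 2 * s)))"
    using density_le by (intro AE_I2) (auto simp: hs_density_def split: prod.split)
  show "(\<lambda>(x, y). hs_density s s' h x y) \<in> borel_measurable (lborel \<Otimes>\<^sub>M lborel)"
    unfolding hs_density_def by measurable
qed

text \<open>Cauchy--Schwarz in \<open>y\<close>, with the weight moved from \<open>f\<close> to the kernel.\<close>

lemma kernel_integrable:
  assumes f: "f \<in> L2w s"
  shows "integrable lborel (\<lambda>y. h x y * rep_aefun f y)"
    and "(jbracket x powr (- s') * cmod (LINT y|lborel. h x y * rep_aefun f y))\<^sup>2
      \<le> (LINT y|lborel. hs_density s s' h x y) * (L2w_norm s f)\<^sup>2"
proof -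
  let ?p = "\<lambda>y. cmod (h x y) * jbracket y powr (- s)"
  let ?q = "\<lambda>y. jbracket y powr s * cmod (rep_aefun f y)"
  have pq: "?p y * ?q y = cmod (h x y * rep_aefun f y)" for y
    using less_imp_neq[OF jbracket_pos[of y]] by (simp add: norm_mult powr_minus field_simps)
  have P: "integrable lborel (\<lambda>y. (?p y)\<^sup>2)"
  proof (rule Bochner_Integration.integrable_bound)
    show "integrable lborel (\<lambda>y. (C * jbracket x)\<^sup>2 * jbracket y powr (2 - 2 * s))"
      using weights by (intro integrable_mult_right integrable_jbracket_powr) auto
    have "?p y \<le> C * jbracket x * (jbracket y powr (- s) * jbracket y)" for y
      using mult_right_mono[OF h_le[of x y], of "jbracket y powr (- s)"] by (simp add: mult_ac)
    then have "(?p y)\<^sup>2 \<le> (C * jbracket x * (jbracket y powr (- s) * jbracket y))\<^sup>2" for y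
      by (rule power_mono) simp
    then show "AE y in lborel. norm ((?p y)\<^sup>2) \<le> norm ((C * jbracket x)\<^sup>2 * jbracket y powr (2 - 2 * s))"
      by (intro AE_I2) (simp add: power_mult_distrib[of "C * jbracket x"] jbracket_weight)
  qed measurable
  have Q: "integrable lborel (\<lambda>y. (?q y)\<^sup>2)" using f by (simp add: L2w_iff)
  have 1: "integrable lborel (\<lambda>y. ?p y * ?q y)"
    and 2: "(LINT y|lborel. \<bar>?p y * ?q y\<bar>) \<le> sqrt (LINT y|lborel. (?p y)\<^sup>2) * sqrt (LINT y|lborel. (?q y)\<^sup>2)"
    by (rule L2_pairing[OF _ _ P Q]; measurable)+
  show "integrable lborel (\<lambda>y. h x y * rep_aefun f y)"
  proof (rule Bochner_Integration.integrable_bound[OF 1])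
    show "AE y in lborel. norm (h x y * rep_aefun f y) \<le> norm (?p y * ?q y)" unfolding pq by simp
  qed measurable
  have "cmod (LINT y|lborel. h x y * rep_aefun f y) \<le> (LINT y|lborel. \<bar>?p y * ?q y\<bar>)"
    unfolding pq using integral_norm_bound[of lborel "\<lambda>y. h x y * rep_aefun f y"] by simp
  then have "jbracket x powr (- s') * cmod (LINT y|lborel. h x y * rep_aefun f y)
      \<le> jbracket x powr (- s') * (sqrt (LINT y|lborel. (?p y)\<^sup>2) * sqrt (LINT y|lborel. (?q y)\<^sup>2))"
    using 2 by (intro mult_left_mono) auto
  then have "(jbracket x powr (- s') * cmod (LINT y|lborel. h x y * rep_aefun f y))\<^sup>2
      \<le> (jbracket x powr (- s') * (sqrt (LINT y|lborel. (?p y)\<^sup>2) * sqrt (LINT y|lborel. (?q y)\<^sup>2)))\<^sup>2"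
    by (rule power_mono) simp
  also have "\<dots> = ((jbracket x powr (- s'))\<^sup>2 * (LINT y|lborel. (?p y)\<^sup>2)) * (L2w_norm s f)\<^sup>2"
    by (simp add: power_mult_distrib L2w_norm_sq)
  also have "(jbracket x powr (- s'))\<^sup>2 * (LINT y|lborel. (?p y)\<^sup>2) = (LINT y|lborel. hs_density s s' h x y)"
    by (simp add: hs_density_def power_mult_distrib mult.assoc flip: integral_mult_right_zero)
  finally show "(jbracket x powr (- s') * cmod (LINT y|lborel. h x y * rep_aefun f y))\<^sup>2
      \<le> (LINT y|lborel. hs_density s s' h x y) * (L2w_norm s f)\<^sup>2" .
qed

lemma kernel_meas [measurable]: "(\<lambda>x. LINT y|lborel. h x y * rep_aefun f y) \<in> borel_measurable borel"
  by measurable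

lemma kernel_op_in: "f \<in> L2w s \<Longrightarrow> kernel_op h f \<in> L2w (- s')"
  and kernel_op_le: "f \<in> L2w s \<Longrightarrow>
    L2w_norm (- s') (kernel_op h f) \<le> sqrt (\<integral>(x, y). hs_density s s' h x y \<partial>(lborel \<Otimes>\<^sub>M lborel)) * L2w_norm s f"
proof -
  assume f: "f \<in> L2w s"
  let ?V = "\<lambda>x. LINT y|lborel. hs_density s s' h x y"
  have V: "integrable lborel (\<lambda>x. ?V x * (L2w_norm s f)\<^sup>2)"
    using lborel_pair.integrable_fst'[OF density_integrable] by simp
  have int: "integrable lborel (\<lambda>x. (jbracket x powr (- s') * cmod (LINT y|lborel. h x y * rep_aefun f y))\<^sup>2)"
    by (rule Bochner_Integration.integrable_bound[OF V])
       (use kernel_integrable(2)[OF f] in \<open>auto intro!: AE_I2 intro: order_trans[OF _ abs_ge_self]\<close>)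
  show in_X: "kernel_op h f \<in> L2w (- s')" unfolding kernel_op_def abs_L2w_iff[OF kernel_meas] by (rule int)
  have "(L2w_norm (- s') (kernel_op h f))\<^sup>2 = (LINT x|lborel. (jbracket x powr (- s') * cmod (LINT y|lborel. h x y * rep_aefun f y))\<^sup>2)"
    unfolding kernel_op_def abs_L2w_norm_sq[OF kernel_meas] ..
  also have "\<dots> \<le> (LINT x|lborel. ?V x * (L2w_norm s f)\<^sup>2)"
    by (rule integral_mono[OF int V]) (rule kernel_integrable(2)[OF f])
  also have "\<dots> = (\<integral>(x, y). hs_density s s' h x y \<partial>(lborel \<Otimes>\<^sub>M lborel)) * (L2w_norm s f)\<^sup>2"
    using lborel_pair.integral_fst[of "hs_density s s' h"] density_integrable by simp
  finally have "L2w_norm (- s') (kernel_op h f) \<le>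
      sqrt ((\<integral>(x, y). hs_density s s' h x y \<partial>(lborel \<Otimes>\<^sub>M lborel)) * (L2w_norm s f)\<^sup>2)"
    by (rule real_le_rsqrt)
  then show "L2w_norm (- s') (kernel_op h f) \<le> sqrt (\<integral>(x, y). hs_density s s' h x y \<partial>(lborel \<Otimes>\<^sub>M lborel)) * L2w_norm s f"
    by (simp add: real_sqrt_mult L2w_norm_nonneg)
qed

lemma kernel_op_bounded: "bounded_op s (- s') (kernel_op h)"
  unfolding bounded_op_iff
proof
  fix f assume f: "f \<in> L2w s"
  show "kernel_op h f \<in> L2w (- s')" by (rule kernel_op_in[OF f])
  have "(LINT y|lborel. h x y * rep_aefun (c *\<^sub>c f) y) = c * (LINT y|lborel. h x y * rep_aefun f y)" for c x
  proof -
    have "(LINT y|lborel. h x y * rep_aefun (c *\<^sub>c f) y) = (LINT y|lborel. c * (h x y * rep_aefun f y))"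
      using rep_cscale[of c f] by (intro integral_cong_AE) (auto elim!: eventually_mono)
    then show ?thesis by simp
  qed
  then show "kernel_op h (c *\<^sub>c f) = c *\<^sub>c kernel_op h f" for c
    unfolding kernel_op_def by (simp add: cscale.abs_eq ae_eq_refl)
  fix f' assume f': "f' \<in> L2w s"
  have "(LINT y|lborel. h x y * rep_aefun (f + f') y) = (LINT y|lborel. h x y * rep_aefun f y) + (LINT y|lborel. h x y * rep_aefun f' y)" for x
  proof -
    have "(LINT y|lborel. h x y * rep_aefun (f + f') y) = (LINT y|lborel. h x y * rep_aefun f y + h x y * rep_aefun f' y)"
      using rep_add[of f f'] by (intro integral_cong_AE) (auto simp: algebra_simps elim!: eventually_mono)
    then show ?thesis using kernel_integrable(1)[OF f] kernel_integrable(1)[OF f'] by simp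
  qed
  then show "kernel_op h (f + f') = kernel_op h f + kernel_op h f'"
    unfolding kernel_op_def by (simp add: plus_aefun.abs_eq ae_eq_refl)
next
  show "\<exists>C. \<forall>f\<in>L2w s. L2w_norm (- s') (kernel_op h f) \<le> C * L2w_norm s f"
    using kernel_op_le by blast
qed

end

lemma moderate_kernel_diff:
  assumes "moderate_kernel s s' h C" "moderate_kernel s s' h' C'"
  shows "moderate_kernel s s' (\<lambda>x y. h x y - h' x y) (C + C')"
    and "f \<in> L2w s \<Longrightarrow> kernel_op h f - kernel_op h' f = kernel_op (\<lambda>x y. h x y - h' x y) f"
proof -
  interpret h: moderate_kernel s s' h C by fact
  interpret h': moderate_kernel s s' h' C' by fact
  show "moderate_kernel s s' (\<lambda>x y. h x y - h' x y) (C + C')"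
  proof
    show "cmod (h x y - h' x y) \<le> (C + C') * jbracket x * jbracket y" for x y
      using order_trans[OF norm_triangle_ineq4 add_mono[OF h.h_le h'.h_le]] by (simp add: algebra_simps)
  qed (use h.weights in \<open>auto intro: borel_measurable_diff\<close>)
  assume f: "f \<in> L2w s"
  show "kernel_op h f - kernel_op h' f = kernel_op (\<lambda>x y. h x y - h' x y) f"
    unfolding kernel_op_def using h.kernel_integrable(1)[OF f] h'.kernel_integrable(1)[OF f]
    by (simp add: minus_aefun.abs_eq ae_eq_refl left_diff_distrib)
qed

section \<open>The rank one regularization\<close>

text \<open>The operator \<open>mean_op\<close> is the orthogonal projection of \<open>L2\<close> onto the span of the indicator function
  of a unit interval.  An interval symmetric about \<open>0\<close> makes the average of an odd function
  vanish.\<close>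

definition window :: "real \<Rightarrow> complex" where "window x = of_real (indicat_real {- (1/2)..1/2} x)"
definition window_fun :: aefun where "window_fun = abs_aefun window"
definition mean :: "aefun \<Rightarrow> complex" where "mean u = (LINT x|lborel. rep_aefun u x * window x)"
definition mean_op :: "aefun \<Rightarrow> aefun" where "mean_op u = mean u *\<^sub>c window_fun"

lemma window_measurable [measurable]: "window \<in> borel_measurable borel"
  unfolding window_def by measurable

lemma average_window: "average f = (LINT x|lborel. f x * window x)"
  unfolding average_def window_def by (simp add: scaleR_conv_of_real mult.commute)

lemma window_fun_in: "window_fun \<in> L2w t"
  unfolding window_fun_def by (rule compact_support_L2w[of window 1 "1/2"]) (auto simp: window_def indicator_def)

lemma mean_dual: "mean \<in> dual_L2w t"
  using pairing_in_dual[OF window_fun_in[of "- t"]]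
  unfolding window_fun_def pairing_abs[OF window_measurable] mean_def[abs_def] by simp

lemma mean_op_bounded: "bounded_op a b mean_op" and mean_op_finite_rank: "finite_rank a mean_op"
  unfolding mean_op_def[abs_def]
  by (rule rank_one_bounded_op[OF mean_dual window_fun_in], rule rank_one_finite_rank)

context cubic_roots
begin

lemma G_measurable [measurable]: "G \<in> borel_measurable borel"
  using G_integrable by (simp add: integrable_iff_bounded)

text \<open>The term linear in the integration variable averages to zero.\<close>

lemma average_G:
  "average (\<lambda>t. G (x - t)) = a + b * of_real x + p x"
  "average (\<lambda>t. G (t - x)) = a - b * of_real x + q x"
proof -
  have c: "continuous_on UNIV (\<lambda>t::real. b * complex_of_real t)" by (intro continuous_intros)
  have odd: "average (\<lambda>t. b * of_real t) = 0" by (simp add: average_cmult average_odd)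
  have "average (\<lambda>t. G (x - t)) = average (\<lambda>t. ((a + b * of_real x) - b * of_real t) + g (x - t))"
    by (simp add: G_eq algebra_simps)
  also have "\<dots> = average (\<lambda>t. (a + b * of_real x) - b * of_real t) + p x" unfolding pker_def
    by (intro average_add shift_continuous continuous_intros)
  also have "average (\<lambda>t. (a + b * of_real x) - b * of_real t) = a + b * of_real x"
    by (subst average_diff[OF _ c]) (auto simp: average_const odd)
  finally show "average (\<lambda>t. G (x - t)) = a + b * of_real x + p x" .
  have "average (\<lambda>t. G (t - x)) = average (\<lambda>t. ((a - b * of_real x) + b * of_real t) + g (t - x))"
    by (simp add: G_eq algebra_simps)
  also have "\<dots> = average (\<lambda>t. (a - b * of_real x) + b * of_real t) + q x" unfolding qker_def
    by (intro average_add shift_continuous continuous_intros)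
  also have "average (\<lambda>t. (a - b * of_real x) + b * of_real t) = a - b * of_real x"
    by (subst average_add[OF _ c]) (auto simp: average_const odd)
  finally show "average (\<lambda>t. G (t - x)) = a - b * of_real x + q x" .
qed

lemma R0_in: "u \<in> L2 \<Longrightarrow> R0 u \<in> L2"
  by (rule bounded_op_in[OF R0_bounded])

lemma rep_R0: "AE x in lborel. rep_aefun (R0 u) x = (LINT y|lborel. G (x - y) * rep_aefun u y)"
  unfolding R0_def conv_op_def by (rule rep_abs_aefun) measurable

lemma rep_R0_window_fun: "AE x in lborel. rep_aefun (R0 window_fun) x = a + b * of_real x + p x"
  using rep_R0[of window_fun]
proof eventually_elim
  case (elim x)
  have "(LINT y|lborel. G (x - y) * rep_aefun window_fun y) = (LINT y|lborel. G (x - y) * window y)"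
    using rep_abs_aefun[OF window_measurable] unfolding window_fun_def
    by (intro integral_cong_AE) (auto elim!: eventually_mono)
  also have "\<dots> = a + b * of_real x + p x" by (simp only: average_window[symmetric] average_G)
  finally show ?case using elim by simp
qed

lemma mean_R0:
  assumes u: "u \<in> L2"
  shows "mean (R0 u) = (LINT y|lborel. rep_aefun u y * (a - b * of_real y + q y))"
    and "integrable lborel (\<lambda>y. rep_aefun u y * (a - b * of_real y + q y))"
proof -
  have sq: "integrable lborel (\<lambda>x. (cmod (window x))\<^sup>2)"
  proof -
    have "(cmod (window x))\<^sup>2 = indicat_real {- (1/2)..1/2} x" for x by (auto simp: window_def indicator_def)
    then show ?thesis by (simp add: integrable_indicator_iff emeasure_lborel_Icc_eq)
  qed
  have *: "(LINT x|lborel. G (x - y) * window x) = a - b * of_real y + q y" for y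
    by (simp only: average_window[symmetric] average_G)
  show "mean (R0 u) = (LINT y|lborel. rep_aefun u y * (a - b * of_real y + q y))"
    using conv_op_pairing(1)[OF G_integrable u window_measurable sq] unfolding * mean_def R0_def .
  show "integrable lborel (\<lambda>y. rep_aefun u y * (a - b * of_real y + q y))"
    using conv_op_pairing(2)[OF G_integrable u window_measurable sq] unfolding * .
qed

lemma p_measurable [measurable]: "p \<in> borel_measurable borel"
  by (rule borel_measurable_continuous_onI[OF p_continuous])

lemma g_measurable [measurable]: "g \<in> borel_measurable borel"
  by (rule borel_measurable_continuous_onI[OF g_continuous])

lemma q_measurable [measurable]: "q \<in> borel_measurable borel"
  unfolding qker_def[abs_def] average_def by measurable

lemma mean_R0_window_fun: "mean (R0 window_fun) = a + d - 1"
proof -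
  have "mean (R0 window_fun) = (LINT x|lborel. (a + b * of_real x + p x) * window x)"
    unfolding mean_def using rep_R0_window_fun by (intro integral_cong_AE) (auto elim!: eventually_mono)
  also have "\<dots> = average (\<lambda>x. (a + b * of_real x) + p x)" by (simp only: average_window)
  also have "\<dots> = average (\<lambda>x. a + b * of_real x) + average p"
    by (intro average_add p_continuous continuous_intros)
  also have "average (\<lambda>x. a + b * of_real x) = a"
    by (subst average_add) (auto simp: average_const average_cmult average_odd intro!: continuous_intros)
  finally show ?thesis by (simp add: dker_def)
qed

lemma mean_linear:
  assumes "u \<in> L2" "v \<in> L2"
  shows "mean (u + c *\<^sub>c v) = mean u + c * mean v"
  using dual_L2wD[OF mean_dual[of 0]] assms L2w_cscale by metis

lemma diff_op_combination:
  assumes "u \<in> Sobolev 3" "v \<in> Sobolev 3"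
  shows "u + c *\<^sub>c v \<in> Sobolev 3"
    and "diff_op 3 (u + c *\<^sub>c v) - z *\<^sub>c (u + c *\<^sub>c v) = (diff_op 3 u - z *\<^sub>c u) + c *\<^sub>c (diff_op 3 v - z *\<^sub>c v)"
proof -
  have cv: "c *\<^sub>c v \<in> Sobolev 3" using Sobolev_subspace[of 3] assms by (simp add: cvec.subspace_def)
  show "u + c *\<^sub>c v \<in> Sobolev 3" using Sobolev_subspace[of 3] assms cv by (simp add: cvec.subspace_def)
  have "diff_op 3 (u + c *\<^sub>c v) = diff_op 3 u + c *\<^sub>c diff_op 3 v"
    using diff_op_3_linear assms cv by (simp add: linear_on_def)
  then show "diff_op 3 (u + c *\<^sub>c v) - z *\<^sub>c (u + c *\<^sub>c v) = (diff_op 3 u - z *\<^sub>c u) + c *\<^sub>c (diff_op 3 v - z *\<^sub>c v)"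
    by (simp add: cvec.scale_right_distrib cvec.scale_right_diff_distrib mult.commute)
qed

text \<open>The equation \<open>A u + mean u w - z u = f\<close>, with \<open>w\<close> the indicator function, says
  \<open>u = R0 f - mean u (R0 w)\<close>.  Applying \<open>mean\<close> gives \<open>mean u = mean (R0 f) / (a + d)\<close>, as
  \<open>mean (R0 w) = a + d - 1\<close>.\<close>

theorem mean_perturbation_resolvent:
  assumes small: "cmod k1 \<le> 1 / 4"
  shows "z \<in> resolvent_set (Sobolev 3) (\<lambda>u. diff_op 3 u + mean_op u)"
    and "f \<in> L2 \<Longrightarrow> resolvent_op (Sobolev 3) (\<lambda>u. diff_op 3 u + mean_op u) z f
        = R0 f + (- mean (R0 f) / (a + d)) *\<^sub>c R0 window_fun"
proof -
  let ?T = "\<lambda>u. diff_op 3 u + mean_op u"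
  have den: "a + d \<noteq> 0" by (rule denominator(1)[OF small])
  have S_L2: "Sobolev 3 \<subseteq> L2" by (auto simp: Sobolev_def)
  note window_sol = R0_solves[OF window_fun_in[of 0]]
  define U where "U f = R0 f + (- mean (R0 f) / (a + d)) *\<^sub>c R0 window_fun" for f
  have U: "U f \<in> Sobolev 3" "?T (U f) - z *\<^sub>c U f = f" if f: "f \<in> L2" for f
  proof -
    let ?c = "- mean (R0 f) / (a + d)"
    note Rf = R0_solves[OF f]
    show "U f \<in> Sobolev 3" unfolding U_def by (rule diff_op_combination(1)[OF Rf(1) window_sol(1)])
    have "mean (U f) = - ?c"
      unfolding U_def mean_linear[OF R0_in[OF f] R0_in[OF window_fun_in]] mean_R0_window_fun using den by (simp add: field_simps)
    then have "?T (U f) - z *\<^sub>c U f = (diff_op 3 (U f) - z *\<^sub>c U f) - ?c *\<^sub>c window_fun"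
      by (simp add: mean_op_def)
    also have "diff_op 3 (U f) - z *\<^sub>c U f = f + ?c *\<^sub>c window_fun"
      unfolding U_def diff_op_combination(2)[OF Rf(1) window_sol(1)] Rf(2) window_sol(2) ..
    finally show "?T (U f) - z *\<^sub>c U f = f" by simp
  qed
  have inj: "u = 0" if u: "u \<in> Sobolev 3" and eq: "?T u - z *\<^sub>c u = 0" for u
  proof -
    have "diff_op 3 (u + mean u *\<^sub>c R0 window_fun) - z *\<^sub>c (u + mean u *\<^sub>c R0 window_fun) = 0"
      unfolding diff_op_combination(2)[OF u window_sol(1)] window_sol(2) using eq by (simp add: mean_op_def algebra_simps)
    from diff_op_3_injective[OF diff_op_combination(1)[OF u window_sol(1)] this]
    have 0: "u + mean u *\<^sub>c R0 window_fun = 0" .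
    have "mean u + mean u * (a + d - 1) = mean (u + mean u *\<^sub>c R0 window_fun)"
      using mean_linear[of u "R0 window_fun" "mean u"] u S_L2 R0_in[OF window_fun_in] by (auto simp: mean_R0_window_fun)
    also have "\<dots> = 0" unfolding 0 using mean_linear[of 0 0 "-1"] by (simp add: L2w_0)
    finally have "mean u * (a + d) = 0" by (simp add: algebra_simps)
    then show "u = 0" using den 0 by simp
  qed
  have lin: "linear_on (Sobolev 3) ?T"
    unfolding linear_on_def
  proof (intro conjI ballI allI)
    show "cvec.subspace (Sobolev 3)" by (rule Sobolev_subspace)
    have K: "linear_on L2 mean_op" using mean_op_bounded[of 0 0] by (simp add: bounded_op_def)
    fix u v c assume u: "u \<in> Sobolev 3"
    show "?T (c *\<^sub>c u) = c *\<^sub>c ?T u"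
      using diff_op_3_linear K u S_L2 by (auto simp: linear_on_def cvec.scale_right_distrib)
    assume v: "v \<in> Sobolev 3"
    show "?T (u + v) = ?T u + ?T v"
      using diff_op_3_linear K u v S_L2 by (auto simp: linear_on_def subset_iff)
  qed
  have T_L2: "?T ` Sobolev 3 \<subseteq> L2"
    using diff_op_3_in S_L2 bounded_op_in[OF mean_op_bounded[of 0 0]] by (auto intro!: L2w.V_add)
  obtain C0 where C0: "\<And>u. u \<in> L2 \<Longrightarrow> L2w_norm 0 (R0 u) \<le> C0 * L2w_norm 0 u"
    using R0_bounded unfolding bounded_op_def by blast
  obtain C1 where C1: "0 < C1" "\<And>u. u \<in> L2 \<Longrightarrow> cmod (mean u) \<le> C1 * L2w_norm 0 u"
    using dual_L2w_bound_pos[OF mean_dual[of 0]] by blast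
  have U_le: "L2w_norm 0 (U f) \<le> (C0 + C1 * C0 / cmod (a + d) * L2w_norm 0 (R0 window_fun)) * L2w_norm 0 f" if f: "f \<in> L2" for f
  proof -
    have "cmod (- mean (R0 f) / (a + d)) \<le> C1 * (C0 * L2w_norm 0 f) / cmod (a + d)"
      using order_trans[OF C1(2)[OF R0_in[OF f]] mult_left_mono[OF C0[OF f] less_imp_le[OF C1(1)]]]
      by (simp add: norm_divide divide_right_mono)
    from mult_right_mono[OF this L2w_norm_nonneg[of 0 "R0 window_fun"]]
    have "L2w_norm 0 ((- mean (R0 f) / (a + d)) *\<^sub>c R0 window_fun) \<le> C1 * (C0 * L2w_norm 0 f) / cmod (a + d) * L2w_norm 0 (R0 window_fun)"
      by (simp only: L2w_norm_cscale)
    moreover have "L2w_norm 0 (U f) \<le> L2w_norm 0 (R0 f) + L2w_norm 0 ((- mean (R0 f) / (a + d)) *\<^sub>c R0 window_fun)"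
      unfolding U_def by (intro L2w_norm_triangle L2w_cscale R0_in f window_fun_in)
    ultimately show ?thesis using C0[OF f] by (simp add: algebra_simps)
  qed
  show res: "z \<in> resolvent_set (Sobolev 3) ?T"
    by (rule resolvent_setI[OF lin S_L2 T_L2 inj]) (use U U_le in blast)+
  assume f: "f \<in> L2"
  show "resolvent_op (Sobolev 3) ?T z f = R0 f + (- mean (R0 f) / (a + d)) *\<^sub>c R0 window_fun"
    using resolvent_setD(3)[OF res U(1)[OF f]] unfolding U(2)[OF f] by (simp add: U_def)
qed

lemma Hker_measurable [measurable]: "(\<lambda>(x, y). Hker k1 k2 k3 x y) \<in> borel_measurable (borel \<Otimes>\<^sub>M borel)"
  unfolding Hker_def by measurable

lemma resolvent_eq_kernel_op:
  assumes small: "cmod k1 \<le> 1 / 4" and f: "f \<in> L2"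
  shows "resolvent_op (Sobolev 3) (\<lambda>u. diff_op 3 u + mean_op u) z f = kernel_op (Hker k1 k2 k3) f"
  unfolding mean_perturbation_resolvent(2)[OF assms]
proof (rule aefun_eqI)
  let ?c = "- mean (R0 f) / (a + d)"
  have K: "AE x in lborel. rep_aefun (kernel_op (Hker k1 k2 k3) f) x = (LINT y|lborel. Hker k1 k2 k3 x y * rep_aefun f y)"
    unfolding kernel_op_def by (rule rep_abs_aefun) measurable
  show "AE x in lborel. rep_aefun (R0 f + ?c *\<^sub>c R0 window_fun) x = rep_aefun (kernel_op (Hker k1 k2 k3) f) x"
    using K rep_add[of "R0 f" "?c *\<^sub>c R0 window_fun"] rep_cscale[of ?c "R0 window_fun"] rep_R0[of f] rep_R0_window_fun
      conv_AE_integrable[OF G_integrable f]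
  proof eventually_elim
    case (elim x)
    let ?r = "\<lambda>y. rep_aefun f y * (a - b * of_real y + q y)" and ?w = "(a + b * of_real x + p x) / (a + d)"
    have "Hker k1 k2 k3 x y * rep_aefun f y = G (x - y) * rep_aefun f y - ?w * ?r y" for y
      unfolding Hker_def G_eq by (simp add: algebra_simps add_divide_distrib diff_divide_distrib)
    then have "(LINT y|lborel. Hker k1 k2 k3 x y * rep_aefun f y) = (LINT y|lborel. G (x - y) * rep_aefun f y) - ?w * mean (R0 f)"
      using elim mean_R0[OF f] by simp
    then show ?case using elim by simp
  qed
qed

end

section \<open>Convergence in operator norm\<close>

lemma g0_measurable [measurable]: "g0 \<in> borel_measurable borel"
  unfolding g0_def[abs_def] by measurable

lemma H0_measurable [measurable]: "(\<lambda>(x, y). H0 x y) \<in> borel_measurable (borel \<Otimes>\<^sub>M borel)"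
proof -
  have [measurable]: "p0 \<in> borel_measurable borel" "q0 \<in> borel_measurable borel"
    unfolding p0_def[abs_def] q0_def[abs_def] average_def by measurable
  show ?thesis unfolding H0_def by measurable
qed

lemma (in cubic_roots) root_small:
  assumes "cmod z \<le> 1 / 64" shows "cmod k1 \<le> 1 / 4"
proof -
  have "root 3 (cmod z) \<le> root 3 ((1 / 4) ^ 3)" using assms by (intro real_root_le_mono) (auto simp: power3_eq_cube)
  then show ?thesis by (simp add: norm_roots real_root_power_cancel)
qed

lemma root_tendsto_0:
  assumes "\<And>n. cubic_roots (z n) (k1 n) (k2 n) (k3 n)" "z \<longlonglongrightarrow> 0"
  shows "k1 \<longlonglongrightarrow> 0"
proof (rule tendsto_norm_zero_cancel)
  have "(\<lambda>n. root 3 (cmod (z n))) \<longlonglongrightarrow> root 3 0"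
    using assms(2) by (intro tendsto_real_root tendsto_norm_zero)
  then show "(\<lambda>n. cmod (k1 n)) \<longlonglongrightarrow> 0" by (simp add: cubic_roots.norm_roots(1)[OF assms(1)])
qed

text \<open>The uniform bound of \<open>H_bound\<close> passes to the limit along a sequence on the imaginary axis inside
  the disc of radius \<open>1 / 64\<close>, where \<open>\<bar>k1\<bar> \<le> 1 / 4\<close>.\<close>

lemma H0_bound: "cmod (H0 x y) \<le> 60 * jbracket x * jbracket y"
proof -
  define z :: "nat \<Rightarrow> complex" where "z n = \<i> * of_real (1 / (64 * real (Suc n)))" for n
  have "\<forall>n. \<exists>k1 k2 k3. cubic_roots (z n) k1 k2 k3"
    using cubic_roots_exist by (auto simp: z_def)
  then obtain k1 k2 k3 where k: "\<And>n. cubic_roots (z n) (k1 n) (k2 n) (k3 n)" by metis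
  have small: "cmod (k1 n) \<le> 1 / 4" for n
  proof (rule cubic_roots.root_small[OF k])
    have "cmod (z n) = 1 / (64 * real (Suc n))" unfolding z_def norm_mult norm_of_real by simp
    also have "\<dots> \<le> 1 / 64" by (rule divide_left_mono) auto
    finally show "cmod (z n) \<le> 1 / 64" .
  qed
  have "(\<lambda>n. 1 / 64 * (1 / real (Suc n))) \<longlonglongrightarrow> 1 / 64 * 0"
    using LIMSEQ_inverse_real_of_nat by (intro tendsto_mult tendsto_const) (simp add: inverse_eq_divide)
  then have "(\<lambda>n. 1 / (64 * real (Suc n))) \<longlonglongrightarrow> 0" by (simp add: field_simps)
  then have "z \<longlonglongrightarrow> \<i> * of_real 0" unfolding z_def by (intro tendsto_intros)
  then have "z \<longlonglongrightarrow> 0" by simp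
  from tendsto_norm[OF Hker_tendsto[OF k small root_tendsto_0[OF k this]]]
  show ?thesis by (rule LIMSEQ_le_const2) (use cubic_roots.H_bound[OF k small] in blast)
qed

text \<open>The operator norm of the difference is at most its Hilbert--Schmidt norm \<open>sqrt (W z)\<close>, and \<open>W\<close>
  tends to \<open>0\<close> by dominated convergence: the kernels converge pointwise, and the differences are
  bounded by \<open>(60 + 60) \<langle>x\<rangle> \<langle>y\<rangle>\<close>.\<close>

theorem mean_perturbation_limit:
  assumes weights: "3 / 2 < s" "3 / 2 < s'"
  shows "\<forall>\<^sub>F z in at 0 within {z. 0 < Im z}. z \<in> resolvent_set (Sobolev 3) (\<lambda>u. diff_op 3 u + mean_op u)"
    and "uniform_op_limit s (- s') (resolvent_op (Sobolev 3) (\<lambda>u. diff_op 3 u + mean_op u)) (kernel_op H0)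
        (at 0 within {z. 0 < Im z})"
proof -
  let ?F = "at 0 within {z. 0 < Im z \<and> cmod z < 1 / 64}"
  have F: "at 0 within {z. 0 < Im z} = ?F"
    by (rule at_within_nhd[of _ "ball 0 (1 / 64)"]) auto
  have "\<forall>z. \<exists>k1 k2 k3. 0 < Im z \<longrightarrow> cubic_roots z k1 k2 k3" using cubic_roots_exist by blast
  then obtain k1 k2 k3 where k: "\<And>z. 0 < Im z \<Longrightarrow> cubic_roots z (k1 z) (k2 z) (k3 z)" by metis
  define H where "H z = Hker (k1 z) (k2 z) (k3 z)" for z
  let ?U = "{z. 0 < Im z \<and> cmod z < 1 / 64}"
  have small: "cmod (k1 z) \<le> 1 / 4" if "z \<in> ?U" for z
    by (rule cubic_roots.root_small[OF k]) (use that in auto)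
  have ev: "\<forall>\<^sub>F z in ?F. z \<in> ?U" unfolding eventually_at_filter by (rule always_eventually) simp
  show "\<forall>\<^sub>F z in at 0 within {z. 0 < Im z}. z \<in> resolvent_set (Sobolev 3) (\<lambda>u. diff_op 3 u + mean_op u)"
    unfolding F using ev by eventually_elim (use cubic_roots.mean_perturbation_resolvent(1)[OF k small] in auto)
  interpret M0: moderate_kernel s s' H0 60
    by unfold_locales (use weights H0_bound in auto)
  have M: "moderate_kernel s s' (H z) 60" if "z \<in> ?U" for z
  proof
    show "cmod (H z x y) \<le> 60 * jbracket x * jbracket y" for x y
      unfolding H_def using that by (intro cubic_roots.H_bound[OF k small]) auto
    show "(\<lambda>(x, y). H z x y) \<in> borel_measurable (borel \<Otimes>\<^sub>M borel)"
      unfolding H_def using that by (intro cubic_roots.Hker_measurable[OF k]) auto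
  qed (rule weights)+
  note MD = moderate_kernel_diff[OF M M0.moderate_kernel_axioms]
  define W where "W z = (\<integral>(x, y). hs_density s s' (\<lambda>x y. H z x y - H0 x y) x y \<partial>(lborel \<Otimes>\<^sub>M lborel))" for z
  have W_tendsto: "(W \<longlongrightarrow> 0) ?F"
    unfolding tendsto_at_iff_sequentially comp_def
  proof (intro allI impI)
    fix X :: "nat \<Rightarrow> complex" assume X: "\<forall>i. X i \<in> ?U - {0}" "X \<longlonglongrightarrow> 0"
    then have XU: "X i \<in> ?U" for i by blast
    then have Xk: "cubic_roots (X i) (k1 (X i)) (k2 (X i)) (k3 (X i))" for i using k by simp
    have lim: "(\<lambda>n. H (X n) x y) \<longlonglongrightarrow> H0 x y" for x y
      unfolding H_def
      by (rule Hker_tendsto[OF Xk small[OF XU] root_tendsto_0[OF Xk X(2)]])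
    have "(\<lambda>n. W (X n)) \<longlonglongrightarrow> (\<integral>z. 0 \<partial>(lborel \<Otimes>\<^sub>M lborel :: (real \<times> real) measure))"
      unfolding W_def
    proof (rule integral_dominated_convergence)
      let ?h = "\<lambda>n. case_prod (hs_density s s' (\<lambda>x y. H (X n) x y - H0 x y))"
      show "integrable (lborel \<Otimes>\<^sub>M lborel)
          (\<lambda>(x, y). (60 + 60)\<^sup>2 * (jbracket x powr (2 - 2 * s') * jbracket y powr (2 - 2 * s)))"
        by (rule moderate_kernel.dominating_integrable[OF MD(1)[OF XU[of 0]]])
      show "?h n \<in> borel_measurable (lborel \<Otimes>\<^sub>M lborel)" for n
        using moderate_kernel.density_integrable[OF MD(1)[OF XU[of n]]] by (rule borel_measurable_integrable)
      show "AE z in lborel \<Otimes>\<^sub>M lborel. norm (?h n z) \<le>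
          (case z of (x, y) \<Rightarrow> (60 + 60)\<^sup>2 * (jbracket x powr (2 - 2 * s') * jbracket y powr (2 - 2 * s)))" for n
      proof (rule AE_I2)
        fix z :: "real \<times> real"
        obtain x y where z: "z = (x, y)" by fastforce
        have "0 \<le> hs_density s s' (\<lambda>x y. H (X n) x y - H0 x y) x y" by (simp add: hs_density_def)
        then show "norm (?h n z) \<le>
            (case z of (x, y) \<Rightarrow> (60 + 60)\<^sup>2 * (jbracket x powr (2 - 2 * s') * jbracket y powr (2 - 2 * s)))"
          using moderate_kernel.density_le[OF MD(1)[OF XU[of n]], of x y] unfolding z by simp
      qed
      show "AE z in lborel \<Otimes>\<^sub>M lborel. (\<lambda>n. ?h n z) \<longlonglongrightarrow> 0"
      proof (rule AE_I2)
        fix z :: "real \<times> real"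
        obtain x y where z: "z = (x, y)" by fastforce
        have "(\<lambda>n. (jbracket x powr (- s') * cmod (H (X n) x y - H0 x y) * jbracket y powr (- s))\<^sup>2)
            \<longlonglongrightarrow> (jbracket x powr (- s') * cmod (H0 x y - H0 x y) * jbracket y powr (- s))\<^sup>2"
          by (intro tendsto_power tendsto_mult tendsto_const tendsto_norm tendsto_diff lim)
        then show "(\<lambda>n. ?h n z) \<longlonglongrightarrow> 0" by (simp add: z hs_density_def)
      qed
    qed simp
    then show "(\<lambda>n. W (X n)) \<longlonglongrightarrow> 0" by simp
  qed
  show "uniform_op_limit s (- s') (resolvent_op (Sobolev 3) (\<lambda>u. diff_op 3 u + mean_op u)) (kernel_op H0)
        (at 0 within {z. 0 < Im z})"
    unfolding uniform_op_limit_def F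
  proof (intro conjI allI impI)
    show "bounded_op s (- s') (kernel_op H0)" by (rule M0.kernel_op_bounded)
    fix e :: real assume e: "0 < e"
    have "((\<lambda>z. sqrt (W z)) \<longlongrightarrow> sqrt 0) ?F" by (intro tendsto_intros W_tendsto)
    then have "\<forall>\<^sub>F z in ?F. sqrt (W z) < e" using e by (simp add: order_tendstoD)
    with ev show "\<forall>\<^sub>F z in ?F. \<forall>u\<in>L2w s.
        L2w_norm (- s') (resolvent_op (Sobolev 3) (\<lambda>u. diff_op 3 u + mean_op u) z u - kernel_op H0 u) \<le> e * L2w_norm s u"
    proof eventually_elim
      case (elim z)
      show ?case
      proof
        fix u assume u: "u \<in> L2w s"
        have u0: "u \<in> L2" using L2w_mono(1)[OF _ u, of 0] weights by simp
        have "resolvent_op (Sobolev 3) (\<lambda>u. diff_op 3 u + mean_op u) z u = kernel_op (H z) u"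
          unfolding H_def using elim(1) u0 by (intro cubic_roots.resolvent_eq_kernel_op[OF k small]) auto
        then have "L2w_norm (- s') (resolvent_op (Sobolev 3) (\<lambda>u. diff_op 3 u + mean_op u) z u - kernel_op H0 u)
            \<le> sqrt (W z) * L2w_norm s u"
          using moderate_kernel.kernel_op_le[OF MD(1)[OF elim(1)] u] MD(2)[OF elim(1) u] by (simp add: W_def)
        also have "\<dots> \<le> e * L2w_norm s u"
          using elim(2) by (intro mult_right_mono) (auto simp: L2w_norm_nonneg)
        finally show "L2w_norm (- s') (resolvent_op (Sobolev 3) (\<lambda>u. diff_op 3 u + mean_op u) z u - kernel_op H0 u)
            \<le> e * L2w_norm s u" .
      qed
    qed
  qed
qed

lemma upper_half_plane_accumulates: "at 0 within {z. 0 < Im z} \<noteq> bot"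
proof -
  have "0 islimpt {z. 0 < Im z}"
    unfolding islimpt_approachable
  proof (intro allI impI)
    fix e :: real assume "0 < e"
    then show "\<exists>x'\<in>{z. 0 < Im z}. x' \<noteq> 0 \<and> dist x' 0 < e"
      by (intro bexI[of _ "\<i> * of_real (e / 2)"]) (auto simp: norm_mult norm_divide)
  qed
  then show ?thesis by (simp add: trivial_limit_within)
qed

theorem theorem1p1:
  fixes N :: nat and z0 :: complex and \<Omega> :: "complex set" and s s' :: real
    and B :: "aefun \<Rightarrow> aefun"
  assumes "N = 3" and "z0 = 0" and "\<Omega> = {z. Im z > 0}"
    and "s > real N - 3 / 2" and "s' > real N - 3 / 2"
    and "relatively_compact_op (- s') s (Sobolev N) (diff_op N) B"
  shows
    "((\<exists>R. lap_limit s (- s') \<Omega> z0 (Sobolev N) (\<lambda>u. diff_op N u + B u) R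
         \<and> uniform_op_limit s (- s')
              (resolvent_op (Sobolev N) (\<lambda>u. diff_op N u + B u)) R (at z0 within \<Omega>))
      \<and> \<not> (\<exists>\<Psi>. virtual_state s (- s') \<Omega> z0 (Sobolev N) (diff_op N) B \<Psi>))
     \<or> ((\<exists>\<Psi>. virtual_state s (- s') \<Omega> z0 (Sobolev N) (diff_op N) B \<Psi>)
        \<and> \<not> LAP s (- s') \<Omega> z0 (Sobolev N) (\<lambda>u. diff_op N u + B u))"
proof -
  have weights: "3 / 2 < s" "3 / 2 < s'" using assms(1,4,5) by auto
  interpret closable_operator "- s'" "Sobolev N" "diff_op N"
    unfolding assms(1) by (rule diff_op_3_closable) (use weights in simp)
  interpret compact_perturbation s' "Sobolev N" "diff_op N" s \<Omega> z0 mean_op "kernel_op H0" B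
  proof (intro compact_perturbation.intro finite_rank_regularization.intro
      finite_rank_regularization_axioms.intro compact_perturbation_axioms.intro)
    show "closable_operator (- s') (Sobolev N) (diff_op N)" by (rule closable_operator_axioms)
    show "0 \<le> s" "0 \<le> s'" using weights by auto
    show "Sobolev N \<subseteq> L2" by (auto simp: Sobolev_def)
    show "diff_op N ` Sobolev N \<subseteq> L2" unfolding assms(1) by (rule diff_op_3_in)
    show "bounded_op (- s') s mean_op" "finite_rank (- s') mean_op"
      by (rule mean_op_bounded, rule mean_op_finite_rank)
    show "z0 \<notin> \<Omega>" using assms by simp
    show "at z0 within \<Omega> \<noteq> bot" unfolding assms(2,3) by (rule upper_half_plane_accumulates)
    show "\<forall>\<^sub>F z in at z0 within \<Omega>. z \<in> resolvent_set (Sobolev N) (\<lambda>u. diff_op N u + mean_op u)"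
      unfolding assms(1-3) by (rule mean_perturbation_limit(1)[OF weights])
    show "uniform_op_limit s (- s') (resolvent_op (Sobolev N) (\<lambda>u. diff_op N u + mean_op u)) (kernel_op H0) (at z0 within \<Omega>)"
      unfolding assms(1-3) by (rule mean_perturbation_limit(2)[OF weights])
    show "compact_operator cscale (closure_dom (- s') (Sobolev N) (diff_op N)) (closable_operator.graph_norm (- s') (Sobolev N) (diff_op N))
        (L2w s) (L2w_norm s) B"
      by (rule relatively_compact_imp_compact[OF assms(6)])
  qed
  show ?thesis by (rule virtual_state_dichotomy)
qed

end
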